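(* Let $\Omega$ be a general Rooms and Passages domain with skeleton $\Gamma$, and let $\widetilde L^2(\Gamma)$, $\widetilde H^1(\Gamma)$, $\hat H^1(\Omega)$, $H_\Gamma$, $H_\Omega$, $E_1$ and $T_1$ be as defined in the context. \begin{enumerate} \item The operator $(H_\Gamma+I)^{-1}$ is not compact on $\widetilde L^2(\Gamma)$ and $0\in\sigma_{ess}(H_\Gamma)$. \item $E_1$ is not compact and $0\in\sigma_{ess}(H_\Omega)$. \item If $E_1(T_1T_1^*-I):\hat H^1(\Omega)\to L^2(\Omega)$ is compact, then $\sigma_{ess}(H_\Omega)\subseteq\sigma_{ess}(H_\Gamma)$. \end{enumerate}
   Context: General Rooms and Passages domain: $\Omega\subset\mathbb{R}^2$ is the union of square rooms $R_i$ ($i$ odd) of size $h_i\times h_i$ joined consecutively along the $x$-axis by rectangular passages $P_i$ ($i$ even) of length $h_i$ and width $\delta_i$, all symmetric about the $x$-axis, with $\delta_i<\min\{h_{i-1},h_{i+1}\}$ and $h_i\to0$ as $i\to\infty$. Explicitly, with $x_0=0$, $x_i=h_1+\dots+h_i$: $R_i=\{x_{i-1}<x<x_i,\ |y|<h_i/2\}$ for $i$ odd, $P_i=\{x_{i-1}\le x\le x_i,\ |y|<\delta_i/2\}$ for $i$ even. Skeleton: a near point of $\mathbf{x}\in\Omega$ is a $\mathbf{y}\in\partial\Omega$ with $|\mathbf{x}-\mathbf{y}|=\mathrm{dist}(\mathbf{x},\partial\Omega)$. The skeleton $\Gamma$ is the set of points of $\Omega$ having more than one near point. It is a union of a sequence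 of edges $e$ (line segments and parabolic arcs); write $e\in\Gamma$. Each $\mathbf{x}\in\Omega$ (up to a null set) lies on one of two line segments $C_\pm(\mathbf{t})$ joining some $\mathbf{t}\in\Gamma$ to its two near points; set $\tau(\mathbf{x})=\mathbf{t}$, $\tau=(\tau_1,\tau_2)$. On $\tau^{-1}(e)$ use coordinates $(\sigma,s)$, where $\sigma$ is arc length along $e$, $\mathbf{t}=\mathbf{t}(\sigma)=\tau(\mathbf{x})$, $l(\sigma)$ is the common length of $C_\pm(\mathbf{t}(\sigma))$, and $s\in(-l(\sigma),l(\sigma))$ is the signed distance from $\mathbf{t}(\sigma)$ to $\mathbf{x}$ ($s\ge0$ on $C_+$, $s\le0$ on $C_-$). The Jacobian is $|\partial(x,y)/\partial(\sigma,s)|=1/|\nabla\tau|$ with $|\nabla\tau|=(|\nabla\tau_1|^2+|\nabla\tau_2|^2)^{1/2}$. Put $$\alpha(\sigma)=\int_{-l(\sigma)}^{l(\sigma)}\frac{ds}{|\nabla\tau(\sigma,s)|},\qquad \beta(\sigma)=\int_{-l(\sigma)}^{l(\sigma)}|\nabla\tau(\sigma,s)|\,ds.$$ Edges: $\Gamma_{reg}$ is the set of edges lying either on the $x$-axis inside a passage, or on the $x$-axis in the centre of a room (points whose near points are on the top and bottom walls), or along the diagonals emanating from the (non-re-entrant) corners of a room. On the first two kinds $\alpha=\beta=\delta$ (passage of width $\delta$), respectively $\alpha=\beta=h$ (room of height $h$); on the diagonal edges, with $\sigma$ measured from the corner, $\alpha(\sigma)=\sigma$, $\beta(\sigma)=2\sigma$.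 $\Gamma_{sing}$ is the set of remaining edges, every point of which has a re-entrant corner (at a junction of a passage and a room) as a near point: the parabolic arcs in the rooms, and the segments of the $x$-axis joining an end of a passage to the parabolic arcs. Spaces (Hilbert space direct sums; $\mathbf{1}_e$ is the characteristic function of $e$): $$\widetilde L^2(\Gamma)=\bigoplus_{e\in\Gamma_{reg}}L^2(e;\alpha\,d\sigma)\oplus\bigoplus_{e\in\Gamma_{sing}}\mathbb{C}\mathbf{1}_e,\qquad \widetilde H^1(\Gamma)=\bigoplus_{e\in\Gamma_{reg}}H^1(e;\alpha,\beta)\oplus\bigoplus_{e\in\Gamma_{sing}}\mathbb{C}\mathbf{1}_e,$$ where $H^1(e;\alpha,\beta)$ is the weighted Sobolev space with inner product $\int_e(f'\overline{g'}\beta+f\overline g\alpha)\,d\sigma$ (prime is the derivative in arc length). The inner products are $(f,g)=\sum_{e\in\Gamma}\int_e f\overline g\,\alpha\,d\sigma$ on $\widetilde L^2(\Gamma)$ and $$(f,g)_{\widetilde H^1(\Gamma)}=\sum_{e\in\Gamma_{reg}}\int_e(f'\overline{g'}\beta+f\overline g\alpha)\,d\sigma+\sum_{e\in\Gamma_{sing}}\int_e f\overline g\,\alpha\,d\sigma .$$ $H_\Gamma$ is the operator such that $H_\Gamma+I$ is the self-adjoint operator in $\widetilde L^2(\Gamma)$ associated with the $\widetilde H^1(\Gamma)$ inner product, where $I$ is the identity. $\hat H^1(\Omega)=\bigoplus_{e\in\Gamma}H^1(\tau^{-1}(e))$ with its natural inner product; $E_1$ is the natural embedding of $\hat H^1(\Omega)$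 into $\bigoplus_{e\in\Gamma}L^2(\tau^{-1}(e))=L^2(\Omega)$; $H_\Omega=\bigoplus_{e\in\Gamma}(-\Delta_{N,\tau^{-1}(e)})$ is the orthogonal sum of the Neumann Laplacians on the regions $\tau^{-1}(e)$, a self-adjoint operator in $L^2(\Omega)$ (the one associated with the $\hat H^1(\Omega)$ inner product). $T_1:\widetilde H^1(\Gamma)\to\hat H^1(\Omega)$ is $T_1f=f\circ\tau$, with Hilbert space adjoint $T_1^*:\hat H^1(\Omega)\to\widetilde H^1(\Gamma)$. $\sigma_{ess}$ denotes the essential spectrum. *)

theory Defs
  imports "HOL-Analysis.Analysis"
begin

section \<open>Hilbert spaces of functions and operators in them\<close>

text \<open>
  A Hilbert space whose elements are classes of complex functions is represented by the set of
  all representatives and the inner product (linear in the first argument) on representatives.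
  Two representatives denote the same element iff their difference has norm 0, so convergence,
  dimension and closedness are always expressed through the norm.
\<close>

record 'a hspace =
  carr :: "('a \<Rightarrow> complex) set"
  ip :: "('a \<Rightarrow> complex) \<Rightarrow> ('a \<Rightarrow> complex) \<Rightarrow> complex"

definition hnorm :: "'a hspace \<Rightarrow> ('a \<Rightarrow> complex) \<Rightarrow> real" where
  "hnorm X f = sqrt (Re (ip X f f))"

text \<open>
  Hilbert space direct sum of spaces \<open>X e\<close> of functions living on disjoint pieces of one set:
  the element with components \<open>f\<^sub>e\<close> is represented by a single function that agrees with
  \<open>f\<^sub>e\<close> on the piece belonging to \<open>e\<close>.
\<close>

definition hsum :: "'i set \<Rightarrow> ('i \<Rightarrow> 'a hspace) \<Rightarrow> 'a hspace" where
  "hsum I X = \<lparr>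
     carr = {f. (\<forall>e\<in>I. f \<in> carr (X e)) \<and> (\<lambda>e. (hnorm (X e) f)\<^sup>2) summable_on I},
     ip = (\<lambda>f g. \<Sum>\<^sub>\<infinity>e\<in>I. ip (X e) f g) \<rparr>"

text \<open>Operators, bounded or not, are given by their graphs.\<close>

type_synonym 'a hop = "(('a \<Rightarrow> complex) \<times> ('a \<Rightarrow> complex)) set"

definition graph_on :: "'a hspace \<Rightarrow> (('a \<Rightarrow> complex) \<Rightarrow> ('a \<Rightarrow> complex)) \<Rightarrow> 'a hop" where
  "graph_on X T = {(f, T f) | f. f \<in> carr X}"

definition op_shift :: "'a hop \<Rightarrow> complex \<Rightarrow> 'a hop"  \<comment> \<open>the operator \<open>A + c I\<close>\<close> where
  "op_shift A c = {(u, \<lambda>x. w x + c * u x) | u w. (u, w) \<in> A}"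

definition hadjoint :: "'a hspace \<Rightarrow> 'a hspace \<Rightarrow> 'a hop \<Rightarrow> 'a hop" where
  "hadjoint X Y T = {(u, f). u \<in> carr Y \<and> f \<in> carr X \<and> (\<forall>(g, k)\<in>T. ip Y k u = ip X g f)}"

definition compact_op :: "'a hspace \<Rightarrow> 'a hspace \<Rightarrow> 'a hop \<Rightarrow> bool" where
  "compact_op X Y T \<longleftrightarrow>
     (\<forall>u v. (\<forall>n::nat. (u n, v n) \<in> T) \<and> (\<exists>C. \<forall>n. hnorm X (u n) \<le> C) \<longrightarrow>
        (\<exists>r w. strict_mono (r :: nat \<Rightarrow> nat) \<and> w \<in> carr Y \<and>
           (\<lambda>n. hnorm Y (\<lambda>x. v (r n) x - w x)) \<longlonglongrightarrow> 0))"

text \<open>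
  The self-adjoint operator in \<open>L\<close> associated with the inner product of a space \<open>V\<close> that is
  continuously embedded in \<open>L\<close> (first representation theorem).
\<close>

definition assoc_op :: "'a hspace \<Rightarrow> 'a hspace \<Rightarrow> 'a hop" where
  "assoc_op V L =
     {(u, w). u \<in> carr V \<and> w \<in> carr L \<and> (\<forall>v\<in>carr V. ip V u v = ip L w v)}"

definition finite_codim :: "'a hspace \<Rightarrow> ('a \<Rightarrow> complex) set \<Rightarrow> ('a \<Rightarrow> complex) set \<Rightarrow> bool"
  \<comment> \<open>\<open>dim (K / R) < \<infinity>\<close> for subspaces \<open>R \<subseteq> K\<close>\<close> where
  "finite_codim X R K \<longleftrightarrow>
     (\<exists>F. finite F \<and> F \<subseteq> K \<and>
        (\<forall>w\<in>K. \<exists>r\<in>R. \<exists>c. hnorm X (\<lambda>x. w x - (r x + (\<Sum>b\<in>F. c b * b x))) = 0))"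

definition op_kernel :: "'a hspace \<Rightarrow> 'a hop \<Rightarrow> ('a \<Rightarrow> complex) set" where
  "op_kernel X A = {u. \<exists>w. (u, w) \<in> A \<and> hnorm X w = 0}"

definition hclosed :: "'a hspace \<Rightarrow> ('a \<Rightarrow> complex) set \<Rightarrow> bool" where
  "hclosed X S \<longleftrightarrow>
     (\<forall>v w. (\<forall>n::nat. v n \<in> S) \<and> w \<in> carr X \<and> (\<lambda>n. hnorm X (\<lambda>x. v n x - w x)) \<longlonglongrightarrow> 0 \<longrightarrow>
        (\<exists>z\<in>S. hnorm X (\<lambda>x. z x - w x) = 0))"

definition fredholm :: "'a hspace \<Rightarrow> 'a hop \<Rightarrow> bool" where
  "fredholm X A \<longleftrightarrow>
     finite_codim X {\<lambda>x. 0} (op_kernel X A) \<and> hclosed X (Range A) \<and>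
     finite_codim X (Range A) (carr X)"

definition ess_spectrum :: "'a hspace \<Rightarrow> 'a hop \<Rightarrow> complex set" where
  "ess_spectrum X A = {z. \<not> fredholm X (op_shift A (- z))}"


section \<open>Lebesgue and Sobolev spaces, Neumann Laplacian\<close>

definition L2 :: "'a::euclidean_space set \<Rightarrow> 'a hspace" where
  "L2 G = \<lparr>
     carr = {f. f \<in> borel_measurable (lebesgue_on G) \<and>
                integrable (lebesgue_on G) (\<lambda>x. (cmod (f x))\<^sup>2)},
     ip = (\<lambda>f g. LINT x|lebesgue_on G. f x * cnj (g x)) \<rparr>"

definition test_functions :: "'a::euclidean_space set \<Rightarrow> ('a \<Rightarrow> real) set"
  \<comment> \<open>\<open>C\<^sup>1\<close> functions with compact support in \<open>G\<close>\<close> where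
  "test_functions G = {\<phi>. (\<forall>x. \<phi> differentiable at x) \<and>
     (\<forall>v. continuous_on UNIV (\<lambda>x. frechet_derivative \<phi> (at x) v)) \<and>
     (\<exists>K. compact K \<and> K \<subseteq> G \<and> (\<forall>x. x \<notin> K \<longrightarrow> \<phi> x = 0))}"

definition locally_integrable :: "'a::euclidean_space set \<Rightarrow> ('a \<Rightarrow> complex) \<Rightarrow> bool" where
  "locally_integrable G f \<longleftrightarrow> (\<forall>K. compact K \<and> K \<subseteq> G \<longrightarrow> integrable (lebesgue_on K) f)"

definition has_weak_derivative ::
  "'a::euclidean_space set \<Rightarrow> ('a \<Rightarrow> complex) \<Rightarrow> 'a \<Rightarrow> ('a \<Rightarrow> complex) \<Rightarrow> bool"
  \<comment> \<open>\<open>g\<close> is the weak directional derivative of \<open>f\<close> along \<open>v\<close> in the open set \<open>G\<close>\<close> where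
  "has_weak_derivative G f v g \<longleftrightarrow> locally_integrable G f \<and> locally_integrable G g \<and>
     (\<forall>\<phi>\<in>test_functions G.
        (LINT x|lebesgue_on G. f x * complex_of_real (frechet_derivative \<phi> (at x) v)) =
        - (LINT x|lebesgue_on G. g x * complex_of_real (\<phi> x)))"

definition weak_derivative ::
  "'a::euclidean_space set \<Rightarrow> ('a \<Rightarrow> complex) \<Rightarrow> 'a \<Rightarrow> 'a \<Rightarrow> complex" where
  "weak_derivative G f v = (SOME g. has_weak_derivative G f v g)"

definition H1 :: "'a::euclidean_space set \<Rightarrow> 'a hspace" where
  "H1 G = \<lparr>
     carr = {f \<in> carr (L2 G). \<forall>b\<in>Basis. \<exists>g\<in>carr (L2 G). has_weak_derivative G f b g},
     ip = (\<lambda>f g. LINT x|lebesgue_on G.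
             (\<Sum>b\<in>Basis. weak_derivative G f b x * cnj (weak_derivative G g b x))
             + f x * cnj (g x)) \<rparr>"

definition neumann_laplacian :: "'a::euclidean_space set \<Rightarrow> 'a hop"  \<comment> \<open>\<open>- \<Delta>\<^sub>N\<close>\<close> where
  "neumann_laplacian G = op_shift (assoc_op (H1 G) (L2 G)) (- 1)"


section \<open>Rooms and Passages domains\<close>

type_synonym point = "real \<times> real"

text \<open>Only the values \<open>h i\<close> with \<open>i \<ge> 1\<close> and \<open>\<delta> i\<close> with \<open>i \<ge> 2\<close> even are meaningful.\<close>

definition rooms_and_passages :: "(nat \<Rightarrow> real) \<Rightarrow> (nat \<Rightarrow> real) \<Rightarrow> bool" where
  "rooms_and_passages h \<delta> \<longleftrightarrow>
     (\<forall>i\<ge>1. 0 < h i) \<and>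
     (\<forall>i\<ge>1. even i \<longrightarrow> 0 < \<delta> i \<and> \<delta> i < min (h (i - 1)) (h (i + 1))) \<and>
     h \<longlonglongrightarrow> 0"

definition xpos :: "(nat \<Rightarrow> real) \<Rightarrow> nat \<Rightarrow> real" where
  "xpos h i = (\<Sum>k=1..i. h k)"

definition room :: "(nat \<Rightarrow> real) \<Rightarrow> nat \<Rightarrow> point set" where
  "room h i = {(x, y). xpos h (i - 1) < x \<and> x < xpos h i \<and> \<bar>y\<bar> < h i / 2}"

definition passage :: "(nat \<Rightarrow> real) \<Rightarrow> (nat \<Rightarrow> real) \<Rightarrow> nat \<Rightarrow> point set" where
  "passage h \<delta> i = {(x, y). xpos h (i - 1) \<le> x \<and> x \<le> xpos h i \<and> \<bar>y\<bar> < \<delta> i / 2}"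

definition Omega :: "(nat \<Rightarrow> real) \<Rightarrow> (nat \<Rightarrow> real) \<Rightarrow> point set" where
  "Omega h \<delta> = (\<Union>i\<in>{i. 1 \<le> i \<and> odd i}. room h i) \<union> (\<Union>i\<in>{i. 1 \<le> i \<and> even i}. passage h \<delta> i)"


section \<open>The skeleton of an open set\<close>

definition near_points :: "point set \<Rightarrow> point \<Rightarrow> point set" where
  "near_points G x = {y \<in> frontier G. dist x y = infdist x (frontier G)}"

definition skeleton :: "point set \<Rightarrow> point set" where
  "skeleton G = {x \<in> G. \<exists>y\<in>near_points G x. \<exists>z\<in>near_points G x. y \<noteq> z}"

definition ridge_map :: "point set \<Rightarrow> point \<Rightarrow> point"  \<comment> \<open>the map \<open>\<tau>\<close>\<close> where
  "ridge_map G x =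
     (THE t. t \<in> skeleton G \<and> (\<exists>y\<in>near_points G t. x \<in> closed_segment t y))"

definition grad_norm :: "point set \<Rightarrow> point \<Rightarrow> real"  \<comment> \<open>\<open>\<bar>\<nabla>\<tau>\<bar>\<close>\<close> where
  "grad_norm G x =
     sqrt (\<Sum>b\<in>Basis. (norm (frechet_derivative (ridge_map G) (at x) b))\<^sup>2)"

text \<open>
  For a point \<open>t\<close> of the skeleton with exactly two near points, \<open>C\<^sub>+\<close> and \<open>C\<^sub>-\<close> are the
  segments from \<open>t\<close> to \<open>near_plus G t\<close> and \<open>near_minus G t\<close>; which near point is called
  plus is immaterial.
\<close>

definition near_plus :: "point set \<Rightarrow> point \<Rightarrow> point" where
  "near_plus G t = (SOME y. y \<in> near_points G t)"

definition near_minus :: "point set \<Rightarrow> point \<Rightarrow> point" where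
  "near_minus G t = (SOME y. y \<in> near_points G t \<and> y \<noteq> near_plus G t)"

definition segment_length :: "point set \<Rightarrow> point \<Rightarrow> real" where
  "segment_length G t = infdist t (frontier G)"

definition segment_point :: "point set \<Rightarrow> point \<Rightarrow> real \<Rightarrow> point"
  \<comment> \<open>the point at signed distance \<open>s\<close> from \<open>t\<close> on \<open>C\<^sub>+ \<union> C\<^sub>-\<close>\<close> where
  "segment_point G t s =
     t + (\<bar>s\<bar> / segment_length G t) *\<^sub>R ((if 0 \<le> s then near_plus G t else near_minus G t) - t)"


section \<open>Edges of the skeleton of a Rooms and Passages domain\<close>

text \<open>
  Room \<open>i\<close> meets two passages, one at its West (left) and one at its East (right) side; the
  first room has only the East one. The edges are:
  \<^item> \<open>Pass i\<close>: the part of the axis inside passage \<open>i\<close>;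
  \<^item> \<open>Centre i\<close>: the part of the axis with near points on the top and bottom walls of room \<open>i\<close>;
  \<^item> \<open>Diag i a b\<close>: the diagonal edge that starts at the corner \<open>(a, b)\<close> of room \<open>i\<close>;
  \<^item> \<open>Arc i a b\<close>: the parabolic arc with near points on the horizontal wall \<open>b\<close> of
    room \<open>i\<close> and at the re-entrant corner in the half \<open>b\<close> of side \<open>a\<close>;
  \<^item> \<open>Join i a\<close>: the segment of the axis with near points at the two re-entrant corners of
    side \<open>a\<close> of room \<open>i\<close>.
\<close>

datatype side = West | East
datatype half = North | South
datatype edge =
  Pass nat | Centre nat | Diag nat side half | Arc nat side half | Join nat side

fun has_mouth :: "nat \<Rightarrow> side \<Rightarrow> bool" where
  "has_mouth i West = (3 \<le> i)"
| "has_mouth i East = True"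

definition edges_reg :: "edge set" where
  "edges_reg = {Pass i | i. 1 \<le> i \<and> even i} \<union> {Centre i | i. 1 \<le> i \<and> odd i} \<union>
     {Diag i a b | i a b. 1 \<le> i \<and> odd i}"

definition edges_sing :: "edge set" where
  "edges_sing = {Arc i a b | i a b. 1 \<le> i \<and> odd i \<and> has_mouth i a} \<union>
     {Join i a | i a. 1 \<le> i \<and> odd i \<and> has_mouth i a}"

abbreviation edges :: "edge set" where
  "edges \<equiv> edges_reg \<union> edges_sing"

fun mouth_width :: "(nat \<Rightarrow> real) \<Rightarrow> nat \<Rightarrow> side \<Rightarrow> real" where
  "mouth_width \<delta> i West = (if 3 \<le> i then \<delta> (i - 1) else 0)"
| "mouth_width \<delta> i East = \<delta> (i + 1)"

fun wall_x :: "(nat \<Rightarrow> real) \<Rightarrow> nat \<Rightarrow> side \<Rightarrow> real" where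
  "wall_x h i West = xpos h (i - 1)"
| "wall_x h i East = xpos h i"

fun inward :: "side \<Rightarrow> real" where
  "inward West = 1"
| "inward East = - 1"

fun half_sign :: "half \<Rightarrow> real" where
  "half_sign North = 1"
| "half_sign South = - 1"

definition reach :: "(nat \<Rightarrow> real) \<Rightarrow> (nat \<Rightarrow> real) \<Rightarrow> nat \<Rightarrow> side \<Rightarrow> real"
  \<comment> \<open>length of \<open>Join i a\<close>: where the re-entrant corners become as distant as the
     horizontal walls, \<open>\<xi>\<^sup>2 + (w/2)\<^sup>2 = (h/2)\<^sup>2\<close>\<close> where
  "reach h \<delta> i a = sqrt ((h i)\<^sup>2 - (mouth_width \<delta> i a)\<^sup>2) / 2"

text \<open>
  Parametrisations, the parameter running from 0 to \<open>edge_end h \<delta> e\<close>. Let \<open>w\<close> be the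
  mouth width on side \<open>a\<close> and \<open>\<xi>\<close> the distance to that wall. The diagonal ends at
  \<open>\<xi> = (h - w)/2\<close>, \<open>\<bar>y\<bar> = w/2\<close>, where the near point on the wall reaches the re-entrant
  corner. There the arc \<open>\<xi>\<^sup>2 + (\<bar>y\<bar> - w/2)\<^sup>2 = (h/2 - \<bar>y\<bar>)\<^sup>2\<close>, that is
  \<open>\<bar>y\<bar> = (h + w)/4 - \<xi>\<^sup>2/(h - w)\<close>, takes over until it meets the axis at \<open>\<xi> = reach\<close>.
  With \<open>w = 0\<close> this also covers the West side of the first room, where the two diagonals
  meet at the midpoint of the room.
\<close>

fun edge_path :: "(nat \<Rightarrow> real) \<Rightarrow> (nat \<Rightarrow> real) \<Rightarrow> edge \<Rightarrow> real \<Rightarrow> point" where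
  "edge_path h \<delta> (Pass i) r = (xpos h (i - 1) + r, 0)"
| "edge_path h \<delta> (Centre i) r = (xpos h (i - 1) + reach h \<delta> i West + r, 0)"
| "edge_path h \<delta> (Diag i a b) r =
     (wall_x h i a + inward a * (r / sqrt 2), half_sign b * (h i / 2 - r / sqrt 2))"
| "edge_path h \<delta> (Arc i a b) r =
     (let w = mouth_width \<delta> i a; \<xi> = (h i - w) / 2 + r
      in (wall_x h i a + inward a * \<xi>, half_sign b * ((h i + w) / 4 - \<xi>\<^sup>2 / (h i - w))))"
| "edge_path h \<delta> (Join i a) r = (wall_x h i a + inward a * r, 0)"

fun edge_end :: "(nat \<Rightarrow> real) \<Rightarrow> (nat \<Rightarrow> real) \<Rightarrow> edge \<Rightarrow> real" where
  "edge_end h \<delta> (Pass i) = h i"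
| "edge_end h \<delta> (Centre i) = h i - reach h \<delta> i West - reach h \<delta> i East"
| "edge_end h \<delta> (Diag i a b) = (h i - mouth_width \<delta> i a) / sqrt 2"
| "edge_end h \<delta> (Arc i a b) = reach h \<delta> i a - (h i - mouth_width \<delta> i a) / 2"
| "edge_end h \<delta> (Join i a) = reach h \<delta> i a"

text \<open>Edges are taken without their end points.\<close>

definition edge_set :: "(nat \<Rightarrow> real) \<Rightarrow> (nat \<Rightarrow> real) \<Rightarrow> edge \<Rightarrow> point set" where
  "edge_set h \<delta> e = edge_path h \<delta> e ` {0<..<edge_end h \<delta> e}"

definition arc_length :: "(nat \<Rightarrow> real) \<Rightarrow> (nat \<Rightarrow> real) \<Rightarrow> edge \<Rightarrow> real \<Rightarrow> real" where
  "arc_length h \<delta> e r =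
     integral {0..r} (\<lambda>\<rho>. norm (vector_derivative (edge_path h \<delta> e) (at \<rho>)))"

definition edge_length :: "(nat \<Rightarrow> real) \<Rightarrow> (nat \<Rightarrow> real) \<Rightarrow> edge \<Rightarrow> real" where
  "edge_length h \<delta> e = arc_length h \<delta> e (edge_end h \<delta> e)"

abbreviation arc_interval :: "(nat \<Rightarrow> real) \<Rightarrow> (nat \<Rightarrow> real) \<Rightarrow> edge \<Rightarrow> real set" where
  "arc_interval h \<delta> e \<equiv> {0<..<edge_length h \<delta> e}"

definition edge_point :: "(nat \<Rightarrow> real) \<Rightarrow> (nat \<Rightarrow> real) \<Rightarrow> edge \<Rightarrow> real \<Rightarrow> point"
  \<comment> \<open>the parametrisation \<open>\<sigma> \<mapsto> t(\<sigma>)\<close> by arc length\<close> where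
  "edge_point h \<delta> e \<sigma> =
     edge_path h \<delta> e (inv_into {0..edge_end h \<delta> e} (arc_length h \<delta> e) \<sigma>)"

definition tau :: "(nat \<Rightarrow> real) \<Rightarrow> (nat \<Rightarrow> real) \<Rightarrow> point \<Rightarrow> point" where
  "tau h \<delta> = ridge_map (Omega h \<delta>)"

definition region :: "(nat \<Rightarrow> real) \<Rightarrow> (nat \<Rightarrow> real) \<Rightarrow> edge \<Rightarrow> point set"
  \<comment> \<open>\<open>\<tau>\<^sup>-\<^sup>1(e)\<close>\<close> where
  "region h \<delta> e = {x \<in> Omega h \<delta>. tau h \<delta> x \<in> edge_set h \<delta> e}"

definition alpha :: "(nat \<Rightarrow> real) \<Rightarrow> (nat \<Rightarrow> real) \<Rightarrow> edge \<Rightarrow> real \<Rightarrow> real" where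
  "alpha h \<delta> e \<sigma> =
     (let G = Omega h \<delta>; t = edge_point h \<delta> e \<sigma>; l = segment_length G t
      in LINT s|lebesgue_on {- l<..<l}. 1 / grad_norm G (segment_point G t s))"

text \<open>
  On singular edges the integral defining \<open>\<beta>\<close> diverges (the integrand is of order
  1/distance at the re-entrant corner); \<open>\<beta>\<close> is used on regular edges only.
\<close>

definition beta :: "(nat \<Rightarrow> real) \<Rightarrow> (nat \<Rightarrow> real) \<Rightarrow> edge \<Rightarrow> real \<Rightarrow> real" where
  "beta h \<delta> e \<sigma> =
     (let G = Omega h \<delta>; t = edge_point h \<delta> e \<sigma>; l = segment_length G t
      in LINT s|lebesgue_on {- l<..<l}. grad_norm G (segment_point G t s))"


section \<open>Function spaces and operators on the skeleton and on the domain\<close>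

text \<open>
  Functions on the skeleton are represented by functions on the plane; only the values on the
  edges matter.
\<close>

definition L2_edge :: "(nat \<Rightarrow> real) \<Rightarrow> (nat \<Rightarrow> real) \<Rightarrow> edge \<Rightarrow> point hspace"
  \<comment> \<open>\<open>L\<^sup>2(e; \<alpha> d\<sigma>)\<close>\<close> where
  "L2_edge h \<delta> e = \<lparr>
     carr = {f. (\<lambda>\<sigma>. f (edge_point h \<delta> e \<sigma>)) \<in> borel_measurable (lebesgue_on (arc_interval h \<delta> e)) \<and>
                integrable (lebesgue_on (arc_interval h \<delta> e))
                  (\<lambda>\<sigma>. (cmod (f (edge_point h \<delta> e \<sigma>)))\<^sup>2 * alpha h \<delta> e \<sigma>)},
     ip = (\<lambda>f g. LINT \<sigma>|lebesgue_on (arc_interval h \<delta> e).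
             f (edge_point h \<delta> e \<sigma>) * cnj (g (edge_point h \<delta> e \<sigma>)) *
             complex_of_real (alpha h \<delta> e \<sigma>)) \<rparr>"

definition const_edge :: "(nat \<Rightarrow> real) \<Rightarrow> (nat \<Rightarrow> real) \<Rightarrow> edge \<Rightarrow> point hspace"
  \<comment> \<open>\<open>\<complex> 1\<^sub>e\<close>, as a subspace of \<open>L\<^sup>2(e; \<alpha> d\<sigma>)\<close>\<close> where
  "const_edge h \<delta> e = \<lparr>
     carr = {f. \<exists>c. AE \<sigma> in lebesgue_on (arc_interval h \<delta> e). f (edge_point h \<delta> e \<sigma>) = c},
     ip = ip (L2_edge h \<delta> e) \<rparr>"

definition edge_deriv ::
  "(nat \<Rightarrow> real) \<Rightarrow> (nat \<Rightarrow> real) \<Rightarrow> edge \<Rightarrow> (point \<Rightarrow> complex) \<Rightarrow> real \<Rightarrow> complex" where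
  "edge_deriv h \<delta> e f =
     weak_derivative (arc_interval h \<delta> e) (\<lambda>\<sigma>. f (edge_point h \<delta> e \<sigma>)) 1"

definition H1_edge :: "(nat \<Rightarrow> real) \<Rightarrow> (nat \<Rightarrow> real) \<Rightarrow> edge \<Rightarrow> point hspace"
  \<comment> \<open>\<open>H\<^sup>1(e; \<alpha>, \<beta>)\<close>\<close> where
  "H1_edge h \<delta> e = \<lparr>
     carr = {f \<in> carr (L2_edge h \<delta> e). \<exists>g.
               has_weak_derivative (arc_interval h \<delta> e) (\<lambda>\<sigma>. f (edge_point h \<delta> e \<sigma>)) 1 g \<and>
               integrable (lebesgue_on (arc_interval h \<delta> e))
                 (\<lambda>\<sigma>. (cmod (g \<sigma>))\<^sup>2 * beta h \<delta> e \<sigma>)},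
     ip = (\<lambda>f g. LINT \<sigma>|lebesgue_on (arc_interval h \<delta> e).
             edge_deriv h \<delta> e f \<sigma> * cnj (edge_deriv h \<delta> e g \<sigma>) *
               complex_of_real (beta h \<delta> e \<sigma>) +
             f (edge_point h \<delta> e \<sigma>) * cnj (g (edge_point h \<delta> e \<sigma>)) *
               complex_of_real (alpha h \<delta> e \<sigma>)) \<rparr>"

definition L2_Gamma :: "(nat \<Rightarrow> real) \<Rightarrow> (nat \<Rightarrow> real) \<Rightarrow> point hspace" where
  "L2_Gamma h \<delta> =
     hsum edges (\<lambda>e. if e \<in> edges_reg then L2_edge h \<delta> e else const_edge h \<delta> e)"

definition H1_Gamma :: "(nat \<Rightarrow> real) \<Rightarrow> (nat \<Rightarrow> real) \<Rightarrow> point hspace" where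
  "H1_Gamma h \<delta> =
     hsum edges (\<lambda>e. if e \<in> edges_reg then H1_edge h \<delta> e else const_edge h \<delta> e)"

definition H_Gamma :: "(nat \<Rightarrow> real) \<Rightarrow> (nat \<Rightarrow> real) \<Rightarrow> point hop" where
  "H_Gamma h \<delta> = op_shift (assoc_op (H1_Gamma h \<delta>) (L2_Gamma h \<delta>)) (- 1)"

definition L2_Omega :: "(nat \<Rightarrow> real) \<Rightarrow> (nat \<Rightarrow> real) \<Rightarrow> point hspace" where
  "L2_Omega h \<delta> = L2 (Omega h \<delta>)"

definition H1_Omega :: "(nat \<Rightarrow> real) \<Rightarrow> (nat \<Rightarrow> real) \<Rightarrow> point hspace"
  \<comment> \<open>the direct sum of the spaces \<open>H\<^sup>1(\<tau>\<^sup>-\<^sup>1(e))\<close>, not the Sobolev space of the whole domain\<close> where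
  "H1_Omega h \<delta> = hsum edges (\<lambda>e. H1 (region h \<delta> e))"

definition E1 :: "(nat \<Rightarrow> real) \<Rightarrow> (nat \<Rightarrow> real) \<Rightarrow> point hop" where
  "E1 h \<delta> = graph_on (H1_Omega h \<delta>) (\<lambda>u. u)"

definition H_Omega :: "(nat \<Rightarrow> real) \<Rightarrow> (nat \<Rightarrow> real) \<Rightarrow> point hop"
  \<comment> \<open>orthogonal sum of the Neumann Laplacians of the regions\<close> where
  "H_Omega h \<delta> = {(u, w). u \<in> carr (L2_Omega h \<delta>) \<and> w \<in> carr (L2_Omega h \<delta>) \<and>
     (\<forall>e\<in>edges. (u, w) \<in> neumann_laplacian (region h \<delta> e))}"

definition T1 :: "(nat \<Rightarrow> real) \<Rightarrow> (nat \<Rightarrow> real) \<Rightarrow> point hop" where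
  "T1 h \<delta> = graph_on (H1_Gamma h \<delta>) (\<lambda>f. f \<circ> tau h \<delta>)"

definition T1_adj :: "(nat \<Rightarrow> real) \<Rightarrow> (nat \<Rightarrow> real) \<Rightarrow> point hop" where
  "T1_adj h \<delta> = hadjoint (H1_Gamma h \<delta>) (H1_Omega h \<delta>) (T1 h \<delta>)"

end

theory Submission
  imports Defs
begin

text \<open>
  The indicator functions of the passages are constant on every edge (on every region), so both
  forms agree on them with the inner products of the spaces of square integrable functions: after
  normalisation they are an infinite orthonormal sequence of eigenfunctions of both operators for
  the eigenvalue 0. Such a sequence has no convergent subsequence, which excludes compactness, and
  it makes the kernel infinite dimensional, which puts 0 into both essential spectra.

  For the inclusion it is then enough that the operator on the domain is Fredholm at every
  \<open>z \<noteq> 0\<close>. It vanishes on the space \<open>K\<close> of functions that are constant on each region, and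
  the abstract lemma \<open>fredholm_off_eigenvalue\<close> reduces the claim to the absence of an orthonormal
  sequence, bounded in the form norm, that is orthogonal to \<open>K\<close>. Let there be one.
  On singular regions its members have mean zero while compositions with \<open>\<tau>\<close> of elements of
  the skeleton space are constant, so the adjoint of \<open>T\<^sub>1\<close> annihilates
  the singular parts (\<open>T1_adj_singular_part\<close>). The assumed compact operator maps them to their
  negatives, and weak convergence to 0 becomes strong along a subsequence.
  Regular regions are rectangles up to null sets, with diameters tending to 0. The Poincare
  inequality (\<open>poincare_box\<close>) bounds the parts on all but finitely many of them by a small multiple
  of the form norm, and subdividing the remaining rectangles
  adds finitely many functionals, which tend to 0 along the sequence
  (\<open>regular_parts_estimate\<close>). Together these contradict the normalisation.

  All this needs the regions explicitly, up to null sets. That \<open>\<tau>\<close> is well defined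
  rests on the fact that an interior point of a segment to a near point has no other near point
  (\<open>near_points_on_segment\<close>). The cells of the individual edges are covered by such segments and
  cover the domain up to countably many lines.
\<close>

abbreviation "cr == complex_of_real"
abbreviation "wkd == weak_derivative"
abbreviation "hwd == has_weak_derivative"
abbreviation "fd == frechet_derivative"
abbreviation "lon == lebesgue_on"
abbreviation "bm M == borel_measurable M"
abbreviation "lint == locally_integrable"
abbreviation "ind == indicator"
abbreviation "nm == hnorm"
abbreviation tends_to (infixr "~~>" 60) where "X ~~> c == X \<longlonglongrightarrow> c"
lemmas BI_cong = Bochner_Integration.integral_cong
lemmas BI_nonneg = Bochner_Integration.integral_nonneg
lemmas BI_add = Bochner_Integration.integral_add
lemmas BI_icong = Bochner_Integration.integrable_cong

section \<open>Semi-inner products on representatives\<close>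

locale semi_ip =
 fixes X :: "'a hspace"
 assumes zero_mem [simp, intro]: "(%x. 0) : carr X"
 and add_mem [simp, intro]: "f : carr X ==> g : carr X ==> (%x. f x+g x) : carr X"
 and scale_mem [simp, intro]: "f : carr X ==> (%x. c * f x) : carr X"
 and ip_add_left: "f : carr X ==> g : carr X ==> k : carr X ==>
 ip X (%x. f x+g x) k=ip X f k+ip X g k"
 and ip_scale_left: "f : carr X ==> k : carr X ==> ip X (%x. c * f x) k=c * ip X f k"
 and ip_commute: "f : carr X ==> g : carr X ==> ip X g f=cnj (ip X f g)"
 and ip_nonneg: "f : carr X ==> 0 <= Re (ip X f f)"
begin

lemma minus_mem [simp, intro]: "f : carr X ==> (%x.-f x) : carr X"
 using scale_mem[of f "-1"] by simp

lemma diff_mem [simp, intro]: "f : carr X ==> g : carr X ==> (%x. f x-g x) : carr X"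
 using add_mem[of f "%x.-g x"] by simp

lemma sum_mem [simp, intro]: "(!!i. i : I ==> f i : carr X) ==> (%x. \<Sum>i\<in>I. f i x) : carr X"
 by (induction I rule: infinite_finite_induct) auto

lemma ip_add_right:
 assumes "f : carr X" "g : carr X" "k : carr X"
 shows "ip X k (%x. f x+g x)=ip X k f+ip X k g"
 using assms ip_add_left[of f g k] by (simp add: ip_commute[of _ k])

lemma ip_scale_right:
 assumes "f : carr X" "k : carr X"
 shows "ip X k (%x. c * f x)=cnj c * ip X k f"
 using assms ip_scale_left[of f k c] by (simp add: ip_commute[of _ k])

lemma ip_minus_left: "f : carr X ==> k : carr X ==> ip X (%x.-f x) k=- ip X f k"
 using ip_scale_left[of f k "-1"] by simp

lemma ip_minus_right: "f : carr X ==> k : carr X ==> ip X k (%x.-f x)=- ip X k f"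
 using ip_scale_right[of f k "-1"] by simp

lemma ip_diff_left:
 assumes "f : carr X" "g : carr X" "k : carr X"
 shows "ip X (%x. f x-g x) k=ip X f k-ip X g k"
 using assms ip_add_left[of f "%x.-g x" k] by (simp add: ip_minus_left)

lemma ip_diff_right:
 assumes "f : carr X" "g : carr X" "k : carr X"
 shows "ip X k (%x. f x-g x)=ip X k f-ip X k g"
 using assms ip_add_right[of f "%x.-g x" k] by (simp add: ip_minus_right)

lemma ip_zero_left [simp]: "k : carr X ==> ip X (%x. 0) k=0"
 using ip_scale_left[of "%x. 0" k 0] by simp

lemma ip_zero_right [simp]: "k : carr X ==> ip X k (%x. 0)=0"
 using ip_scale_right[of "%x. 0" k 0] by simp

lemma ip_sum_left:
 assumes "!!i. i : I ==> f i : carr X" "k : carr X"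
 shows "ip X (%x. \<Sum>i\<in>I. f i x) k=(\<Sum>i\<in>I. ip X (f i) k)"
 using assms by (induction I rule: infinite_finite_induct) (simp_all add: ip_add_left)

lemma ip_sum_right:
 assumes "!!i. i : I ==> f i : carr X" "k : carr X"
 shows "ip X k (%x. \<Sum>i\<in>I. f i x)=(\<Sum>i\<in>I. ip X k (f i))"
 using assms by (induction I rule: infinite_finite_induct) (simp_all add: ip_add_right)

lemmas ip_simps=ip_add_left ip_add_right ip_scale_left ip_scale_right ip_diff_left ip_diff_right
 ip_minus_left ip_minus_right

lemma hnorm_sq: "f : carr X ==> (nm X f)^2=Re (ip X f f)"
 using ip_nonneg by (simp add: hnorm_def)

lemma hnorm_nonneg [simp]: "f : carr X ==> 0 <= nm X f"
 using ip_nonneg by (simp add: hnorm_def)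

lemma ip_self: "f : carr X ==> ip X f f=cr ((nm X f)^2)"
 using ip_commute[of f f] by (simp add: hnorm_sq complex_eq_iff)

lemma hnorm_zero [simp]: "nm X (%x. 0)=0"
 by (simp add: hnorm_def)

lemma hnorm_sq_diff_scale:
 assumes "f : carr X" "g : carr X"
 shows "(nm X (%x. f x-t * g x))^2 =
 (nm X f)^2-2 * Re (cnj t * ip X f g)+(cmod t)^2*(nm X g)^2"
proof -
 have "ip X (%x. f x-t * g x) (%x. f x-t * g x) =
 ip X f f-cnj t * ip X f g-t * cnj (ip X f g)+t * cnj t * ip X g g"
 using assms ip_commute[of f g] by (simp add: ip_simps algebra_simps)
 also have "t * cnj t=cr ((cmod t)^2)" by (rule complex_norm_square[symmetric])
 finally show ?thesis
 using assms by (simp add: hnorm_sq)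
qed

lemma hnorm_sq_add_scale:
 assumes "f : carr X" "g : carr X"
 shows "(nm X (%x. f x+t * g x))^2 =
 (nm X f)^2+2 * Re (cnj t * ip X f g)+(cmod t)^2*(nm X g)^2"
 using hnorm_sq_diff_scale[OF assms, of "- t"] by simp

lemma cauchy_schwarz:
 assumes f: "f : carr X" and g: "g : carr X"
 shows "cmod (ip X f g) <= nm X f * nm X g"
proof -
 let ?p="ip X f g"
 have key: "0 <= (nm X f)^2-2 * s * (cmod ?p)^2+s^2*(cmod ?p)^2*(nm X g)^2" for s :: real
 proof -
 have "Re (cnj (cr s * ?p)*?p)=s * (cmod ?p)^2"
 by (simp add: cmod_def power2_eq_square algebra_simps)
 thus ?thesis
 using hnorm_sq_diff_scale[OF f g, of "s * ?p"]
 zero_le_power2[of "nm X (%x. f x-s * ?p * g x)"]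
 by (simp add: norm_mult power_mult_distrib)
 qed
 show ?thesis
 proof (cases "nm X g=0")
 case True
 have "cmod ?p=0"
 proof (rule ccontr)
 assume "cmod ?p ~= 0"
 hence pos: "(cmod ?p)^2 > 0" by simp
 show False
 using key[of "((nm X f)^2+1)/(2*(cmod ?p)^2)"] True pos by (simp add: field_simps)
 qed
 thus ?thesis using f g by simp
 next
 case False
 hence pos: "(nm X g)^2 > 0" by simp
 have "(1/(nm X g)^2)^2*(cmod ?p)^2*(nm X g)^2=(cmod ?p)^2/(nm X g)^2"
 using False by (simp add: power2_eq_square)
 hence "(cmod ?p)^2/(nm X g)^2 <= (nm X f)^2"
 using key[of "1/(nm X g)^2"] by simp
 hence "(cmod ?p)^2 <= (nm X f)^2*(nm X g)^2"
 using pos by (simp add: pos_divide_le_eq)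
 hence "(cmod ?p)^2 <= (nm X f * nm X g)^2" by (simp add: power_mult_distrib)
 thus ?thesis by (rule power2_le_imp_le) (use f g in simp)
 qed
qed

lemma ip_null_left: "f : carr X ==> g : carr X ==> nm X f=0 ==> ip X f g=0"
 using cauchy_schwarz[of f g] by simp

lemma hnorm_scale: "f : carr X ==> nm X (%x. c * f x)=cmod c * nm X f"
proof -
 assume f: "f : carr X"
 have "(nm X (%x. c * f x))^2=(cmod c * nm X f)^2"
 using hnorm_sq_add_scale[OF zero_mem f, of c] f by (simp add: power_mult_distrib)
 thus ?thesis using f by (simp add: power2_eq_iff_nonneg)
qed

lemma hnorm_minus: "f : carr X ==> nm X (%x.-f x)=nm X f"
 using hnorm_scale[of f "-1"] by simp

lemma hnorm_triangle:
 assumes f: "f : carr X" and g: "g : carr X"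
 shows "nm X (%x. f x+g x) <= nm X f+nm X g"
proof -
 have "(nm X (%x. f x+g x))^2=(nm X f)^2+2 * Re (ip X f g)+(nm X g)^2"
 using hnorm_sq_add_scale[OF f g, of 1] by simp
 also have "\<dots> <= (nm X f+nm X g)^2"
 using cauchy_schwarz[OF f g] complex_Re_le_cmod[of "ip X f g"] by (simp add: power2_sum)
 finally show ?thesis by (rule power2_le_imp_le) (use f g in simp)
qed

lemma hnorm_diff_commute: "f : carr X ==> g : carr X ==>
 nm X (%x. f x-g x)=nm X (%x. g x-f x)"
 using hnorm_minus[of "%x. g x-f x"] by simp

lemma hnorm_triangle_diff:
 assumes "f : carr X" "g : carr X" "k : carr X"
 shows "nm X (%x. f x-k x) <= nm X (%x. f x-g x)+nm X (%x. g x-k x)"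
 using hnorm_triangle[of "%x. f x-g x" "%x. g x-k x"] assms by simp

lemma hnorm_diff_ge:
 assumes "f : carr X" "g : carr X"
 shows "\<bar>nm X f-nm X g\<bar> <= nm X (%x. f x-g x)"
 using hnorm_triangle[of "%x. f x-g x" g] hnorm_triangle[of "%x. g x-f x" f] assms
 hnorm_diff_commute[OF assms] by simp

lemma hnorm_tendsto:
 assumes v: "!!n. v n : carr X" and w: "w : carr X" and lim: "(%n. nm X (%x. v n x-w x)) ~~> 0"
 shows "(%n. nm X (v n)) ~~> nm X w"
proof -
 have "(%n. nm X (v n)-nm X w) ~~> 0"
 by (rule Lim_null_comparison[OF _ lim]) (use hnorm_diff_ge[OF v w] in simp)
 thus ?thesis by (simp add: LIM_zero_iff)
qed

lemma ip_tendsto: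
 assumes v: "!!n. v n : carr X" and w: "w : carr X" and k: "k : carr X"
 and lim: "(%n. nm X (%x. v n x-w x)) ~~> 0"
 shows "(%n. ip X (v n) k) ~~> ip X w k"
proof -
 have "(%n. ip X (v n) k-ip X w k) ~~> 0"
 proof (rule Lim_null_comparison)
 show "\<forall>\<^sub>F n in sequentially. norm (ip X (v n) k-ip X w k) <= nm X (%x. v n x-w x) * nm X k"
 using cauchy_schwarz[of "%x. v _ x-w x" k] v w k by (simp add: ip_diff_left)
 show "(%n. nm X (%x. v n x-w x) * nm X k) ~~> 0"
 using tendsto_mult_left_zero[OF lim] by simp
 qed
 thus ?thesis by (simp add: LIM_zero_iff)
qed

subsection \<open>Orthonormal systems\<close>

definition orthonormal :: "'i set => ('i => 'a => complex) => bool" where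
 "orthonormal I ph \<longleftrightarrow> (ALL i:I. ph i : carr X) & (ALL i:I. ALL j:I. ip X (ph i) (ph j) = of_bool (i=j))"

lemma orthonormal_carr: "orthonormal I ph ==> i : I ==> ph i : carr X"
 by (simp add: orthonormal_def)

lemma orthonormal_ip: "orthonormal I ph ==> i : I ==> j : I ==> ip X (ph i) (ph j) = of_bool (i=j)"
 by (simp add: orthonormal_def)

lemma orthonormal_hnorm: "orthonormal I ph ==> i : I ==> nm X (ph i)=1"
 by (simp add: hnorm_def orthonormal_ip)

lemma residual_orthogonal:
 assumes on: "orthonormal J ph" and fin: "finite J" and v: "v : carr X" and j: "j : J"
 shows "ip X (%x. v x-(\<Sum>i\<in>J. ip X v (ph i) * ph i x)) (ph j)=0"
proof -
 have mem: "(%x. ip X v (ph i) * ph i x) : carr X" if "i : J" for i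
 using orthonormal_carr[OF on that] by simp
 have "ip X (%x. \<Sum>i\<in>J. ip X v (ph i) * ph i x) (ph j)=(\<Sum>i\<in>J. ip X v (ph i) * of_bool (i=j))"
 using mem j on by (simp add: ip_sum_left ip_scale_left orthonormal_carr orthonormal_ip)
 also have "\<dots>=ip X v (ph j)"
 using j fin by (simp add: of_bool_def if_distrib cong: if_cong)
 finally show ?thesis
 using v mem orthonormal_carr[OF on j] by (simp add: ip_diff_left)
qed

lemma bessel:
 assumes on: "orthonormal J ph" and fin: "finite J" and v: "v : carr X"
 shows "(\<Sum>j\<in>J. (cmod (ip X v (ph j)))^2) <= (nm X v)^2"
proof -
 let ?p="%x. \<Sum>i\<in>J. ip X v (ph i) * ph i x"
 let ?r="%x. v x - ?p x"
 have ph: "!!i. i : J ==> ph i : carr X" using orthonormal_carr[OF on] .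
 have p: "?p : carr X" and r: "?r : carr X" using ph v by auto
 have "ip X ?r ?p=(\<Sum>j\<in>J. ip X ?r (%x. ip X v (ph j) * ph j x))"
 using ph r by (intro ip_sum_right) auto
 also have "\<dots>=(\<Sum>j\<in>J. cnj (ip X v (ph j)) * ip X ?r (ph j))"
 using ph r by (intro sum.cong refl ip_scale_right) auto
 also have "\<dots>=0" using residual_orthogonal[OF on fin v] by simp
 finally have orth: "ip X ?r ?p=0" .
 have "ip X v v=ip X (%x. ?r x + ?p x) v" by simp
 also have "\<dots>=ip X ?r v+ip X ?p v" using r p v by (rule ip_add_left)
 also have "ip X ?r v=ip X ?r (%x. ?r x + ?p x)" by simp
 also have "\<dots>=ip X ?r ?r" using r p orth by (simp only: ip_add_right add_0_right)
 also have "ip X ?p v=(\<Sum>j\<in>J. ip X v (ph j) * ip X (ph j) v)"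
 using ph v by (subst ip_sum_left) (auto simp: ip_scale_left)
 also have "\<dots>=(\<Sum>j\<in>J. cr ((cmod (ip X v (ph j)))^2))"
 using ph v by (intro sum.cong refl) (simp add: ip_commute[of v] complex_norm_square del: of_real_power)
 finally have "Re (ip X v v)=Re (ip X ?r ?r)+(\<Sum>j\<in>J. (cmod (ip X v (ph j)))^2)"
 by (simp add: Re_sum)
 thus ?thesis using ip_nonneg[OF r] v by (simp add: hnorm_sq)
qed

lemma orthonormal_weakly_null:
 assumes on: "orthonormal UNIV (ph :: nat => _)" and v: "v : carr X"
 shows "(%n. ip X (ph n) v) ~~> 0"
proof -
 have "orthonormal J ph" for J using on by (simp add: orthonormal_def)
 hence "summable (%j. (cmod (ip X v (ph j)))^2)"
 using bessel[OF _ _ v] by (intro summableI_nonneg_bounded[of _ "(nm X v)^2"]) auto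
 hence "(%j. (cmod (ip X v (ph j)))^2) ~~> 0" by (rule summable_LIMSEQ_zero)
 hence "(%j. cmod (ip X v (ph j))) ~~> 0" by simp
 moreover have "cmod (ip X v (ph j))=cmod (ip X (ph j) v)" for j
 using v orthonormal_carr[OF on, of j] by (simp add: ip_commute[of v])
 ultimately show ?thesis by (simp add: tendsto_norm_zero_iff)
qed

lemma orthonormal_no_convergent_subseq:
 assumes on: "orthonormal UNIV (ph :: nat => _)" and r: "strict_mono (r :: nat => nat)" and w: "w : carr X"
 shows "\<not> (%n. nm X (%x. ph (r n) x-w x)) ~~> 0"
proof
 assume lim: "(%n. nm X (%x. ph (r n) x-w x)) ~~> 0"
 have ph: "ph n : carr X" for n using orthonormal_carr[OF on] by simp
 have "(%n. ip X (ph (r n)) w) ~~> ip X w w"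
 by (rule ip_tendsto[OF _ w w lim]) (rule ph)
 moreover have "(%n. ip X (ph (r n)) w) ~~> 0"
 using LIMSEQ_subseq_LIMSEQ[OF orthonormal_weakly_null[OF on w] r] by (simp add: o_def)
 ultimately have "ip X w w=0" using LIMSEQ_unique by blast
 hence "nm X w=0" by (simp add: hnorm_def)
 moreover have "(%n. nm X (ph (r n))) ~~> nm X w" by (rule hnorm_tendsto[OF _ w lim]) (rule ph)
 moreover have "nm X (ph (r n))=1" for n using orthonormal_hnorm[OF on] by simp
 ultimately show False by (simp add: LIMSEQ_const_iff)
qed

end

text \<open>More unknowns than equations.\<close>

lemma homogeneous_system_solution:
 fixes c :: "'j => 'b => 'f::field"
 assumes "finite F" "finite J" "card F<card J"
 shows "EX d. (EX j:J. d j ~= 0) & (ALL b:F. (\<Sum>j\<in>J. d j * c j b)=0)"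
 using assms
proof (induction F arbitrary: J c rule: finite_induct)
 case empty
 thus ?case by (intro exI[of _ "%_. 1"]) (auto simp: card_gt_0_iff)
next
 case (insert b F)
 show ?case
 proof (cases "EX p:J. c p b ~= 0")
 case False
 thus ?thesis using insert.IH[of J c] insert.prems insert.hyps by auto
 next
 case True
 then obtain p where p: "p : J" "c p b ~= 0" by blast
 define J' where "J'=J-{p}"
 define c' where "c' j x=c j x-c j b/c p b * c p x" for j x
 have J': "finite J'" "card F<card J'" using insert p by (auto simp: J'_def)
 obtain d j where d: "j : J'" "d j ~= 0" "!!x. x : F ==> (\<Sum>j\<in>J'. d j * c' j x)=0"
 using insert.IH[OF J', of c'] by blast
 define m where "m=(\<Sum>j\<in>J'. d j * c j b)"
 define e where "e=d(p :=-m/c p b)"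
 have split: "(\<Sum>j\<in>J. e j * c j x)=- m/c p b * c p x+(\<Sum>j\<in>J'. d j * c j x)" for x
 proof -
 have "(\<Sum>j\<in>J. e j * c j x)=e p * c p x+(\<Sum>j\<in>J'. e j * c j x)"
 using p insert.prems unfolding J'_def by (simp add: sum.remove)
 also have "(\<Sum>j\<in>J'. e j * c j x)=(\<Sum>j\<in>J'. d j * c j x)"
 by (intro sum.cong) (auto simp: e_def J'_def)
 finally show ?thesis by (simp add: e_def)
 qed
 have "(\<Sum>j\<in>J. e j * c j b)=0" using p by (simp add: split m_def)
 moreover have "(\<Sum>j\<in>J. e j * c j x)=0" if "x : F" for x
 proof -
 have "0=(\<Sum>j\<in>J'. d j * c j x)-(\<Sum>j\<in>J'. d j * c j b/c p b * c p x)"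
 using d(3)[OF that] by (simp add: c'_def algebra_simps sum_subtractf)
 also have "(\<Sum>j\<in>J'. d j * c j b/c p b * c p x)=m/c p b * c p x"
 by (simp add: m_def sum_distrib_right sum_divide_distrib)
 finally show ?thesis by (simp add: split)
 qed
 moreover have "EX j:J. e j ~= 0" using d by (auto simp: e_def J'_def intro!: bexI[of _ j])
 ultimately show ?thesis by auto
 qed
qed

context semi_ip begin

text \<open>A space spanned by \<open>m\<close> elements contains a nonzero combination of any \<open>m + 1\<close> orthonormal ones whose coordinates vanish. Its norm is 0, against Pythagoras.\<close>

lemma orthonormal_infinite_dim:
 assumes on: "orthonormal UNIV (ph :: nat => _)" and K: "!!n. ph n : K" "K <= carr X"
 shows "\<not> finite_codim X {%x. 0} K"
proof
 assume "finite_codim X {%x. 0} K"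
 then obtain F where F: "finite F" "F <= K"
 and ex: "ALL w:K. EX c. nm X (%x. w x-(\<Sum>b\<in>F. c b * b x))=0"
 by (auto simp: finite_codim_def)
 obtain c where c: "!!n. nm X (%x. ph n x-(\<Sum>b\<in>F. c n b * b x))=0"
 using choice[of "%n c. nm X (%x. ph n x-(\<Sum>b\<in>F. c b * b x))=0"] bspec[OF ex K(1)] by blast
 obtain d j where d: "j : {..card F}" "d j ~= 0" "!!b. b : F ==> (\<Sum>j\<le>card F. d j * c j b)=0"
 using homogeneous_system_solution[OF F(1), of "{..card F}" c] by auto
 have Fc: "b : carr X" if "b : F" for b using that F K by auto
 have ph: "ph n : carr X" for n using K by auto
 have pc: "(%x. \<Sum>b\<in>F. c n b * b x) : carr X" for n using Fc by (intro sum_mem scale_mem)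
 have eq: "ip X (ph n) (ph j)=(\<Sum>b\<in>F. c n b * ip X b (ph j))" for n
 proof -
 have "0=ip X (%x. ph n x-(\<Sum>b\<in>F. c n b * b x)) (ph j)"
 using c pc ph by (subst ip_null_left) auto
 also have "\<dots>=ip X (ph n) (ph j)-ip X (%x. \<Sum>b\<in>F. c n b * b x) (ph j)"
 using ph pc by (intro ip_diff_left)
 also have "ip X (%x. \<Sum>b\<in>F. c n b * b x) (ph j)=(\<Sum>b\<in>F. c n b * ip X b (ph j))"
 using Fc ph by (subst ip_sum_left) (auto simp: ip_scale_left)
 finally show ?thesis by simp
 qed
 have "d j=(\<Sum>n\<le>card F. d n * ip X (ph n) (ph j))"
 using d(1) by (simp add: orthonormal_ip[OF on] of_bool_def if_distrib cong: if_cong)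
 also have "\<dots>=(\<Sum>n\<le>card F. \<Sum>b\<in>F. d n * c n b * ip X b (ph j))"
 by (simp add: eq sum_distrib_left mult.assoc)
 also have "\<dots>=(\<Sum>b\<in>F. (\<Sum>n\<le>card F. d n * c n b) * ip X b (ph j))"
 by (subst sum.swap) (simp add: sum_distrib_right)
 also have "\<dots>=0" using d(3) by simp
 finally show False using d(2) by simp
qed

end

section \<open>Completeness and the Riesz representation theorem\<close>

definition hcauchy :: "'a hspace => (nat => 'a => complex) => bool" where
 "hcauchy X f \<longleftrightarrow> (ALL e>0. EX N. ALL m>=N. ALL n>=N. nm X (%x. f m x-f n x)<e)"

locale semi_hilbert=semi_ip +
 assumes complete: "(!!n. f n : carr X) ==> hcauchy X f ==>
 EX g:carr X. (%n. nm X (%x. f n x-g x)) ~~> 0"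

text \<open>Closed subspaces that contain all representatives of their elements.\<close>

definition closed_subspace :: "'a hspace => ('a => complex) set => bool" where
 "closed_subspace X S \<longleftrightarrow> S <= carr X & (%x. 0) : S &
 (ALL f:S. ALL g:S. (%x. f x+g x) : S) & (ALL f:S. ALL c. (%x. c * f x) : S) &
 (ALL v w. (ALL n::nat. v n : S) & w : carr X & (%n. nm X (%x. v n x-w x)) ~~> 0 --> w : S)"

lemma closed_subspaceD:
 assumes S: "closed_subspace X S"
 shows "f : S ==> f : carr X" "(%x. 0) : S"
 "f : S ==> g : S ==> (%x. f x+g x) : S"
 "f : S ==> (%x. c * f x) : S"
 "(!!n::nat. v n : S) ==> w : carr X ==>
 (%n. nm X (%x. v n x-w x)) ~~> 0 ==> w : S"
proof -
 show "f : S ==> f : carr X" "(%x. 0) : S"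
 "f : S ==> g : S ==> (%x. f x+g x) : S"
 "f : S ==> (%x. c * f x) : S"
 using S unfolding closed_subspace_def by (blast, simp, simp, simp)
 note cl=S[unfolded closed_subspace_def, THEN conjunct2, THEN conjunct2, THEN conjunct2, THEN conjunct2,
 rule_format, OF conjI, OF _ conjI]
 show "w : S" if "!!n. v n : S" "w : carr X" "(%n. nm X (%x. v n x-w x)) ~~> 0"
 by (rule cl[of v w]) (use that in auto)
qed

text \<open>A minimising sequence for \<open>norm v ^ 2 - 2 Re (l v)\<close> is a Cauchy sequence by the parallelogram law, and its limit represents the functional.\<close>

lemma (in semi_hilbert) riesz:
 assumes S: "closed_subspace X S"
 and add: "!!v w. v : S ==> w : S ==> l (%x. v x+w x)=l v+l w"
 and scale: "!!v c. v : S ==> l (%x. c * v x)=cnj c * l v"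
 and bound: "!!v. v : S ==> cmod (l v) <= C * nm X v" and C: "0 <= C"
 shows "EX u:S. ALL v:S. ip X u v=l v"
proof -
 note SX=closed_subspaceD(1)[OF S] and S0=closed_subspaceD(2)[OF S] and Sadd=closed_subspaceD(3)[OF S]
 and Ssc=closed_subspaceD(4)[OF S] and Scl=closed_subspaceD(5)[OF S]
 define J where "J v=(nm X v)^2-2 * Re (l v)" for v
 have Jge: "- (C^2) <= J v" if "v : S" for v
 proof -
 have "Re (l v) <= C * nm X v"
 using bound[OF that] complex_Re_le_cmod[of "l v"] by linarith
 moreover have "0 <= (nm X v)^2-2*(C * nm X v)+C^2"
 using zero_le_power2[of "nm X v-C"] by (simp add: power2_diff algebra_simps)
 ultimately show ?thesis by (simp add: J_def)
 qed
 define m where "m=Inf (J ` S)"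
 have bdd: "bdd_below (J ` S)" using Jge by (auto intro!: bdd_belowI)
 have mle: "m <= J v" if "v : S" for v using that bdd by (auto simp: m_def intro: cInf_lower)
 have ex: "EX v. v : S & J v<m+1/Suc n" for n
 proof -
 have "Inf (J ` S)<m+1/Suc n" by (simp add: m_def)
 from cInf_lessD[OF _ this] S0 show ?thesis by blast
 qed
 define v where "v n=(SOME v. v : S & J v<m+1/Suc n)" for n
 have v: "v n : S" "J (v n)<m+1/Suc n" for n
 using someI_ex[OF ex[of n]] by (auto simp: v_def)
 have arith: "d <= 2*(P-2 * lp)+2*(Q-2 * lq)-4 * m"
 if "H=1/4 * s" "lh=(lp+lq)/2" "d+s=2 * P+2 * Q" "m <= H-2 * lh"
 for d P Q lp lq H s lh :: real
 using that by (simp add: field_simps)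
 have dist: "(nm X (%x. p x-q x))^2 <= 2 * J p+2 * J q-4 * m" if "p : S" "q : S" for p q
 proof -
 define h where "h=(%x. (1/2)*(p x+q x))"
 have h: "h : S" unfolding h_def using Ssc[OF Sadd[OF that]] .
 have "nm X h=1/2 * nm X (%x. p x+q x)"
 unfolding h_def using that SX by (subst hnorm_scale) auto
 hence "(nm X h)^2=1/4*(nm X (%x. p x+q x))^2"
 by (simp only: power_mult_distrib) (simp add: power2_eq_square)
 moreover have "l h=1/2*(l p+l q)"
 using scale[OF Sadd[OF that], of "1/2"] add[OF that] by (simp add: h_def)
 hence "Re (l h)=Re (1/2*(l p+l q))" by (rule arg_cong)
 hence "Re (l h)=(Re (l p)+Re (l q))/2" by simp
 moreover have "(nm X (%x. p x-q x))^2+(nm X (%x. p x+q x))^2 =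
 2*(nm X p)^2+2*(nm X q)^2"
 using hnorm_sq_diff_scale[OF SX SX, OF that, of 1] hnorm_sq_add_scale[OF SX SX, OF that, of 1] by simp
 ultimately show ?thesis
 using mle[OF h] unfolding J_def by (intro arith)
 qed
 have "hcauchy X v"
 unfolding hcauchy_def
 proof (intro allI impI)
 fix e :: real assume e: "0<e"
 obtain N where N: "1/real (Suc N)<e^2/4" using e nat_approx_posE[of "e^2/4"] by auto
 show "EX N. ALL m>=N. ALL n>=N. nm X (%x. v m x-v n x)<e"
 proof (intro exI[of _ N] allI impI)
 fix a b assume ab: "N <= a" "N <= b"
 have "1/real (Suc a) <= 1/Suc N" "1/real (Suc b) <= 1/Suc N"
 using ab by (auto simp: field_simps)
 hence "(nm X (%x. v a x-v b x))^2<e^2"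
 using dist[OF v(1)[of a] v(1)[of b]] v(2)[of a] v(2)[of b] N by linarith
 thus "nm X (%x. v a x-v b x)<e" using e by (simp add: power_less_imp_less_base)
 qed
 qed
 then obtain u where u: "u : carr X" and lim: "(%n. nm X (%x. v n x-u x)) ~~> 0"
 using complete[of v, OF SX[OF v(1)]] by blast
 have uS: "u : S" by (rule Scl[OF v(1) u lim])
 have Ju: "J u <= m"
 proof (rule LIMSEQ_le)
 have "(%n. l (v n)-l u) ~~> 0"
 proof (rule Lim_null_comparison)
 show "\<forall>\<^sub>F n in sequentially. norm (l (v n)-l u) <= C * nm X (%x. v n x-u x)"
 proof (intro always_eventually allI)
 fix n
 have d: "(%x. v n x+(-1) * u x) : S" by (intro Sadd Ssc v uS)
 have "l (%x. v n x+(-1) * u x)=l (v n)-l u"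
 unfolding add[OF v(1) Ssc[OF uS]] scale[OF uS] by simp
 thus "norm (l (v n)-l u) <= C * nm X (%x. v n x-u x)"
 using bound[OF d] by simp
 qed
 show "(%n. C * nm X (%x. v n x-u x)) ~~> 0" using tendsto_mult_left[OF lim, of C] by simp
 qed
 hence "(%n. l (v n)) ~~> l u" by (simp add: LIM_zero_iff)
 thus "(%n. J (v n)) ~~> J u"
 unfolding J_def by (intro tendsto_intros hnorm_tendsto[OF _ u lim] SX v)
 show "(%n. m+1/real (Suc n)) ~~> m"
 using tendsto_add[OF tendsto_const LIMSEQ_inverse_real_of_nat, of m] by (simp add: inverse_eq_divide)
 show "EX N. ALL n>=N. J (v n) <= m+1/real (Suc n)"
 by (intro exI allI impI less_imp_le v(2))
 qed
 have "ip X u w=l w" if w: "w : S" for w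
 proof (rule ccontr)
 assume ne: "ip X u w ~= l w"
 define d where "d=ip X u w-l w"
 define s where "s=1/((nm X w)^2+1)"
 have pos: "(nm X w)^2+1 > 0" by (simp add: add_nonneg_pos)
 have s: "s > 0" "s * (nm X w)^2<1" using pos by (auto simp: s_def divide_less_eq)
 define t where "t=- cr s * d"
 have Ret: "Re (cnj t * d)=- s * (cmod d)^2"
 unfolding t_def cmod_power2 by (simp add: power2_eq_square algebra_simps)
 have cmt: "(cmod t)^2=s * s * (cmod d)^2"
 by (simp add: t_def norm_mult power_mult_distrib power2_eq_square)
 have lt: "l (%x. u x+t * w x)=l u+cnj t * l w"
 unfolding add[OF uS Ssc[OF w]] scale[OF w] ..
 have mem: "(%x. u x+t * w x) : S" by (intro Sadd Ssc uS w)
 have "Re (cnj t * ip X u w)-Re (cnj t * l w)=Re (cnj t * d)"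
 by (simp only: d_def right_diff_distrib minus_complex.simps)
 hence "J (%x. u x+t * w x)=J u+2 * Re (cnj t * d)+(cmod t)^2*(nm X w)^2"
 unfolding J_def lt using hnorm_sq_add_scale[OF SX SX, OF uS w, of t]
 by (simp del: times_complex.simps)
 hence "J (%x. u x+t * w x)=J u+s * (cmod d)^2*(s * (nm X w)^2-2)"
 unfolding Ret cmt by (simp add: algebra_simps)
 moreover have "(cmod d)^2 > 0" using ne by (simp add: d_def)
 hence "s * (cmod d)^2*(s * (nm X w)^2-2)<0"
 using s by (intro mult_pos_neg mult_pos_pos) auto
 ultimately show False using mle[OF mem] Ju by linarith
 qed
 thus ?thesis using uS by (intro bexI[of _ u] ballI)
qed

section \<open>Finite codimension\<close>

text \<open>Finitely many functionals cut out a subspace of finite codimension: functionals that vanish on the common kernel of the others are dropped by induction.\<close>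

lemma functional_reduction:
 fixes l :: "'j => ('a => complex) => complex"
 assumes "finite J" and R0: "(%x. 0) : R"
 and Radd: "!!f g. f : R ==> g : R ==> (%x. f x+g x) : R"
 and Rscale: "!!f c. f : R ==> (%x. c * f x) : R"
 and ladd: "!!j f g. j : J ==> f : R ==> g : R ==> l j (%x. f x+g x)=l j f+l j g"
 and lscale: "!!j f c. j : J ==> f : R ==> l j (%x. c * f x)=c * l j f"
 shows "EX E. finite E & E <= R &
 (ALL w:R. EX r:R. (ALL j:J. l j r=0) & (EX c. w=(%x. r x+(\<Sum>b\<in>E. c b * b x))))"
 using assms(1) ladd lscale
proof (induction J rule: finite_induct)
 case empty
 show ?case
 proof (intro exI[of _ "{}"] conjI ballI)
 fix w assume "w : R"
 thus "EX r:R. (ALL j:{}. l j r=0) & (EX c. w=(%x. r x+(\<Sum>b\<in>{}. c b * b x)))"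
 by (intro bexI[of _ w] conjI exI) simp_all
 qed simp_all
next
 case (insert j J)
 have "EX E. finite E & E <= R &
 (ALL w:R. EX r:R. (ALL j:J. l j r=0) & (EX c. w=(%x. r x+(\<Sum>b\<in>E. c b * b x))))"
 by (rule insert.IH) (use insert.prems in simp_all)
 then obtain E where E: "finite E" "E <= R"
 and red: "!!w. w : R ==> EX r:R. (ALL j:J. l j r=0) & (EX c. w=(%x. r x+(\<Sum>b\<in>E. c b * b x)))"
 by (elim exE conjE) (rule that, auto)
 show ?case
 proof (cases "EX b:R. (ALL i:J. l i b=0) & l j b ~= 0")
 case False
 have "EX r:R. (ALL i:insert j J. l i r=0) & (EX c. w=(%x. r x+(\<Sum>e\<in>E. c e * e x)))"
 if w: "w : R" for w
 proof -
 obtain r c where r: "r : R" "ALL i:J. l i r=0"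
 and wr: "w=(%x. r x+(\<Sum>b\<in>E. c b * b x))" using red[OF w] by (elim bexE conjE exE)
 have "l j r=0" using r False by blast
 hence "ALL i:insert j J. l i r=0" using r by simp
 thus ?thesis using r(1) wr by (intro bexI[of _ r] conjI exI[of _ c])
 qed
 thus ?thesis using E by (intro exI[of _ E] conjI ballI)
 next
 case True
 then obtain b where b: "b : R" "!!i. i : J ==> l i b=0" "l j b ~= 0" by blast
 have "EX r:R. (ALL i:insert j J. l i r=0) & (EX c. w=(%x. r x+(\<Sum>e\<in>insert b E. c e * e x)))"
 if w: "w : R" for w
 proof -
 obtain r c where r: "r : R" "!!i. i : J ==> l i r=0"
 and wr: "w=(%x. r x+(\<Sum>b\<in>E. c b * b x))" using red[OF w] by (elim bexE conjE exE) simp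
 define m where "m=l j r/l j b"
 define c' where "c' e=(if e=b then m else 0)+(if e : E then c e else 0)" for e
 let ?r="%x. r x+(- m) * b x"
 have "l i ?r=l i r+(- m) * l i b" if "i : insert j J" for i
 using insert.prems(1)[OF that r(1) Rscale[OF b(1)], of "- m"] insert.prems(2)[OF that b(1), of "- m"]
 by simp
 hence "l i ?r=0" if "i : insert j J" for i
 using that r(2) b(2,3) by (cases "i=j") (auto simp: m_def)
 moreover have "(\<Sum>e\<in>insert b E. c' e * e x)=m * b x+(\<Sum>e\<in>E. c e * e x)" for x
 proof -
 have "(\<Sum>e\<in>insert b E. c' e * e x)=(\<Sum>e\<in>insert b E. (if e=b then m else 0) * e x)
 +(\<Sum>e\<in>insert b E. (if e : E then c e else 0) * e x)"
 by (simp add: c'_def distrib_right sum.distrib)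
 also have "(\<Sum>e\<in>insert b E. (if e=b then m else 0) * e x)=m * b x"
 using E by (simp add: if_distrib[of "%y. y * _"] cong: if_cong)
 also have "(\<Sum>e\<in>insert b E. (if e : E then c e else 0) * e x)=(\<Sum>e\<in>E. c e * e x)"
 using E by (intro sum.mono_neutral_cong_right) auto
 finally show ?thesis .
 qed
 hence "w=(%x. ?r x+(\<Sum>e\<in>insert b E. c' e * e x))" by (simp add: wr)
 moreover have "?r : R" by (intro Radd Rscale r b)
 ultimately show ?thesis by (intro bexI[of _ ?r] conjI ballI exI[of _ c'])
 qed
 thus ?thesis using E b(1) by (intro exI[of _ "insert b E"] conjI ballI) simp_all
 qed
qed

context semi_ip begin

text \<open>If the added vector is not in the closure, its coefficient is controlled by the norm of the sum, so the coefficients of a convergent sequence converge too.\<close>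

lemma hclosed_add_line:
 assumes S: "S <= carr X" and cl: "hclosed X S" and b: "b : carr X"
 and Sadd: "!!f g. f : S ==> g : S ==> (%x. f x+g x) : S"
 and Sscale: "!!f c. f : S ==> (%x. c * f x) : S"
 shows "hclosed X {%x. s x+m * b x | s m. s : S}"
 unfolding hclosed_def
proof (intro allI impI)
 fix v w
 assume asm: "(ALL n::nat. v n : {%x. s x+m * b x |s m. s : S}) & w : carr X &
 (%n. nm X (%x. v n x-w x)) ~~> 0"
 hence w: "w : carr X" and lim: "(%n. nm X (%x. v n x-w x)) ~~> 0" by auto
 have "ALL n. EX s m. v n=(%x. s x+m * b x) & s : S" using asm by blast
 then obtain s m where v: "!!n. v n=(%x. s n x+m n * b x)" and s: "!!n. s n : S" by metis
 have sX: "s n : carr X" for n using s S by auto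
 have vX: "v n : carr X" for n unfolding v using sX b by auto
 have clD: "EX z:S. nm X (%x. z x-w x)=0"
 if "!!n. v n : S" "w : carr X" "(%n. nm X (%x. v n x-w x)) ~~> 0" for v :: "nat => _" and w
 using cl that unfolding hclosed_def by blast
 show "EX z:{%x. s x+m * b x |s m. s : S}. nm X (%x. z x-w x)=0"
 proof (cases "EX t:S. nm X (%x. t x-b x)=0")
 case True
 then obtain t where t: "t : S" "nm X (%x. t x-b x)=0" by blast
 have tX: "t : carr X" using t S by auto
 have "(%n. nm X (%x. (s n x+m n * t x)-w x)) ~~> 0"
 proof (rule Lim_null_comparison[OF _ lim], intro always_eventually allI)
 fix n
 have "nm X (%x. (s n x+m n * t x)-w x) <=
 nm X (%x. (s n x+m n * t x)-v n x)+nm X (%x. v n x-w x)"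
 using sX tX vX w by (intro hnorm_triangle_diff) auto
 moreover have "(%x. (s n x+m n * t x)-v n x)=(%x. m n * (t x-b x))"
 by (auto simp: v algebra_simps)
 ultimately show "norm (nm X (%x. (s n x+m n * t x)-w x)) <= nm X (%x. v n x-w x)"
 using t tX b sX w by (simp add: hnorm_scale)
 qed
 then obtain z where "z : S" "nm X (%x. z x-w x)=0"
 using clD[of "%n x. s n x+m n * t x" w] s t(1) w Sadd Sscale by blast
 moreover have "z=(%x. z x+0 * b x)" by simp
 ultimately show ?thesis by blast
 next
 case False
 have "EX e>0. ALL t:S. e <= nm X (%x. t x-b x)"
 proof (rule ccontr)
 assume "\<not> ?thesis"
 hence "ALL n. EX t:S. nm X (%x. t x-b x)<inverse (real (Suc n))"
 by (metis inverse_positive_iff_positive not_less of_nat_0_less_iff zero_less_Suc)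
 then obtain t where t: "!!n. t n : S" "!!n. nm X (%x. t n x-b x)<inverse (real (Suc n))"
 by metis
 have "(%n. nm X (%x. t n x-b x)) ~~> 0"
 proof (rule Lim_null_comparison[OF _ LIMSEQ_inverse_real_of_nat], intro always_eventually allI)
 fix n
 have "t n : carr X" using t S by auto
 thus "norm (nm X (%x. t n x-b x)) <= inverse (real (Suc n))"
 using t(2)[of n] b by simp
 qed
 thus False using clD[of t b] t(1) b False by blast
 qed
 then obtain e where e: "e > 0" and far: "!!t. t : S ==> e <= nm X (%x. t x-b x)" by blast
 have lower: "cmod mu * e <= nm X (%x. t x+mu * b x)" if t: "t : S" for t mu
 proof (cases "mu=0")
 case True
 thus ?thesis using t S by auto
 next
 case False
 have "e <= nm X (%x. (- 1/mu) * t x-b x)" by (rule far[OF Sscale[OF t]])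
 hence "cmod mu * e <= cmod (- mu) * nm X (%x. (- 1/mu) * t x-b x)"
 by (simp add: mult_left_mono)
 also have "\<dots>=nm X (%x.-mu * ((- 1/mu) * t x-b x))"
 using t S b by (intro hnorm_scale[symmetric] diff_mem scale_mem) auto
 also have "(%x.-mu * ((- 1/mu) * t x-b x))=(%x. t x+mu * b x)"
 using False by (auto simp: field_simps)
 finally show ?thesis .
 qed
 have "Cauchy m"
 proof (rule metric_CauchyI)
 fix d :: real assume d: "0<d"
 hence "0<d * e/2" using e by simp
 hence "\<forall>\<^sub>F n in sequentially. nm X (%x. v n x-w x)<d * e/2"
 using order_tendstoD(2)[OF lim] by blast
 then obtain N where N: "!!n. n >= N ==> nm X (%x. v n x-w x)<d * e/2"
 by (auto simp: eventually_sequentially)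
 show "EX M. ALL p>=M. ALL q>=M. dist (m p) (m q)<d"
 proof (intro exI[of _ N] allI impI)
 fix p q assume pq: "N <= p" "N <= q"
 have mem: "(%x. s p x+(-1) * s q x) : S" by (intro Sadd Sscale s)
 have "cmod (m p-m q) * e <= nm X (%x. s p x+(-1) * s q x+(m p-m q) * b x)"
 by (rule lower[OF mem])
 also have "(%x. s p x+(-1) * s q x+(m p-m q) * b x)=(%x. v p x-v q x)"
 by (auto simp: v algebra_simps)
 also have "nm X (%x. v p x-v q x) <= nm X (%x. v p x-w x)+nm X (%x. w x-v q x)"
 by (intro hnorm_triangle_diff vX w)
 also have "\<dots><d * e" using N[OF pq(1)] N[OF pq(2)] hnorm_diff_commute[OF w vX, of q] by simp
 finally show "dist (m p) (m q)<d" using e by (simp add: dist_norm)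
 qed
 qed
 then obtain mu where mlim: "m ~~> mu" by (meson Cauchy_convergent convergentD)
 have wb: "(%x. w x-mu * b x) : carr X" using w b by auto
 have "(%n. nm X (%x. s n x-(w x-mu * b x))) ~~> 0"
 proof (rule Lim_null_comparison, intro always_eventually allI)
 fix n
 have "nm X (%x. (v n x-w x)+(mu-m n) * b x) <=
 nm X (%x. v n x-w x)+nm X (%x. (mu-m n) * b x)"
 using vX w b by (intro hnorm_triangle) auto
 moreover have "(%x. (v n x-w x)+(mu-m n) * b x)=(%x. s n x-(w x-mu * b x))"
 by (auto simp: v algebra_simps)
 moreover have "nm X (%x. s n x-(w x-mu * b x)) >= 0"
 by (intro hnorm_nonneg diff_mem sX wb)
 ultimately show "norm (nm X (%x. s n x-(w x-mu * b x))) <=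
 nm X (%x. v n x-w x)+cmod (mu-m n) * nm X b"
 by (simp add: hnorm_scale[OF b])
 next
 have "(%n. cmod (mu-m n) * nm X b) ~~> cmod (mu-mu) * nm X b"
 by (intro tendsto_intros mlim)
 thus "(%n. nm X (%x. v n x-w x)+cmod (mu-m n) * nm X b) ~~> 0"
 using tendsto_add[OF lim] by fastforce
 qed
 then obtain z where "z : S" and z0: "nm X (%x. z x-(w x-mu * b x))=0"
 using clD[of s, OF s wb] by blast
 moreover have "(%x. z x-(w x-mu * b x))=(%x. (z x+mu * b x)-w x)" by (auto simp: algebra_simps)
 ultimately show ?thesis by (intro bexI[of _ "%x. z x+mu * b x"]) auto
 qed
qed

lemma hclosed_add_span:
 assumes "finite E" "E <= carr X" and S: "S <= carr X" and cl: "hclosed X S"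
 and Sadd: "!!f g. f : S ==> g : S ==> (%x. f x+g x) : S"
 and Sscale: "!!f c. f : S ==> (%x. c * f x) : S"
 shows "hclosed X {%x. s x+(\<Sum>b\<in>E. c b * b x) | s c. s : S}"
 using assms(1,2)
proof (induction E rule: finite_induct)
 case empty
 thus ?case using cl by simp
next
 case (insert b E)
 define T where "T={%x. s x+(\<Sum>b\<in>E. c b * b x) | s c. s : S}"
 have TI: "(%x. s x+(\<Sum>b\<in>E. c b * b x)) : T" if "s : S" for s c using that by (auto simp: T_def)
 have "hclosed X {%x. t x+m * b x | t m. t : T}"
 proof (rule hclosed_add_line)
 show "hclosed X T" using insert by (auto simp: T_def)
 show "T <= carr X"
 proof
 fix t assume "t : T"
 then obtain s c where t: "s : S" "t=(%x. s x+(\<Sum>b\<in>E. c b * b x))" by (auto simp: T_def)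
 show "t : carr X" unfolding t(2) using t(1) insert.prems S by (intro add_mem sum_mem scale_mem) auto
 qed
 show "b : carr X" using insert.prems by simp
 show "(%x. f x+g x) : T" if "f : T" "g : T" for f g
 proof -
 obtain s c s' c' where f: "s : S" "f=(%x. s x+(\<Sum>b\<in>E. c b * b x))"
 and g: "s' : S" "g=(%x. s' x+(\<Sum>b\<in>E. c' b * b x))"
 using \<open>f : T\<close> \<open>g : T\<close> by (auto simp: T_def)
 have "(%x. f x+g x)=(%x. (s x+s' x)+(\<Sum>b\<in>E. (c b+c' b) * b x))"
 by (simp add: f g distrib_right sum.distrib add_ac)
 thus ?thesis using TI[OF Sadd[OF f(1) g(1)]] by simp
 qed
 show "(%x. a * f x) : T" if "f : T" for f a
 proof -
 obtain s c where f: "s : S" "f=(%x. s x+(\<Sum>b\<in>E. c b * b x))"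
 using \<open>f : T\<close> by (auto simp: T_def)
 have "(%x. a * f x)=(%x. a * s x+(\<Sum>b\<in>E. (a * c b) * b x))"
 by (simp add: f distrib_left sum_distrib_left mult.assoc)
 thus ?thesis using TI[OF Sscale[OF f(1)]] by simp
 qed
 qed
 also have "{%x. t x+m * b x | t m. t : T}={%x. s x+(\<Sum>b\<in>insert b E. c b * b x) | s c. s : S}"
 proof safe
 fix t m assume "t : T"
 then obtain s c where t: "s : S" "t=(%x. s x+(\<Sum>b\<in>E. c b * b x))" by (auto simp: T_def)
 have "(\<Sum>e\<in>E. (c(b := m)) e * e x)=(\<Sum>e\<in>E. c e * e x)" for x
 using insert.hyps by (intro sum.cong) auto
 thus "EX s c. (%x. t x+m * b x)=(%x. s x+(\<Sum>b\<in>insert b E. c b * b x)) & s : S"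
 using t insert.hyps by (intro exI[of _ s] exI[of _ "c(b := m)"]) (auto simp: fun_eq_iff)
 next
 fix s c assume "s : S"
 thus "EX t m. (%x. s x+(\<Sum>b\<in>insert b E. c b * b x))=(%x. t x+m * b x) & t : T"
 using insert.hyps TI[of s c]
 by (intro exI[of _ "%x. s x+(\<Sum>b\<in>E. c b * b x)"] exI[of _ "c b"]) (auto simp: fun_eq_iff)
 qed
 finally show ?case .
qed

lemma geometric_hcauchy:
 assumes f: "!!n. f n : carr X" and step: "!!n. nm X (%x. f (Suc n) x-f n x) <= D * (1/2)^n"
 shows "hcauchy X f"
 unfolding hcauchy_def
proof (intro allI impI)
 fix e :: real assume e: "0<e"
 have "0 <= nm X (%x. f (Suc 0) x-f 0 x)" by (intro hnorm_nonneg diff_mem f)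
 hence D: "0 <= D" using step[of 0] by simp
 have far: "nm X (%x. f (N+k) x-f N x) <= D * (1/2)^N * (2-2*(1/2)^k)" for N k
 proof (induction k)
 case 0
 thus ?case by simp
 next
 case (Suc k)
 have "nm X (%x. f (N+Suc k) x-f N x) <=
 nm X (%x. f (N+Suc k) x-f (N+k) x)+nm X (%x. f (N+k) x-f N x)"
 by (intro hnorm_triangle_diff f)
 also have "\<dots> <= D * (1/2)^(N+k)+D * (1/2)^N * (2-2*(1/2)^k)"
 using step[of "N+k"] Suc by simp
 also have "\<dots>=D * (1/2)^N * (2-2*(1/2)^Suc k)"
 by (simp add: power_add algebra_simps)
 finally show ?case .
 qed
 have "(%N. D * (1/2)^N) ~~> D * 0"
 by (intro tendsto_intros LIMSEQ_realpow_zero) auto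
 hence "\<forall>\<^sub>F N in sequentially. D * (1/2)^N<e/4"
 using e by (intro order_tendstoD(2)) auto
 then obtain N where N: "D * (1/2)^N<e/4" by (auto simp: eventually_sequentially)
 have near: "nm X (%x. f m x-f N x)<e/2" if "N <= m" for m
 proof -
 have "D * (1/2)^N * (2-2*(1/2)^(m-N)) <= D * (1/2)^N * 2"
 using D by (intro mult_left_mono) auto
 thus ?thesis using far[of N "m-N"] that N by simp
 qed
 show "EX N. ALL m>=N. ALL n>=N. nm X (%x. f m x-f n x)<e"
 proof (intro exI[of _ N] allI impI)
 fix m n assume "N <= m" "N <= n"
 thus "nm X (%x. f m x-f n x)<e"
 using near[of m] near[of n] hnorm_triangle_diff[of "f m" "f N" "f n"] f
 hnorm_diff_commute[OF f f, of N n] by simp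
 qed
qed

end

section \<open>Forms that are compact off an eigenspace\<close>

text \<open>A form that agrees with the ambient inner product on \<open>K\<close> and is compactly embedded off \<open>K\<close>; compactness is expressed by the absence of bounded orthonormal sequences, the only form in which it is used.\<close>

locale form_pair=V: semi_hilbert V+L: semi_ip L for V L :: "'a hspace" +
 fixes K :: "('a => complex) set"
 assumes VL: "v : carr V ==> v : carr L"
 and norm_le: "v : carr V ==> nm L v <= nm V v"
 and K_mem: "k : K ==> k : carr V"
 and K_ip: "k : K ==> v : carr V ==> ip V k v=ip L k v"
 and K_proj: "f : carr L ==> EX k:K. ALL k':K. ip L (%x. f x-k x) k'=0"
 and no_sequence: "!!ph C. L.orthonormal (UNIV :: nat set) ph ==>
 (!!n. ph n : carr V & (ALL k:K. ip L (ph n) k=0) & nm V (ph n) <= C) ==> False"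
begin

definition W where "W={v : carr V. ALL k:K. ip L v k=0}"

lemma W_carr: "v : W ==> v : carr V" by (simp add: W_def)

lemma K_ip_right: "k : K ==> v : carr V ==> ip V v k=ip L v k"
 using K_ip[of k v] V.ip_commute[of k v] L.ip_commute[of k v] K_mem VL by simp

text \<open>Otherwise unit vectors that violate the inequality could be chosen one after the other, each orthogonal to the previous ones, which gives a forbidden sequence.\<close>

lemma coercive_complement:
 assumes M: "M > 0"
 shows "EX J. finite J & J <= W & L.orthonormal J (%ph. ph) &
 (ALL v:W. (ALL ph:J. ip L v ph=0) --> M * (nm L v)^2 <= (nm V v)^2)"
proof (rule ccontr)
 assume neg: "\<not> ?thesis"
 have step: "EX r:W. ip L r r=1 & (nm V r)^2 <= M & (ALL ph:J. ip L r ph=0)"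
 if J: "finite J" "J <= W" "L.orthonormal J (%ph. ph)" for J
 proof -
 obtain v where v: "v : W" "!!ph. ph : J ==> ip L v ph=0" "(nm V v)^2<M * (nm L v)^2"
 using neg J by (meson not_less)
 have vV: "v : carr V" and vL: "v : carr L" using v(1) VL by (auto simp: W_def)
 have nz: "nm L v ~= 0" using v(3) by auto
 define a where "a=cr (1/nm L v)"
 define r where "r=(%x. a * v x)"
 have rW: "r : W" unfolding r_def W_def using v(1) VL K_mem by (auto simp: W_def L.ip_scale_left)
 have ca: "cmod a=1/nm L v" using vL by (simp add: a_def norm_divide)
 have "nm L r=1" unfolding r_def L.hnorm_scale[OF vL] ca using nz by simp
 hence "ip L r r=1" using L.ip_self[OF VL[OF W_carr[OF rW]]] by simp
 moreover have "(nm V r)^2=(nm V v)^2/(nm L v)^2"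
 unfolding r_def V.hnorm_scale[OF vV] ca by (simp add: power_divide)
 hence "(nm V r)^2 <= M" using v(3) nz by (simp add: divide_le_eq)
 moreover have "ip L r ph=0" if "ph : J" for ph
 proof -
 have "ph : carr L" using that J VL by (auto simp: W_def)
 thus ?thesis using v(2)[OF that] vL by (simp add: r_def L.ip_scale_left)
 qed
 ultimately show ?thesis using rW by blast
 qed
 let ?P="%(f :: nat => 'a => complex) n r. r : W & ip L r r=1 & (nm V r)^2 <= M & (ALL m<n. ip L r (f m)=0)"
 have "EX f. ALL n. ?P f n (f n)"
 proof (rule dependent_wellorder_choice)
 fix r and f g :: "nat => 'a => complex" and n :: nat
 assume "!!y. y<n ==> f y=g y"
 thus "?P f n r = ?P g n r" by auto
 next
 fix n and f :: "nat => 'a => complex"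
 assume prev: "!!y. y<n ==> ?P f y (f y)"
 have fL: "f y : carr L" if "y<n" for y using prev[OF that] VL by (auto simp: W_def)
 have "ip L (f i) (f j) = of_bool (f i=f j)" if "i<n" "j<n" for i j
 proof (cases i j rule: linorder_cases)
 case less
 hence z: "ip L (f j) (f i)=0" using prev[OF that(2)] by simp
 hence "ip L (f i) (f j)=0" using L.ip_commute[OF fL[OF that(2)] fL[OF that(1)]] by simp
 moreover have "f i ~= f j" using z prev[OF that(2)] by auto
 ultimately show ?thesis by simp
 next
 case equal
 thus ?thesis using prev[OF that(1)] by simp
 next
 case greater
 hence z: "ip L (f i) (f j)=0" using prev[OF that(1)] by simp
 moreover have "f i ~= f j" using z prev[OF that(1)] by auto
 ultimately show ?thesis by simp
 qed
 hence "L.orthonormal (f ` {..<n}) (%ph. ph)" using fL by (auto simp: L.orthonormal_def)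
 moreover have "f ` {..<n} <= W" using prev by auto
 ultimately show "EX r. ?P f n r" using step[of "f ` {..<n}"] by auto
 qed
 then obtain f where f: "!!n. ?P f n (f n)" by blast
 have fL: "f n : carr L" for n using f[of n] VL by (auto simp: W_def)
 have "ip L (f i) (f j) = of_bool (i=j)" for i j
 proof (cases i j rule: linorder_cases)
 case less
 hence "ip L (f j) (f i)=0" using f[of j] by simp
 thus ?thesis using L.ip_commute[OF fL[of j] fL[of i]] less by simp
 qed (use f[of i] in auto)
 hence "L.orthonormal UNIV f" using fL by (simp add: L.orthonormal_def)
 moreover have "nm V (f n) <= sqrt M" for n using f[of n] by (simp add: real_le_rsqrt)
 hence "f n : carr V & (ALL k:K. ip L (f n) k=0) & nm V (f n) <= sqrt M" for n
 using f[of n] by (simp add: W_def)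
 ultimately show False using no_sequence by blast
qed

end

text \<open>The shifted form is coercive on the orthogonal complement of the finite system \<open>J\<close> in the complement of \<open>K\<close>. There the equation is solved by iteration; \<open>K\<close> and \<open>J\<close> are then added again.\<close>

locale form_reduction=form_pair +
 fixes c :: complex and J :: "('a => complex) set"
 assumes c: "c ~= 1" and finJ: "finite J" and JW: "J <= W" and onJ: "L.orthonormal J (%ph. ph)"
 and coercive: "!!v. v : W ==> (!!ph. ph : J ==> ip L v ph=0) ==>
 (2 * cmod c+1)^2*(nm L v)^2 <= (nm V v)^2"
begin

definition a where "a u v=ip V u v-c * ip L u v"

definition WJ where "WJ={v : W. ALL ph:J. ip L v ph=0}"

abbreviation q where "q \<equiv> 2 * cmod c+1"

lemma q_pos: "q > 0" by (simp add: add_nonneg_pos)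

lemma WJ_carr: "v : WJ ==> v : carr V" and WJ_W: "v : WJ ==> v : W"
 by (auto simp: WJ_def W_def)

lemma J_carr: "ph : J ==> ph : carr V" using JW W_carr by blast

lemma J_carrL: "ph : J ==> ph : carr L" using J_carr VL by blast

lemma WJ_coercive: "v : WJ ==> q * nm L v <= nm V v"
proof -
 assume v: "v : WJ"
 have "(q * nm L v)^2 <= (nm V v)^2"
 using coercive[of v] v by (simp add: WJ_def power_mult_distrib)
 thus ?thesis by (rule power2_le_imp_le) (use WJ_carr[OF v] in simp)
qed

lemma L_tendsto_of_V:
 assumes v: "!!n. v n : carr V" and w: "w : carr V" and lim: "(%n. nm V (%x. v n x-w x)) ~~> 0"
 shows "(%n. nm L (%x. v n x-w x)) ~~> 0"
proof (rule Lim_null_comparison[OF _ lim], intro always_eventually allI)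
 fix n
 have "(%x. v n x-w x) : carr V" using v w by auto
 thus "norm (nm L (%x. v n x-w x)) <= nm V (%x. v n x-w x)"
 using norm_le VL by simp
qed

lemma WJ_closed: "closed_subspace V WJ"
 unfolding closed_subspace_def
proof (intro conjI ballI allI impI)
 show "WJ <= carr V" using WJ_carr by blast
 show "(%x. 0) : WJ" using VL K_mem J_carrL by (auto simp: WJ_def W_def)
 show "(%x. f x+g x) : WJ" if "f : WJ" "g : WJ" for f g
 using that VL K_mem J_carrL by (auto simp: WJ_def W_def L.ip_add_left)
 show "(%x. b * f x) : WJ" if "f : WJ" for f b
 using that VL K_mem J_carrL by (auto simp: WJ_def W_def L.ip_scale_left)
 fix v w
 assume asm: "(ALL n::nat. v n : WJ) & w : carr V & (%n. nm V (%x. v n x-w x)) ~~> 0"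
 hence v: "!!n. v n : WJ" and w: "w : carr V" and lim: "(%n. nm V (%x. v n x-w x)) ~~> 0"
 by auto
 have z: "ip L w k=0" if k: "k : carr L" and 0: "!!n. ip L (v n) k=0" for k
 proof -
 have "(%n. ip L (v n) k) ~~> ip L w k"
 by (rule L.ip_tendsto[OF _ VL[OF w] k L_tendsto_of_V[OF _ w lim]]) (use v WJ_carr VL in auto)
 thus ?thesis using 0 by (simp add: LIMSEQ_const_iff)
 qed
 have "ip L w k=0" if "k : K" for k
 by (rule z) (use that v K_mem VL in \<open>auto simp: WJ_def W_def\<close>)
 moreover have "ip L w ph=0" if "ph : J" for ph
 by (rule z) (use that v J_carrL in \<open>auto simp: WJ_def W_def\<close>)
 ultimately show "w : WJ" using w by (simp add: WJ_def W_def)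
qed

lemmas WJ_add=closed_subspaceD(3)[OF WJ_closed]
lemmas WJ_scale=closed_subspaceD(4)[OF WJ_closed]

lemma WJ_diff: "f : WJ ==> g : WJ ==> (%x. f x-g x) : WJ"
 using WJ_add[of f "%x. -1 * g x"] WJ_scale[of g "-1"] by simp

lemma a_add: "u : carr V ==> u' : carr V ==> v : carr V ==> a (%x. u x+u' x) v=a u v+a u' v"
 by (simp add: a_def V.ip_add_left L.ip_add_left VL algebra_simps)

lemma a_diff: "u : carr V ==> u' : carr V ==> v : carr V ==> a (%x. u x-u' x) v=a u v-a u' v"
 by (simp add: a_def V.ip_diff_left L.ip_diff_left VL algebra_simps)

lemma a_scale: "u : carr V ==> v : carr V ==> a (%x. b * u x) v=b * a u v"
 by (simp add: a_def V.ip_scale_left L.ip_scale_left VL algebra_simps)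

lemma a_add_right: "u : carr V ==> v : carr V ==> v' : carr V ==> a u (%x. v x+v' x)=a u v+a u v'"
 by (simp add: a_def V.ip_add_right L.ip_add_right VL algebra_simps)

lemma a_scale_right: "u : carr V ==> v : carr V ==> a u (%x. b * v x)=cnj b * a u v"
 by (simp add: a_def V.ip_scale_right L.ip_scale_right VL algebra_simps)

lemma a_sum_right:
 "u : carr V ==> (!!i. i : I ==> f i : carr V) ==> a u (%x. \<Sum>i\<in>I. f i x)=(\<Sum>i\<in>I. a u (f i))"
 by (simp add: a_def V.ip_sum_right L.ip_sum_right VL sum_subtractf sum_distrib_left)

lemma a_bound:
 assumes u: "u : carr V" and v: "v : carr V"
 shows "cmod (a u v) <= (1+cmod c) * nm V u * nm V v"
proof -
 have "cmod (a u v) <= cmod (ip V u v)+cmod c * cmod (ip L u v)"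
 unfolding a_def by (metis norm_mult norm_triangle_ineq4)
 moreover have "cmod (ip V u v) <= nm V u * nm V v" by (rule V.cauchy_schwarz[OF u v])
 moreover have "cmod (ip L u v) <= nm V u * nm V v"
 using L.cauchy_schwarz[OF VL[OF u] VL[OF v]] norm_le[OF u] norm_le[OF v] VL[OF u] VL[OF v] u v
 by (meson L.hnorm_nonneg V.hnorm_nonneg mult_mono order_trans)
 hence "cmod c * cmod (ip L u v) <= cmod c * (nm V u * nm V v)" by (simp add: mult_left_mono)
 ultimately show ?thesis by (simp add: algebra_simps)
qed

lemma a_coercive:
 assumes v: "v : WJ"
 shows "(nm V v)^2 <= 2 * cmod (a v v)"
proof -
 have vV: "v : carr V" and vL: "v : carr L" using WJ_carr[OF v] VL by auto
 have "2 * cmod c * (nm L v)^2 <= q * q * (nm L v)^2"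
 by (intro mult_right_mono) (auto simp: algebra_simps add_nonneg_nonneg)
 also have "\<dots>=(q * nm L v)^2" by (simp add: power2_eq_square)
 also have "\<dots> <= (nm V v)^2"
 using WJ_coercive[OF v] vL q_pos by (intro power_mono) auto
 finally have small: "2 * cmod c * (nm L v)^2 <= (nm V v)^2" .
 have "(nm V v)^2=cmod (a v v+c * ip L v v)"
 using V.ip_self[OF vV] by (simp add: a_def norm_power)
 also have "\<dots> <= cmod (a v v)+cmod c * (nm L v)^2"
 using norm_triangle_ineq[of "a v v" "c * ip L v v"] L.ip_self[OF vL] by (simp add: norm_mult norm_power)
 finally show ?thesis using small by linarith
qed

lemma rep_bound:
 assumes u: "u : WJ" and g: "g : carr L" and rep: "!!v. v : WJ ==> ip V u v=ip L g v"
 shows "q * nm V u <= nm L g"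
proof (cases "nm V u=0")
 case False
 have uV: "u : carr V" and uL: "u : carr L" using WJ_carr[OF u] VL by auto
 have pos: "nm V u > 0" using False V.hnorm_nonneg[OF uV] by linarith
 have "(nm V u)^2=cmod (ip L g u)"
 using V.ip_self[OF uV] rep[OF u] by (metis norm_of_real abs_power2)
 also have "\<dots> <= nm L g * nm L u" by (rule L.cauchy_schwarz[OF g uL])
 finally have "q * (nm V u)^2 <= q * (nm L g * nm L u)"
 using q_pos by (intro mult_left_mono) auto
 also have "\<dots>=nm L g * (q * nm L u)" by simp
 also have "\<dots> <= nm L g * nm V u"
 using WJ_coercive[OF u] g by (intro mult_left_mono) auto
 finally have "(q * nm V u) * nm V u <= nm L g * nm V u"
 by (simp add: power2_eq_square algebra_simps)
 thus ?thesis using pos by (rule mult_right_le_imp_le)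
qed (use g in simp)

lemma representative:
 assumes g: "g : carr L"
 shows "EX u:WJ. ALL v:WJ. ip V u v=ip L g v"
proof (rule V.riesz[OF WJ_closed])
 show "cmod (ip L g v) <= nm L g * nm V v" if "v : WJ" for v
 using L.cauchy_schwarz[OF g VL[OF WJ_carr[OF that]]] norm_le[OF WJ_carr[OF that]] g
 by (meson L.hnorm_nonneg mult_left_mono order_trans)
qed (use g VL WJ_carr in \<open>auto simp: L.ip_add_right L.ip_scale_right\<close>)

lemma solvable:
 assumes g: "g : carr L"
 shows "EX u:WJ. ALL v:WJ. a u v=ip L g v"
proof -
 define B where "B f=(SOME u. u : WJ & (ALL v:WJ. ip V u v=ip L f v))" for f
 have B: "B f : WJ" "!!v. v : WJ ==> ip V (B f) v=ip L f v" if "f : carr L" for f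
 using someI_ex[of "%u. u : WJ & (ALL v:WJ. ip V u v=ip L f v)"] representative[OF that]
 unfolding B_def by blast+
 define u where "u=rec_nat (%x. 0) (%_ w. B (%x. g x+c * w x))"
 have uS: "u (Suc n)=B (%x. g x+c * u n x)" for n by (simp add: u_def)
 have u: "u n : WJ" for n
 proof (induction n)
 case 0
 thus ?case using closed_subspaceD(2)[OF WJ_closed] by (simp add: u_def)
 next
 case (Suc n)
 hence "(%x. g x+c * u n x) : carr L" using g VL WJ_carr by auto
 thus ?case using B(1) by (simp add: uS)
 qed
 have uV: "u n : carr V" and uL: "u n : carr L" for n using WJ_carr[OF u] VL by auto
 have eq: "ip V (u (Suc n)) v=ip L g v+c * ip L (u n) v" if v: "v : WJ" for n v
 unfolding uS using B(2)[OF _ v, of "%x. g x+c * u n x"] g uL VL[OF WJ_carr[OF v]]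
 by (simp add: L.ip_add_left L.ip_scale_left)
 define D where "D=nm V (%x. u (Suc 0) x-u 0 x)"
 have step: "nm V (%x. u (Suc n) x-u n x) <= D * (1/2)^n" for n
 proof (induction n)
 case 0
 thus ?case by (simp add: D_def)
 next
 case (Suc n)
 let ?d="%x. u (Suc n) x-u n x"
 have "q * nm V (%x. u (Suc (Suc n)) x-u (Suc n) x) <= nm L (%x. c * ?d x)"
 proof (rule rep_bound)
 fix v assume v: "v : WJ"
 hence "v : carr L" "v : carr V" using VL WJ_carr by auto
 thus "ip V (%x. u (Suc (Suc n)) x-u (Suc n) x) v=ip L (%x. c * ?d x) v"
 using uV uL v
 by (simp add: V.ip_diff_left L.ip_scale_left L.ip_diff_left eq algebra_simps)
 qed (use u uL WJ_diff in auto)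
 also have "\<dots>=cmod c * nm L ?d" using uL by (intro L.hnorm_scale) auto
 also have "\<dots> <= (q/2) * nm V ?d"
 using norm_le[of ?d] uV uL by (intro mult_mono) auto
 also have "\<dots> <= (q/2)*(D * (1/2)^n)" using Suc q_pos by (intro mult_left_mono) auto
 finally have "q * nm V (%x. u (Suc (Suc n)) x-u (Suc n) x) <= q * (D * (1/2)^Suc n)" by simp
 thus ?case using q_pos by (rule mult_left_le_imp_le)
 qed
 then obtain w where w: "w : carr V" and lim: "(%n. nm V (%x. u n x-w x)) ~~> 0"
 using V.complete[of u, OF uV] V.geometric_hcauchy[of u D, OF uV step] by blast
 have wW: "w : WJ" by (rule closed_subspaceD(5)[OF WJ_closed u w lim])
 have "a w v=ip L g v" if v: "v : WJ" for v
 proof -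
 have vV: "v : carr V" and vL: "v : carr L" using WJ_carr[OF v] VL by auto
 have "(%n. ip V (u n) v) ~~> ip V w v" by (rule V.ip_tendsto[OF uV w vV lim])
 hence "(%n. ip V (u (Suc n)) v) ~~> ip V w v" by (rule LIMSEQ_Suc)
 moreover have "(%n. ip L (u n) v) ~~> ip L w v"
 by (rule L.ip_tendsto[OF uL VL[OF w] vL L_tendsto_of_V[OF uV w lim]])
 hence "(%n. ip V (u (Suc n)) v) ~~> ip L g v+c * ip L w v"
 unfolding eq[OF v] by (intro tendsto_intros)
 ultimately have "ip V w v=ip L g v+c * ip L w v" by (rule LIMSEQ_unique)
 thus ?thesis by (simp add: a_def)
 qed
 thus ?thesis using wW by blast
qed

definition S where "S g=(SOME u. u : WJ & (ALL v:WJ. a u v=ip L g v))"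

lemma S_mem: "g : carr L ==> S g : WJ"
 and S_eq: "g : carr L ==> v : WJ ==> a (S g) v=ip L g v"
 using someI_ex[of "%u. u : WJ & (ALL v:WJ. a u v=ip L g v)"] solvable[of g]
 unfolding S_def by blast+

lemma S_carr: "g : carr L ==> S g : carr V"
 using S_mem WJ_carr by blast

lemma S_unique:
 assumes u: "u : WJ" and g: "g : carr L" and eq: "!!v. v : WJ ==> a u v=ip L g v" and v: "v : carr V"
 shows "a (S g) v=a u v"
proof -
 let ?d="%x. S g x-u x"
 have uV: "u : carr V" by (rule WJ_carr[OF u])
 have d: "?d : WJ" by (rule WJ_diff[OF S_mem[OF g] u])
 have "a ?d ?d=0"
 using a_diff[OF S_carr[OF g] uV WJ_carr[OF d]] S_eq[OF g d] eq[OF d] by simp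
 hence "nm V ?d=0" using a_coercive[OF d] by simp
 hence "a ?d v=0" using a_bound[OF WJ_carr[OF d] v] by simp
 thus ?thesis using a_diff[OF S_carr[OF g] uV v] by simp
qed

lemma S_bound: "g : carr L ==> nm V (S g) <= 2 * nm L g"
proof (cases "nm V (S g)=0")
 case False
 assume g: "g : carr L"
 note SV=S_carr[OF g] note SL=VL[OF SV]
 have pos: "nm V (S g) > 0" using False V.hnorm_nonneg[OF SV] by linarith
 have "(nm V (S g))^2 <= 2 * cmod (ip L g (S g))"
 using a_coercive[OF S_mem[OF g]] S_eq[OF g S_mem[OF g]] by simp
 also have "cmod (ip L g (S g)) <= nm L g * nm V (S g)"
 using L.cauchy_schwarz[OF g SL] norm_le[OF SV] g by (meson L.hnorm_nonneg mult_left_mono order_trans)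
 finally have "nm V (S g) * nm V (S g) <= (2 * nm L g) * nm V (S g)"
 by (simp add: power2_eq_square)
 thus ?thesis using pos by (rule mult_right_le_imp_le)
qed simp

definition l where "l ph g=ip L g ph-a (S g) ph"

lemma l_add:
 assumes ph: "ph : J" and f: "f : carr L" and g: "g : carr L"
 shows "l ph (%x. f x+g x)=l ph f+l ph g"
proof -
 have "a (S (%x. f x+g x)) ph=a (%x. S f x+S g x) ph"
 proof (rule S_unique)
 show "a (%x. S f x+S g x) v=ip L (%x. f x+g x) v" if "v : WJ" for v
 using a_add[OF S_carr[OF f] S_carr[OF g] WJ_carr[OF that]] S_eq[OF f that] S_eq[OF g that]
 L.ip_add_left[OF f g VL[OF WJ_carr[OF that]]] by simp
 qed (use WJ_add S_mem f g J_carr ph in auto)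
 thus ?thesis
 using a_add[OF S_carr[OF f] S_carr[OF g] J_carr[OF ph]] L.ip_add_left[OF f g J_carrL[OF ph]]
 by (simp add: l_def)
qed

lemma l_scale:
 assumes ph: "ph : J" and f: "f : carr L"
 shows "l ph (%x. b * f x)=b * l ph f"
proof -
 have "a (S (%x. b * f x)) ph=a (%x. b * S f x) ph"
 proof (rule S_unique)
 show "a (%x. b * S f x) v=ip L (%x. b * f x) v" if "v : WJ" for v
 using a_scale[OF S_carr[OF f] WJ_carr[OF that]] S_eq[OF f that]
 L.ip_scale_left[OF f VL[OF WJ_carr[OF that]]] by simp
 qed (use WJ_scale S_mem f J_carr ph in auto)
 thus ?thesis
 using a_scale[OF S_carr[OF f] J_carr[OF ph]] L.ip_scale_left[OF f J_carrL[OF ph]]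
 by (simp add: l_def algebra_simps)
qed

lemma l_bound:
 assumes ph: "ph : J" and g: "g : carr L"
 shows "cmod (l ph g) <= nm L g * (nm L ph+(1+cmod c)*2 * nm V ph)"
proof -
 have "cmod (l ph g) <= cmod (ip L g ph)+cmod (a (S g) ph)" unfolding l_def by (rule norm_triangle_ineq4)
 also have "cmod (ip L g ph) <= nm L g * nm L ph" by (rule L.cauchy_schwarz[OF g J_carrL[OF ph]])
 also have "cmod (a (S g) ph) <= (1+cmod c) * nm V (S g) * nm V ph"
 by (rule a_bound[OF S_carr[OF g] J_carr[OF ph]])
 also have "\<dots> <= (1+cmod c)*(2 * nm L g) * nm V ph"
 using S_bound[OF g] J_carr[OF ph] by (intro mult_right_mono mult_left_mono) auto
 finally show ?thesis by (simp add: algebra_simps)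
qed

definition R0 where "R0={g : carr L. ALL ph:J. l ph g=0}"

definition R where "R={g : carr L. EX u:carr V. ALL v:carr V. a u v=ip L g v}"

lemma R0_closed: "hclosed L R0"
 unfolding hclosed_def
proof (intro allI impI)
 fix v w
 assume "(ALL n::nat. v n : R0) & w : carr L & (%n. nm L (%x. v n x-w x)) ~~> 0"
 hence v: "!!n. v n : R0" and w: "w : carr L" and lim: "(%n. nm L (%x. v n x-w x)) ~~> 0"
 by auto
 have vL: "v n : carr L" for n using v[of n] by (simp add: R0_def)
 have "l ph w=0" if ph: "ph : J" for ph
 proof -
 define C where "C=nm L ph+(1+cmod c)*2 * nm V ph"
 have "cmod (l ph w) <= nm L (%x. v n x-w x) * C" for n
 proof -
 have "l ph (%x. w x+(-1) * v n x)=l ph w"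
 using l_add[OF ph w L.scale_mem[OF vL], of "-1" n] l_scale[OF ph vL, of "-1" n] v[of n] ph
 by (simp add: R0_def)
 thus ?thesis
 using l_bound[OF ph L.diff_mem[OF w vL[of n]]] L.hnorm_diff_commute[OF w vL[of n]] by (simp add: C_def)
 qed
 moreover have "(%n. nm L (%x. v n x-w x) * C) ~~> 0 * C" by (intro tendsto_intros lim)
 ultimately have "cmod (l ph w) <= 0 * C" by (intro LIMSEQ_le_const) auto
 thus ?thesis by simp
 qed
 thus "EX z:R0. nm L (%x. z x-w x)=0" using w by (intro bexI[of _ w]) (auto simp: R0_def)
qed

lemma R0_sub_R: "R0 <= R"
proof
 fix g assume "g : R0"
 hence g: "g : carr L" and l0: "!!ph. ph : J ==> a (S g) ph=ip L g ph"
 by (auto simp: R0_def l_def)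
 obtain k where k: "k : K" "!!k'. k' : K ==> ip L (%x. g x-k x) k'=0" using K_proj[OF g] by blast
 have kV: "k : carr V" and kL: "k : carr L" using K_mem k(1) VL by auto
 have SW: "S g : W" and SV: "S g : carr V" and SL: "S g : carr L"
 using S_mem[OF g] WJ_W WJ_carr VL by auto
 define u where "u=(%x. (1/(1-c)) * k x+S g x)"
 have uV: "u : carr V" unfolding u_def by (intro V.add_mem V.scale_mem kV SV)
 have "a u v=ip L g v" if v: "v : carr V" for v
 proof -
 have vL: "v : carr L" using v VL by simp
 obtain kv where kv: "kv : K" "!!k'. k' : K ==> ip L (%x. v x-kv x) k'=0" using K_proj[OF vL] by blast
 have kvV: "kv : carr V" and kvL: "kv : carr L" using K_mem kv(1) VL by auto
 define w where "w=(%x. v x-kv x)"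
 have wW: "w : W" unfolding w_def W_def using kv v kvV by auto
 have wV: "w : carr V" and wL: "w : carr L" using wW W_carr VL by auto
 define p where "p=(%x. \<Sum>ph\<in>J. ip L w ph * ph x)"
 have pV: "p : carr V" unfolding p_def using J_carr by (intro V.sum_mem V.scale_mem)
 have pL: "p : carr L" using pV VL by simp
 define w' where "w'=(%x. w x-p x)"
 have pK: "ip L p k'=0" if "k' : K" for k'
 proof -
 have "ip L p k'=(\<Sum>ph\<in>J. ip L w ph * ip L ph k')"
 unfolding p_def using J_carrL K_mem VL that
 by (subst L.ip_sum_left) (auto simp: L.ip_scale_left)
 also have "\<dots>=0" using JW that by (intro sum.neutral) (auto simp: W_def)
 finally show ?thesis .
 qed
 have w'W: "w' : WJ"
 proof -
 have "ip L w' k'=0" if "k' : K" for k'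
 using pK[OF that] wW that K_mem[OF that] VL wL pL by (simp add: w'_def L.ip_diff_left W_def)
 moreover have "ip L w' ph=0" if "ph : J" for ph
 unfolding w'_def p_def using L.residual_orthogonal[OF onJ finJ wL that] .
 ultimately show ?thesis using wV pV by (auto simp: WJ_def W_def w'_def)
 qed
 have Sp: "a (S g) p=ip L g p"
 proof -
 have "a (S g) p=(\<Sum>ph\<in>J. a (S g) (%x. ip L w ph * ph x))"
 unfolding p_def using J_carr SV by (intro a_sum_right) auto
 also have "\<dots>=(\<Sum>ph\<in>J. ip L g (%x. ip L w ph * ph x))"
 using J_carr J_carrL SV g by (intro sum.cong) (auto simp: a_scale_right L.ip_scale_right l0)
 also have "\<dots>=ip L g p"
 unfolding p_def using J_carrL g by (intro L.ip_sum_right[symmetric]) auto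
 finally show ?thesis .
 qed
 have "a (S g) w'=ip L g w'" by (rule S_eq[OF g w'W])
 moreover have w_split: "w=(%x. w' x+p x)" by (simp add: w'_def)
 ultimately have Sw: "a (S g) w=ip L g w"
 using Sp a_add_right[OF SV WJ_carr[OF w'W] pV] L.ip_add_right[OF VL[OF WJ_carr[OF w'W]] pL g]
 by metis
 have Sk: "a (S g) kv=0"
 using SW kv(1) K_ip_right[OF kv(1) SV] by (simp add: a_def W_def)
 have v_split: "v=(%x. w x+kv x)" by (simp add: w_def)
 have "a (S g) v=ip L g w"
 using a_add_right[OF SV wV kvV] Sw Sk v_split by simp
 moreover have "a (%x. (1/(1-c)) * k x) v=ip L k v"
 proof -
 have "a (%x. (1/(1-c)) * k x) v=(1/(1-c)) * a k v" by (rule a_scale[OF kV v])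
 also have "a k v=(1-c) * ip L k v" using K_ip[OF k(1) v] by (simp add: a_def algebra_simps)
 finally show ?thesis using c by simp
 qed
 moreover have "ip L k v=ip L g kv"
 proof -
 have "ip L k w=0" using wW k(1) L.ip_commute[OF wL kL] by (simp add: W_def)
 hence "ip L k v=ip L k kv" using v_split L.ip_add_right[OF wL kvL kL] by simp
 moreover have "ip L g kv=ip L k kv" using k(2)[OF kv(1)] L.ip_diff_left[OF g kL kvL] by simp
 ultimately show ?thesis by simp
 qed
 moreover have "ip L g v=ip L g w+ip L g kv" using v_split L.ip_add_right[OF wL kvL g] by simp
 moreover have "a u v=a (%x. (1/(1-c)) * k x) v+a (S g) v"
 unfolding u_def by (intro a_add V.scale_mem kV SV v)
 ultimately show ?thesis by simp
 qed
 thus "g : R" using g uV by (auto simp: R_def)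
qed

lemma R_zero: "(%x. 0) : R"
 using VL by (auto simp: R_def a_def intro!: bexI[of _ "%x. 0"])

lemma R_add: "f : R ==> g : R ==> (%x. f x+g x) : R"
proof -
 assume "f : R" "g : R"
 then obtain u w where "f : carr L" "g : carr L" "u : carr V" "w : carr V"
 "!!v. v : carr V ==> a u v=ip L f v" "!!v. v : carr V ==> a w v=ip L g v"
 unfolding R_def by blast
 thus ?thesis unfolding R_def
 by (auto intro!: bexI[of _ "%x. u x+w x"] simp: a_add L.ip_add_left VL)
qed

lemma R_scale: "f : R ==> (%x. b * f x) : R"
proof -
 assume "f : R"
 then obtain u where "f : carr L" "u : carr V" "!!v. v : carr V ==> a u v=ip L f v"
 unfolding R_def by blast
 thus ?thesis unfolding R_def
 by (auto intro!: bexI[of _ "%x. b * u x"] simp: a_scale L.ip_scale_left VL)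
qed

lemma R_closed: "hclosed L R"
proof -
 have RL: "R <= carr L" by (auto simp: R_def)
 have "EX E. finite E & E <= R &
 (ALL w:R. EX r:R. (ALL ph:J. l ph r=0) & (EX c. w=(%x. r x+(\<Sum>b\<in>E. c b * b x))))"
 using RL by (intro functional_reduction finJ R_zero R_add R_scale l_add l_scale) auto
 then obtain E where E: "finite E" "E <= R"
 and red: "!!w. w : R ==> EX r:R. (ALL ph:J. l ph r=0) & (EX c. w=(%x. r x+(\<Sum>b\<in>E. c b * b x)))"
 by (elim exE conjE) (rule that, auto)
 have sumR: "(%x. \<Sum>b\<in>E. c b * b x) : R" for c
 using E by (induction E rule: finite_induct) (auto intro: R_zero R_add R_scale)
 have "R={%x. s x+(\<Sum>b\<in>E. c b * b x) | s c. s : R0}"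
 proof (intro equalityI subsetI)
 fix w assume "w : R"
 from red[OF this] obtain r c where r: "r : R" "ALL ph:J. l ph r=0" "w=(%x. r x+(\<Sum>b\<in>E. c b * b x))"
 by (elim bexE conjE exE)
 hence "r : R0" using RL by (auto simp: R0_def)
 thus "w : {%x. s x+(\<Sum>b\<in>E. c b * b x) | s c. s : R0}" using r(3) by blast
 next
 fix w assume "w : {%x. s x+(\<Sum>b\<in>E. c b * b x) | s c. s : R0}"
 thus "w : R" using R0_sub_R R_add sumR by blast
 qed
 moreover have "hclosed L {%x. s x+(\<Sum>b\<in>E. c b * b x) | s c. s : R0}"
 using E RL R0_closed by (intro L.hclosed_add_span) (auto simp: R0_def l_add l_scale)
 ultimately show ?thesis by simp
qed

lemma R_finite_codim: "finite_codim L R (carr L)"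
proof -
 have "EX E. finite E & E <= carr L &
 (ALL w:carr L. EX r:carr L. (ALL ph:J. l ph r=0) & (EX c. w=(%x. r x+(\<Sum>b\<in>E. c b * b x))))"
 by (intro functional_reduction finJ L.zero_mem L.add_mem L.scale_mem l_add l_scale)
 then obtain E where E: "finite E" "E <= carr L"
 and red: "!!w. w : carr L ==> EX r:carr L. (ALL ph:J. l ph r=0) & (EX c. w=(%x. r x+(\<Sum>b\<in>E. c b * b x)))"
 by (elim exE conjE) (rule that, auto)
 have "EX r:R. EX c. nm L (%x. w x-(r x+(\<Sum>b\<in>E. c b * b x)))=0" if w: "w : carr L" for w
 proof -
 from red[OF w] obtain r c where r: "r : carr L" "ALL ph:J. l ph r=0" "w=(%x. r x+(\<Sum>b\<in>E. c b * b x))"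
 by (elim bexE conjE exE)
 hence "r : R" using R0_sub_R by (auto simp: R0_def)
 thus ?thesis using r(3) by (intro bexI[of _ r] exI[of _ c]) simp
 qed
 thus ?thesis using E unfolding finite_codim_def by blast
qed

definition N where "N={u : carr V. ALL v:carr V. a u v=0}"

lemma N_finite_dim: "finite_codim L {%x. 0} N"
proof -
 have "EX E. finite E & E <= N &
 (ALL w:N. EX r:N. (ALL ph:J. ip L r ph=0) & (EX c. w=(%x. r x+(\<Sum>b\<in>E. c b * b x))))"
 using VL J_carrL
 by (intro functional_reduction[where l="%ph r. ip L r ph"] finJ)
 (auto simp: N_def a_add a_scale L.ip_add_left L.ip_scale_left, auto simp: a_def)
 then obtain E where E: "finite E" "E <= N"
 and red: "!!w. w : N ==> EX r:N. (ALL ph:J. ip L r ph=0) & (EX c. w=(%x. r x+(\<Sum>b\<in>E. c b * b x)))"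
 by (elim exE conjE) (rule that, auto)
 have "EX c. nm L (%x. w x-(0+(\<Sum>b\<in>E. c b * b x)))=0" if w: "w : N" for w
 proof -
 from red[OF w] obtain r d where r: "r : N" "ALL ph:J. ip L r ph=0" "w=(%x. r x+(\<Sum>b\<in>E. d b * b x))"
 by (elim bexE conjE exE)
 have rV: "r : carr V" and r0: "!!v. v : carr V ==> a r v=0" using r(1) by (auto simp: N_def)
 have "ip L r k=0" if k: "k : K" for k
 proof -
 have "(1-c) * ip L r k=a r k" using K_ip_right[OF k rV] by (simp add: a_def algebra_simps)
 also have "\<dots>=0" by (rule r0[OF K_mem[OF k]])
 finally show ?thesis using c by simp
 qed
 hence "r : WJ" using r(2) rV by (simp add: WJ_def W_def)
 hence "nm V r=0" using a_coercive[of r] r0[OF rV] by simp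
 hence "nm L r=0" using norm_le[OF rV] L.hnorm_nonneg[OF VL[OF rV]] by simp
 thus ?thesis using r(3) by (intro exI[of _ d]) simp
 qed
 thus ?thesis
 unfolding finite_codim_def by (intro exI[of _ E] conjI E ballI bexI[of _ "%x. 0"]) auto
qed

end

context form_pair begin

text \<open>The range contains a subspace cut out by finitely many functionals, and the kernel meets the coercive part trivially.\<close>

theorem fredholm_off_eigenvalue:
 assumes z: "z ~= 0"
 shows "fredholm L (op_shift (op_shift (assoc_op V L) (- 1)) (- z))" (is "fredholm L ?A")
proof -
 define c where "c=1+z"
 have "2 * cmod c+1 > 0" by (simp add: add_nonneg_pos)
 hence "(2 * cmod c+1)^2 > 0" by (rule zero_less_power)
 from coercive_complement[OF this] obtain J where J: "finite J" "J <= W" "L.orthonormal J (%ph. ph)"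
 "!!v. v : W ==> (ALL ph:J. ip L v ph=0) ==> (2 * cmod c+1)^2*(nm L v)^2 <= (nm V v)^2" by blast
 interpret form_reduction V L K c J
 by unfold_locales (use J z in \<open>auto simp: c_def\<close>)
 have A: "(u, g) : ?A \<longleftrightarrow> u : carr V & g : carr L & (ALL v:carr V. a u v=ip L g v)" for u g
 proof
 assume "(u, g) : ?A"
 then obtain w where w: "(u, w) : assoc_op V L" and g: "g=(%x. w x+- 1 * u x+- z * u x)"
 by (auto simp: op_shift_def)
 have uV: "u : carr V" and uL: "u : carr L" and wL: "w : carr L"
 and eq: "!!v. v : carr V ==> ip V u v=ip L w v" using w VL by (auto simp: assoc_op_def)
 have g': "g=(%x. w x+(- c) * u x)" by (auto simp: g c_def algebra_simps)
 have gL: "g : carr L" unfolding g' by (intro L.add_mem L.scale_mem uL wL)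
 have "a u v=ip L g v" if v: "v : carr V" for v
 unfolding g' a_def eq[OF v] using uL wL VL[OF v] L.scale_mem[OF uL, of "- c"]
 by (simp add: L.ip_diff_left L.ip_scale_left)
 thus "u : carr V & g : carr L & (ALL v:carr V. a u v=ip L g v)" using uV gL by simp
 next
 assume asm: "u : carr V & g : carr L & (ALL v:carr V. a u v=ip L g v)"
 hence uL: "u : carr L" using VL by simp
 define w where "w=(%x. g x+c * u x)"
 have "(u, w) : assoc_op V L"
 using asm uL VL by (auto simp: assoc_op_def w_def a_def L.ip_add_left L.ip_scale_left algebra_simps)
 moreover have "g=(%x. w x+- 1 * u x+- z * u x)" by (auto simp: w_def c_def algebra_simps)
 ultimately show "(u, g) : ?A" unfolding op_shift_def
 by (intro CollectI exI[of _ u] exI[of _ "%x. w x+- 1 * u x"] exI[of _ w] conjI) simp_all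
 qed
 have "Range ?A=R" using A by (auto simp: R_def)
 moreover have "op_kernel L ?A=N"
 proof (intro equalityI subsetI)
 fix u assume "u : op_kernel L ?A"
 then obtain g where g: "(u, g) : ?A" "nm L g=0" by (auto simp: op_kernel_def)
 thus "u : N" using VL unfolding A by (auto simp: N_def L.ip_null_left)
 next
 fix u assume "u : N"
 hence "(u, %x. 0) : ?A" unfolding A using VL by (auto simp: N_def)
 thus "u : op_kernel L ?A" unfolding op_kernel_def using L.hnorm_zero by blast
 qed
 ultimately show ?thesis
 using R_closed R_finite_codim N_finite_dim by (simp add: fredholm_def)
qed

end

section \<open>Square integrable functions\<close>

lemma measurable_weighted_product:
 fixes f g :: "'s => complex"
 assumes [measurable]: "f : bm M" "g : bm M"
 and [measurable]: "(%s. (cmod (f s))^2 * w s) : bm M"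
 shows "(%s. f s * cnj (g s) * cr (w s)) : bm M"
proof -
 have "(%s. f s * cnj (g s) * cr (w s)) =
 (%s. if f s=0 then 0 else f s * cnj (g s)/cr ((cmod (f s))^2) *
 cr ((cmod (f s))^2 * w s))"
 by (auto simp: fun_eq_iff)
 also have "\<dots> : bm M"
 proof -
 have [measurable]: "cnj : bm borel" "cr : bm borel"
 by (intro borel_measurable_continuous_onI continuous_intros)+
 have "{s : space M. f s=0}=f -` {0} \<inter> space M" by auto
 hence [measurable]: "{s : space M. f s=0} : sets M" using measurable_sets[OF assms(1), of "{0}"] by simp
 show ?thesis by measurable
 qed
 finally show ?thesis .
qed

lemma integrable_weighted_product:
 fixes f g :: "'s => complex"
 assumes f: "f : bm M" and g: "g : bm M" and w: "!!s. s : space M ==> 0 <= w s"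
 and fi: "integrable M (%s. (cmod (f s))^2 * w s)" and gi: "integrable M (%s. (cmod (g s))^2 * w s)"
 shows "integrable M (%s. f s * cnj (g s) * cr (w s))"
proof (rule Bochner_Integration.integrable_bound[OF Bochner_Integration.integrable_add[OF fi gi]])
 show "(%s. f s * cnj (g s) * cr (w s)) : bm M"
 by (rule measurable_weighted_product) (use f g fi in auto)
 show "AE s in M. norm (f s * cnj (g s) * cr (w s)) <=
 norm ((cmod (f s))^2 * w s+(cmod (g s))^2 * w s)"
 proof (rule AE_I2)
 fix s assume s: "s : space M"
 have "0 <= (cmod (f s)-cmod (g s))^2" by simp
 hence "2*(cmod (f s) * cmod (g s)) <= (cmod (f s))^2+(cmod (g s))^2"
 by (simp add: power2_diff)
 moreover have "0 <= cmod (f s) * cmod (g s)" by simp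
 ultimately have "cmod (f s) * cmod (g s) <= (cmod (f s))^2+(cmod (g s))^2" by linarith
 hence "cmod (f s) * cmod (g s) * w s <= ((cmod (f s))^2+(cmod (g s))^2) * w s"
 using w[OF s] by (rule mult_right_mono)
 thus "norm (f s * cnj (g s) * cr (w s)) <=
 norm ((cmod (f s))^2 * w s+(cmod (g s))^2 * w s)"
 using w[OF s] by (simp add: norm_mult distrib_right)
 qed
qed

lemma weighted_L2_semi_ip:
 fixes p :: "'s => 'a" and M :: "'s measure"
 assumes w: "!!s. s : space M ==> 0 <= w s"
 shows "semi_ip \<lparr>
 carr={f. (%s. f (p s)) : bm M & integrable M (%s. (cmod (f (p s)))^2 * w s)},
 ip=(%f g. LINT s|M. f (p s) * cnj (g (p s)) * cr (w s)) \<rparr>" (is "semi_ip ?X")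
proof -
 have int: "integrable M (%s. f (p s) * cnj (g (p s)) * cr (w s))"
 if "f : carr ?X" "g : carr ?X" for f g
 by (rule integrable_weighted_product[OF _ _ w]) (use that in auto)
 show ?thesis
 proof
 fix f g k :: "'a => complex" and c :: complex
 show "(%x. 0) : carr ?X" by simp
 show "(%x. f x+g x) : carr ?X" if f: "f : carr ?X" and g: "g : carr ?X"
 proof -
 have eq: "(%s. (cmod (f (p s)+g (p s)))^2 * w s)=(%s. (cmod (f (p s)))^2 * w s +
 2 * Re (f (p s) * cnj (g (p s)) * cr (w s))+(cmod (g (p s)))^2 * w s)"
 unfolding cmod_power2 by (auto simp: fun_eq_iff power2_eq_square algebra_simps)
 have "integrable M (%s. (cmod (f (p s)+g (p s)))^2 * w s)"
 unfolding eq using f g int[OF f g]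
 by (intro Bochner_Integration.integrable_add integrable_mult_right integrable_Re) auto
 thus ?thesis using f g by (auto intro: borel_measurable_add)
 qed
 show "(%x. c * f x) : carr ?X" if "f : carr ?X"
 using that by (auto simp: norm_mult power_mult_distrib mult.assoc intro!: borel_measurable_times)
 show "ip ?X (%x. f x+g x) k=ip ?X f k+ip ?X g k"
 if "f : carr ?X" "g : carr ?X" "k : carr ?X"
 using int[OF that(1,3)] int[OF that(2,3)] by (simp add: algebra_simps)
 show "ip ?X (%x. c * f x) k=c * ip ?X f k" if "f : carr ?X" "k : carr ?X"
 by (simp add: mult.assoc)
 show "ip ?X g f=cnj (ip ?X f g)" if "f : carr ?X" "g : carr ?X"
 proof -
 have "cnj (ip ?X f g)=(LINT s|M. cnj (f (p s) * cnj (g (p s)) * cr (w s)))"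
 using int[OF that] by (simp only: integral_bounded_linear[OF bounded_linear_cnj] hspace.simps)
 thus ?thesis by (simp add: mult_ac)
 qed
 show "0 <= Re (ip ?X f f)" if f: "f : carr ?X"
 proof -
 have "(%s. f (p s) * cnj (f (p s)) * cr (w s)) =
 (%s. cr ((cmod (f (p s)))^2 * w s))"
 by (auto simp: fun_eq_iff complex_norm_square[symmetric] simp del: of_real_power)
 hence "ip ?X f f=cr (LINT s|M. (cmod (f (p s)))^2 * w s)"
 by (simp only: hspace.simps integral_complex_of_real)
 moreover have "0 <= (LINT s|M. (cmod (f (p s)))^2 * w s)"
 using w by (intro integral_nonneg_AE AE_I2) auto
 ultimately show ?thesis by simp
 qed
 qed
qed

lemma L2_semi_ip: "semi_ip (L2 G)"
 using weighted_L2_semi_ip[of "lon G" "%_. 1" "%x. x"] by (simp add: L2_def)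

lemma L2_mem: "f : carr (L2 G) \<longleftrightarrow>
 f : bm (lon G) & integrable (lon G) (%x. (cmod (f x))^2)"
 by (simp add: L2_def)

lemma L2_ip: "ip (L2 G) f g=(LINT x|lon G. f x * cnj (g x))"
 by (simp add: L2_def)

lemma L2_integrable_product:
 "f : carr (L2 G) ==> g : carr (L2 G) ==> integrable (lon G) (%x. f x * cnj (g x))"
 using integrable_weighted_product[of f "lon G" g "%_. 1"] by (simp add: L2_mem)

lemma L2_hnorm_sq: "(nm (L2 G) f)^2=(LINT x|lon G. (cmod (f x))^2)"
proof -
 have "ip (L2 G) f f=cr (LINT x|lon G. (cmod (f x))^2)"
 unfolding L2_ip by (simp only: complex_norm_square[symmetric] integral_complex_of_real)
 moreover have "0 <= (LINT x|lon G. (cmod (f x))^2)" by (intro integral_nonneg_AE) auto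
 ultimately show ?thesis by (simp add: hnorm_def)
qed

lemma L2_hnorm_sq_nn:
 "f : carr (L2 G) ==> (\<integral>\<^sup>+x. ennreal ((cmod (f x))^2) \<partial>lon G)=ennreal ((nm (L2 G) f)^2)"
 unfolding L2_hnorm_sq by (rule nn_integral_eq_integral) (auto simp: L2_mem)

text \<open>The classical proof: a rapidly converging subsequence converges almost everywhere, and Fatou identifies its limit as the limit in the norm.\<close>

lemma L2_complete:
 fixes G :: "'a::euclidean_space set"
 shows "semi_hilbert (L2 G)"
proof -
 interpret L: semi_ip "L2 G" by (rule L2_semi_ip)
 let ?M="lon G"
 show ?thesis
 proof unfold_locales
 fix f :: "nat => 'a => complex"
 assume f: "!!n. f n : carr (L2 G)" and cau: "hcauchy (L2 G) f"
 have meas [measurable]: "f n : bm ?M" for n using f by (simp add: L2_mem)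
 have "EX N. ALL m>=N. ALL n>=N. nm (L2 G) (%x. f m x-f n x)<(1/2)^k" for k :: nat
 using cau unfolding hcauchy_def by simp
 then obtain N where N: "!!k m n. N k <= m ==> N k <= n ==> nm (L2 G) (%x. f m x-f n x)<(1/2)^k"
 by metis
 define r where "r k=(\<Sum>i\<le>k. N i)+k" for k
 have rN: "N k <= r j" if "k <= j" for k j
 proof -
 have "N k <= (\<Sum>i\<le>j. N i)" using that by (intro member_le_sum) auto
 thus ?thesis by (simp add: r_def)
 qed
 define d where "d k=(%x. f (r (Suc k)) x-f (r k) x)" for k
 have dmem: "d k : carr (L2 G)" for k unfolding d_def by (intro L.diff_mem f)
 have dmeas [measurable]: "d k : bm ?M" for k using dmem by (simp add: L2_mem)
 have dn: "(nm (L2 G) (d k))^2 <= (1/4)^k" for k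
 proof -
 have "nm (L2 G) (d k) <= (1/2)^k"
 unfolding d_def using N[of k "r (Suc k)" "r k"] rN by (simp add: less_imp_le)
 hence "(nm (L2 G) (d k))^2 <= ((1/2)^k)^2"
 using L.hnorm_nonneg[OF dmem] by (rule power_mono)
 also have "((1/2)^k)^2=(1/4 :: real)^k"
 by (simp add: power_mult[symmetric] mult.commute[of k 2]) (simp add: power_mult power2_eq_square power_divide)
 finally show ?thesis .
 qed
 have "(\<integral>\<^sup>+x. (\<Sum>k. ennreal (2^k * (cmod (d k x))^2)) \<partial>?M)=(\<Sum>k. \<integral>\<^sup>+x. ennreal (2^k * (cmod (d k x))^2) \<partial>?M)"
 by (intro nn_integral_suminf) measurable
 also have "\<dots> <= (\<Sum>k. ennreal ((1/2)^k))"
 proof (intro suminf_le summableI)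
 fix k
 have "(\<integral>\<^sup>+x. ennreal (2^k * (cmod (d k x))^2) \<partial>?M)=ennreal (2^k)*(\<integral>\<^sup>+x. ennreal ((cmod (d k x))^2) \<partial>?M)"
 by (subst nn_integral_cmult[symmetric]) (auto simp: ennreal_mult')
 also have "\<dots>=ennreal (2^k * (nm (L2 G) (d k))^2)"
 by (simp add: L2_hnorm_sq_nn[OF dmem] ennreal_mult')
 also have "\<dots> <= ennreal (2^k * (1/4)^k)"
 using dn[of k] by (intro ennreal_leI mult_left_mono) auto
 also have "2^k * (1/4)^k=(1/2 :: real)^k" by (simp add: power_mult_distrib[symmetric])
 finally show "(\<integral>\<^sup>+x. ennreal (2^k * (cmod (d k x))^2) \<partial>?M) <= ennreal ((1/2)^k)" .
 qed
 also have "\<dots><\<infinity>"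
 proof -
 have "summable (%k. (1/2 :: real)^k)" by (rule summable_geometric) simp
 hence "(\<Sum>k. ennreal ((1/2)^k))=ennreal (\<Sum>k. (1/2)^k)" by (intro suminf_ennreal2) auto
 thus ?thesis by simp
 qed
 finally have fin: "(\<integral>\<^sup>+x. (\<Sum>k. ennreal (2^k * (cmod (d k x))^2)) \<partial>?M) ~= \<infinity>" by simp
 have "AE x in ?M. (\<Sum>k. ennreal (2^k * (cmod (d k x))^2)) ~= \<infinity>"
 by (rule nn_integral_PInf_AE[OF _ fin]) measurable
 hence conv: "AE x in ?M. convergent (%k. f (r k) x)"
 proof eventually_elim
 case (elim x)
 have "summable (%k. 2^k * (cmod (d k x))^2)"
 using elim by (intro summable_suminf_not_top) (auto simp: top_unique)
 hence "Bseq (%k. 2^k * (cmod (d k x))^2)"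
 using summable_LIMSEQ_zero convergent_imp_Bseq convergentI by blast
 then obtain C where C: "C > 0" "!!k. norm (2^k * (cmod (d k x))^2) <= C" by (auto simp: Bseq_def)
 have "summable (%k. d k x)"
 proof (rule summable_comparison_test')
 show "summable (%k. sqrt C * (sqrt (1/2))^k)"
 by (intro summable_mult summable_geometric) (simp add: real_sqrt_divide)
 fix k
 have "(cmod (d k x))^2 <= C * (1/2)^k"
 using C(2)[of k] by (simp add: field_simps power_divide)
 hence "cmod (d k x) <= sqrt (C * (1/2)^k)" by (rule real_le_rsqrt)
 also have "\<dots>=sqrt C * (sqrt (1/2))^k" by (simp only: real_sqrt_mult real_sqrt_power)
 finally show "norm (d k x) <= sqrt C * (sqrt (1/2))^k" .
 qed
 hence "(%n. \<Sum>k<n. d k x) ~~> (\<Sum>k. d k x)" by (rule summable_LIMSEQ)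
 moreover have "(\<Sum>k<n. d k x)=f (r n) x-f (r 0) x" for n
 unfolding d_def by (rule sum_lessThan_telescope)
 ultimately have "(%n. (f (r n) x-f (r 0) x)+f (r 0) x) ~~> (\<Sum>k. d k x)+f (r 0) x"
 by (intro tendsto_add) auto
 thus ?case by (auto simp: convergent_def)
 qed
 define g where "g x=lim (%k. f (r k) x)" for x
 have gmeas [measurable]: "g : bm ?M" unfolding g_def by measurable
 have tail: "(\<integral>\<^sup>+x. ennreal ((cmod (f n x-g x))^2) \<partial>?M) <= ennreal (((1/2)^k)^2)" if n: "N k <= n" for n k
 proof -
 have "(\<integral>\<^sup>+x. ennreal ((cmod (f n x-g x))^2) \<partial>?M) <=
 (\<integral>\<^sup>+x. liminf (%j. ennreal ((cmod (f n x-f (r j) x))^2)) \<partial>?M)"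
 proof (rule nn_integral_mono_AE)
 show "AE x in ?M. ennreal ((cmod (f n x-g x))^2) <= liminf (%j. ennreal ((cmod (f n x-f (r j) x))^2))"
 using conv
 proof eventually_elim
 case (elim x)
 hence "(%j. f (r j) x) ~~> g x" by (simp add: g_def convergent_LIMSEQ_iff)
 hence "(%j. ennreal ((cmod (f n x-f (r j) x))^2)) ~~> ennreal ((cmod (f n x-g x))^2)"
 by (intro tendsto_ennrealI tendsto_intros)
 thus ?case using lim_imp_Liminf[OF sequentially_bot] by force
 qed
 qed
 also have "\<dots> <= liminf (%j. \<integral>\<^sup>+x. ennreal ((cmod (f n x-f (r j) x))^2) \<partial>?M)"
 by (intro nn_integral_liminf) measurable
 also have "\<dots> <= ennreal (((1/2)^k)^2)"
 proof (rule Liminf_le)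
 show "\<forall>\<^sub>F j in sequentially. (\<integral>\<^sup>+x. ennreal ((cmod (f n x-f (r j) x))^2) \<partial>?M) <= ennreal (((1/2)^k)^2)"
 unfolding eventually_sequentially
 proof (intro exI[of _ k] allI impI)
 fix j assume "k <= j"
 hence "nm (L2 G) (%x. f n x-f (r j) x) <= (1/2)^k"
 using N[OF n rN[of k j]] by simp
 hence "(nm (L2 G) (%x. f n x-f (r j) x))^2 <= ((1/2)^k)^2"
 using L.hnorm_nonneg[OF L.diff_mem[OF f f]] by (rule power_mono)
 thus "(\<integral>\<^sup>+x. ennreal ((cmod (f n x-f (r j) x))^2) \<partial>?M) <= ennreal (((1/2)^k)^2)"
 using L2_hnorm_sq_nn[OF L.diff_mem[OF f f], of n "r j"] by (simp add: ennreal_leI)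
 qed
 qed simp
 finally show ?thesis .
 qed
 have diff: "(%x. f n x-g x) : carr (L2 G)" if "N k <= n" for n k
 proof -
 have "(\<integral>\<^sup>+x. ennreal ((cmod (f n x-g x))^2) \<partial>?M)<\<infinity>"
 using tail[OF that] by (auto intro: le_less_trans)
 hence "integrable ?M (%x. (cmod (f n x-g x))^2)"
 by (intro integrableI_bounded) auto
 thus ?thesis unfolding L2_mem by (intro conjI) measurable
 qed
 have "(%x. f (N 0) x-(f (N 0) x-g x)) : carr (L2 G)"
 by (rule L.diff_mem[OF f diff[of 0]]) simp
 hence gmem: "g : carr (L2 G)" by simp
 have near: "nm (L2 G) (%x. f n x-g x) <= (1/2)^k" if "N k <= n" for n k
 proof -
 have "ennreal ((nm (L2 G) (%x. f n x-g x))^2) <= ennreal (((1/2)^k)^2)"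
 using tail[OF that] L2_hnorm_sq_nn[OF diff[OF that]] by simp
 hence "(nm (L2 G) (%x. f n x-g x))^2 <= ((1/2)^k)^2" by (subst (asm) ennreal_le_iff) auto
 thus ?thesis by (rule power2_le_imp_le) simp
 qed
 have "(%n. nm (L2 G) (%x. f n x-g x)) ~~> 0"
 proof (rule LIMSEQ_I)
 fix e :: real assume "0<e"
 then obtain k where k: "(1/2 :: real)^k<e" using real_arch_pow_inv[of e "1/2"] by auto
 show "EX no. ALL n>=no. norm (nm (L2 G) (%x. f n x-g x)-0)<e"
 proof (intro exI[of _ "N k"] allI impI)
 fix n assume "N k <= n"
 thus "norm (nm (L2 G) (%x. f n x-g x)-0)<e"
 using near[of k n] k L.hnorm_nonneg[OF L.diff_mem[OF f gmem], of n] by simp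
 qed
 qed
 thus "EX g:carr (L2 G). (%n. nm (L2 G) (%x. f n x-g x)) ~~> 0" using gmem by blast
 qed
qed

section \<open>Test functions\<close>

lemma test_functionD:
 assumes "ph : test_functions G"
 obtains K where "compact K" "K <= G" "!!x. x ~: K ==> ph x=0"
 "!!x v. x ~: K ==> fd ph (at x) v=0"
proof -
 obtain K where K: "compact K" "K <= G" "!!x. x ~: K ==> ph x=0"
 using assms by (auto simp: test_functions_def)
 have "fd ph (at x) v=0" if "x ~: K" for x v
 proof -
 have "((%x. 0) has_derivative (%h. 0)) (at x)" by simp
 hence "(ph has_derivative (%h. 0)) (at x)"
 by (rule has_derivative_transform_within_open[where s="- K"])
 (use K that compact_imp_closed in auto)
 thus ?thesis by (metis frechet_derivative_at)
 qed
 thus ?thesis using that K by blast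
qed

lemma test_function_has_derivative:
 "ph : test_functions G ==> (ph has_derivative fd ph (at x)) (at x)"
 by (simp add: test_functions_def frechet_derivative_works[symmetric])

lemma test_function_continuous: "ph : test_functions G ==> continuous_on UNIV ph"
 using test_function_has_derivative
 by (intro has_derivative_continuous_on) (auto intro: has_derivative_at_withinI)

lemma test_function_deriv_continuous:
 "ph : test_functions G ==> continuous_on UNIV (%x. fd ph (at x) v)"
 by (simp add: test_functions_def)

lemma test_functions_mono: "Q <= G ==> test_functions Q <= test_functions G"
 unfolding test_functions_def by (blast intro: subset_trans)

lemma test_functionsI:
 assumes der: "!!x. (ph has_derivative D x) (at x)" and cont: "!!v. continuous_on UNIV (%x. D x v)"
 and K: "compact K" "K <= G" "!!x. x ~: K ==> ph x=0"
 shows "ph : test_functions G"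
proof -
 have "fd ph (at x)=D x" for x using der by (metis frechet_derivative_at)
 moreover have "ph differentiable at x" for x using der by (auto simp: differentiable_def)
 ultimately show ?thesis using cont K by (auto simp: test_functions_def)
qed

lemma compactly_supported_bounded:
 fixes f :: "'a::euclidean_space => real"
 assumes "continuous_on UNIV f" "compact K" "!!x. x ~: K ==> f x=0"
 obtains B where "B > 0" "!!x. \<bar>f x\<bar> <= B"
proof -
 have "compact (f ` K)" using assms by (meson compact_continuous_image continuous_on_subset subset_UNIV)
 hence "bounded (f ` K)" by (rule compact_imp_bounded)
 then obtain B where B: "B > 0" "!!y. y : f ` K ==> norm y <= B" by (auto simp: bounded_pos)
 have "\<bar>f x\<bar> <= B" for x using B assms(3)[of x] by (cases "x : K") auto
 thus ?thesis using that B by blast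
qed

text \<open>Multiplication by a continuous function with compact support.\<close>

lemma locally_integrable_times_supported:
 fixes f :: "'a::euclidean_space => complex"
 assumes G: "G : sets lebesgue" and f: "lint G f"
 and ps: "continuous_on UNIV ps" and K: "compact K" "K <= G" "!!x. x ~: K ==> ps x=(0::real)"
 shows "integrable (lon G) (%x. f x * cr (ps x))" (is ?A)
 and "(LINT x|lon G. f x * cr (ps x)) =
 (LINT x|lon K. f x * cr (ps x))" (is ?B)
proof -
 have Km: "K : sets lebesgue" using K by (simp add: lmeasurable_compact fmeasurableD)
 obtain B where B: "B > 0" "!!x. \<bar>ps x\<bar> <= B" by (rule compactly_supported_bounded[OF ps K(1)]) (blast intro: K(3) that)+
 have fi: "integrable (lon K) f" using f K by (simp add: locally_integrable_def)
 have "ps : bm (lon K)"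
 by (rule continuous_imp_measurable_on_sets_lebesgue[OF continuous_on_subset[OF ps]]) (use Km in auto)
 hence psm: "(%x. cr (ps x)) : bm (lon K)" by simp
 have int: "integrable (lon K) (%x. f x * cr (ps x))"
 proof (rule Bochner_Integration.integrable_bound)
 show "integrable (lon K) (%x. cr B * f x)" using fi by simp
 show "(%x. f x * cr (ps x)) : bm (lon K)"
 using fi psm by (intro borel_measurable_times) auto
 show "AE x in lon K. norm (f x * cr (ps x)) <= norm (cr B * f x)"
 proof (rule AE_I2)
 fix x
 have "cmod (f x) * \<bar>ps x\<bar> <= cmod (f x) * B" using B(2) by (rule mult_left_mono) simp
 thus "norm (f x * cr (ps x)) <= norm (cr B * f x)"
 using B(1) by (simp add: norm_mult mult.commute)
 qed
 qed
 have eq: "(%x. if x : K then f x * cr (ps x) else 0) =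
 (%x. if x : G then f x * cr (ps x) else 0)"
 using K(2,3) by (auto simp: fun_eq_iff)
 show ?A using int unfolding Lebesgue_Measure.integrable_restrict_UNIV[OF Km, symmetric]
 Lebesgue_Measure.integrable_restrict_UNIV[OF G, symmetric] eq .
 show ?B unfolding Lebesgue_Measure.integral_restrict_UNIV[OF Km, symmetric]
 Lebesgue_Measure.integral_restrict_UNIV[OF G, symmetric] eq ..
qed

lemma test_integrable:
 assumes "G : sets lebesgue" "lint G f" "ph : test_functions G"
 shows "integrable (lon G) (%x. f x * cr (ph x))"
 and "integrable (lon G) (%x. f x * cr (fd ph (at x) v))"
proof -
 from test_functionD[OF assms(3)] obtain K where K: "compact K" "K <= G" "!!x. x ~: K ==> ph x=0"
 "!!x v. x ~: K ==> fd ph (at x) v=0" by blast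
 show "integrable (lon G) (%x. f x * cr (ph x))"
 by (rule locally_integrable_times_supported(1)[OF assms(1,2) test_function_continuous[OF assms(3)] K(1,2,3)])
 show "integrable (lon G) (%x. f x * cr (fd ph (at x) v))"
 by (rule locally_integrable_times_supported(1)[OF assms(1,2) test_function_deriv_continuous[OF assms(3)] K(1,2,4)])
qed

lemma test_integral_subset:
 assumes "G : sets lebesgue" "Q : sets lebesgue" "Q <= G" "ph : test_functions Q"
 shows "(LINT x|lon Q. f x * cr (ph x))=(LINT x|lon G. f x * cr (ph x))"
 and "(LINT x|lon Q. f x * cr (fd ph (at x) v)) =
 (LINT x|lon G. f x * cr (fd ph (at x) v))"
proof -
 from test_functionD[OF assms(4)] obtain K where K: "compact K" "K <= Q" "!!x. x ~: K ==> ph x=0"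
 "!!x v. x ~: K ==> fd ph (at x) v=0" by blast
 have *: "(LINT x|lon Q. f x * cr (ps x))=(LINT x|lon G. f x * cr (ps x))"
 if "!!x. x ~: K ==> ps x=0" for ps
 proof -
 have "(%x. if x : Q then f x * cr (ps x) else 0) =
 (%x. if x : G then f x * cr (ps x) else 0)"
 using K(2) that assms(3) by (auto simp: fun_eq_iff)
 thus ?thesis unfolding Lebesgue_Measure.integral_restrict_UNIV[OF assms(1), symmetric]
 Lebesgue_Measure.integral_restrict_UNIV[OF assms(2), symmetric] by (rule arg_cong)
 qed
 show "(LINT x|lon Q. f x * cr (ph x))=(LINT x|lon G. f x * cr (ph x))"
 using *[of ph] K(3) by simp
 show "(LINT x|lon Q. f x * cr (fd ph (at x) v)) =
 (LINT x|lon G. f x * cr (fd ph (at x) v))"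
 using *[of "%x. fd ph (at x) v"] K(4) by simp
qed

subsection \<open>Smooth approximations of the ind function of a box\<close>

lemma square_positive_part_derivative:
 "((%s::real. (max 0 s)^2) has_real_derivative 2 * max 0 s) (at s)"
proof (cases s "0::real" rule: linorder_cases)
 case less
 have "((%s::real. 0) has_real_derivative 0) (at s)" by simp
 hence "((%s::real. (max 0 s)^2) has_real_derivative 0) (at s)"
 by (rule has_field_derivative_transform_within_open[where S="{..<0}"]) (use less in auto)
 thus ?thesis using less by simp
next
 case equal
 have "(%h::real. (max 0 h)^2/h) \<midarrow>0\<rightarrow> 0"
 proof (rule Lim_null_comparison)
 show "\<forall>\<^sub>F h in at (0::real). norm ((max 0 h)^2/h) <= \<bar>h\<bar>"
 by (intro always_eventually) (auto simp: max_def power2_eq_square)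
 show "(%h::real. \<bar>h\<bar>) \<midarrow>0\<rightarrow> 0" by (auto intro: tendsto_rabs_zero)
 qed
 thus ?thesis using equal by (simp add: DERIV_def)
next
 case greater
 have "((%s::real. s^2) has_real_derivative 2 * s) (at s)" by (auto intro!: derivative_eq_intros)
 hence "((%s::real. (max 0 s)^2) has_real_derivative 2 * s) (at s)"
 by (rule has_field_derivative_transform_within_open[where S="{0<..}"]) (use greater in auto)
 thus ?thesis using greater by simp
qed

definition ramp :: "real => real" where
 "ramp s=(max 0 s)^2/((max 0 s)^2+(max 0 (1-s))^2)"

definition ramp_deriv :: "real => real" where
 "ramp_deriv s=(2 * max 0 s * ((max 0 s)^2+(max 0 (1-s))^2) -
 (max 0 s)^2*(2 * max 0 s-2 * max 0 (1-s)))/((max 0 s)^2+(max 0 (1-s))^2)^2"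

lemma ramp_denom: "(max 0 s)^2+(max 0 (1-s))^2 > (0::real)"
 by (cases "s > 0") (auto simp: max_def add_pos_nonneg)

lemma ramp_has_derivative: "(ramp has_real_derivative ramp_deriv s) (at s)"
proof -
 have 1: "((%s::real. (max 0 (1-s))^2) has_real_derivative-2 * max 0 (1-s)) (at s)"
 proof -
 have "((%s::real. 1-s) has_real_derivative -1) (at s)" by (auto intro!: derivative_eq_intros)
 from DERIV_chain2[where f="%s. (max 0 s)^2" and g="%s. 1-s",
 OF square_positive_part_derivative this]
 show ?thesis by simp
 qed
 have "((%s. (max 0 s)^2/((max 0 s)^2+(max 0 (1-s))^2)) has_real_derivative ramp_deriv s) (at s)"
 using DERIV_quotient[OF square_positive_part_derivative
 DERIV_add[OF square_positive_part_derivative 1] less_imp_neq[OF ramp_denom, symmetric]]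
 by (simp add: ramp_deriv_def power2_eq_square mult.commute)
 thus ?thesis unfolding ramp_def[abs_def] .
qed

lemma ramp_deriv_continuous: "continuous_on UNIV ramp_deriv"
proof -
 have "((max 0 s)^2+(max 0 (1-s))^2)^2 ~= (0::real)" for s
 by (rule power_not_zero[OF less_imp_neq[OF ramp_denom, symmetric]])
 thus ?thesis unfolding ramp_deriv_def[abs_def] by (intro continuous_intros ballI)
qed

lemma ramp_values: "s <= 0 ==> ramp s=0" "1 <= s ==> ramp s=1" "0 <= ramp s" "ramp s <= 1"
 using ramp_denom[of s] by (auto simp: ramp_def divide_le_eq)

text \<open>Products of powers of a continuously differentiable ramp, one for each face, increase to the indicator function of the box.\<close>

lemma box_bump:
 fixes c d :: "'a::euclidean_space"
 obtains ph :: "nat => 'a => real" where "!!n. ph n : test_functions (box c d)"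
 "!!n x. 0 <= ph n x" "!!n x. ph n x <= 1" "!!n x. x ~: box c d ==> ph n x=0"
 "!!x. x : box c d ==> (%n. ph n x) ~~> 1"
proof -
 define k where "k n b s=ramp (real (Suc n)*(s-c \<bullet> b)-1) * ramp (real (Suc n)*(d \<bullet> b-s)-1)"
 for n :: nat and b :: 'a and s :: real
 define k' where "k' n b s =
 real (Suc n) * ramp_deriv (real (Suc n)*(s-c \<bullet> b)-1) * ramp (real (Suc n)*(d \<bullet> b-s)-1)
 -real (Suc n) * ramp_deriv (real (Suc n)*(d \<bullet> b-s)-1) * ramp (real (Suc n)*(s-c \<bullet> b)-1)"
 for n :: nat and b :: 'a and s :: real
 have ramp_c: "continuous_on UNIV ramp"
 by (rule DERIV_continuous_on[of _ _ ramp_deriv]) (auto intro: has_field_derivative_at_within ramp_has_derivative)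
 have kd: "(k n b has_real_derivative k' n b s) (at s)" for n b s
 unfolding k_def[abs_def] k'_def
 by (rule derivative_eq_intros DERIV_chain2[OF ramp_has_derivative] refl | simp add: algebra_simps)+
 have kc: "continuous_on UNIV (k n b)" for n b
 unfolding k_def[abs_def] by (intro continuous_intros continuous_on_compose2[OF ramp_c]) auto
 have kc': "continuous_on UNIV (k' n b)" for n b
 unfolding k'_def[abs_def]
 by (intro continuous_intros continuous_on_compose2[OF ramp_c] continuous_on_compose2[OF ramp_deriv_continuous]) auto
 define ph where "ph n x=(\<Prod>b\<in>Basis. k n b (x \<bullet> b))" for n and x :: 'a
 have k01: "0 <= k n b s" "k n b s <= 1" for n b s
 unfolding k_def using ramp_values(3,4) by (auto intro: mult_nonneg_nonneg mult_le_one)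
 have der: "(ph n has_derivative (%y. \<Sum>b\<in>Basis. (k' n b (x \<bullet> b)*(y \<bullet> b))*(\<Prod>j\<in>Basis-{b}. k n j (x \<bullet> j)))) (at x)" for n x
 unfolding ph_def[abs_def]
 proof (rule has_derivative_prod)
 fix b :: 'a
 have "(k n b has_derivative (%h. k' n b (x \<bullet> b) * h)) (at (x \<bullet> b))"
 using kd[of n b "x \<bullet> b"] by (simp add: has_field_derivative_def)
 from has_derivative_compose[where f="%x. x \<bullet> b" and f'="%y. y \<bullet> b" and g="k n b" and s=UNIV, OF _ this]
 show "((%x. k n b (x \<bullet> b)) has_derivative (%y. k' n b (x \<bullet> b)*(y \<bullet> b))) (at x)"
 by (simp add: bounded_linear_imp_has_derivative bounded_linear_inner_left)
 qed
 have supp: "ph n x=0" if outside: "x ~: cbox (c+(1/real (Suc n)) *\<^sub>R One) (d-(1/real (Suc n)) *\<^sub>R One)" for n x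
 proof -
 obtain b where b: "b : Basis" "x \<bullet> b<c \<bullet> b+1/real (Suc n) \<or> d \<bullet> b-1/real (Suc n)<x \<bullet> b"
 proof -
 have One: "(One :: 'a) \<bullet> b=1" if "b : Basis" for b
 using inner_sum_left_Basis[OF that, of "%_. 1"] by simp
 from outside have "\<not> (ALL b:Basis. c \<bullet> b+1/real (Suc n) <= x \<bullet> b & x \<bullet> b <= d \<bullet> b-1/real (Suc n))"
 by (simp add: mem_box inner_add_left inner_diff_left One)
 hence "EX b:Basis. x \<bullet> b<c \<bullet> b+1/real (Suc n) \<or> d \<bullet> b-1/real (Suc n)<x \<bullet> b"
 by (meson not_le)
 thus thesis using that by blast
 qed
 have "real (Suc n)*(x \<bullet> b-c \<bullet> b)-1 <= 0 \<or> real (Suc n)*(d \<bullet> b-x \<bullet> b)-1 <= 0"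
 using b(2) by (auto simp: field_simps)
 hence "k n b (x \<bullet> b)=0" by (auto simp: k_def ramp_values(1))
 thus ?thesis unfolding ph_def using b(1) by (intro prod_zero) auto
 qed
 have inside: "cbox (c+(1/real (Suc n)) *\<^sub>R One) (d-(1/real (Suc n)) *\<^sub>R One) <= box c d" for n
 proof
 fix x assume x: "x : cbox (c+(1/real (Suc n)) *\<^sub>R One) (d-(1/real (Suc n)) *\<^sub>R One)"
 have pos: "0<1/real (Suc n)" by simp
 show "x : box c d"
 unfolding mem_box
 proof (intro ballI)
 fix b :: 'a assume b: "b : Basis"
 have One: "(One :: 'a) \<bullet> b=1" using inner_sum_left_Basis[OF b, of "%_. 1"] by simp
 have "c \<bullet> b+1/real (Suc n) <= x \<bullet> b & x \<bullet> b <= d \<bullet> b-1/real (Suc n)"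
 using x b unfolding mem_box by (auto simp: inner_add_left inner_diff_left One)
 thus "c \<bullet> b<x \<bullet> b & x \<bullet> b<d \<bullet> b" using pos by linarith
 qed
 qed
 show ?thesis
 proof
 show "ph n : test_functions (box c d)" for n
 proof (rule test_functionsI[OF der _ compact_cbox inside supp])
 show "continuous_on UNIV (%x. \<Sum>b\<in>Basis. (k' n b (x \<bullet> b)*(v \<bullet> b))*(\<Prod>j\<in>Basis-{b}. k n j (x \<bullet> j)))" for v
 by (intro continuous_intros continuous_on_compose2[OF kc] continuous_on_compose2[OF kc']) auto
 qed
 show "0 <= ph n x" for n x unfolding ph_def using k01 by (intro prod_nonneg) auto
 show "ph n x <= 1" for n x unfolding ph_def using k01 by (intro prod_le_1) auto
 show "ph n x=0" if "x ~: box c d" for n x using supp inside that by blast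
 show "(%n. ph n x) ~~> 1" if x: "x : box c d" for x
 proof (rule tendsto_eventually)
 have "\<forall>\<^sub>F n in sequentially. k n b (x \<bullet> b)=1" if b: "b : Basis" for b
 proof -
 have pos: "x \<bullet> b-c \<bullet> b > 0" "d \<bullet> b-x \<bullet> b > 0" using x b by (auto simp: mem_box)
 obtain N1 N2 where N: "2<real N1*(x \<bullet> b-c \<bullet> b)" "2<real N2*(d \<bullet> b-x \<bullet> b)"
 using reals_Archimedean3[OF pos(1)] reals_Archimedean3[OF pos(2)] by blast
 show ?thesis unfolding eventually_sequentially
 proof (intro exI[of _ "max N1 N2"] allI impI)
 fix n assume n: "max N1 N2 <= n"
 have "real N1*(x \<bullet> b-c \<bullet> b) <= real (Suc n)*(x \<bullet> b-c \<bullet> b)"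
 "real N2*(d \<bullet> b-x \<bullet> b) <= real (Suc n)*(d \<bullet> b-x \<bullet> b)"
 using n pos by (intro mult_right_mono; simp)+
 thus "k n b (x \<bullet> b)=1" using N by (simp add: k_def ramp_values(2))
 qed
 qed
 hence "\<forall>\<^sub>F n in sequentially. ALL b:Basis. k n b (x \<bullet> b)=1" by (intro eventually_ball_finite) auto
 thus "\<forall>\<^sub>F n in sequentially. ph n x=1" by eventually_elim (simp add: ph_def)
 qed
 qed
qed

subsection \<open>The fundamental lemma of the calculus of variations\<close>

text \<open>By approximation with bumps the integral over every box vanishes, hence the function vanishes almost everywhere.\<close>

lemma fundamental_lemma:
 fixes f :: "'a::euclidean_space => complex"
 assumes Q: "open Q" and f: "lint Q f"
 and zero: "!!ph. ph : test_functions Q ==> (LINT x|lon Q. f x * cr (ph x))=0"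
 shows "AE x in lon Q. f x=0"
proof -
 have Qm: "Q : sets lebesgue" using Q by (simp add: borel_open)
 have cbox_zero: "(LINT x|lon (cbox c d). f x)=0" if cd: "cbox c d <= Q" for c d
 proof -
 have fi: "integrable (lon (cbox c d)) f" using f cd by (simp add: locally_integrable_def)
 obtain ph :: "nat => 'a => real" where ph: "!!n. ph n : test_functions (box c d)"
 "!!n x. 0 <= ph n x" "!!n x. ph n x <= 1" "!!n x. x ~: box c d ==> ph n x=0"
 "!!x. x : box c d ==> (%n. ph n x) ~~> 1" by (rule box_bump[of c d]) (rule that)
 have phQ: "ph n : test_functions Q" and phC: "ph n : test_functions (cbox c d)" for n
 using ph(1) test_functions_mono[of "box c d"] box_subset_cbox[of c d] cd by blast+
 have fC: "lint (cbox c d) f" using f cd by (auto simp: locally_integrable_def)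
 have "(LINT x|lon (cbox c d). f x * cr (ph n x))=0" for n
 using test_integral_subset(1)[OF Qm _ cd phC] zero[OF phQ] by simp
 moreover have "(%n. LINT x|lon (cbox c d). f x * cr (ph n x)) ~~>
 (LINT x|lon (cbox c d). f x)"
 proof (rule integral_dominated_convergence)
 show "f : bm (lon (cbox c d))" using fi by simp
 show "(%x. f x * cr (ph n x)) : bm (lon (cbox c d))" for n
 using test_integrable(1)[OF _ fC phC] by simp
 show "integrable (lon (cbox c d)) (%x. cmod (f x))" using fi by simp
 show "AE x in lon (cbox c d). norm (f x * cr (ph n x)) <= cmod (f x)" for n
 using ph(2,3)[of n] by (intro AE_I2) (simp add: norm_mult mult_left_le)
 have "AE x in lebesgue. x ~: cbox c d-box c d"
 using AE_not_in[of "cbox c d-box c d" lebesgue] negligible_frontier_interval[of c d]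
 by (simp only: negligible_iff_null_sets)
 thus "AE x in lon (cbox c d). (%n. f x * cr (ph n x)) ~~> f x"
 unfolding AE_restrict_space_iff[of "cbox c d" lebesgue, simplified]
 proof (rule AE_mp, intro AE_I2 impI)
 fix x assume "x ~: cbox c d-box c d" "x : cbox c d"
 hence "(%n. ph n x) ~~> 1" using ph(5) by blast
 from tendsto_mult[OF tendsto_const tendsto_of_real[OF this], of "f x"]
 show "(%n. f x * cr (ph n x)) ~~> f x" by simp
 qed
 qed
 ultimately show ?thesis by (simp add: LIMSEQ_const_iff)
 qed
 have box_AE: "AE x in lebesgue. x : cbox a b --> f x=0" if ab: "cbox a b <= Q" for a b
 proof -
 define F where "F x=(if x : cbox a b then f x else 0)" for x
 have fi: "integrable (lon (cbox a b)) f" using f ab by (simp add: locally_integrable_def)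
 hence Fi: "integrable lebesgue F" unfolding F_def by (subst Lebesgue_Measure.integrable_restrict_UNIV) auto
 have "F integrable_on cbox c d" for c d
 proof (rule integrable_on_subcbox[of _ UNIV])
 show "F integrable_on UNIV" using integrable_on_lebesgue[OF Fi] .
 qed simp
 then obtain N where N: "negligible N" "!!x e. [|x ~: N; 0<e|] ==> EX d>0. ALL h. 0<h & h<d -->
 norm (integral (cbox x (x+h *\<^sub>R One)) F /\<^sub>R h ^ DIM('a)-F x)<e"
 using integrable_ccontinuous_explicit[of F] by blast
 have "f x=0" if x: "x : box a b" "x ~: N" for x
 proof -
 obtain r where r: "r > 0" "cball x r <= box a b" using x(1) open_contains_cball[of "box a b"] by auto
 have "norm (f x)<e" if e: "e > 0" for e
 proof -
 obtain d where d: "d > 0" "!!h. 0<h & h<d ==>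
 norm (integral (cbox x (x+h *\<^sub>R One)) F /\<^sub>R h ^ DIM('a)-F x)<e" using N(2)[OF x(2) e] by blast
 define h where "h=min (d/2) (r/norm (One :: 'a))"
 have One: "norm (One :: 'a) > 0" by simp
 have h: "0<h" "h<d" using d r One by (auto simp: h_def)
 have sub: "cbox x (x+h *\<^sub>R One) <= box a b"
 proof -
 have "norm (h *\<^sub>R (One :: 'a)) <= r"
 proof -
 have "h * norm (One :: 'a) <= (r/norm (One :: 'a)) * norm (One :: 'a)"
 by (intro mult_right_mono) (auto simp: h_def)
 thus ?thesis using One h by simp
 qed
 hence "x+h *\<^sub>R One : cball x r" by (simp add: dist_norm)
 hence "x+h *\<^sub>R One : box a b" using r by blast
 thus ?thesis using x(1) by (auto simp: mem_box subset_eq) (smt (verit))+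
 qed
 hence subQ: "cbox x (x+h *\<^sub>R One) <= Q" using ab box_subset_cbox by blast
 have "integral (cbox x (x+h *\<^sub>R One)) F=integral (cbox x (x+h *\<^sub>R One)) f"
 using sub box_subset_cbox by (intro Henstock_Kurzweil_Integration.integral_cong) (auto simp: F_def)
 also have "\<dots>=(LINT x|lon (cbox x (x+h *\<^sub>R One)). f x)"
 using f subQ by (intro lebesgue_integral_eq_integral[symmetric]) (auto simp: locally_integrable_def)
 also have "\<dots>=0" by (rule cbox_zero[OF subQ])
 finally have "norm (F x)<e" using d(2)[of h] h by simp
 moreover have "x : cbox a b" using x(1) box_subset_cbox[of a b] by blast
 ultimately show ?thesis by (simp add: F_def)
 qed
 thus ?thesis by (metis less_irrefl zero_less_norm_iff)
 qed
 hence sub: "{x. \<not> (x : cbox a b --> f x=0)} <= N \<union> (cbox a b-box a b)" by auto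
 have "negligible (N \<union> (cbox a b-box a b))" using N(1) negligible_frontier_interval by auto
 hence "negligible {x. \<not> (x : cbox a b --> f x=0)}" using sub negligible_subset by blast
 thus ?thesis by (intro AE_I'[of "{x. \<not> (x : cbox a b --> f x=0)}"]) (auto simp: negligible_iff_null_sets)
 qed
 obtain D where D: "countable D" "D <= Pow Q" "!!X. X : D ==> EX a b. X=cbox a b" "\<Union>D=Q"
 using open_countable_Union_open_cbox[OF Q] by auto
 have "AE x in lebesgue. ALL X:D. x : X --> f x=0"
 unfolding AE_ball_countable[OF D(1)] using D(2,3) box_AE by blast
 hence "AE x in lebesgue. x : Q --> f x=0" by eventually_elim (use D(4) in blast)
 thus ?thesis using Qm by (simp add: AE_restrict_space_iff)
qed

section \<open>Weak derivatives and first order Sobolev spaces\<close>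

text \<open>Measurability and integrability on subsets of Euclidean space.\<close>

lemma negligible_sets: "negligible S ==> S : sets lebesgue"
 by (simp add: negligible_iff_null_sets null_setsD2)

lemma integrable_lebesgue_on_subset:
 fixes f :: "'a::euclidean_space => 'b::{banach, second_countable_topology}"
 assumes "integrable (lon G) f" "G : sets lebesgue" "S : sets lebesgue" "S <= G"
 shows "integrable (lon S) f"
proof -
 have "integrable lebesgue (%x. ind S x *\<^sub>R (ind G x *\<^sub>R f x))"
 by (rule integrable_mult_indicator[OF assms(3)]) (use assms in \<open>simp add: integrable_restrict_space\<close>)
 moreover have "(%x. ind S x *\<^sub>R (ind G x *\<^sub>R f x))=(%x. ind S x *\<^sub>R f x)"
 using assms(4) by (auto simp: fun_eq_iff indicator_def)
 ultimately show ?thesis using assms by (simp add: integrable_restrict_space)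
qed

lemma measurable_lebesgue_on_subset:
 fixes f :: "'a::euclidean_space => 'b::euclidean_space"
 assumes "f : bm (lon G)" "S <= G"
 shows "f : bm (lon S)"
 using measurable_restrict_mono[OF assms] .

lemma AE_lebesgue_on_subset:
 assumes "AE x in lon G. P x" "G : sets lebesgue" "S : sets lebesgue" "S <= G"
 shows "AE x in lon S. P x"
 using assms by (auto simp: AE_restrict_space_iff elim: eventually_mono)

lemma borel_measurable_lebesgue_on_AE:
 fixes f :: "'a::euclidean_space => complex"
 assumes f: "f : bm (lon G)" and G: "G : sets lebesgue"
 and eq: "AE x in lon G. f x=g x"
 shows "g : bm (lon G)"
proof -
 define d where "d x=(if x : G then g x-f x else 0)" for x
 define N where "N={x. d x ~= 0}"
 have "AE x in lebesgue. x : G --> f x=g x" using eq G by (simp add: AE_restrict_space_iff)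
 hence "AE x in lebesgue. x ~: N" by eventually_elim (auto simp: N_def d_def)
 hence N: "negligible N"
 by (simp add: negligible_iff_null_sets AE_iff_null_sets[symmetric] completion.AE_iff_null_sets)
 have "d : bm lebesgue"
 proof (rule borel_measurableI)
 fix S :: "complex set"
 define A where "A={x. d x : S & d x ~= 0}"
 have A: "A : sets lebesgue"
 by (rule negligible_sets[OF negligible_subset[OF N]]) (auto simp: A_def N_def)
 have "d -` S \<inter> space lebesgue=(if 0 : S then-N \<union> A else A)"
 by (auto simp: A_def N_def)
 thus "d -` S \<inter> space lebesgue : sets lebesgue"
 using A negligible_sets[OF N] by (auto simp: Compl_in_sets_lebesgue)
 qed
 hence d: "d : bm (lon G)" by (rule measurable_restrict_space1)
 have "(%x. f x+d x) : bm (lon G)" using f d by (rule borel_measurable_add)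
 also have "?this \<longleftrightarrow> ?thesis" by (rule measurable_cong) (use G in \<open>auto simp: d_def\<close>)
 finally show ?thesis .
qed

lemma L2_mem_AE:
 assumes f: "f : carr (L2 G)" and G: "G : sets lebesgue" and eq: "AE x in lon G. f x=g x"
 shows "g : carr (L2 G)"
proof -
 have g: "g : bm (lon G)"
 using borel_measurable_lebesgue_on_AE[OF _ G eq] f by (simp add: L2_mem)
 have "integrable (lon G) (%x. (cmod (g x))^2)"
 proof (rule Bochner_Integration.integrable_cong_AE_imp)
 show "integrable (lon G) (%x. (cmod (f x))^2)" using f by (simp add: L2_mem)
 show "(%x. (cmod (g x))^2) : bm (lon G)" using g by measurable
 show "AE x in lon G. (cmod (f x))^2=(cmod (g x))^2" using eq by eventually_elim simp
 qed
 thus ?thesis using g by (simp add: L2_mem)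
qed

lemma L2_ip_cong_AE:
 assumes "f : carr (L2 G)" "f' : carr (L2 G)" "g : carr (L2 G)" "g' : carr (L2 G)"
 and "AE x in lon G. f x=f' x" "AE x in lon G. g x=g' x"
 shows "ip (L2 G) f g=ip (L2 G) f' g'"
 unfolding L2_ip
proof (rule integral_cong_AE)
 show "(%x. f x * cnj (g x)) : bm (lon G)"
 "(%x. f' x * cnj (g' x)) : bm (lon G)"
 using L2_integrable_product[of f G g] L2_integrable_product[of f' G g'] assms by auto
 show "AE x in lon G. f x * cnj (g x)=f' x * cnj (g' x)"
 using assms(5,6) by eventually_elim simp
qed

lemma L2_locally_integrable:
 assumes f: "f : carr (L2 G)" and G: "G : sets lebesgue"
 shows "lint G f"
 unfolding locally_integrable_def
proof (intro allI impI)
 fix K assume K: "compact K & K <= G"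
 hence Km: "K : lmeasurable" by (simp add: lmeasurable_compact)
 have Ks: "K : sets lebesgue" using Km by (rule fmeasurableD)
 show "integrable (lon K) f"
 proof (rule Bochner_Integration.integrable_bound)
 have "integrable (lon K) (%x. (cmod (f x))^2)"
 by (rule integrable_lebesgue_on_subset[OF _ G Ks]) (use f K in \<open>auto simp: L2_mem\<close>)
 moreover have "integrable (lon K) (%x. 1 :: real)"
 using Km by (intro finite_measure.integrable_const finite_measure_lebesgue_on)
 ultimately show "integrable (lon K) (%x. 1+(cmod (f x))^2)"
 by (intro Bochner_Integration.integrable_add)
 show "f : bm (lon K)"
 by (rule measurable_lebesgue_on_subset[of f G K]) (use f K in \<open>auto simp: L2_mem\<close>)
 have "cmod z <= 1+(cmod z)^2" for z
 proof -
 have "0 <= (cmod z-1)^2" by simp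
 hence "2 * cmod z <= (cmod z)^2+1" by (simp add: power2_diff)
 thus ?thesis using norm_ge_zero[of z] by linarith
 qed
 thus "AE x in lon K. norm (f x) <= norm (1+(cmod (f x))^2)" by (intro AE_I2) simp
 qed
qed

lemma locally_integrable_add:
 "lint G f ==> lint G g ==> lint G (%x. f x+g x)"
 by (simp add: locally_integrable_def)

lemma locally_integrable_scale: "lint G f ==> lint G (%x. c * f x)"
 by (simp add: locally_integrable_def)

lemma locally_integrable_subset: "lint G f ==> Q <= G ==> lint Q f"
 by (auto simp: locally_integrable_def)

lemma locally_integrable_AE_const:
 assumes G: "G : sets lebesgue" and eq: "AE x in lon G. f x=(c :: complex)"
 shows "lint G f"
 unfolding locally_integrable_def
proof (intro allI impI)
 fix K assume K: "compact K & K <= G"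
 hence Km: "K : lmeasurable" and Ks: "K : sets lebesgue" by (simp_all add: lmeasurable_compact fmeasurableD)
 have int: "integrable (lon K) (%x. c)"
 using Km by (intro finite_measure.integrable_const finite_measure_lebesgue_on)
 have AE: "AE x in lon K. c=f x"
 using AE_lebesgue_on_subset[OF eq G Ks] K by auto
 show "integrable (lon K) f"
 by (rule Bochner_Integration.integrable_cong_AE_imp[OF int _ AE])
 (rule borel_measurable_lebesgue_on_AE[OF _ Ks AE], simp)
qed

subsection \<open>Weak derivatives\<close>

text \<open>The preimages of the edges are known only up to null sets. Test functions ignore a null set of the region, so such sets behave like open ones.\<close>

definition almost_open :: "'a::euclidean_space set => bool" where
 "almost_open G \<longleftrightarrow> (EX Q. open Q & Q <= G & negligible (G-Q))"

lemma almost_open_sets: "almost_open G ==> G : sets lebesgue"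
proof -
 assume "almost_open G"
 then obtain Q where Q: "open Q" "Q <= G" "negligible (G-Q)" by (auto simp: almost_open_def)
 have "Q \<union> (G-Q) : sets lebesgue" using Q(1) by (intro sets.Un negligible_sets[OF Q(3)]) simp
 moreover have "Q \<union> (G-Q)=G" using Q by auto
 ultimately show ?thesis by simp
qed

lemma open_almost_open: "open G ==> almost_open G"
 by (auto simp: almost_open_def)

lemma weak_derivative_unique:
 assumes G: "almost_open G" and g: "hwd G f v g" and g': "hwd G f v g'"
 shows "AE x in lon G. g x=g' x"
proof -
 note Gm=almost_open_sets[OF G]
 obtain Q where Q: "open Q" "Q <= G" "negligible (G-Q)" using G by (auto simp: almost_open_def)
 have Qm: "Q : sets lebesgue" using Q by (simp add: borel_open)
 have li: "lint G g" "lint G g'" using g g' by (auto simp: has_weak_derivative_def)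
 have "AE x in lon Q. g x+(-1) * g' x=0"
 proof (rule fundamental_lemma[OF Q(1)])
 show "lint Q (%x. g x+(-1) * g' x)"
 using li Q(2) by (intro locally_integrable_add locally_integrable_scale) (auto intro: locally_integrable_subset)
 fix ph assume ph: "ph : test_functions Q"
 hence phG: "ph : test_functions G" using test_functions_mono[OF Q(2)] by blast
 have "(LINT x|lon Q. (g x+(-1) * g' x) * cr (ph x)) =
 (LINT x|lon G. (g x+(-1) * g' x) * cr (ph x))"
 by (rule test_integral_subset(1)[OF Gm Qm Q(2) ph])
 also have "\<dots>=(LINT x|lon G. g x * cr (ph x)-g' x * cr (ph x))"
 by (simp add: algebra_simps)
 also have "\<dots>=(LINT x|lon G. g x * cr (ph x))-(LINT x|lon G. g' x * cr (ph x))"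
 by (intro Bochner_Integration.integral_diff test_integrable(1)[OF Gm _ phG] li)
 also have "\<dots>=0"
 proof -
 have *: "(LINT x|lon G. f x * cr (fd ph (at x) v)) =
 -(LINT x|lon G. k x * cr (ph x))" if "hwd G f v k" for k
 using that phG by (simp add: has_weak_derivative_def)
 show ?thesis using *[OF g] *[OF g'] by simp
 qed
 finally show "(LINT x|lon Q. (g x+(-1) * g' x) * cr (ph x))=0" .
 qed
 hence "AE x in lebesgue. x : Q --> g x=g' x" using Qm by (simp add: AE_restrict_space_iff)
 moreover have "AE x in lebesgue. x ~: G-Q"
 using Q(3) by (intro AE_not_in) (simp add: negligible_iff_null_sets)
 ultimately have "AE x in lebesgue. x : G --> g x=g' x" by eventually_elim auto
 thus ?thesis using Gm by (simp add: AE_restrict_space_iff)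
qed

lemma has_weak_derivative_weak_derivative:
 "hwd G f v g ==> hwd G f v (wkd G f v)"
 using someI[of "hwd G f v" g] unfolding weak_derivative_def .

lemma weak_derivative_AE:
 "almost_open G ==> hwd G f v g ==> AE x in lon G. wkd G f v x=g x"
 using weak_derivative_unique has_weak_derivative_weak_derivative by blast

lemma has_weak_derivative_add:
 assumes G: "G : sets lebesgue" and f: "hwd G f v g" and f': "hwd G f' v g'"
 shows "hwd G (%x. f x+f' x) v (%x. g x+g' x)"
 unfolding has_weak_derivative_def
proof (intro conjI ballI)
 have li: "lint G f" "lint G g" "lint G f'" "lint G g'"
 using f f' by (auto simp: has_weak_derivative_def)
 thus "lint G (%x. f x+f' x)" "lint G (%x. g x+g' x)"
 by (auto intro: locally_integrable_add)
 fix ph assume ph: "ph : test_functions G"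
 note int=test_integrable[OF G _ ph]
 show "(LINT x|lon G. (f x+f' x) * cr (fd ph (at x) v)) =
 -(LINT x|lon G. (g x+g' x) * cr (ph x))"
 using f f' ph int(2)[OF li(1), of v] int(2)[OF li(3), of v] int(1)[OF li(2)] int(1)[OF li(4)]
 by (simp add: distrib_right has_weak_derivative_def)
qed

lemma has_weak_derivative_scale:
 assumes f: "hwd G f v g"
 shows "hwd G (%x. c * f x) v (%x. c * g x)"
 using f by (simp add: has_weak_derivative_def locally_integrable_scale mult.assoc)

lemma has_weak_derivative_subset:
 assumes f: "hwd G f v g" and "G : sets lebesgue" "Q : sets lebesgue" "Q <= G"
 shows "hwd Q f v g"
 unfolding has_weak_derivative_def
proof (intro conjI ballI)
 show "lint Q f" "lint Q g"
 using f assms(4) by (auto simp: has_weak_derivative_def intro: locally_integrable_subset)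
 fix ph assume ph: "ph : test_functions Q"
 hence "ph : test_functions G" using test_functions_mono[OF assms(4)] by blast
 thus "(LINT x|lon Q. f x * cr (fd ph (at x) v)) =
 -(LINT x|lon Q. g x * cr (ph x))"
 using f unfolding test_integral_subset[OF assms(2,3,4) ph] by (simp add: has_weak_derivative_def)
qed

lemma test_deriv_linear:
 "ph : test_functions G ==> linear (fd ph (at x))"
 using has_derivative_linear[OF test_function_has_derivative] .

lemma has_weak_derivative_direction:
 fixes v :: "'a::euclidean_space"
 assumes G: "G : sets lebesgue" and g: "!!b. b : Basis ==> hwd G f b (g b)"
 shows "hwd G f v (%x. \<Sum>b\<in>Basis. cr (v \<bullet> b) * g b x)"
 unfolding has_weak_derivative_def
proof (intro conjI ballI)
 have li: "lint G f" using g[OF SOME_Basis] by (simp add: has_weak_derivative_def)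
 have gi: "lint G (g b)" if "b : Basis" for b using g[OF that] by (simp add: has_weak_derivative_def)
 show "lint G f" by (rule li)
 show "lint G (%x. \<Sum>b\<in>Basis. cr (v \<bullet> b) * g b x)"
 using gi by (simp add: locally_integrable_def)
 fix ph assume ph: "ph : test_functions G"
 have lin: "fd ph (at x) v=(\<Sum>b\<in>Basis. (v \<bullet> b) * fd ph (at x) b)" for x
 proof -
 interpret linear "fd ph (at x)" by (rule test_deriv_linear[OF ph])
 have "fd ph (at x) v=fd ph (at x) (\<Sum>b\<in>Basis. (v \<bullet> b) *\<^sub>R b)"
 by (simp add: euclidean_representation)
 also have "\<dots>=(\<Sum>b\<in>Basis. (v \<bullet> b) * fd ph (at x) b)" by (simp add: sum scale)
 finally show ?thesis .
 qed
 have "(LINT x|lon G. f x * cr (fd ph (at x) v)) =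
 (LINT x|lon G. (\<Sum>b\<in>Basis. cr (v \<bullet> b)*(f x * cr (fd ph (at x) b))))"
 unfolding lin by (simp add: sum_distrib_left mult_ac)
 also have "\<dots>=(\<Sum>b\<in>Basis. cr (v \<bullet> b)*(LINT x|lon G. f x * cr (fd ph (at x) b)))"
 using test_integrable(2)[OF G li ph] by (subst Bochner_Integration.integral_sum) auto
 also have "\<dots>=(\<Sum>b\<in>Basis. cr (v \<bullet> b)*(- (LINT x|lon G. g b x * cr (ph x))))"
 using g ph by (intro sum.cong) (auto simp: has_weak_derivative_def)
 also have "\<dots>=- (LINT x|lon G. (\<Sum>b\<in>Basis. cr (v \<bullet> b)*(g b x * cr (ph x))))"
 using test_integrable(1)[OF G gi ph] by (subst Bochner_Integration.integral_sum) (auto simp: sum_negf)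
 also have "\<dots>=- (LINT x|lon G. (\<Sum>b\<in>Basis. cr (v \<bullet> b) * g b x) * cr (ph x))"
 by (simp add: sum_distrib_right mult.assoc)
 finally show "(LINT x|lon G. f x * cr (fd ph (at x) v)) =
 -(LINT x|lon G. (\<Sum>b\<in>Basis. cr (v \<bullet> b) * g b x) * cr (ph x))" .
qed

lemma lborel_integral_translate:
 fixes f :: "'a::euclidean_space => 'b::{banach, second_countable_topology}"
 assumes "f : bm borel"
 shows "(LINT x|lborel. f (x+c))=(LINT x|lborel. f x)"
proof -
 have "(LINT x|lborel. f x)=(LINT x|distr lborel borel ((+) c). f x)" by (simp add: lborel_distr_plus)
 also have "\<dots>=(LINT x|lborel. f (c+x))" using assms by (intro integral_distr) auto
 finally show ?thesis by (simp add: add.commute)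
qed

lemma lborel_integrable_translate:
 fixes f :: "'a::euclidean_space => 'b::{banach, second_countable_topology}"
 assumes "integrable lborel f"
 shows "integrable lborel (%x. f (x+c))"
proof -
 have "integrable (distr lborel borel ((+) c)) f" using assms by (simp add: lborel_distr_plus)
 hence "integrable lborel (%x. f (c+x))" by (subst (asm) integrable_distr_eq) (use assms in auto)
 thus ?thesis by (simp add: add.commute)
qed

lemma test_function_along_segment:
 assumes ph: "ph : test_functions G"
 shows "((%s. ph (x+s *\<^sub>R v)) has_vector_derivative fd ph (at (x+s *\<^sub>R v)) v) (at s within S)"
proof -
 have "((%s. x+s *\<^sub>R v) has_derivative (%h. h *\<^sub>R v)) (at s within S)"
 by (auto intro!: derivative_eq_intros)
 from has_derivative_compose[OF this test_function_has_derivative[OF ph]]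
 have "((%s. ph (x+s *\<^sub>R v)) has_derivative (%h. fd ph (at (x+s *\<^sub>R v)) (h *\<^sub>R v))) (at s within S)" .
 thus ?thesis
 by (simp add: has_vector_derivative_def linear_scale[OF test_deriv_linear[OF ph]])
qed

lemma test_deriv_integral:
 fixes v :: "'a::euclidean_space"
 assumes ph: "ph : test_functions G"
 shows "(LINT x|lborel. fd ph (at x) v)=0"
proof -
 define h where "h x=fd ph (at x) v" for x
 have hc: "continuous_on UNIV h" unfolding h_def[abs_def] by (rule test_function_deriv_continuous[OF ph])
 have hm [measurable]: "h : bm borel" using hc by (rule borel_measurable_continuous_onI)
 obtain K where K: "compact K" "!!x. x ~: K ==> ph x=0" "!!x. x ~: K ==> h x=0"
 using test_functionD[OF ph] unfolding h_def by metis
 obtain r where r: "!!x. x : K ==> norm x <= r"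
 using compact_imp_bounded[OF K(1)] by (auto simp: bounded_iff)
 define R where "R=r+norm v"
 define F where "F s x=ind {0..1} s *\<^sub>R h (x+s *\<^sub>R v)" for s :: real and x
 have "integrable lborel (%z. ind ({0..1} \<times> cball 0 R) z *\<^sub>R h (snd z+fst z *\<^sub>R v))"
 by (intro borel_integrable_compact compact_Times) (auto intro!: continuous_intros continuous_on_compose2[OF hc])
 moreover have "ind ({0..1} \<times> cball 0 R) z *\<^sub>R h (snd z+fst z *\<^sub>R v)=(case z of (s, x) => F s x)" for z :: "real \<times> 'a"
 proof -
 obtain s x where z: "z=(s, x)" by (cases z)
 have "h (x+s *\<^sub>R v)=0" if "s : {0..1}" "x ~: cball 0 R"
 proof -
 have "norm (s *\<^sub>R v) <= norm v" using that(1) by (simp add: mult_left_le_one_le)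
 hence "norm (x+s *\<^sub>R v) > r"
 using that(2) norm_triangle_ineq2[of x "- (s *\<^sub>R v)"] by (simp add: R_def)
 hence "x+s *\<^sub>R v ~: K" using r by force
 thus ?thesis by (rule K(3))
 qed
 thus ?thesis by (auto simp: z F_def indicator_def)
 qed
 ultimately have int: "integrable (lborel \<Otimes>\<^sub>M lborel) (%(s, x). F s x)" by (simp add: lborel_prod)
 have phc: "continuous_on UNIV ph" by (rule test_function_continuous[OF ph])
 have "integrable lborel (%x. ind K x *\<^sub>R ph x)"
 using K(1) by (intro borel_integrable_compact continuous_on_subset[OF phc]) auto
 moreover have "(%x. ind K x *\<^sub>R ph x)=ph" using K(2) by (auto simp: fun_eq_iff indicator_def)
 ultimately have phi: "integrable lborel ph" by simp
 have "(LINT x|lborel. LINT s|lborel. F s x)=(LINT s|lborel. LINT x|lborel. F s x)"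
 by (rule lborel_pair.Fubini_integral[OF int])
 also have "\<dots>=(LINT s|lborel. ind {0..1::real} s *\<^sub>R (LINT x|lborel. h x))"
 unfolding F_def using lborel_integral_translate[OF hm] by simp
 also have "\<dots>=(LINT x|lborel. h x)" by simp
 also have "(LINT x|lborel. LINT s|lborel. F s x)=(LINT x|lborel. ph (x+v)-ph x)"
 proof (rule BI_cong[OF refl])
 fix x
 have "(LINT s|lborel. F s x)=ph (x+1 *\<^sub>R v)-ph (x+0 *\<^sub>R v)"
 unfolding F_def h_def
 proof (rule integral_FTC_atLeastAtMost)
 show "continuous_on {0..1} (%s. fd ph (at (x+s *\<^sub>R v)) v)"
 by (rule continuous_on_compose2[OF hc[unfolded h_def[abs_def]]]) (auto intro!: continuous_intros)
 qed (auto intro: test_function_along_segment[OF ph])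
 thus "(LINT s|lborel. F s x)=ph (x+v)-ph x" by simp
 qed
 also have "\<dots>=0"
 using phi lborel_integrable_translate[OF phi, of v] lborel_integral_translate[of ph v] by simp
 finally show ?thesis by (simp add: h_def)
qed

lemma has_weak_derivative_AE_const:
 assumes G: "G : sets lebesgue" and eq: "AE x in lon G. f x=(c :: complex)"
 shows "hwd G f v (%x. 0)"
 unfolding has_weak_derivative_def
proof (intro conjI ballI)
 show li: "lint G f" by (rule locally_integrable_AE_const[OF G eq])
 show "lint G (%x. 0)" by (simp add: locally_integrable_def)
 have lc: "lint G (%x. c)" by (rule locally_integrable_AE_const[OF G, where c=c]) simp
 fix ph assume ph: "ph : test_functions G"
 obtain K where K: "compact K" "K <= G" "!!x. x ~: K ==> fd ph (at x) v=0"
 using test_functionD[OF ph] by metis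
 have m: "(%x. fd ph (at x) v) : bm lborel"
 using borel_measurable_continuous_onI[OF test_function_deriv_continuous[OF ph]] by simp
 have "(LINT x|lon G. f x * cr (fd ph (at x) v)) =
 (LINT x|lon G. c * cr (fd ph (at x) v))"
 using test_integrable(2)[OF G li ph, of v] test_integrable(2)[OF G lc ph, of v] eq
 by (intro integral_cong_AE) (auto elim: eventually_mono)
 also have "\<dots>=(LINT x|lebesgue. (if x : G then c * cr (fd ph (at x) v) else 0))"
 by (rule Lebesgue_Measure.integral_restrict_UNIV[OF G, symmetric])
 also have "\<dots>=(LINT x|lebesgue. c * cr (fd ph (at x) v))"
 using K by (intro BI_cong) auto
 also have "\<dots>=c * cr (LINT x|lebesgue. fd ph (at x) v)" by simp
 also have "(LINT x|lebesgue. fd ph (at x) v)=(LINT x|lborel. fd ph (at x) v)"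
 using m by (rule integral_completion)
 also have "\<dots>=0" by (rule test_deriv_integral[OF ph])
 finally show "(LINT x|lon G. f x * cr (fd ph (at x) v)) =
 -(LINT x|lon G. 0 * cr (ph x))" by simp
qed

lemma weak_derivative_AE_const:
 assumes "almost_open G" "AE x in lon G. f x=(c :: complex)"
 shows "AE x in lon G. wkd G f v x=0"
 using weak_derivative_AE[OF assms(1) has_weak_derivative_AE_const[OF almost_open_sets[OF assms(1)] assms(2)]] .

subsection \<open>The Sobolev space as a Hilbert space\<close>

lemma H1_sub_L2: "f : carr (H1 G) ==> f : carr (L2 G)"
 by (simp add: H1_def)

lemma H1_memI:
 "f : carr (L2 G) ==> (!!b. b : Basis ==> g b : carr (L2 G)) ==>
 (!!b. b : Basis ==> hwd G f b (g b)) ==> f : carr (H1 G)"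
 by (auto simp: H1_def)

lemma H1_has_weak_derivative:
 "f : carr (H1 G) ==> b : Basis ==> hwd G f b (wkd G f b)"
 by (auto simp: H1_def intro: has_weak_derivative_weak_derivative)

lemma H1_weak_derivative_L2:
 assumes G: "almost_open G" and f: "f : carr (H1 G)" and b: "b : Basis"
 shows "wkd G f b : carr (L2 G)"
proof -
 obtain g where g: "g : carr (L2 G)" "hwd G f b g" using f b by (auto simp: H1_def)
 have "AE x in lon G. g x=wkd G f b x"
 using weak_derivative_AE[OF G g(2)] by eventually_elim simp
 thus ?thesis by (rule L2_mem_AE[OF g(1) almost_open_sets[OF G]])
qed

lemma H1_ip:
 assumes G: "almost_open G" and f: "f : carr (H1 G)" and g: "g : carr (H1 G)"
 shows "ip (H1 G) f g =
 (\<Sum>b\<in>Basis. ip (L2 G) (wkd G f b) (wkd G g b))+ip (L2 G) f g"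
proof -
 have int: "integrable (lon G) (%x. wkd G f b x * cnj (wkd G g b x))"
 if "b : Basis" for b
 using H1_weak_derivative_L2[OF G f that] H1_weak_derivative_L2[OF G g that] by (rule L2_integrable_product)
 have "ip (H1 G) f g=(LINT x|lon G.
 (\<Sum>b\<in>Basis. wkd G f b x * cnj (wkd G g b x))+f x * cnj (g x))"
 by (simp add: H1_def)
 also have "\<dots>=(LINT x|lon G. (\<Sum>b\<in>Basis. wkd G f b x * cnj (wkd G g b x)))
 +(LINT x|lon G. f x * cnj (g x))"
 by (intro BI_add Bochner_Integration.integrable_sum int
 L2_integrable_product[OF H1_sub_L2[OF f] H1_sub_L2[OF g]])
 also have "(LINT x|lon G. (\<Sum>b\<in>Basis. wkd G f b x * cnj (wkd G g b x))) =
 (\<Sum>b\<in>Basis. LINT x|lon G. wkd G f b x * cnj (wkd G g b x))"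
 using int by (rule Bochner_Integration.integral_sum)
 finally show ?thesis by (simp add: L2_ip)
qed

lemma H1_add_mem:
 assumes G: "G : sets lebesgue" and f: "f : carr (H1 G)" and g: "g : carr (H1 G)"
 shows "(%x. f x+g x) : carr (H1 G)"
proof -
 interpret L: semi_ip "L2 G" by (rule L2_semi_ip)
 obtain Df where Df: "!!b. b : Basis ==> Df b : carr (L2 G) & hwd G f b (Df b)"
 using f by (simp add: H1_def) metis
 obtain Dg where Dg: "!!b. b : Basis ==> Dg b : carr (L2 G) & hwd G g b (Dg b)"
 using g by (simp add: H1_def) metis
 show ?thesis
 by (rule H1_memI[where g="%b x. Df b x+Dg b x"])
 (use Df Dg f g G in \<open>auto intro: has_weak_derivative_add simp: H1_sub_L2\<close>)
qed

lemma H1_scale_mem: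
 assumes f: "f : carr (H1 G)"
 shows "(%x. c * f x) : carr (H1 G)"
proof -
 interpret L: semi_ip "L2 G" by (rule L2_semi_ip)
 obtain Df where Df: "!!b. b : Basis ==> Df b : carr (L2 G) & hwd G f b (Df b)"
 using f by (simp add: H1_def) metis
 show ?thesis
 by (rule H1_memI[where g="%b x. c * Df b x"])
 (use Df f in \<open>auto intro: has_weak_derivative_scale simp: H1_sub_L2\<close>)
qed

lemma H1_AE_const_mem:
 assumes G: "G : sets lebesgue" and f: "f : carr (L2 G)" and eq: "AE x in lon G. f x=c"
 shows "f : carr (H1 G)"
proof -
 interpret L: semi_ip "L2 G" by (rule L2_semi_ip)
 show ?thesis
 by (rule H1_memI[where g="%b x. 0"]) (auto intro: has_weak_derivative_AE_const[OF G eq] f)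
qed

lemma weak_derivative_add_AE:
 assumes G: "almost_open G" and f: "f : carr (H1 G)" and g: "g : carr (H1 G)" and b: "b : Basis"
 shows "AE x in lon G. wkd G (%x. f x+g x) b x=wkd G f b x+wkd G g b x"
 by (rule weak_derivative_AE[OF G has_weak_derivative_add[OF almost_open_sets[OF G]
 H1_has_weak_derivative[OF f b] H1_has_weak_derivative[OF g b]]])

lemma weak_derivative_scale_AE:
 assumes G: "almost_open G" and f: "f : carr (H1 G)" and b: "b : Basis"
 shows "AE x in lon G. wkd G (%x. c * f x) b x=c * wkd G f b x"
 by (rule weak_derivative_AE[OF G has_weak_derivative_scale[OF H1_has_weak_derivative[OF f b]]])

lemma H1_semi_ip:
 fixes G :: "'a::euclidean_space set"
 assumes G: "almost_open G"
 shows "semi_ip (H1 G)"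
proof -
 interpret L: semi_ip "L2 G" by (rule L2_semi_ip)
 note Gm=almost_open_sets[OF G] and D=H1_weak_derivative_L2[OF G]
 note add=H1_add_mem[OF Gm] and sc=H1_scale_mem
 show ?thesis
 proof unfold_locales
 fix f g k :: "'a => complex" and c :: complex
 show zero: "(%x. 0) : carr (H1 G)" by (rule H1_AE_const_mem[OF Gm, where c=0]) auto
 show "(%x. f x+g x) : carr (H1 G)" if "f : carr (H1 G)" "g : carr (H1 G)" using add that .
 show "(%x. c * f x) : carr (H1 G)" if "f : carr (H1 G)" using sc that .
 show "ip (H1 G) (%x. f x+g x) k=ip (H1 G) f k+ip (H1 G) g k"
 if f: "f : carr (H1 G)" and g: "g : carr (H1 G)" and k: "k : carr (H1 G)"
 proof -
 have "ip (L2 G) (wkd G (%x. f x+g x) b) (wkd G k b) =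
 ip (L2 G) (wkd G f b) (wkd G k b)+ip (L2 G) (wkd G g b) (wkd G k b)"
 if b: "b : Basis" for b
 proof -
 have "ip (L2 G) (wkd G (%x. f x+g x) b) (wkd G k b) =
 ip (L2 G) (%x. wkd G f b x+wkd G g b x) (wkd G k b)"
 by (rule L2_ip_cong_AE[OF _ _ _ _ weak_derivative_add_AE[OF G f g b]])
 (use D[OF add[OF f g] b] D[OF f b] D[OF g b] D[OF k b] in auto)
 thus ?thesis using D[OF f b] D[OF g b] D[OF k b] by (simp add: L.ip_add_left)
 qed
 thus ?thesis
 using f g k add[OF f g] by (simp add: H1_ip[OF G] H1_sub_L2 L.ip_add_left sum.distrib)
 qed
 show "ip (H1 G) (%x. c * f x) k=c * ip (H1 G) f k"
 if f: "f : carr (H1 G)" and k: "k : carr (H1 G)"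
 proof -
 have "ip (L2 G) (wkd G (%x. c * f x) b) (wkd G k b) =
 c * ip (L2 G) (wkd G f b) (wkd G k b)" if b: "b : Basis" for b
 proof -
 have "ip (L2 G) (wkd G (%x. c * f x) b) (wkd G k b) =
 ip (L2 G) (%x. c * wkd G f b x) (wkd G k b)"
 by (rule L2_ip_cong_AE[OF _ _ _ _ weak_derivative_scale_AE[OF G f b]])
 (use D[OF sc[OF f] b] D[OF f b] D[OF k b] in auto)
 thus ?thesis using D[OF f b] D[OF k b] by (simp add: L.ip_scale_left)
 qed
 thus ?thesis
 using f k sc[OF f] by (simp add: H1_ip[OF G] H1_sub_L2 L.ip_scale_left sum_distrib_left distrib_left)
 qed
 show "ip (H1 G) g f=cnj (ip (H1 G) f g)" if f: "f : carr (H1 G)" and g: "g : carr (H1 G)"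
 proof -
 have "ip (L2 G) (wkd G g b) (wkd G f b) =
 cnj (ip (L2 G) (wkd G f b) (wkd G g b))" if "b : Basis" for b
 by (rule L.ip_commute[OF D[OF f that] D[OF g that]])
 moreover have "ip (L2 G) g f=cnj (ip (L2 G) f g)" using f g by (intro L.ip_commute H1_sub_L2)
 ultimately show ?thesis using f g by (simp add: H1_ip[OF G])
 qed
 show "0 <= Re (ip (H1 G) f f)" if f: "f : carr (H1 G)"
 using D[OF f] f by (auto simp: H1_ip[OF G] Re_sum H1_sub_L2 intro!: add_nonneg_nonneg sum_nonneg L.ip_nonneg)
 qed
qed

lemma H1_hnorm_sq:
 assumes G: "almost_open G" and f: "f : carr (H1 G)"
 shows "(nm (H1 G) f)^2=(\<Sum>b\<in>Basis. (nm (L2 G) (wkd G f b))^2)+(nm (L2 G) f)^2"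
proof -
 interpret L: semi_ip "L2 G" by (rule L2_semi_ip)
 interpret H: semi_ip "H1 G" by (rule H1_semi_ip[OF G])
 show ?thesis
 using f H1_sub_L2[OF f] H1_weak_derivative_L2[OF G f]
 by (simp add: H.hnorm_sq H1_ip[OF G] L.hnorm_sq Re_sum)
qed

lemma weak_derivative_diff_hnorm:
 assumes G: "almost_open G" and f: "f : carr (H1 G)" and g: "g : carr (H1 G)" and b: "b : Basis"
 shows "nm (L2 G) (wkd G (%x. f x-g x) b) =
 nm (L2 G) (%x. wkd G f b x-wkd G g b x)"
proof -
 interpret L: semi_ip "L2 G" by (rule L2_semi_ip)
 interpret H: semi_ip "H1 G" by (rule H1_semi_ip[OF G])
 note D=H1_weak_derivative_L2[OF G]
 have "AE x in lon G. wkd G (%x. f x+(-1) * g x) b x =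
 wkd G f b x+wkd G (%x. (-1) * g x) b x"
 by (rule weak_derivative_add_AE[OF G f H1_scale_mem[OF g] b])
 hence "AE x in lon G. wkd G (%x. f x-g x) b x =
 wkd G f b x-wkd G g b x"
 using weak_derivative_scale_AE[OF G g b, of "-1"] by eventually_elim simp
 hence "ip (L2 G) (wkd G (%x. f x-g x) b) (wkd G (%x. f x-g x) b) =
 ip (L2 G) (%x. wkd G f b x-wkd G g b x) (%x. wkd G f b x-wkd G g b x)"
 using D[OF f b] D[OF g b] D[OF H.diff_mem[OF f g] b] by (intro L2_ip_cong_AE) auto
 thus ?thesis by (simp add: hnorm_def)
qed

text \<open>Weak derivatives pass to limits, because integration against a test function is continuous in the norm.\<close>

lemma H1_complete:
 fixes G :: "'a::euclidean_space set"
 assumes G: "almost_open G"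
 shows "semi_hilbert (H1 G)"
proof -
 interpret L: semi_hilbert "L2 G" by (rule L2_complete)
 interpret H: semi_ip "H1 G" by (rule H1_semi_ip[OF G])
 note Gm=almost_open_sets[OF G] and D=H1_weak_derivative_L2[OF G]
 show ?thesis
 proof unfold_locales
 fix f :: "nat => 'a => complex"
 assume f: "!!n. f n : carr (H1 G)" and cau: "hcauchy (H1 G) f"
 have fL: "f n : carr (L2 G)" for n using H1_sub_L2[OF f] .
 have parts: "nm (L2 G) u <= nm (H1 G) u"
 "b : Basis ==> nm (L2 G) (wkd G u b) <= nm (H1 G) u" if u: "u : carr (H1 G)" for u b
 proof -
 have nn: "0 <= (\<Sum>b\<in>Basis. (nm (L2 G) (wkd G u b))^2)" by (intro sum_nonneg) auto
 show "nm (L2 G) u <= nm (H1 G) u"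
 by (rule power2_le_imp_le) (use H1_hnorm_sq[OF G u] nn u in simp_all)
 assume b: "b : Basis"
 have "(nm (L2 G) (wkd G u b))^2 <= (\<Sum>b\<in>Basis. (nm (L2 G) (wkd G u b))^2)"
 using b by (intro member_le_sum) auto
 moreover have "0 <= (nm (L2 G) u)^2" by simp
 ultimately have "(nm (L2 G) (wkd G u b))^2 <= (nm (H1 G) u)^2"
 unfolding H1_hnorm_sq[OF G u] by linarith
 thus "nm (L2 G) (wkd G u b) <= nm (H1 G) u"
 by (rule power2_le_imp_le) (use u in simp)
 qed
 have cau0: "hcauchy (L2 G) f"
 unfolding hcauchy_def
 proof (intro allI impI)
 fix e :: real assume "0<e"
 then obtain N where N: "ALL m>=N. ALL n>=N. nm (H1 G) (%x. f m x-f n x)<e"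
 using cau unfolding hcauchy_def by blast
 thus "EX N. ALL m>=N. ALL n>=N. nm (L2 G) (%x. f m x-f n x)<e"
 proof (intro exI[of _ N] allI impI)
 fix m n assume "N <= m" "N <= n"
 hence "nm (H1 G) (%x. f m x-f n x)<e" using N by blast
 thus "nm (L2 G) (%x. f m x-f n x)<e"
 using parts(1)[OF H.diff_mem[OF f f], of m n] by simp
 qed
 qed
 have cau1: "hcauchy (L2 G) (%n. wkd G (f n) b)" if b: "b : Basis" for b
 unfolding hcauchy_def
 proof (intro allI impI)
 fix e :: real assume "0<e"
 then obtain N where N: "ALL m>=N. ALL n>=N. nm (H1 G) (%x. f m x-f n x)<e"
 using cau unfolding hcauchy_def by blast
 thus "EX N. ALL m>=N. ALL n>=N. nm (L2 G) (%x. wkd G (f m) b x-wkd G (f n) b x)<e"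
 proof (intro exI[of _ N] allI impI)
 fix m n assume "N <= m" "N <= n"
 hence "nm (H1 G) (%x. f m x-f n x)<e" using N by blast
 thus "nm (L2 G) (%x. wkd G (f m) b x-wkd G (f n) b x)<e"
 using parts(2)[OF H.diff_mem[OF f f] b, of m n] weak_derivative_diff_hnorm[OF G f f b, of m n] by simp
 qed
 qed
 obtain f0 where f0: "f0 : carr (L2 G)" and f0lim: "(%n. nm (L2 G) (%x. f n x-f0 x)) ~~> 0"
 using L.complete[of f, OF fL cau0] by blast
 define g where "g b=(SOME g. g : carr (L2 G) &
 (%n. nm (L2 G) (%x. wkd G (f n) b x-g x)) ~~> 0)" for b
 have "g b : carr (L2 G) & (%n. nm (L2 G) (%x. wkd G (f n) b x-g b x)) ~~> 0"
 if b: "b : Basis" for b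
 proof -
 have "EX g. g : carr (L2 G) & (%n. nm (L2 G) (%x. wkd G (f n) b x-g x)) ~~> 0"
 using L.complete[of "%n. wkd G (f n) b", OF D[OF f b] cau1[OF b]]
 by (simp only: Bex_def)
 from someI_ex[OF this] show ?thesis unfolding g_def .
 qed
 hence g: "!!b. b : Basis ==> g b : carr (L2 G)"
 "!!b. b : Basis ==> (%n. nm (L2 G) (%x. wkd G (f n) b x-g b x)) ~~> 0"
 by blast+
 have testL2: "(%x. cr (ps x)) : carr (L2 G)"
 if ps: "continuous_on UNIV ps" "compact K" "K <= G" "!!x. x ~: K ==> ps x=0" for ps :: "'a => real" and K
 proof -
 have "integrable (lon G) (%x. 1 * cr ((ps x)^2))"
 by (rule locally_integrable_times_supported(1)[OF Gm _ _ ps(2,3)])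
 (use ps in \<open>auto intro!: continuous_intros locally_integrable_AE_const[OF Gm, where c=1]\<close>)
 hence "integrable (lon G) (%x. Re (1 * cr ((ps x)^2)))" by (rule integrable_Re)
 moreover have "integrable (lon G) (%x. 1 * cr (ps x))"
 by (rule locally_integrable_times_supported(1)[OF Gm _ _ ps(2,3)])
 (use ps in \<open>auto intro!: locally_integrable_AE_const[OF Gm, where c=1]\<close>)
 hence "(%x. 1 * cr (ps x)) : bm (lon G)"
 by (rule borel_measurable_integrable)
 ultimately show ?thesis by (simp add: L2_mem)
 qed
 have wd: "hwd G f0 b (g b)" if b: "b : Basis" for b
 unfolding has_weak_derivative_def
 proof (intro conjI ballI)
 show "lint G f0" by (rule L2_locally_integrable[OF f0 Gm])
 show "lint G (g b)" by (rule L2_locally_integrable[OF g(1)[OF b] Gm])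
 fix ph assume ph: "ph : test_functions G"
 obtain K where K: "compact K" "K <= G" "!!x. x ~: K ==> ph x=0"
 "!!x v. x ~: K ==> fd ph (at x) v=0" using test_functionD[OF ph] by blast
 have m1: "(%x. cr (ph x)) : carr (L2 G)"
 by (rule testL2[OF test_function_continuous[OF ph] K(1,2,3)])
 have m2: "(%x. cr (fd ph (at x) b)) : carr (L2 G)"
 by (rule testL2[OF test_function_deriv_continuous[OF ph] K(1,2,4)])
 have eqn: "ip (L2 G) (f n) (%x. cr (fd ph (at x) b)) =
 -ip (L2 G) (wkd G (f n) b) (%x. cr (ph x))" for n
 using H1_has_weak_derivative[OF f b, of n] ph by (simp add: L2_ip has_weak_derivative_def)
 have "(%n. ip (L2 G) (f n) (%x. cr (fd ph (at x) b))) ~~>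
 ip (L2 G) f0 (%x. cr (fd ph (at x) b))"
 by (rule L.ip_tendsto[OF fL f0 m2 f0lim])
 moreover have "(%n. ip (L2 G) (f n) (%x. cr (fd ph (at x) b))) ~~>
 -ip (L2 G) (g b) (%x. cr (ph x))"
 unfolding eqn by (rule tendsto_minus[OF L.ip_tendsto[OF D[OF f b] g(1)[OF b] m1 g(2)[OF b]]])
 ultimately have "ip (L2 G) f0 (%x. cr (fd ph (at x) b)) =
 -ip (L2 G) (g b) (%x. cr (ph x))" by (rule LIMSEQ_unique)
 thus "(LINT x|lon G. f0 x * cr (fd ph (at x) b)) =
 -(LINT x|lon G. g b x * cr (ph x))" by (simp add: L2_ip)
 qed
 have f0H: "f0 : carr (H1 G)" by (rule H1_memI[OF f0 g(1) wd])
 have gD: "nm (L2 G) (wkd G (%x. f n x-f0 x) b) =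
 nm (L2 G) (%x. wkd G (f n) b x-g b x)" if b: "b : Basis" for n b
 proof -
 have "AE x in lon G. wkd G (f n) b x-wkd G f0 b x =
 wkd G (f n) b x-g b x"
 using weak_derivative_AE[OF G wd[OF b]] by eventually_elim simp
 hence "ip (L2 G) (%x. wkd G (f n) b x-wkd G f0 b x)
 (%x. wkd G (f n) b x-wkd G f0 b x) =
 ip (L2 G) (%x. wkd G (f n) b x-g b x) (%x. wkd G (f n) b x-g b x)"
 using D[OF f b] D[OF f0H b] g(1)[OF b] by (intro L2_ip_cong_AE) auto
 thus ?thesis using weak_derivative_diff_hnorm[OF G f f0H b, of n] by (simp add: hnorm_def)
 qed
 have "(%n. (\<Sum>b\<in>Basis. (nm (L2 G) (%x. wkd G (f n) b x-g b x))^2) +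
 (nm (L2 G) (%x. f n x-f0 x))^2) ~~> (\<Sum>b\<in>(Basis :: 'a set). 0^2)+0^2"
 by (intro tendsto_intros g(2) f0lim)
 moreover have "(nm (H1 G) (%x. f n x-f0 x))^2 =
 (\<Sum>b\<in>Basis. (nm (L2 G) (%x. wkd G (f n) b x-g b x))^2) +
 (nm (L2 G) (%x. f n x-f0 x))^2" for n
 using H1_hnorm_sq[OF G H.diff_mem[OF f f0H], of n] gD by simp
 ultimately have "(%n. (nm (H1 G) (%x. f n x-f0 x))^2) ~~> 0" by simp
 hence "(%n. nm (H1 G) (%x. f n x-f0 x)) ~~> 0" by simp
 thus "EX g:carr (H1 G). (%n. nm (H1 G) (%x. f n x-g x)) ~~> 0" using f0H by blast
 qed
qed

section \<open>The Poincare inequality\<close>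

text \<open>Averages of translates of a test function.\<close>

text \<open>Averaging a test function over a segment turns the difference of its translates into a directional derivative, which can be moved onto a weakly differentiable function.\<close>

lemma averaged_test_function:
 fixes v :: "'a::euclidean_space"
 assumes Q: "convex Q" and ph: "ph : test_functions {x : Q. x+v : Q}"
 defines "ps \<equiv> %x. integral {0..1} (%s. ph (x-s *\<^sub>R v))"
 shows "ps : test_functions Q" and "fd ps (at x) v=ph x-ph (x-v)"
proof -
 define D where "D x y=integral {0..1} (%s. fd ph (at (x-s *\<^sub>R v)) y)" for x y
 have phc: "continuous_on UNIV ph" by (rule test_function_continuous[OF ph])
 have Dc: "continuous_on UNIV (%x. fd ph (at x) y)" for y
 by (rule test_function_deriv_continuous[OF ph])
 define B where "B x=(\<Sum>b\<in>Basis. fd ph (at x) b *\<^sub>R blinfun_inner_left b)" for x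
 have Bc: "continuous_on UNIV B" unfolding B_def[abs_def] by (intro continuous_intros Dc)
 have B: "blinfun_apply (B x) y=fd ph (at x) y" for x y
 proof -
 interpret linear "fd ph (at x)" by (rule test_deriv_linear[OF ph])
 have "fd ph (at x) y=fd ph (at x) (\<Sum>b\<in>Basis. (y \<bullet> b) *\<^sub>R b)"
 by (simp add: euclidean_representation)
 also have "\<dots>=(\<Sum>b\<in>Basis. (y \<bullet> b) * fd ph (at x) b)" by (simp add: sum scale)
 finally show ?thesis
 by (simp add: B_def blinfun.sum_left blinfun.scaleR_left inner_commute mult.commute)
 qed
 have der: "(ps has_derivative D x) (at x)" for x
 proof -
 have "((%x. integral (cbox 0 1) (%s. ph (x-s *\<^sub>R v))) has_derivative
 blinfun_apply (integral (cbox 0 1) (%s. B (x-s *\<^sub>R v)))) (at x within UNIV)"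
 proof (rule leibniz_rule)
 fix x s
 have "((%x. x-s *\<^sub>R v) has_derivative (%h. h)) (at x)" by (auto intro!: derivative_eq_intros)
 from has_derivative_compose[OF this test_function_has_derivative[OF ph]]
 show "((%x. ph (x-s *\<^sub>R v)) has_derivative blinfun_apply (B (x-s *\<^sub>R v))) (at x within UNIV)"
 by (simp add: B[abs_def])
 next
 fix x
 show "(%s. ph (x-s *\<^sub>R v)) integrable_on cbox 0 1"
 by (intro integrable_continuous continuous_on_compose2[OF phc]) (auto intro!: continuous_intros)
 next
 show "continuous_on (UNIV \<times> cbox 0 1) (%(x, s). B (x-s *\<^sub>R v))"
 by (auto simp: case_prod_beta intro!: continuous_on_compose2[OF Bc] continuous_intros)
 qed auto
 moreover have "blinfun_apply (integral (cbox 0 1) (%s. B (x-s *\<^sub>R v)))=D x"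
 proof
 fix y
 have "(%s. B (x-s *\<^sub>R v)) integrable_on cbox 0 1"
 by (intro integrable_continuous continuous_on_compose2[OF Bc]) (auto intro!: continuous_intros)
 from integral_linear[OF this, of "%F. blinfun_apply F y"]
 show "blinfun_apply (integral (cbox 0 1) (%s. B (x-s *\<^sub>R v))) y=D x y"
 by (simp add: blinfun.bounded_linear_left o_def B D_def)
 qed
 ultimately show ?thesis by (simp add: ps_def)
 qed
 obtain K where K: "compact K" "K <= {x : Q. x+v : Q}" "!!x. x ~: K ==> ph x=0"
 using test_functionD[OF ph] by metis
 define K' where "K'=(%(k, s). k+s *\<^sub>R v) ` (K \<times> {0..1::real})"
 show "ps : test_functions Q"
 proof (rule test_functionsI[OF der])
 show "continuous_on UNIV (%x. D x y)" for y
 unfolding D_def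
 proof -
 have "continuous_on UNIV (%x. integral (cbox 0 (1::real)) (%s. fd ph (at (x-s *\<^sub>R v)) y))"
 by (rule integral_continuous_on_param)
 (auto simp: case_prod_beta intro!: continuous_on_compose2[OF Dc] continuous_intros)
 thus "continuous_on UNIV (%x. integral {0..1} (%s. fd ph (at (x-s *\<^sub>R v)) y))" by simp
 qed
 show "compact K'"
 unfolding K'_def using K(1)
 by (intro compact_continuous_image compact_Times) (auto simp: case_prod_beta intro!: continuous_intros)
 show "K' <= Q"
 proof
 fix x assume "x : K'"
 then obtain k s where ks: "k : K" "0 <= s" "s <= 1" "x=k+s *\<^sub>R v" by (auto simp: K'_def)
 have "(1-s) *\<^sub>R k+s *\<^sub>R (k+v) : Q"
 using Q K(2) ks by (intro convexD) auto
 moreover have "(1-s) *\<^sub>R k+s *\<^sub>R (k+v)=x" using ks by (simp add: algebra_simps)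
 ultimately show "x : Q" by simp
 qed
 fix x assume x: "x ~: K'"
 have "ph (x-s *\<^sub>R v)=0" if "s : {0..1}" for s
 proof (rule K(3), rule notI)
 assume "x-s *\<^sub>R v : K"
 hence "(%(k, s). k+s *\<^sub>R v) (x-s *\<^sub>R v, s) : K'" unfolding K'_def using that by (intro imageI) auto
 thus False using x by simp
 qed
 hence "integral {0..1} (%s. ph (x-s *\<^sub>R v))=integral {0..1} (%s::real. 0)"
 by (rule Henstock_Kurzweil_Integration.integral_cong)
 thus "ps x=0" by (simp add: ps_def)
 qed
 have "fd ps (at x) v=D x v" using der by (metis frechet_derivative_at)
 also have "D x v=(- ph (x-1 *\<^sub>R v))-(- ph (x-0 *\<^sub>R v))"
 unfolding D_def
 proof (rule integral_unique, rule fundamental_theorem_of_calculus)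
 fix s :: real
 have "((%s. ph (x+s *\<^sub>R (- v))) has_vector_derivative fd ph (at (x+s *\<^sub>R (- v))) (- v)) (at s within {0..1})"
 by (rule test_function_along_segment[OF ph])
 from has_vector_derivative_minus[OF this]
 show "((%s.-ph (x-s *\<^sub>R v)) has_vector_derivative fd ph (at (x-s *\<^sub>R v)) v) (at s within {0..1})"
 by (simp add: linear_neg[OF test_deriv_linear[OF ph]])
 qed simp
 finally show "fd ps (at x) v=ph x-ph (x-v)" by simp
qed

lemma integrable_segment_product:
 fixes g :: "'a::euclidean_space => complex" and w :: 'a
 assumes g: "integrable lborel g" and ka: "(%(s, x). ka s x) : bm (lborel \<Otimes>\<^sub>M lborel)"
 and B: "!!s x. cmod (ka s x) <= B"
 shows "integrable (lborel \<Otimes>\<^sub>M lborel) (%(s, x). ind {0..1::real} s *\<^sub>R (g (x+s *\<^sub>R w) * ka s x))"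
proof -
 have gm [measurable]: "g : bm borel" using g by (simp add: borel_measurable_integrable)
 have [measurable]: "(%z. ka (fst z) (snd z)) : bm (lborel \<Otimes>\<^sub>M lborel)"
 using ka by (simp add: case_prod_beta)
 have meas: "(%(s, x). ind {0..1::real} s *\<^sub>R (g (x+s *\<^sub>R w) * ka s x)) : bm (lborel \<Otimes>\<^sub>M lborel)"
 unfolding case_prod_beta by measurable
 have [measurable]: "(%x. ka s x) : bm borel" for s
 using measurable_compose[OF measurable_Pair1'[of s lborel lborel] ka] by simp
 have int: "integrable lborel (%x. ind {0..1::real} s *\<^sub>R (g (x+s *\<^sub>R w) * ka s x))" for s
 proof (rule Bochner_Integration.integrable_bound)
 show "integrable lborel (%x. cr B * g (x+s *\<^sub>R w))"
 using lborel_integrable_translate[OF g] by simp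
 show "(%x. ind {0..1::real} s *\<^sub>R (g (x+s *\<^sub>R w) * ka s x)) : bm lborel" by measurable
 show "AE x in lborel. norm (ind {0..1::real} s *\<^sub>R (g (x+s *\<^sub>R w) * ka s x)) <=
 norm (cr B * g (x+s *\<^sub>R w))"
 proof (rule AE_I2)
 fix x
 have "0 <= B" using B[of s x] norm_ge_zero order_trans by blast
 moreover have "cmod (g (x+s *\<^sub>R w)) * cmod (ka s x) <= cmod (g (x+s *\<^sub>R w)) * B"
 using B by (rule mult_left_mono) simp
 ultimately show "norm (ind {0..1::real} s *\<^sub>R (g (x+s *\<^sub>R w) * ka s x)) <=
 norm (cr B * g (x+s *\<^sub>R w))"
 by (auto simp: norm_mult mult.commute indicator_def)
 qed
 qed
 have le: "(LINT x|lborel. norm (ind {0..1::real} s *\<^sub>R (g (x+s *\<^sub>R w) * ka s x))) <=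
 ind {0..1} s * (B * (LINT x|lborel. cmod (g x)))" for s
 proof -
 have "(LINT x|lborel. norm (ind {0..1::real} s *\<^sub>R (g (x+s *\<^sub>R w) * ka s x))) <=
 (LINT x|lborel. ind {0..1} s * (B * cmod (g (x+s *\<^sub>R w))))"
 proof (rule integral_mono)
 show "integrable lborel (%x. ind {0..1} s * (B * cmod (g (x+s *\<^sub>R w))))"
 using lborel_integrable_translate[OF g] by simp
 show "norm (ind {0..1::real} s *\<^sub>R (g (x+s *\<^sub>R w) * ka s x)) <= ind {0..1} s * (B * cmod (g (x+s *\<^sub>R w)))" for x
 using mult_left_mono[OF B norm_ge_zero, of "g (x+s *\<^sub>R w)" s x] by (simp add: norm_mult mult.commute indicator_def)
 qed (rule integrable_norm[OF int])
 also have "\<dots>=ind {0..1} s * (B * (LINT x|lborel. cmod (g (x+s *\<^sub>R w))))" by simp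
 also have "(LINT x|lborel. cmod (g (x+s *\<^sub>R w)))=(LINT x|lborel. cmod (g x))"
 by (rule lborel_integral_translate) measurable
 finally show ?thesis .
 qed
 show ?thesis
 proof (rule lborel_pair.Fubini_integrable[OF meas])
 show "integrable lborel (%s. LINT x|lborel. norm (case (s, x) of (s, x) => ind {0..1::real} s *\<^sub>R (g (x+s *\<^sub>R w) * ka s x)))"
 proof (rule Bochner_Integration.integrable_bound)
 show "integrable lborel (%s. ind {0..1::real} s * (B * (LINT x|lborel. cmod (g x))))"
 by (intro integrable_mult_left) simp
 show "(%s. LINT x|lborel. norm (case (s, x) of (s, x) => ind {0..1::real} s *\<^sub>R (g (x+s *\<^sub>R w) * ka s x))) : bm lborel"
 using meas by measurable
 show "AE s in lborel. norm (LINT x|lborel. norm (case (s, x) of (s, x) => ind {0..1::real} s *\<^sub>R (g (x+s *\<^sub>R w) * ka s x))) <=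
 norm (ind {0..1::real} s * (B * (LINT x|lborel. cmod (g x))))"
 proof (rule AE_I2)
 fix s :: real
 have "0 <= (LINT x|lborel. norm (ind {0..1::real} s *\<^sub>R (g (x+s *\<^sub>R w) * ka s x)))" by simp
 thus "norm (LINT x|lborel. norm (case (s, x) of (s, x) => ind {0..1::real} s *\<^sub>R (g (x+s *\<^sub>R w) * ka s x))) <=
 norm (ind {0..1::real} s * (B * (LINT x|lborel. cmod (g x))))"
 using le[of s] by simp
 qed
 qed
 show "AE s in lborel. integrable lborel (%x. case (s, x) of (s, x) => ind {0..1::real} s *\<^sub>R (g (x+s *\<^sub>R w) * ka s x))"
 using int by simp
 qed
qed

lemma lebesgue_on_integral_lborel:
 fixes f :: "'a::euclidean_space => 'b::euclidean_space"
 assumes "Q : sets lebesgue" "f : bm borel" "!!x. x ~: Q ==> f x=0"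
 shows "(LINT x|lon Q. f x)=(LINT x|lborel. f x)"
proof -
 have "(LINT x|lon Q. f x)=(LINT x|lebesgue. (if x : Q then f x else 0))"
 by (rule Lebesgue_Measure.integral_restrict_UNIV[OF assms(1), symmetric])
 also have "(%x. if x : Q then f x else 0)=f" using assms(3) by auto
 also have "(LINT x|lebesgue. f x)=(LINT x|lborel. f x)" using assms(2) by (intro integral_completion) simp
 finally show ?thesis .
qed

lemma translate_difference:
 fixes f g :: "'a::euclidean_space => complex" and v :: 'a
 assumes Q: "open Q" "convex Q" and wd: "hwd Q f v g"
 and f: "integrable lborel f" and g: "integrable lborel g"
 and f0: "!!x. x ~: Q ==> f x=0" and g0: "!!x. x ~: Q ==> g x=0"
 shows "AE x in lborel. x : Q & x+v : Q -->
 f (x+v)-f x=(LINT s|lborel. ind {0..1::real} s *\<^sub>R g (x+s *\<^sub>R v))"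
proof -
 define Q' where "Q'={x : Q. x+v : Q}"
 have "open ((%x. x+v) -` Q)" using Q(1) by (intro open_vimage) (auto intro!: continuous_intros)
 moreover have "Q'=Q \<inter> (%x. x+v) -` Q" by (auto simp: Q'_def)
 ultimately have Q'o: "open Q'" using Q(1) by auto
 have Qm: "Q : sets lebesgue" and Q'm: "Q' : sets lebesgue" using Q(1) Q'o by auto
 have [measurable]: "f : bm borel" "g : bm borel"
 using f g by (auto dest: borel_measurable_integrable)
 define G1 where "G1 x=(LINT s|lborel. ind {0..1::real} s *\<^sub>R g (x+s *\<^sub>R v))" for x
 have int1: "integrable (lborel \<Otimes>\<^sub>M lborel) (%(s, x). ind {0..1::real} s *\<^sub>R (g (x+s *\<^sub>R v)*1))"
 by (rule integrable_segment_product[OF g, where B=1]) auto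
 have G1i: "integrable lborel G1"
 using lborel_pair.integrable_snd[OF int1[unfolded mult_1_right]] by (simp add: G1_def[abs_def])
 have G1m [measurable]: "G1 : bm borel" using G1i by (auto dest: borel_measurable_integrable)
 define \<Delta> where "\<Delta> x=f (x+v)-f x-G1 x" for x
 have \<Delta>i: "integrable lborel \<Delta>"
 unfolding \<Delta>_def[abs_def] by (intro Bochner_Integration.integrable_diff lborel_integrable_translate f G1i)
 have [measurable]: "\<Delta> : bm borel" using \<Delta>i by (auto dest: borel_measurable_integrable)
 have "AE x in lon Q'. \<Delta> x=0"
 proof (rule fundamental_lemma[OF Q'o])
 show "lint Q' \<Delta>"
 unfolding locally_integrable_def
 proof (intro allI impI)
 fix K assume "compact K & K <= Q'"
 hence "K : sets lebesgue" by (simp add: lmeasurable_compact fmeasurableD)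
 moreover have "integrable (lon UNIV) \<Delta>" using \<Delta>i by (simp add: lebesgue_on_UNIV_eq integrable_completion)
 ultimately show "integrable (lon K) \<Delta>" by (intro integrable_lebesgue_on_subset[of UNIV \<Delta> K]) auto
 qed
 fix ph assume ph: "ph : test_functions Q'"
 have ph': "ph : test_functions {x : Q. x+v : Q}" using ph by (simp add: Q'_def)
 define ps where "ps x=integral {0..1} (%s. ph (x-s *\<^sub>R v))" for x
 have ps: "ps : test_functions Q" and Dps: "!!x. fd ps (at x) v=ph x-ph (x-v)"
 using averaged_test_function[OF Q(2) ph'] by (simp_all add: ps_def[abs_def])
 have phc: "continuous_on UNIV ph" by (rule test_function_continuous[OF ph])
 have [measurable]: "ph : bm borel" using phc by (rule borel_measurable_continuous_onI)
 have [measurable]: "ps : bm borel"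
 using test_function_continuous[OF ps] by (rule borel_measurable_continuous_onI)
 obtain K where K: "compact K" "K <= Q'" "!!x. x ~: K ==> ph x=0" using test_functionD[OF ph] by metis
 obtain B where B: "B > 0" "!!x. \<bar>ph x\<bar> <= B"
 by (rule compactly_supported_bounded[OF phc K(1)]) (blast intro: K(3) that)+
 have prodi: "integrable lborel (%x. k x * cr (ph (x+w)))" if k: "integrable lborel k" for k w
 proof (rule Bochner_Integration.integrable_bound)
 show "integrable lborel (%x. cr B * k x)" using k by simp
 have [measurable]: "k : bm borel" using k by (auto dest: borel_measurable_integrable)
 show "(%x. k x * cr (ph (x+w))) : bm lborel" by measurable
 show "AE x in lborel. norm (k x * cr (ph (x+w))) <= norm (cr B * k x)"
 proof (rule AE_I2)
 fix x
 show "norm (k x * cr (ph (x+w))) <= norm (cr B * k x)"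
 using mult_left_mono[OF B(2) norm_ge_zero, of "k x" "x+w"] B(1) by (simp add: norm_mult mult.commute)
 qed
 qed
 have "(LINT x|lborel. f x * cr (fd ps (at x) v)) =
 -(LINT x|lborel. g x * cr (ps x))"
 proof -
 have "(LINT x|lon Q. f x * cr (fd ps (at x) v)) =
 -(LINT x|lon Q. g x * cr (ps x))"
 using wd ps by (simp add: has_weak_derivative_def)
 moreover have "(LINT x|lon Q. f x * cr (fd ps (at x) v)) =
 (LINT x|lborel. f x * cr (fd ps (at x) v))"
 unfolding Dps using f0 by (intro lebesgue_on_integral_lborel[OF Qm]) auto
 moreover have "(LINT x|lon Q. g x * cr (ps x))=(LINT x|lborel. g x * cr (ps x))"
 using g0 by (intro lebesgue_on_integral_lborel[OF Qm]) auto
 ultimately show ?thesis by simp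
 qed
 moreover have "(LINT x|lborel. f x * cr (fd ps (at x) v)) =
 -(LINT x|lborel. (f (x+v)-f x) * cr (ph x))"
 proof -
 have "(LINT x|lborel. f x * cr (fd ps (at x) v)) =
 (LINT x|lborel. f x * cr (ph x)-f x * cr (ph (x-v)))"
 unfolding Dps by (simp add: algebra_simps)
 also have "\<dots>=(LINT x|lborel. f x * cr (ph x))-(LINT x|lborel. f x * cr (ph (x-v)))"
 using prodi[OF f, of 0] prodi[OF f, of "- v"] by (intro Bochner_Integration.integral_diff) auto
 also have "(LINT x|lborel. f x * cr (ph (x-v)))=(LINT x|lborel. f (x+v) * cr (ph x))"
 using lborel_integral_translate[of "%x. f x * cr (ph (x-v))" v] by simp
 also have "(LINT x|lborel. f x * cr (ph x))-(LINT x|lborel. f (x+v) * cr (ph x)) =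
 -(LINT x|lborel. f (x+v) * cr (ph x)-f x * cr (ph x))"
 using prodi[OF f, of 0] prodi[OF lborel_integrable_translate[OF f], of v 0]
 by (subst Bochner_Integration.integral_diff) auto
 finally show ?thesis by (simp add: algebra_simps)
 qed
 moreover have "(LINT x|lborel. g x * cr (ps x))=(LINT x|lborel. G1 x * cr (ph x))"
 proof -
 have ps_int: "cr (ps x)=(LINT s|lborel. ind {0..1::real} s *\<^sub>R cr (ph (x-s *\<^sub>R v)))" for x
 proof -
 have "continuous_on {0..1} (%s. ph (x-s *\<^sub>R v))"
 by (intro continuous_on_compose2[OF phc]) (auto intro!: continuous_intros)
 hence "set_integrable lborel {0..1} (%s. ph (x-s *\<^sub>R v))"
 unfolding set_integrable_def by (intro borel_integrable_compact) auto
 hence "ps x=(LINT s|lborel. ind {0..1::real} s *\<^sub>R ph (x-s *\<^sub>R v))"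
 using set_borel_integral_eq_integral(2) unfolding ps_def set_lebesgue_integral_def by metis
 thus ?thesis
 by (simp add: integral_complex_of_real[symmetric] scaleR_conv_of_real del: integral_complex_of_real)
 qed
 have meas1: "(%(s, x). cr (ph (x-s *\<^sub>R v))) : bm (lborel \<Otimes>\<^sub>M lborel)"
 unfolding case_prod_beta by measurable
 have meas2: "(%(s :: real, x). cr (ph x)) : bm (lborel \<Otimes>\<^sub>M lborel)"
 unfolding case_prod_beta by measurable
 have i1: "integrable (lborel \<Otimes>\<^sub>M lborel)
 (%(s, x). ind {0..1::real} s *\<^sub>R (g (x+s *\<^sub>R 0) * cr (ph (x-s *\<^sub>R v))))"
 by (rule integrable_segment_product[OF g meas1]) (use B in simp)
 have i2: "integrable (lborel \<Otimes>\<^sub>M lborel)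
 (%(s, x). ind {0..1::real} s *\<^sub>R (g (x+s *\<^sub>R v) * cr (ph x)))"
 by (rule integrable_segment_product[OF g meas2]) (use B in simp)
 have "(LINT x|lborel. g x * cr (ps x)) =
 (LINT x|lborel. LINT s|lborel. ind {0..1::real} s *\<^sub>R (g (x+s *\<^sub>R 0) * cr (ph (x-s *\<^sub>R v))))"
 unfolding ps_int by (simp add: integral_mult_right_zero[symmetric] del: integral_mult_right_zero)
 also have "\<dots>=(LINT s|lborel. LINT x|lborel. ind {0..1::real} s *\<^sub>R (g (x+s *\<^sub>R 0) * cr (ph (x-s *\<^sub>R v))))"
 by (rule lborel_pair.Fubini_integral[OF i1])
 also have "\<dots>=(LINT s|lborel. LINT x|lborel. ind {0..1::real} s *\<^sub>R (g (x+s *\<^sub>R v) * cr (ph x)))"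
 proof (rule BI_cong[OF refl])
 fix s :: real
 show "(LINT x|lborel. ind {0..1::real} s *\<^sub>R (g (x+s *\<^sub>R 0) * cr (ph (x-s *\<^sub>R v)))) =
 (LINT x|lborel. ind {0..1::real} s *\<^sub>R (g (x+s *\<^sub>R v) * cr (ph x)))"
 using lborel_integral_translate[of "%x. g x * cr (ph (x-s *\<^sub>R v))" "s *\<^sub>R v"] by simp
 qed
 also have "\<dots>=(LINT x|lborel. LINT s|lborel. ind {0..1::real} s *\<^sub>R (g (x+s *\<^sub>R v) * cr (ph x)))"
 by (rule lborel_pair.Fubini_integral[OF i2, symmetric])
 also have "\<dots>=(LINT x|lborel. G1 x * cr (ph x))"
 unfolding G1_def by (simp add: integral_mult_left_zero[symmetric] del: integral_mult_left_zero)
 finally show ?thesis .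
 qed
 ultimately have key: "(LINT x|lborel. (f (x+v)-f x) * cr (ph x))=(LINT x|lborel. G1 x * cr (ph x))"
 by simp
 have "(LINT x|lon Q'. \<Delta> x * cr (ph x))=(LINT x|lborel. \<Delta> x * cr (ph x))"
 using K by (intro lebesgue_on_integral_lborel[OF Q'm]) auto
 also have "\<dots>=(LINT x|lborel. (f (x+v)-f x) * cr (ph x)-G1 x * cr (ph x))"
 by (simp add: \<Delta>_def algebra_simps)
 also have "\<dots>=(LINT x|lborel. (f (x+v)-f x) * cr (ph x))-(LINT x|lborel. G1 x * cr (ph x))"
 using prodi[of "%x. f (x+v)-f x" 0] prodi[OF G1i, of 0] f lborel_integrable_translate[OF f]
 by (intro Bochner_Integration.integral_diff) auto
 finally show "(LINT x|lon Q'. \<Delta> x * cr (ph x))=0" using key by simp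
 qed
 hence "AE x in lebesgue. x : Q' --> \<Delta> x=0" using Q'm by (simp add: AE_restrict_space_iff)
 hence "AE x in lborel. x : Q' --> \<Delta> x=0" by (simp add: AE_completion_iff)
 thus ?thesis by eventually_elim (simp add: Q'_def \<Delta>_def G1_def)
qed

lemma lborel_nn_integral_translate:
 fixes c :: "'a::euclidean_space"
 assumes "f : bm borel"
 shows "(\<integral>\<^sup>+x. f (x+c) \<partial>lborel)=(\<integral>\<^sup>+x. f x \<partial>lborel)"
proof -
 have "(\<integral>\<^sup>+x. f x \<partial>lborel)=(\<integral>\<^sup>+x. f x \<partial>distr lborel borel ((+) c))" by (simp add: lborel_distr_plus)
 also have "\<dots>=(\<integral>\<^sup>+x. f (c+x) \<partial>lborel)" using assms by (intro nn_integral_distr) auto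
 finally show ?thesis by (simp add: add.commute)
qed

text \<open>The increment of \<open>u\<close> along a vector is an average of directional derivatives over the segment; Cauchy-Schwarz in the parameter gives the estimate.\<close>

lemma translate_estimate:
 fixes f g :: "'a::euclidean_space => complex" and v :: 'a
 assumes Q: "open Q" "convex Q" and wd: "hwd Q f v g"
 and f: "integrable lborel f" and g: "integrable lborel g"
 and f0: "!!x. x ~: Q ==> f x=0" and g0: "!!x. x ~: Q ==> g x=0"
 shows "(\<integral>\<^sup>+x. ind {x : Q. x+v : Q} x * ennreal ((cmod (f (x+v)-f x))^2) \<partial>lborel) <=
 (\<integral>\<^sup>+x. ennreal ((cmod (g x))^2) \<partial>lborel)"
proof -
 have [measurable]: "g : bm borel" using g by (auto dest: borel_measurable_integrable)
 have pointwise: "ennreal ((cmod (LINT s|lborel. ind {0..1::real} s *\<^sub>R g (x+s *\<^sub>R v)))^2) <=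
 (\<integral>\<^sup>+s. ind {0..1::real} s * ennreal ((cmod (g (x+s *\<^sub>R v)))^2) \<partial>lborel)" for x
 proof -
 define I where "I=(LINT s|lborel. ind {0..1::real} s *\<^sub>R g (x+s *\<^sub>R v))"
 have "ennreal (cmod I) <= (\<integral>\<^sup>+s. ennreal (norm (ind {0..1::real} s *\<^sub>R g (x+s *\<^sub>R v))) \<partial>lborel)"
 proof (cases "integrable lborel (%s. ind {0..1::real} s *\<^sub>R g (x+s *\<^sub>R v))")
 case True
 thus ?thesis unfolding I_def by (rule integral_norm_bound_ennreal)
 next
 case False
 thus ?thesis unfolding I_def by (simp add: not_integrable_integral_eq)
 qed
 also have "\<dots>=(\<integral>\<^sup>+s. ind {0..1::real} s * (ind {0..1::real} s * ennreal (cmod (g (x+s *\<^sub>R v)))) \<partial>lborel)"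
 by (intro nn_integral_cong) (auto simp: indicator_def)
 finally have "(ennreal (cmod I))^2 <=
 (\<integral>\<^sup>+s. ind {0..1::real} s * (ind {0..1::real} s * ennreal (cmod (g (x+s *\<^sub>R v)))) \<partial>lborel)^2"
 by (rule power_mono) simp
 also have "\<dots> <= (\<integral>\<^sup>+s. (ind {0..1::real} s)^2 \<partial>lborel) *
 (\<integral>\<^sup>+s. (ind {0..1::real} s * ennreal (cmod (g (x+s *\<^sub>R v))))^2 \<partial>lborel)"
 by (rule Cauchy_Schwarz_nn_integral) measurable
 also have "(\<integral>\<^sup>+s. (ind {0..1::real} s)^2 \<partial>lborel)=(\<integral>\<^sup>+s. ind {0..1::real} s \<partial>lborel)"
 by (intro nn_integral_cong) (auto simp: indicator_def)
 also have "\<dots>=1" by simp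
 also have "(\<integral>\<^sup>+s. (ind {0..1::real} s * ennreal (cmod (g (x+s *\<^sub>R v))))^2 \<partial>lborel) =
 (\<integral>\<^sup>+s. ind {0..1::real} s * ennreal ((cmod (g (x+s *\<^sub>R v)))^2) \<partial>lborel)"
 by (intro nn_integral_cong) (auto simp: indicator_def ennreal_power)
 finally show ?thesis by (simp add: I_def ennreal_power)
 qed
 have "(\<integral>\<^sup>+x. ind {x : Q. x+v : Q} x * ennreal ((cmod (f (x+v)-f x))^2) \<partial>lborel) <=
 (\<integral>\<^sup>+x. \<integral>\<^sup>+s. ind {0..1::real} s * ennreal ((cmod (g (x+s *\<^sub>R v)))^2) \<partial>lborel \<partial>lborel)"
 proof (rule nn_integral_mono_AE)
 show "AE x in lborel. ind {x : Q. x+v : Q} x * ennreal ((cmod (f (x+v)-f x))^2) <=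
 (\<integral>\<^sup>+s. ind {0..1::real} s * ennreal ((cmod (g (x+s *\<^sub>R v)))^2) \<partial>lborel)"
 using translate_difference[of Q f v g, OF Q wd f g f0 g0, simplified]
 proof eventually_elim
 case (elim x)
 thus ?case using pointwise[of x] by (auto simp: indicator_def)
 qed
 qed
 also have "\<dots>=(\<integral>\<^sup>+s. \<integral>\<^sup>+x. ind {0..1::real} s * ennreal ((cmod (g (x+s *\<^sub>R v)))^2) \<partial>lborel \<partial>lborel)"
 by (rule lborel_pair.Fubini') measurable
 also have "\<dots>=(\<integral>\<^sup>+s. ind {0..1::real} s * (\<integral>\<^sup>+x. ennreal ((cmod (g x))^2) \<partial>lborel) \<partial>lborel)"
 proof (rule nn_integral_cong)
 fix s :: real
 have "(\<integral>\<^sup>+x. ind {0..1::real} s * ennreal ((cmod (g (x+s *\<^sub>R v)))^2) \<partial>lborel) =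
 ind {0..1::real} s * (\<integral>\<^sup>+x. ennreal ((cmod (g (x+s *\<^sub>R v)))^2) \<partial>lborel)"
 by (rule nn_integral_cmult) measurable
 also have "(\<integral>\<^sup>+x. ennreal ((cmod (g (x+s *\<^sub>R v)))^2) \<partial>lborel)=(\<integral>\<^sup>+x. ennreal ((cmod (g x))^2) \<partial>lborel)"
 by (rule lborel_nn_integral_translate) measurable
 finally show "(\<integral>\<^sup>+x. ind {0..1::real} s * ennreal ((cmod (g (x+s *\<^sub>R v)))^2) \<partial>lborel) =
 ind {0..1::real} s * (\<integral>\<^sup>+x. ennreal ((cmod (g x))^2) \<partial>lborel)" .
 qed
 also have "\<dots>=(\<integral>\<^sup>+x. ennreal ((cmod (g x))^2) \<partial>lborel)"
 by (subst nn_integral_multc) auto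
 finally show ?thesis .
qed

lemma borel_representative:
 fixes u :: "'a::euclidean_space => complex"
 assumes Q: "open Q" and u: "u : bm (lon Q)"
 obtains u0 where "u0 : bm borel" "!!x. x ~: Q ==> u0 x=0" "AE x in lon Q. u x=u0 x"
proof -
 have Qm: "Q : sets lebesgue" using Q by simp
 define U where "U x=(if x : Q then u x else 0)" for x
 have U: "U : bm (completion lborel)" unfolding U_def[abs_def] by (rule borel_measurable_if_I[OF u Qm])
 obtain r where r: "r : bm lborel" "AE x in lborel. Re (U x)=r x"
 using completion_ex_borel_measurable_real[OF measurable_compose[OF U borel_measurable_Re]] by blast
 obtain i where i: "i : bm lborel" "AE x in lborel. Im (U x)=i x"
 using completion_ex_borel_measurable_real[OF measurable_compose[OF U borel_measurable_Im]] by blast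
 define u0 where "u0 x=(if x : Q then Complex (r x) (i x) else 0)" for x
 have [measurable]: "r : bm borel" "i : bm borel" "Q : sets borel"
 using r i Q by auto
 have "(%x. cr (r x)+\<i> * cr (i x)) : bm borel" by measurable
 hence [measurable]: "(%x. Complex (r x) (i x)) : bm borel" by (simp add: Complex_eq)
 have "u0 : bm borel" unfolding u0_def[abs_def] by measurable
 moreover have "AE x in lon Q. u x=u0 x"
 proof -
 have "AE x in lborel. x : Q --> u x=u0 x"
 using r(2) i(2) by eventually_elim (auto simp: U_def u0_def complex_eq_iff)
 hence "AE x in lebesgue. x : Q --> u x=u0 x" by (rule AE_completion)
 thus ?thesis using Qm by (simp add: AE_restrict_space_iff)
 qed
 ultimately show ?thesis using that[of u0] by (simp add: u0_def)
qed

lemma has_weak_derivative_cong_AE: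
 assumes G: "G : sets lebesgue" and wd: "hwd G f v g"
 and f': "lint G f'" "AE x in lon G. f x=f' x"
 and g': "lint G g'" "AE x in lon G. g x=g' x"
 shows "hwd G f' v g'"
 unfolding has_weak_derivative_def
proof (intro conjI ballI f'(1) g'(1))
 fix ph assume ph: "ph : test_functions G"
 have li: "lint G f" "lint G g" using wd by (auto simp: has_weak_derivative_def)
 have "(LINT x|lon G. f x * cr (fd ph (at x) v)) =
 (LINT x|lon G. f' x * cr (fd ph (at x) v))"
 using test_integrable(2)[OF G li(1) ph, of v] test_integrable(2)[OF G f'(1) ph, of v] f'(2)
 by (intro integral_cong_AE) (auto elim: eventually_mono)
 moreover have "(LINT x|lon G. g x * cr (ph x))=(LINT x|lon G. g' x * cr (ph x))"
 using test_integrable(1)[OF G li(2) ph] test_integrable(1)[OF G g'(1) ph] g'(2)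
 by (intro integral_cong_AE) (auto elim: eventually_mono)
 ultimately show "(LINT x|lon G. f' x * cr (fd ph (at x) v)) =
 -(LINT x|lon G. g' x * cr (ph x))"
 using wd ph by (simp add: has_weak_derivative_def)
qed

lemma L2_borel_representative:
 fixes u :: "'a::euclidean_space => complex"
 assumes Q: "open Q" "emeasure lborel Q<\<infinity>" and u: "u : carr (L2 Q)"
 obtains u0 where "u0 : bm borel" "!!x. x ~: Q ==> u0 x=0" "AE x in lon Q. u x=u0 x"
 "integrable lborel u0" "integrable lborel (%x. (cmod (u0 x))^2)"
 "(LINT x|lon Q. (cmod (u x))^2)=(LINT x|lborel. (cmod (u0 x))^2)"
 "(LINT x|lon Q. u x)=(LINT x|lborel. u0 x)"
 "lint Q u0"
proof -
 have Qm: "Q : sets lebesgue" using Q by simp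
 have [measurable]: "Q : sets borel" using Q by simp
 have um: "u : bm (lon Q)" using u by (simp add: L2_mem)
 obtain u0 where u0 [measurable]: "u0 : bm borel" and z: "!!x. x ~: Q ==> u0 x=0"
 and AE: "AE x in lon Q. u x=u0 x" by (rule borel_representative[OF Q(1) um]) (rule that)
 have u0L: "u0 : carr (L2 Q)" by (rule L2_mem_AE[OF u Qm AE])
 have "integrable lebesgue (%x. ind Q x *\<^sub>R (cmod (u0 x))^2)"
 using u0L Qm by (simp add: L2_mem integrable_restrict_space)
 also have "(%x. ind Q x *\<^sub>R (cmod (u0 x))^2)=(%x. (cmod (u0 x))^2)"
 using z by (auto simp: fun_eq_iff indicator_def)
 finally have i2: "integrable lborel (%x. (cmod (u0 x))^2)" by (subst (asm) integrable_completion) auto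
 have i1: "integrable lborel u0"
 proof (rule Bochner_Integration.integrable_bound)
 have "integrable lborel (ind Q :: 'a => real)" using Q by (intro integrable_real_indicator) auto
 thus "integrable lborel (%x. ind Q x+(cmod (u0 x))^2)" using i2 by (rule Bochner_Integration.integrable_add)
 show "AE x in lborel. norm (u0 x) <= norm (ind Q x+(cmod (u0 x))^2)"
 proof (rule AE_I2)
 fix x
 have "0 <= (cmod (u0 x)-1)^2" by simp
 hence "2 * cmod (u0 x) <= (cmod (u0 x))^2+1" by (simp add: power2_diff)
 hence "cmod (u0 x) <= 1+(cmod (u0 x))^2" using norm_ge_zero[of "u0 x"] by linarith
 thus "norm (u0 x) <= norm (ind Q x+(cmod (u0 x))^2)" using z[of x] by (auto simp: indicator_def)
 qed
 qed simp
 have e2: "(LINT x|lon Q. (cmod (u x))^2)=(LINT x|lborel. (cmod (u0 x))^2)"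
 proof -
 have "(LINT x|lon Q. (cmod (u x))^2)=(LINT x|lon Q. (cmod (u0 x))^2)"
 using um u0L AE by (intro integral_cong_AE) (auto simp: L2_mem elim: eventually_mono)
 also have "\<dots>=(LINT x|lborel. (cmod (u0 x))^2)" using z by (intro lebesgue_on_integral_lborel[OF Qm]) auto
 finally show ?thesis .
 qed
 have e1: "(LINT x|lon Q. u x)=(LINT x|lborel. u0 x)"
 proof -
 have "(LINT x|lon Q. u x)=(LINT x|lon Q. u0 x)"
 using um u0L AE by (intro integral_cong_AE) (auto simp: L2_mem elim: eventually_mono)
 also have "\<dots>=(LINT x|lborel. u0 x)" using z by (intro lebesgue_on_integral_lborel[OF Qm]) auto
 finally show ?thesis .
 qed
 show ?thesis using that[OF u0 z AE i1 i2 e2 e1 L2_locally_integrable[OF u0L Qm]] .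
qed

lemma L2_subset:
 assumes "u : carr (L2 G)" "G : sets lebesgue" "Q : sets lebesgue" "Q <= G"
 shows "u : carr (L2 Q)"
 using assms integrable_lebesgue_on_subset[of G "%x. (cmod (u x))^2" Q] measurable_lebesgue_on_subset[of u G Q]
 unfolding L2_mem by blast

text \<open>The left side without the mean term is half the double integral of \<open>(u(x) - u(y))^2\<close>. With \<open>w = y - x\<close> the translation estimate applies for every \<open>w\<close>, and these \<open>w\<close> fill a box whose volume is \<open>2^n\<close> times that of the given one.\<close>

theorem poincare_box:
 fixes p q :: "'a::euclidean_space"
 assumes G: "almost_open G" and QG: "box p q <= G" and pq: "!!b. b : Basis ==> p \<bullet> b <= q \<bullet> b"
 and u: "u : carr (H1 G)"
 shows "measure lborel (box p q)*(LINT x|lon (box p q). (cmod (u x))^2) <=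
 (cmod (LINT x|lon (box p q). u x))^2+2 ^ DIM('a) * measure lborel (box p q)*(norm (q-p))^2 *
 (\<Sum>b\<in>Basis. LINT x|lon (box p q). (cmod (wkd G u b x))^2)"
proof -
 define Q where "Q=box p q"
 have Qo: "open Q" "convex Q" by (simp_all add: Q_def open_box)
 have Qs: "Q : sets lebesgue" and [measurable]: "Q : sets borel" using Qo by auto
 note Gs=almost_open_sets[OF G]
 have Qf: "emeasure lborel Q<\<infinity>" by (simp add: Q_def emeasure_lborel_box_eq)
 have uQ: "u : carr (L2 Q)" using L2_subset[OF H1_sub_L2[OF u] Gs Qs] QG by (simp add: Q_def)
 obtain f where f [measurable]: "f : bm borel" and f0: "!!x. x ~: Q ==> f x=0"
 and fAE: "AE x in lon Q. u x=f x" and fi: "integrable lborel f"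
 and fi2: "integrable lborel (%x. (cmod (f x))^2)"
 and fe2: "(LINT x|lon Q. (cmod (u x))^2)=(LINT x|lborel. (cmod (f x))^2)"
 and fe1: "(LINT x|lon Q. u x)=(LINT x|lborel. f x)" and fl: "lint Q f"
 by (rule L2_borel_representative[OF Qo(1) Qf uQ]) (rule that)
 define R where "R b g \<longleftrightarrow> g : bm borel & (ALL x. x ~: Q --> g x=0) &
 (AE x in lon Q. wkd G u b x=g x) & integrable lborel g &
 integrable lborel (%x. (cmod (g x))^2) &
 (LINT x|lon Q. (cmod (wkd G u b x))^2)=(LINT x|lborel. (cmod (g x))^2) &
 lint Q g" for b and g :: "'a => complex"
 have R: "EX g. R b g" if b: "b : Basis" for b
 proof -
 have wL: "wkd G u b : carr (L2 Q)"
 using L2_subset[OF H1_weak_derivative_L2[OF G u b] Gs Qs] QG by (simp add: Q_def)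
 show ?thesis
 by (rule L2_borel_representative[OF Qo(1) Qf wL], rule exI, unfold R_def, intro conjI allI impI)
 qed
 define g where "g b=(SOME g. R b g)" for b
 have "R b (g b)" if "b : Basis" for b
 unfolding g_def by (rule someI_ex[OF R[OF that]])
 hence g: "!!b. b : Basis ==> g b : bm borel"
 and g0: "!!b x. b : Basis ==> x ~: Q ==> g b x=0"
 and gAE: "!!b. b : Basis ==> AE x in lon Q. wkd G u b x=g b x"
 and gi: "!!b. b : Basis ==> integrable lborel (g b)"
 and gi2: "!!b. b : Basis ==> integrable lborel (%x. (cmod (g b x))^2)"
 and ge2: "!!b. b : Basis ==> (LINT x|lon Q. (cmod (wkd G u b x))^2)=(LINT x|lborel. (cmod (g b x))^2)"
 and gl: "!!b. b : Basis ==> lint Q (g b)"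
 unfolding R_def by simp_all
 have wdb: "hwd Q f b (g b)" if b: "b : Basis" for b
 proof (rule has_weak_derivative_cong_AE[OF Qs _ fl fAE gl[OF b] gAE[OF b]])
 show "hwd Q u b (wkd G u b)"
 by (rule has_weak_derivative_subset[OF H1_has_weak_derivative[OF u b] Gs Qs]) (use QG in \<open>simp add: Q_def\<close>)
 qed
 define gv where "gv v x=(\<Sum>b\<in>Basis. cr (v \<bullet> b) * g b x)" for v x
 have wd: "hwd Q f v (gv v)" for v
 unfolding gv_def by (rule has_weak_derivative_direction[OF Qs wdb])
 have gvi: "integrable lborel (gv v)" for v unfolding gv_def[abs_def] using gi by simp
 have gv0: "gv v x=0" if "x ~: Q" for v x unfolding gv_def using g0 that by simp
 define N where "N=(\<Sum>b\<in>Basis. LINT x|lborel. (cmod (g b x))^2)"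
 have N0: "0 <= N" unfolding N_def by (intro sum_nonneg) simp
 define T where "T=box (p-q) (q-p)"
 have [measurable]: "T : sets borel" by (simp add: T_def)
 define d where "d=norm (q-p)"
 have gvN: "(\<integral>\<^sup>+x. ennreal ((cmod (gv v x))^2) \<partial>lborel) <= ennreal (d^2 * N)" if v: "v : T" for v
 proof -
 have vd: "norm v <= d"
 unfolding d_def
 proof (rule norm_le_componentwise)
 fix b :: 'a assume b: "b : Basis"
 have "(p-q) \<bullet> b < v \<bullet> b" "v \<bullet> b<(q-p) \<bullet> b" using v b by (auto simp: T_def mem_box)
 thus "\<bar>v \<bullet> b\<bar> <= \<bar>(q-p) \<bullet> b\<bar>" by (simp add: inner_diff_left)
 qed
 have le: "(cmod (gv v x))^2 <= d^2*(\<Sum>b\<in>Basis. (cmod (g b x))^2)" for x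
 proof -
 have "cmod (gv v x) <= (\<Sum>b\<in>Basis. \<bar>v \<bullet> b\<bar> * cmod (g b x))"
 unfolding gv_def by (rule order_trans[OF norm_sum]) (simp add: norm_mult)
 also have "\<dots> <= sqrt (\<Sum>b\<in>Basis. \<bar>v \<bullet> b\<bar>^2) * sqrt (\<Sum>b\<in>Basis. (cmod (g b x))^2)"
 using L2_set_mult_ineq[of "%b. \<bar>v \<bullet> b\<bar>" "%b. cmod (g b x)" Basis] by (simp add: L2_set_def)
 also have "sqrt (\<Sum>b\<in>Basis. \<bar>v \<bullet> b\<bar>^2)=norm v"
 by (simp add: norm_eq_sqrt_inner euclidean_inner[of v v] power2_eq_square)
 finally have "cmod (gv v x) <= norm v * sqrt (\<Sum>b\<in>Basis. (cmod (g b x))^2)" .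
 also have "\<dots> <= d * sqrt (\<Sum>b\<in>Basis. (cmod (g b x))^2)"
 using vd by (intro mult_right_mono) (auto intro: sum_nonneg)
 finally have "(cmod (gv v x))^2 <= (d * sqrt (\<Sum>b\<in>Basis. (cmod (g b x))^2))^2" by (rule power_mono) simp
 thus ?thesis by (simp add: power_mult_distrib sum_nonneg)
 qed
 have "(\<integral>\<^sup>+x. ennreal ((cmod (gv v x))^2) \<partial>lborel) <= (\<integral>\<^sup>+x. ennreal (d^2*(\<Sum>b\<in>Basis. (cmod (g b x))^2)) \<partial>lborel)"
 using le by (intro nn_integral_mono ennreal_leI)
 also have "\<dots>=ennreal (LINT x|lborel. d^2*(\<Sum>b\<in>Basis. (cmod (g b x))^2))"
 using gi2 by (intro nn_integral_eq_integral) (auto intro!: sum_nonneg mult_nonneg_nonneg)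
 also have "(LINT x|lborel. d^2*(\<Sum>b\<in>Basis. (cmod (g b x))^2))=d^2 * N"
 using gi2 by (simp add: N_def)
 finally show ?thesis .
 qed
 define S where "S=(\<integral>\<^sup>+x. \<integral>\<^sup>+y. ind Q x * (ind Q y * ennreal ((cmod (f y-f x))^2)) \<partial>lborel \<partial>lborel)"
 define A where "A=(LINT x|lborel. (cmod (f x))^2)"
 define F where "F=(LINT x|lborel. f x)"
 define m where "m=measure lborel Q"
 have indi: "integrable lborel (ind Q :: 'a => real)" using Qf by (intro integrable_real_indicator) auto
 have indI: "(LINT x|lborel. ind Q x :: real)=m" by (simp add: m_def)
 have upper: "S <= ennreal (2 ^ DIM('a) * m * (d^2 * N))"
 proof -
 have "S=(\<integral>\<^sup>+x. \<integral>\<^sup>+t. ind Q x * (ind Q (t+x) * ennreal ((cmod (f (t+x)-f x))^2)) \<partial>lborel \<partial>lborel)"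
 unfolding S_def by (intro nn_integral_cong lborel_nn_integral_translate[symmetric]) measurable
 also have "\<dots>=(\<integral>\<^sup>+t. \<integral>\<^sup>+x. ind Q x * (ind Q (t+x) * ennreal ((cmod (f (t+x)-f x))^2)) \<partial>lborel \<partial>lborel)"
 by (rule lborel_pair.Fubini') measurable
 also have "\<dots> <= (\<integral>\<^sup>+t. ind T t * ennreal (d^2 * N) \<partial>lborel)"
 proof (rule nn_integral_mono)
 fix t :: 'a
 have eq: "(\<integral>\<^sup>+x. ind Q x * (ind Q (t+x) * ennreal ((cmod (f (t+x)-f x))^2)) \<partial>lborel) =
 (\<integral>\<^sup>+x. ind {x : Q. x+t : Q} x * ennreal ((cmod (f (x+t)-f x))^2) \<partial>lborel)"
 by (intro nn_integral_cong) (auto simp: indicator_def add.commute)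
 show "(\<integral>\<^sup>+x. ind Q x * (ind Q (t+x) * ennreal ((cmod (f (t+x)-f x))^2)) \<partial>lborel) <=
 ind T t * ennreal (d^2 * N)"
 proof (cases "t : T")
 case True
 have "(\<integral>\<^sup>+x. ind {x : Q. x+t : Q} x * ennreal ((cmod (f (x+t)-f x))^2) \<partial>lborel) <=
 (\<integral>\<^sup>+x. ennreal ((cmod (gv t x))^2) \<partial>lborel)"
 by (rule translate_estimate[OF Qo wd fi gvi f0 gv0])
 thus ?thesis using gvN[OF True] True unfolding eq by (simp add: order_trans)
 next
 case False
 have "{x : Q. x+t : Q}={}"
 proof (rule ccontr)
 assume "{x : Q. x+t : Q} ~= {}"
 then obtain x where x: "x : Q" "x+t : Q" by blast
 have "t : T" unfolding T_def mem_box
 proof (intro ballI)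
 fix b :: 'a assume b: "b : Basis"
 have "p \<bullet> b<x \<bullet> b" "x \<bullet> b<q \<bullet> b" "p \<bullet> b<(x+t) \<bullet> b" "(x+t) \<bullet> b<q \<bullet> b"
 using x b by (auto simp: Q_def mem_box)
 thus "(p-q) \<bullet> b<t \<bullet> b & t \<bullet> b<(q-p) \<bullet> b" by (simp add: inner_diff_left inner_add_left)
 qed
 thus False using False by simp
 qed
 thus ?thesis unfolding eq by simp
 qed
 qed
 also have "\<dots>=emeasure lborel T * ennreal (d^2 * N)" by (subst nn_integral_multc) auto
 also have "emeasure lborel T=ennreal (2 ^ DIM('a) * m)"
 proof -
 have "emeasure lborel T=ennreal (\<Prod>b\<in>Basis. ((q-p)-(p-q)) \<bullet> b)"
 unfolding T_def by (rule emeasure_lborel_box) (use pq in \<open>simp add: inner_diff_left\<close>)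
 also have "(\<Prod>b\<in>Basis. ((q-p)-(p-q)) \<bullet> b)=(\<Prod>b\<in>(Basis :: 'a set). 2*((q-p) \<bullet> b))"
 by (intro prod.cong) (auto simp: inner_diff_left)
 also have "\<dots>=2 ^ DIM('a)*(\<Prod>b\<in>Basis. (q-p) \<bullet> b)" by (simp add: prod.distrib)
 also have "(\<Prod>b\<in>Basis. (q-p) \<bullet> b)=m"
 using pq by (simp add: m_def Q_def measure_lborel_box_eq)
 finally show ?thesis .
 qed
 also have "ennreal (2 ^ DIM('a) * m) * ennreal (d^2 * N)=ennreal (2 ^ DIM('a) * m * (d^2 * N))"
 using N0 by (intro ennreal_mult[symmetric]) (auto simp: m_def)
 finally show ?thesis .
 qed
 have expand: "(cmod (f y-f x))^2=(cmod (f y))^2-2 * Re (f y * cnj (f x))+(cmod (f x))^2" for x y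
 unfolding cmod_power2 by (simp add: power2_eq_square algebra_simps)
 have "S=ennreal (2 * m * A-2*(cmod F)^2)"
 proof -
 define J where "J x=A-2 * Re (F * cnj (f x))+m * (cmod (f x))^2" for x
 have inner: "(\<integral>\<^sup>+y. ind Q y * ennreal ((cmod (f y-f x))^2) \<partial>lborel)=ennreal (J x) & 0 <= J x" for x
 proof -
 have eq: "ind Q y * (cmod (f y-f x))^2 =
 (cmod (f y))^2-2 * Re (f y * cnj (f x))+ind Q y * (cmod (f x))^2" for y
 using f0[of y] by (auto simp: indicator_def expand)
 have int: "integrable lborel (%y. ind Q y * (cmod (f y-f x))^2)"
 unfolding eq
 by (intro Bochner_Integration.integrable_add Bochner_Integration.integrable_diff integrable_mult_right
 integrable_Re integrable_mult_left fi fi2 indi)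
 have "(LINT y|lborel. ind Q y * (cmod (f y-f x))^2) =
 (LINT y|lborel. (cmod (f y))^2-2 * Re (f y * cnj (f x)))+(LINT y|lborel. ind Q y * (cmod (f x))^2)"
 unfolding eq
 by (intro BI_add Bochner_Integration.integrable_diff integrable_mult_right
 integrable_Re integrable_mult_left fi fi2 indi)
 also have "(LINT y|lborel. (cmod (f y))^2-2 * Re (f y * cnj (f x)))=A-(LINT y|lborel. 2 * Re (f y * cnj (f x)))"
 unfolding A_def
 by (intro Bochner_Integration.integral_diff integrable_mult_right integrable_Re integrable_mult_left fi fi2)
 also have "(LINT y|lborel. 2 * Re (f y * cnj (f x)))=2*(LINT y|lborel. Re (f y * cnj (f x)))"
 by (rule integral_mult_right_zero)
 also have "(LINT y|lborel. Re (f y * cnj (f x)))=Re (LINT y|lborel. f y * cnj (f x))"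
 by (rule integral_Re) (intro integrable_mult_left fi)
 also have "(LINT y|lborel. f y * cnj (f x))=F * cnj (f x)" by (simp add: F_def)
 also have "(LINT y|lborel. ind Q y * (cmod (f x))^2)=m * (cmod (f x))^2" using indI by simp
 finally have LJ: "(LINT y|lborel. ind Q y * (cmod (f y-f x))^2)=J x" by (simp add: J_def)
 have "(\<integral>\<^sup>+y. ind Q y * ennreal ((cmod (f y-f x))^2) \<partial>lborel) =
 (\<integral>\<^sup>+y. ennreal (ind Q y * (cmod (f y-f x))^2) \<partial>lborel)"
 by (intro nn_integral_cong) (auto simp: indicator_def)
 also have "\<dots>=ennreal (J x)" unfolding LJ[symmetric] by (rule nn_integral_eq_integral[OF int]) simp
 finally show ?thesis using LJ by (metis (no_types, lifting) integral_nonneg_AE AE_I2 indicator_pos_le mult_nonneg_nonneg zero_le_power2)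
 qed
 have "S=(\<integral>\<^sup>+x. ind Q x * (\<integral>\<^sup>+y. ind Q y * ennreal ((cmod (f y-f x))^2) \<partial>lborel) \<partial>lborel)"
 unfolding S_def by (intro nn_integral_cong nn_integral_cmult) measurable
 also have "\<dots>=(\<integral>\<^sup>+x. ennreal (ind Q x * J x) \<partial>lborel)"
 using inner by (intro nn_integral_cong) (auto simp: indicator_def)
 also have "\<dots>=ennreal (LINT x|lborel. ind Q x * J x)"
 proof (rule nn_integral_eq_integral)
 have eq: "ind Q x * J x=ind Q x * A-2 * Re (F * cnj (f x))+m * (cmod (f x))^2" for x
 using f0[of x] by (auto simp: indicator_def J_def)
 show "integrable lborel (%x. ind Q x * J x)"
 unfolding eq
 by (intro Bochner_Integration.integrable_add Bochner_Integration.integrable_diff integrable_mult_right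
 integrable_Re integrable_mult_left integrable_cnj fi fi2 indi)
 show "AE x in lborel. 0 <= ind Q x * J x" using inner by simp
 qed
 also have "(LINT x|lborel. ind Q x * J x)=2 * m * A-2*(cmod F)^2"
 proof -
 have eq: "ind Q x * J x=(ind Q x * A-2 * Re (F * cnj (f x)))+m * (cmod (f x))^2" for x
 using f0[of x] by (auto simp: indicator_def J_def)
 have "(LINT x|lborel. ind Q x * J x) =
 (LINT x|lborel. ind Q x * A-2 * Re (F * cnj (f x)))+(LINT x|lborel. m * (cmod (f x))^2)"
 unfolding eq
 by (intro BI_add Bochner_Integration.integrable_diff integrable_mult_right
 integrable_Re integrable_mult_left integrable_cnj fi fi2 indi)
 also have "(LINT x|lborel. ind Q x * A-2 * Re (F * cnj (f x))) =
 (LINT x|lborel. ind Q x * A)-(LINT x|lborel. 2 * Re (F * cnj (f x)))"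
 by (intro Bochner_Integration.integral_diff integrable_mult_right
 integrable_Re integrable_mult_left integrable_cnj fi fi2 indi)
 also have "(LINT x|lborel. ind Q x * A)=m * A" using indI by simp
 also have "(LINT x|lborel. 2 * Re (F * cnj (f x)))=2*(LINT x|lborel. Re (F * cnj (f x)))"
 by (rule integral_mult_right_zero)
 also have "(LINT x|lborel. Re (F * cnj (f x)))=Re (LINT x|lborel. F * cnj (f x))"
 by (rule integral_Re) (intro integrable_mult_right integrable_cnj fi)
 also have "(LINT x|lborel. F * cnj (f x))=cr ((cmod F)^2)"
 by (simp add: F_def complex_norm_square del: of_real_power)
 also have "(LINT x|lborel. m * (cmod (f x))^2)=m * A" by (simp add: A_def)
 finally show ?thesis by simp
 qed
 finally show ?thesis .
 qed
 hence "2 * m * A-2*(cmod F)^2 <= 2 ^ DIM('a) * m * (d^2 * N)"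
 proof -
 have "0 <= 2 ^ DIM('a) * m * (d^2 * N)" using N0 by (auto simp: m_def)
 thus ?thesis using upper unfolding \<open>S=ennreal (2 * m * A-2*(cmod F)^2)\<close> by (simp only: ennreal_le_iff)
 qed
 moreover have "0 <= 2 ^ DIM('a) * m * (d^2 * N)" using N0 by (auto simp: m_def)
 ultimately have "m * A <= (cmod F)^2+2 ^ DIM('a) * m * d^2 * N" by (simp add: algebra_simps)
 thus ?thesis
 unfolding N_def using ge2 by (simp add: A_def F_def m_def d_def Q_def[symmetric] fe1 fe2)
qed

section \<open>Hilbert space direct sums\<close>

lemma hsum_mem: "f : carr (hsum I X) \<longleftrightarrow> (ALL e:I. f : carr (X e)) & (%e. (nm (X e) f)^2) summable_on I"
 by (simp add: hsum_def)

lemma hsum_ip: "ip (hsum I X) f g=(\<Sum>\<^sub>\<infinity>e\<in>I. ip (X e) f g)"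
 by (simp add: hsum_def)

lemma hsum_ip_single:
 assumes "e : I" "!!e'. e' : I ==> e' ~= e ==> ip (X e') f g=0"
 shows "ip (hsum I X) f g=ip (X e) f g"
proof -
 have "(\<Sum>\<^sub>\<infinity>e\<in>I. ip (X e) f g)=(\<Sum>\<^sub>\<infinity>e\<in>{e}. ip (X e) f g)"
 using assms by (intro infsum_cong_neutral) auto
 thus ?thesis by (simp add: hsum_ip)
qed

locale hsum_spaces =
 fixes I :: "'i set" and X :: "'i => 'a hspace"
 assumes parts: "e : I ==> semi_ip (X e)"
begin

abbreviation H where "H \<equiv> hsum I X"

lemma ip_summable:
 assumes f: "f : carr H" and g: "g : carr H"
 shows "(%e. ip (X e) f g) summable_on I"
proof (rule abs_summable_summable)
 have "(%e. (nm (X e) f)^2+(nm (X e) g)^2) summable_on I"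
 using f g by (intro summable_on_add) (auto simp: hsum_mem)
 thus "(%e. norm (ip (X e) f g)) summable_on I"
 proof (rule Infinite_Sum.abs_summable_on_comparison_test')
 fix e assume e: "e : I"
 interpret semi_ip "X e" by (rule parts[OF e])
 have "cmod (ip (X e) f g) <= nm (X e) f * nm (X e) g"
 using f g e by (intro cauchy_schwarz) (auto simp: hsum_mem)
 moreover have "0 <= (nm (X e) f-nm (X e) g)^2" by simp
 hence "2*(nm (X e) f * nm (X e) g) <= (nm (X e) f)^2+(nm (X e) g)^2"
 by (simp add: power2_diff)
 ultimately show "norm (ip (X e) f g) <= (nm (X e) f)^2+(nm (X e) g)^2"
 using norm_ge_zero[of "ip (X e) f g"] by linarith
 qed
qed

lemma ip_self_eq: "f : carr H ==> ip H f f=cr (\<Sum>\<^sub>\<infinity>e\<in>I. (nm (X e) f)^2)"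
proof -
 assume f: "f : carr H"
 have "ip H f f=(\<Sum>\<^sub>\<infinity>e\<in>I. cr ((nm (X e) f)^2))"
 unfolding hsum_ip using f by (intro infsum_cong semi_ip.ip_self parts) (auto simp: hsum_mem)
 moreover have "((%e. cr ((nm (X e) f)^2)) has_sum cr (\<Sum>\<^sub>\<infinity>e\<in>I. (nm (X e) f)^2)) I"
 using f by (intro has_sum_of_real has_sum_infsum) (auto simp: hsum_mem)
 ultimately show ?thesis using infsumI by metis
qed

lemma semi_ip_hsum: "semi_ip H"
proof
 show "(%x. 0) : carr H"
 using parts by (auto simp: hsum_mem semi_ip.zero_mem semi_ip.hnorm_zero cong: summable_on_cong)
next
 fix f g assume f: "f : carr H" and g: "g : carr H"
 have fe: "f : carr (X e)" and ge: "g : carr (X e)" if "e : I" for e using f g that by (auto simp: hsum_mem)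
 have "(%e. (nm (X e) (%x. f x+g x))^2) summable_on I"
 proof (rule summable_on_comparison_test)
 show "(%e. 2*(nm (X e) f)^2+2*(nm (X e) g)^2) summable_on I"
 using f g by (intro summable_on_add summable_on_cmult_right) (auto simp: hsum_mem)
 fix e assume e: "e : I"
 interpret semi_ip "X e" by (rule parts[OF e])
 show "(nm (X e) (%x. f x+g x))^2 <= 2*(nm (X e) f)^2+2*(nm (X e) g)^2"
 using hnorm_sq_add_scale[OF fe[OF e] ge[OF e], of 1] hnorm_sq_diff_scale[OF fe[OF e] ge[OF e], of 1]
 zero_le_power2[of "nm (X e) (%x. f x-1 * g x)"] by simp
 qed simp
 thus "(%x. f x+g x) : carr H" using fe ge parts by (auto simp: hsum_mem semi_ip.add_mem)
next
 fix f c assume f: "f : carr H"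
 have fe: "f : carr (X e)" if "e : I" for e using f that by (auto simp: hsum_mem)
 have "(%e. (cmod c)^2*(nm (X e) f)^2) summable_on I"
 using f by (intro summable_on_cmult_right) (auto simp: hsum_mem)
 moreover have "(nm (X e) (%x. c * f x))^2=(cmod c)^2*(nm (X e) f)^2" if "e : I" for e
 using semi_ip.hnorm_scale[OF parts[OF that] fe[OF that]] by (simp add: power_mult_distrib)
 ultimately have "(%e. (nm (X e) (%x. c * f x))^2) summable_on I" by (simp cong: summable_on_cong)
 thus "(%x. c * f x) : carr H" using fe parts by (auto simp: hsum_mem semi_ip.scale_mem)
next
 fix f g k assume f: "f : carr H" and g: "g : carr H" and k: "k : carr H"
 have "ip H (%x. f x+g x) k=(\<Sum>\<^sub>\<infinity>e\<in>I. ip (X e) f k+ip (X e) g k)"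
 unfolding hsum_ip using f g k by (intro infsum_cong semi_ip.ip_add_left parts) (auto simp: hsum_mem)
 also have "\<dots>=ip H f k+ip H g k" unfolding hsum_ip by (intro infsum_add ip_summable f g k)
 finally show "ip H (%x. f x+g x) k=ip H f k+ip H g k" .
next
 fix f k c assume f: "f : carr H" and k: "k : carr H"
 have "ip H (%x. c * f x) k=(\<Sum>\<^sub>\<infinity>e\<in>I. c * ip (X e) f k)"
 unfolding hsum_ip using f k by (intro infsum_cong semi_ip.ip_scale_left parts) (auto simp: hsum_mem)
 also have "\<dots>=c * ip H f k" unfolding hsum_ip by (rule infsum_cmult_right')
 finally show "ip H (%x. c * f x) k=c * ip H f k" .
next
 fix f g assume f: "f : carr H" and g: "g : carr H"
 have "ip H g f=(\<Sum>\<^sub>\<infinity>e\<in>I. cnj (ip (X e) f g))"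
 unfolding hsum_ip using f g by (intro infsum_cong semi_ip.ip_commute parts) (auto simp: hsum_mem)
 thus "ip H g f=cnj (ip H f g)" by (simp add: hsum_ip)
next
 fix f assume f: "f : carr H"
 show "0 <= Re (ip H f f)" unfolding ip_self_eq[OF f] by (simp add: infsum_nonneg)
qed

sublocale semi_ip H by (rule semi_ip_hsum)

lemma hnorm_sq_eq: "f : carr H ==> (nm H f)^2=(\<Sum>\<^sub>\<infinity>e\<in>I. (nm (X e) f)^2)"
 by (simp add: hnorm_sq ip_self_eq)

lemma hnorm_part_le:
 assumes f: "f : carr H" and e: "e : I"
 shows "nm (X e) f <= nm H f"
proof (rule power2_le_imp_le)
 have "(\<Sum>e\<in>{e}. (nm (X e) f)^2) <= (\<Sum>\<^sub>\<infinity>e\<in>I. (nm (X e) f)^2)"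
 using f e by (intro finite_sum_le_infsum) (auto simp: hsum_mem)
 thus "(nm (X e) f)^2 <= (nm H f)^2" using hnorm_sq_eq[OF f] by simp
qed (use f in simp)

end

text \<open>A Cauchy sequence converges in each component; a common representative of the limits exists because the components live on disjoint pieces.\<close>

lemma hsum_complete:
 fixes I :: "'i set" and X :: "'i => 'a hspace"
 assumes hilb: "!!e. e : I ==> semi_hilbert (X e)"
 and glue: "!!g. (!!e. e : I ==> g e : carr (X e)) ==>
 EX f. ALL e:I. f : carr (X e) & nm (X e) (%x. f x-g e x)=0"
 shows "semi_hilbert (hsum I X)"
proof -
 interpret hsum_spaces I X by (rule hsum_spaces.intro) (rule semi_hilbert.axioms(1)[OF hilb])
 show ?thesis
 proof unfold_locales
 fix f assume f: "!!n. f n : carr H" and cau: "hcauchy H f"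
 have fe: "f n : carr (X e)" if "e : I" for n e using f that by (auto simp: hsum_mem)
 have ex: "EX g. g : carr (X e) & (%n. nm (X e) (%x. f n x-g x)) ~~> 0" if e: "e : I" for e
 proof -
 interpret E: semi_hilbert "X e" by (rule hilb[OF e])
 have "hcauchy (X e) f"
 unfolding hcauchy_def
 proof (intro allI impI)
 fix d :: real assume "0<d"
 then obtain N where N: "ALL m>=N. ALL n>=N. nm H (%x. f m x-f n x)<d"
 using cau unfolding hcauchy_def by blast
 show "EX N. ALL m>=N. ALL n>=N. nm (X e) (%x. f m x-f n x)<d"
 proof (intro exI[of _ N] allI impI)
 fix m n assume "N <= m" "N <= n"
 hence "nm H (%x. f m x-f n x)<d" using N by blast
 thus "nm (X e) (%x. f m x-f n x)<d"
 using hnorm_part_le[OF diff_mem[OF f f] e, of m n] by simp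
 qed
 qed
 from E.complete[of f, OF fe[OF e] this] show ?thesis by blast
 qed
 define g where "g e=(SOME g. g : carr (X e) & (%n. nm (X e) (%x. f n x-g x)) ~~> 0)" for e
 have g: "g e : carr (X e)" "(%n. nm (X e) (%x. f n x-g e x)) ~~> 0" if e: "e : I" for e
 using someI_ex[OF ex[OF e]] unfolding g_def by blast+
 obtain h where h: "!!e. e : I ==> h : carr (X e)"
 "!!e. e : I ==> nm (X e) (%x. h x-g e x)=0"
 using glue[of g] g(1) by blast
 have hlim: "(%n. nm (X e) (%x. f n x-h x)) ~~> 0" if e: "e : I" for e
 proof (rule Lim_null_comparison[OF _ g(2)[OF e]], intro always_eventually allI)
 fix n
 interpret E: semi_hilbert "X e" by (rule hilb[OF e])
 show "norm (nm (X e) (%x. f n x-h x)) <= nm (X e) (%x. f n x-g e x)"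
 using E.hnorm_triangle_diff[OF fe[OF e] g(1)[OF e] h(1)[OF e], of n]
 h(2)[OF e] E.hnorm_diff_commute[OF h(1)[OF e] g(1)[OF e]] fe[OF e] h(1)[OF e] by simp
 qed
 have tail: "(\<Sum>e\<in>J. (nm (X e) (%x. f n x-h x))^2) <= d^2"
 if J: "finite J" "J <= I" and n: "!!m. m >= n ==> nm H (%x. f n x-f m x) <= d" for J n d
 proof (rule LIMSEQ_le_const2)
 show "(%m. \<Sum>e\<in>J. (nm (X e) (%x. f n x-f m x))^2) ~~> (\<Sum>e\<in>J. (nm (X e) (%x. f n x-h x))^2)"
 proof (intro tendsto_sum tendsto_power)
 fix e assume "e : J"
 hence e: "e : I" using J by blast
 interpret E: semi_hilbert "X e" by (rule hilb[OF e])
 have eq: "nm (X e) (%x. (f n x-f m x)-(f n x-h x))=nm (X e) (%x. f m x-h x)" for m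
 using E.hnorm_diff_commute[OF h(1)[OF e] fe[OF e], of m] by simp
 show "(%m. nm (X e) (%x. f n x-f m x)) ~~> nm (X e) (%x. f n x-h x)"
 by (rule E.hnorm_tendsto, rule E.diff_mem[OF fe[OF e] fe[OF e]], rule E.diff_mem[OF fe[OF e] h(1)[OF e]],
 unfold eq, rule hlim[OF e])
 qed
 show "EX N. ALL m>=N. (\<Sum>e\<in>J. (nm (X e) (%x. f n x-f m x))^2) <= d^2"
 proof (intro exI[of _ n] allI impI)
 fix m assume m: "n <= m"
 have mem: "(%x. f n x-f m x) : carr H" by (rule diff_mem[OF f f])
 have "(\<Sum>e\<in>J. (nm (X e) (%x. f n x-f m x))^2) <= (\<Sum>\<^sub>\<infinity>e\<in>I. (nm (X e) (%x. f n x-f m x))^2)"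
 using mem J by (intro finite_sum_le_infsum) (auto simp: hsum_mem)
 also have "\<dots>=(nm H (%x. f n x-f m x))^2" using hnorm_sq_eq[OF mem] by simp
 also have "\<dots> <= d^2" using n[OF m] mem by (intro power_mono) auto
 finally show "(\<Sum>e\<in>J. (nm (X e) (%x. f n x-f m x))^2) <= d^2" .
 qed
 qed
 have close: "(%x. f n x-h x) : carr H & nm H (%x. f n x-h x) <= d"
 if n: "!!m. m >= n ==> nm H (%x. f n x-f m x) <= d" and d: "0 <= d" for n d
 proof -
 have sm: "(%e. (nm (X e) (%x. f n x-h x))^2) summable_on I"
 proof (rule nonneg_bdd_above_summable_on)
 show "bdd_above (sum (%e. (nm (X e) (%x. f n x-h x))^2) ` {F. F <= I & finite F})"
 using tail[OF _ _ n] by (intro bdd_aboveI2[where M="d^2"]) auto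
 qed simp
 have mem: "(%x. f n x-h x) : carr H"
 unfolding hsum_mem
 proof (intro conjI ballI sm)
 fix e assume e: "e : I"
 interpret E: semi_hilbert "X e" by (rule hilb[OF e])
 show "(%x. f n x-h x) : carr (X e)" by (rule E.diff_mem[OF fe[OF e] h(1)[OF e]])
 qed
 have "(\<Sum>\<^sub>\<infinity>e\<in>I. (nm (X e) (%x. f n x-h x))^2) <= d^2"
 by (rule infsum_le_finite_sums[OF sm]) (rule tail[OF _ _ n])
 hence "(nm H (%x. f n x-h x))^2 <= d^2" using hnorm_sq_eq[OF mem] by simp
 thus ?thesis using mem d by (auto intro: power2_le_imp_le)
 qed
 have ev: "EX N. ALL n>=N. ALL m>=n. nm H (%x. f n x-f m x) <= d" if "0<d" for d
 using cau that unfolding hcauchy_def by (meson le_trans less_imp_le)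
 obtain N1 where N1: "!!m. m >= N1 ==> nm H (%x. f N1 x-f m x) <= 1" using ev[of 1] by auto
 have N1': "(%x. f N1 x-h x) : carr H & nm H (%x. f N1 x-h x) <= 1" by (rule close[OF N1]) (assumption, rule zero_le_one)
 have "(%x. f N1 x-(f N1 x-h x)) : carr H" by (rule diff_mem[OF f conjunct1[OF N1']])
 hence hH: "h : carr H" by simp
 have "(%n. nm H (%x. f n x-h x)) ~~> 0"
 proof (rule LIMSEQ_I)
 fix r :: real assume r: "0<r"
 then obtain N where N: "!!n m. n >= N ==> m >= n ==> nm H (%x. f n x-f m x) <= r/2"
 using ev[of "r/2"] by auto
 show "EX no. ALL n>=no. norm (nm H (%x. f n x-h x)-0)<r"
 proof (intro exI[of _ N] allI impI)
 fix n assume "N <= n"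
 thus "norm (nm H (%x. f n x-h x)-0)<r"
 using close[OF N, of n] r f hH by auto
 qed
 qed
 thus "EX g:carr H. (%n. nm H (%x. f n x-g x)) ~~> 0" using hH by blast
 qed
qed

section \<open>Decomposition of square integrable functions\<close>

locale measurable_partition =
 fixes \<Omega> :: "'a::euclidean_space set" and I :: "'i set" and G :: "'i => 'a set"
 assumes I: "countable I" "infinite I" and \<Omega>s: "\<Omega> : sets lebesgue"
 and Gs: "e : I ==> G e : sets lebesgue" and G\<Omega>: "e : I ==> G e <= \<Omega>"
 and disj: "e : I ==> e' : I ==> e ~= e' ==> G e \<inter> G e'={}"
 and rest: "negligible (\<Omega>-(\<Union>e\<in>I. G e))"
begin

abbreviation a where "a \<equiv> from_nat_into I"

lemma a: "bij_betw a UNIV I" by (rule bij_betw_from_nat_into[OF I])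

lemma aI: "a i : I" using a by (auto simp: bij_betw_def)

lemma a_surj: "e : I ==> EX i. e=a i" using a by (auto simp: bij_betw_def)

lemma a_inj: "a i=a j ==> i=j" using a by (auto simp: bij_betw_def inj_on_def)

lemma AE_part: "AE x in lon \<Omega>. EX i. x : G (a i)"
proof -
 have "AE x in lebesgue. x ~: \<Omega>-(\<Union>e\<in>I. G e)"
 using rest by (intro AE_not_in) (simp add: negligible_iff_null_sets)
 hence "AE x in lebesgue. x : \<Omega> --> (EX i. x : G (a i))"
 by eventually_elim (use a_surj in blast)
 thus ?thesis using \<Omega>s by (simp add: AE_restrict_space_iff)
qed

lemma part_sums:
 fixes h :: "'a => 'b::{banach, second_countable_topology}"
 assumes "x : G (a j)"
 shows "(%i. ind (G (a i)) x *\<^sub>R h x) sums h x"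
proof -
 have "(%i. ind (G (a i)) x *\<^sub>R h x) sums (\<Sum>i\<in>{j}. ind (G (a i)) x *\<^sub>R h x)"
 proof (rule sums_finite)
 fix i assume "i ~: {j}"
 hence "x ~: G (a i)" using disj[OF aI aI, of i j] a_inj assms by blast
 thus "ind (G (a i)) x *\<^sub>R h x=0" by simp
 qed simp
 thus ?thesis using assms by simp
qed

lemma integral_part:
 fixes h :: "'a => 'b::{banach, second_countable_topology}"
 assumes "e : I"
 shows "(LINT x|lon \<Omega>. ind (G e) x *\<^sub>R h x)=(LINT x|lon (G e). h x)"
proof -
 have "(LINT x|lon \<Omega>. ind (G e) x *\<^sub>R h x)=(LINT x|lebesgue. ind \<Omega> x *\<^sub>R (ind (G e) x *\<^sub>R h x))"
 using \<Omega>s by (simp add: integral_restrict_space)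
 also have "\<dots>=(LINT x|lebesgue. ind (G e) x *\<^sub>R h x)"
 using G\<Omega>[OF assms] by (intro BI_cong) (auto simp: indicator_def)
 also have "\<dots>=(LINT x|lon (G e). h x)" using Gs[OF assms] by (simp add: integral_restrict_space)
 finally show ?thesis .
qed

lemma integral_has_sum:
 fixes h :: "'a => 'b::{banach, second_countable_topology}"
 assumes h: "integrable (lon \<Omega>) h"
 shows "((%e. LINT x|lon (G e). h x) has_sum (LINT x|lon \<Omega>. h x)) I"
proof -
 let ?M="lon \<Omega>"
 let ?f="%i x. ind (G (a i)) x *\<^sub>R h x"
 have GM: "G (a i) : sets ?M" for i
 using Gs[OF aI] G\<Omega>[OF aI] \<Omega>s by (simp add: sets_restrict_space_iff)
 have fi: "integrable ?M (?f i)" for i by (rule integrable_mult_indicator[OF GM h])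
 have nf: "norm (?f i x)=ind (G (a i)) x *\<^sub>R norm (h x)" for i x by simp
 have s1: "AE x in ?M. summable (%i. norm (?f i x))"
 using AE_part
 proof eventually_elim
 case (elim x)
 then obtain j where "x : G (a j)" by blast
 from part_sums[OF this, of "%x. norm (h x)"] show ?case unfolding nf by (rule sums_summable)
 qed
 have s2: "summable (%i. LINT x|?M. norm (?f i x))"
 proof (rule summableI_nonneg_bounded)
 show "0 <= (LINT x|?M. norm (?f i x))" for i by simp
 fix n
 have "(\<Sum>i<n. LINT x|?M. norm (?f i x))=(LINT x|?M. (\<Sum>i<n. norm (?f i x)))"
 using fi by (intro Bochner_Integration.integral_sum[symmetric] integrable_norm)
 also have "\<dots> <= (LINT x|?M. norm (h x))"
 proof (rule integral_mono_AE)
 show "integrable ?M (%x. \<Sum>i<n. norm (?f i x))"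
 using fi by (intro Bochner_Integration.integrable_sum integrable_norm)
 show "integrable ?M (%x. norm (h x))" using h by (rule integrable_norm)
 show "AE x in ?M. (\<Sum>i<n. norm (?f i x)) <= norm (h x)"
 using AE_part
 proof eventually_elim
 case (elim x)
 then obtain j where "x : G (a j)" by blast
 from part_sums[OF this, of "%x. norm (h x)"]
 show ?case unfolding nf by (metis (no_types, lifting) finite_lessThan nf norm_ge_zero sum_le_suminf sums_iff)
 qed
 qed
 finally show "(\<Sum>i<n. LINT x|?M. norm (?f i x)) <= (LINT x|?M. norm (h x))" .
 qed
 have "(%i. LINT x|?M. ?f i x) sums (LINT x|?M. (\<Sum>i. ?f i x))"
 by (rule sums_integral[OF fi s1 s2])
 also have "(LINT x|?M. (\<Sum>i. ?f i x))=(LINT x|?M. h x)"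
 proof (rule integral_cong_AE)
 show "(%x. \<Sum>i. ?f i x) : bm ?M"
 using fi by (intro borel_measurable_suminf) (auto dest: borel_measurable_integrable)
 show "h : bm ?M" using h by (rule borel_measurable_integrable)
 show "AE x in ?M. (\<Sum>i. ?f i x)=h x"
 using AE_part by eventually_elim (use part_sums[of _ _ h] in \<open>auto simp: sums_iff\<close>)
 qed
 finally have sums: "(%i. LINT x|?M. ?f i x) sums (LINT x|?M. h x)" .
 have "summable (%i. norm (LINT x|?M. ?f i x))"
 by (rule summable_comparison_test'[OF s2]) (simp only: real_norm_def abs_norm_cancel integral_norm_bound)
 hence "((%i. LINT x|?M. ?f i x) has_sum (LINT x|?M. h x)) UNIV"
 using sums by (rule norm_summable_imp_has_sum)
 hence "((%i. LINT x|lon (G (a i)). h x) has_sum (LINT x|?M. h x)) UNIV"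
 by (simp only: integral_part[OF aI])
 thus ?thesis using has_sum_reindex_bij_betw[OF a] by blast
qed

lemma measurable_of_parts:
 fixes u :: "'a => 'b::euclidean_space"
 assumes u: "!!e. e : I ==> u : bm (lon (G e))"
 shows "u : bm (lon \<Omega>)"
proof (rule borel_measurableI)
 fix S :: "'b set" assume S: "open S"
 define N where "N=\<Omega>-(\<Union>e\<in>I. G e)"
 have N: "u -` S \<inter> N : sets lebesgue"
 using rest by (intro negligible_sets) (auto simp: N_def intro: negligible_subset)
 have part: "u -` S \<inter> G e : sets lebesgue" if e: "e : I" for e
 proof -
 have "u -` S \<inter> space (lon (G e)) : sets (lon (G e))"
 using u[OF e] S by (intro measurable_sets) auto
 thus ?thesis using Gs[OF e] by (auto simp: sets_restrict_space_iff)
 qed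
 have "u -` S \<inter> \<Omega>=(\<Union>e\<in>I. u -` S \<inter> G e) \<union> (u -` S \<inter> N)"
 using G\<Omega> by (auto simp: N_def)
 moreover have "(\<Union>e\<in>I. u -` S \<inter> G e) \<union> (u -` S \<inter> N) : sets lebesgue"
 using part N I by (intro sets.Un sets.countable_UN') auto
 ultimately have "u -` S \<inter> \<Omega> : sets lebesgue" by simp
 thus "u -` S \<inter> space (lon \<Omega>) : sets (lon \<Omega>)"
 using \<Omega>s by (simp add: sets_restrict_space_iff)
qed

lemma L2_mem_parts: "u : carr (L2 \<Omega>) \<longleftrightarrow> u : carr (hsum I (%e. L2 (G e)))"
proof
 assume u: "u : carr (L2 \<Omega>)"
 have "((%e. LINT x|lon (G e). (cmod (u x))^2) has_sum (LINT x|lon \<Omega>. (cmod (u x))^2)) I"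
 using u by (intro integral_has_sum) (simp add: L2_mem)
 hence "(%e. (nm (L2 (G e)) u)^2) summable_on I"
 unfolding L2_hnorm_sq by (rule has_sum_imp_summable)
 thus "u : carr (hsum I (%e. L2 (G e)))"
 unfolding hsum_mem using L2_subset[OF u \<Omega>s Gs G\<Omega>] by blast
next
 assume u: "u : carr (hsum I (%e. L2 (G e)))"
 hence ue: "!!e. e : I ==> u : carr (L2 (G e))" and sm: "(%e. (nm (L2 (G e)) u)^2) summable_on I"
 by (auto simp: hsum_mem)
 let ?M="lon \<Omega>"
 have um [measurable]: "u : bm ?M" using ue by (intro measurable_of_parts) (simp add: L2_mem)
 have GM: "G (a i) : sets ?M" for i
 using Gs[OF aI] G\<Omega>[OF aI] \<Omega>s by (simp add: sets_restrict_space_iff)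
 let ?f="%i x. ind (G (a i)) x *\<^sub>R (cmod (u x))^2"
 have fi: "integrable ?M (?f i)" for i
 proof -
 have "integrable lebesgue (%x. ind (G (a i)) x *\<^sub>R (cmod (u x))^2)"
 using ue[OF aI] Gs[OF aI] by (simp add: L2_mem integrable_restrict_space)
 also have "(%x. ind (G (a i)) x *\<^sub>R (cmod (u x))^2)=(%x. ind \<Omega> x *\<^sub>R ?f i x)"
 using G\<Omega>[OF aI, of i] by (auto simp: fun_eq_iff indicator_def)
 finally show ?thesis using \<Omega>s by (simp add: integrable_restrict_space)
 qed
 have "(\<integral>\<^sup>+x. ennreal ((cmod (u x))^2) \<partial>?M)=(\<integral>\<^sup>+x. (\<Sum>i. ennreal (?f i x)) \<partial>?M)"
 proof (rule nn_integral_cong_AE)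
 show "AE x in ?M. ennreal ((cmod (u x))^2)=(\<Sum>i. ennreal (?f i x))"
 using AE_part
 proof eventually_elim
 case (elim x)
 then obtain j where "x : G (a j)" by blast
 have "(%i. ?f i x) sums (cmod (u x))^2" using part_sums[OF \<open>x : G (a j)\<close>, of "%x. (cmod (u x))^2"] .
 hence sm: "summable (%i. ?f i x)" and eq: "(\<Sum>i. ?f i x)=(cmod (u x))^2"
 unfolding sums_iff by blast+
 have "(\<Sum>i. ennreal (?f i x))=ennreal (\<Sum>i. ?f i x)" by (rule suminf_ennreal2[OF _ sm]) simp
 thus ?case unfolding eq by simp
 qed
 qed
 also have "\<dots>=(\<Sum>i. \<integral>\<^sup>+x. ennreal (?f i x) \<partial>?M)"
 using fi by (intro nn_integral_suminf) (auto dest: borel_measurable_integrable)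
 also have "\<dots>=(\<Sum>i. ennreal ((nm (L2 (G (a i))) u)^2))"
 proof (intro suminf_cong)
 fix i
 have "(\<integral>\<^sup>+x. ennreal (?f i x) \<partial>?M)=ennreal (LINT x|?M. ?f i x)"
 by (rule nn_integral_eq_integral[OF fi]) simp
 thus "(\<integral>\<^sup>+x. ennreal (?f i x) \<partial>?M)=ennreal ((nm (L2 (G (a i))) u)^2)"
 unfolding integral_part[OF aI] L2_hnorm_sq .
 qed
 also have "\<dots><\<infinity>"
 proof -
 have "(%i. (nm (L2 (G (a i))) u)^2) summable_on UNIV"
 using sm by (subst summable_on_reindex_bij_betw[OF a])
 hence "summable (%i. (nm (L2 (G (a i))) u)^2)" by (rule summable_on_imp_summable)
 hence "(\<Sum>i. ennreal ((nm (L2 (G (a i))) u)^2))=ennreal (\<Sum>i. (nm (L2 (G (a i))) u)^2)"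
 by (intro suminf_ennreal2) auto
 thus ?thesis by simp
 qed
 finally have "integrable ?M (%x. (cmod (u x))^2)" by (intro integrableI_bounded) auto
 thus "u : carr (L2 \<Omega>)" using um by (simp add: L2_mem)
qed

lemma L2_ip_parts:
 assumes "f : carr (L2 \<Omega>)" "g : carr (L2 \<Omega>)"
 shows "ip (L2 \<Omega>) f g=ip (hsum I (%e. L2 (G e))) f g"
proof -
 have "((%e. LINT x|lon (G e). f x * cnj (g x)) has_sum (LINT x|lon \<Omega>. f x * cnj (g x))) I"
 by (rule integral_has_sum[OF L2_integrable_product[OF assms]])
 thus ?thesis unfolding hsum_ip L2_ip by (simp add: infsumI)
qed

end

section \<open>Near points and the ridge map\<close>

text \<open>A second near point of an interior point of the segment would be too close to \<open>t\<close> unless the triangle inequality is an equality, which puts it on the same ray at the same distance.\<close>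

lemma near_points_on_segment:
 assumes y: "y : near_points G t" and x: "x : closed_segment t y"
 shows "y : near_points G x" and "x ~= t ==> z : near_points G x ==> z=y"
proof -
 obtain s where s: "0 <= s" "s <= 1" "x=(1-s) *\<^sub>R t+s *\<^sub>R y" using x by (auto simp: closed_segment_def)
 have yF: "y : frontier G" and yd: "dist t y=infdist t (frontier G)" using y by (auto simp: near_points_def)
 have F: "frontier G ~= {}" using yF by blast
 have xt: "x-t=s *\<^sub>R (y-t)" and xy: "y-x=(1-s) *\<^sub>R (y-t)" using s(3) by (simp_all add: algebra_simps)
 have split: "dist t x+dist x y=dist t y"
 proof -
 have "norm (x-t)=s * norm (y-t)" unfolding xt using s(1) by simp
 moreover have "norm (y-x)=(1-s) * norm (y-t)" unfolding xy using s(2) by simp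
 ultimately show ?thesis by (simp add: dist_norm norm_minus_commute left_diff_distrib)
 qed
 have "infdist t (frontier G) <= dist t x+infdist x (frontier G)" using infdist_triangle[of t "frontier G" x] by (simp add: add.commute)
 hence "dist x y <= infdist x (frontier G)" using split yd by simp
 moreover have "infdist x (frontier G) <= dist x y" by (rule infdist_le[OF yF])
 ultimately have xd: "dist x y=infdist x (frontier G)" by simp
 thus "y : near_points G x" using yF by (simp add: near_points_def)
 assume ne: "x ~= t" and z: "z : near_points G x"
 have zF: "z : frontier G" and zd: "dist x z=dist x y" using z xd by (auto simp: near_points_def)
 have "dist t y <= dist t z" using infdist_le[OF zF, of t] yd by simp
 hence "norm ((x-t)+(z-x))=norm (x-t)+norm (z-x)"
 using split zd dist_triangle[of t z x] norm_triangle_ineq[of "x-t" "z-x"]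
 by (simp add: dist_norm norm_minus_commute)
 hence "norm (x-t) *\<^sub>R (z-x)=norm (z-x) *\<^sub>R (x-t)" by (simp only: norm_triangle_eq)
 moreover have "norm (x-t) *\<^sub>R (y-x)=norm (y-x) *\<^sub>R (x-t)"
 using s unfolding xt xy by simp
 moreover have "norm (z-x)=norm (y-x)" using zd by (simp add: dist_norm norm_minus_commute)
 ultimately have "norm (x-t) *\<^sub>R (z-x)=norm (x-t) *\<^sub>R (y-x)" by simp
 thus "z=y" using ne by simp
qed

text \<open>Two ridge points serving \<open>x\<close> have the same near point, so one of them lies on the segment of the other and therefore has a single near point.\<close>

lemma ridge_point_unique:
 assumes G: "open G" and x: "x : G"
 and t: "t : skeleton G" "y : near_points G t" "x : closed_segment t y"
 and t': "t' : skeleton G" "y' : near_points G t'" "x : closed_segment t' y'"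
 shows "t=t'"
proof -
 have two: "EX p:near_points G s. p ~= q" if "s : skeleton G" for s q
 proof -
 obtain y z where "y : near_points G s" "z : near_points G s" "y ~= z" using \<open>s : skeleton G\<close> by (auto simp: skeleton_def)
 thus ?thesis by (cases "y=q") auto
 qed
 have notG: "p ~: G" if "p : near_points G s" for p s
 using that G by (auto simp: near_points_def frontier_def interior_open)
 show ?thesis
 proof (cases "x=t \<or> x=t'")
 case True
 thus ?thesis
 proof
 assume "x=t"
 show ?thesis
 proof (rule ccontr)
 assume "t ~= t'"
 hence "!!z. z : near_points G t ==> z=y'"
 using near_points_on_segment(2)[OF t'(2,3)] \<open>x=t\<close> by blast
 thus False using two[OF t(1), of y'] by blast
 qed
 next
 assume "x=t'"
 show ?thesis
 proof (rule ccontr)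
 assume "t ~= t'"
 hence "!!z. z : near_points G t' ==> z=y"
 using near_points_on_segment(2)[OF t(2,3)] \<open>x=t'\<close> by blast
 thus False using two[OF t'(1), of y] by blast
 qed
 qed
 next
 case False
 have yy: "y'=y"
 using near_points_on_segment(2)[OF t(2,3)] near_points_on_segment(1)[OF t'(2,3)] False by blast
 obtain s where s: "0 <= s" "s <= 1" "x=(1-s) *\<^sub>R t+s *\<^sub>R y" using t(3) by (auto simp: closed_segment_def)
 obtain s' where s': "0 <= s'" "s' <= 1" "x=(1-s') *\<^sub>R t'+s' *\<^sub>R y" using t'(3) by (auto simp: closed_segment_def yy)
 have "x ~= y" using notG[OF t(2)] x by blast
 hence s1: "s<1" and s1': "s'<1" using s s' by (auto simp: less_le)
 have e: "x-y=(1-s) *\<^sub>R (t-y)" and e': "x-y=(1-s') *\<^sub>R (t'-y)"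
 by (subst s(3), simp add: algebra_simps) (subst s'(3), simp add: algebra_simps)
 have on: "a : closed_segment b y" if "0<p" "p <= q" "p *\<^sub>R (b-y)=q *\<^sub>R (a-y)" for a b :: point and p q :: real
 proof -
 have "a-y=inverse q *\<^sub>R (q *\<^sub>R (a-y))" using that by simp
 also have "\<dots>=(p/q) *\<^sub>R (b-y)" unfolding that(3)[symmetric] by (simp add: divide_inverse_commute)
 finally have "a-y=(p/q) *\<^sub>R (b-y)" .
 hence "a=(1-(1-p/q)) *\<^sub>R b+(1-p/q) *\<^sub>R y" by (simp add: algebra_simps)
 moreover have "0 <= 1-p/q" "1-p/q <= 1" using that by auto
 ultimately show ?thesis unfolding closed_segment_def by blast
 qed
 show ?thesis
 proof (rule ccontr)
 assume ne: "t ~= t'"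
 show False
 proof (cases "s <= s'")
 case True
 have "t : closed_segment t' y"
 by (rule on[of "1-s'" "1-s"]) (use True s1' e e' in auto)
 hence "!!z. z : near_points G t ==> z=y"
 using near_points_on_segment(2)[OF t'(2)[unfolded yy]] ne by blast
 thus False using two[OF t(1), of y] by blast
 next
 case False
 have "t' : closed_segment t y"
 by (rule on[of "1-s" "1-s'"]) (use False s1 e e' in auto)
 hence "!!z. z : near_points G t' ==> z=y"
 using near_points_on_segment(2)[OF t(2)] ne by metis
 thus False using two[OF t'(1), of y] by blast
 qed
 qed
 qed
qed

lemma ridge_map_eq:
 assumes G: "open G" and x: "x : G"
 and t: "t : skeleton G" "y : near_points G t" "x : closed_segment t y"
 shows "ridge_map G x=t"
 unfolding ridge_map_def
proof (rule the_equality)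
 show "t : skeleton G & (EX y:near_points G t. x : closed_segment t y)" using t by blast
 fix t' assume "t' : skeleton G & (EX y:near_points G t'. x : closed_segment t' y)"
 thus "t'=t" using ridge_point_unique[OF G x _ _ _ t] by blast
qed

lemma near_pointI:
 assumes G: "open G" and sub: "ball t rh <= G" and rh: "0<rh" and y: "y ~: G" "dist t y=rh"
 shows "y : near_points G t" and "infdist t (frontier G)=rh"
proof -
 have "y : closure (ball t rh)" using y rh by simp
 hence "y : closure G" using closure_mono[OF sub] by blast
 hence yF: "y : frontier G" using y G by (simp add: frontier_def interior_open)
 have "rh <= dist t z" if "z : frontier G" for z
 proof (rule ccontr)
 assume "\<not> rh <= dist t z"
 hence "z : G" using sub by auto
 thus False using that G by (simp add: frontier_def interior_open)
 qed
 hence "rh <= infdist t (frontier G)" using yF by (auto simp: infdist_def intro!: cINF_greatest)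
 moreover have "infdist t (frontier G) <= rh" using infdist_le[OF yF, of t] y by simp
 ultimately show "infdist t (frontier G)=rh" by simp
 thus "y : near_points G t" using yF y by (simp add: near_points_def)
qed

section \<open>A room with its mouths in local coordinates\<close>

text \<open>A square of side \<open>h\<close> with mouths of widths \<open>w\<close> and \<open>w'\<close> in its two vertical sides.\<close>

definition mouthed_room :: "real => real => real => point set" where
 "mouthed_room h w w'={(xi, et). (0<xi & xi<h & \<bar>et\<bar><h/2) \<or> (- w<xi & xi <= 0 & \<bar>et\<bar><w/2) \<or>
 (h <= xi & xi<h+w' & \<bar>et\<bar><w'/2)}"

lemma abs_less_of_squares: "a^2<b^2 ==> 0 <= b ==> \<bar>a\<bar><(b :: real)"
 using abs_le_square_iff[of b a] by (simp add: not_le[symmetric])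

lemma ball_plane: "0 <= rh ==> (a, b) : ball (x, y) rh \<longleftrightarrow> (a-x)^2+(b-y)^2<(rh::real)^2" for a b x y :: real
proof -
 assume rh: "0 <= rh"
 have "(a, b) : ball (x, y) rh \<longleftrightarrow> sqrt ((a-x)^2+(b-y)^2)<rh"
 by (simp add: dist_prod_def dist_real_def power2_commute)
 also have "\<dots> \<longleftrightarrow> (a-x)^2+(b-y)^2<rh^2"
 using rh by (metis real_sqrt_less_iff real_sqrt_unique)
 finally show ?thesis .
qed

lemma ball_plane_bounds:
 assumes "(a-x)^2+(b-y)^2<rh^2" "0 <= rh"
 shows "\<bar>a-x\<bar><rh" "\<bar>b-y\<bar><(rh :: real)"
proof -
 have "(a-x)^2<rh^2" "(b-y)^2<rh^2" using assms(1) zero_le_power2[of "a-x"] zero_le_power2[of "b-y"] by linarith+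
 thus "\<bar>a-x\<bar><rh" "\<bar>b-y\<bar><rh" using abs_less_of_squares assms(2) by blast+
qed

definition room_reach :: "real => real => real" where
 "room_reach h w=sqrt (h^2-w^2)/2"

lemma reach_sq: "0 <= v ==> v<h ==> (room_reach h v)^2=(h^2-v^2)/4"
 using power_mono[of v h 2] by (simp add: room_reach_def power_divide)

lemma reach_bounds:
 fixes h v :: real
 assumes v: "0 <= v" "v<h"
 shows "0<room_reach h v" "room_reach h v <= h/2" "(h-v)/2 <= room_reach h v"
 "0 < v ==> room_reach h v<h/2" "0 < v ==> (h-v)/2<room_reach h v"
proof -
 have h_pos: "0<h" using v by linarith
 have lt: "v^2<h^2" using v by (simp add: power_strict_mono)
 thus p: "0<room_reach h v" by (simp add: room_reach_def)
 have "(room_reach h v)^2 <= (h/2)^2" by (simp add: reach_sq[OF v] power_divide)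
 thus "room_reach h v <= h/2" by (rule power2_le_imp_le) (use h_pos in simp)
 have a: "((h-v)/2)^2=(h^2-v^2)/4-v * (h-v)/2" by (simp add: power2_eq_square field_simps)
 have "((h-v)/2)^2 <= (room_reach h v)^2" unfolding a reach_sq[OF v] using mult_nonneg_nonneg[of v "h-v"] v by linarith
 thus "(h-v)/2 <= room_reach h v" by (rule power2_le_imp_le) (use p in simp)
 assume v0: "0 < v"
 have "(room_reach h v)^2<(h/2)^2" using v0 by (simp add: reach_sq[OF v] power_divide)
 thus "room_reach h v<h/2" by (rule power_less_imp_less_base) (use h_pos in simp)
 have "((h-v)/2)^2<(room_reach h v)^2" unfolding a reach_sq[OF v] using mult_pos_pos[of v "h-v"] v v0 by linarith
 thus "(h-v)/2<room_reach h v" by (rule power_less_imp_less_base) (use p in simp)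
qed

context
 fixes h w w' :: real
 assumes w: "0 <= w" "w<h" and w': "0 <= w'" "w'<h"
begin

lemma room_height_pos: "0<h" using w by linarith

lemma ball_diag:
 assumes ka: "0<ka" "ka<(h-w)/2"
 shows "ball (ka, h/2-ka) ka <= mouthed_room h w w'"
proof (clarify)
 fix a b :: real assume "(a, b) : ball (ka, h/2-ka) ka"
 hence "(a-ka)^2+(b-(h/2-ka))^2<ka^2" using ball_plane[of ka] ka by simp
 from ball_plane_bounds[OF this] have "\<bar>a-ka\<bar><ka" "\<bar>b-(h/2-ka)\<bar><ka" using ka by auto
 thus "(a, b) : mouthed_room h w w'" using ka w unfolding mouthed_room_def by auto
qed

text \<open>Points of the disc about \<open>(x, y)\<close> through the corner that lie behind the wall stay within the mouth.\<close>

lemma behind_wall: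
 assumes b: "(a-x)^2+(b-y)^2<x^2+d^2" and "0 <= x" "0 <= d" "a <= 0"
 shows "\<bar>b-y\<bar><d" "- d<(a::real)"
proof -
 have "x^2 <= (a-x)^2" using assms by (simp add: power2_commute[of a] power_mono)
 hence "(b-y)^2<d^2" using b by linarith
 thus bd: "\<bar>b-y\<bar><d" using abs_less_of_squares assms by blast
 have "(x-a)^2<x^2+d^2" using b zero_le_power2[of "b-y"] power2_commute[of a x] by linarith
 also have "\<dots> <= (x+d)^2" using mult_nonneg_nonneg[OF assms(2,3)] by (simp add: power2_sum mult.commute)
 finally have "(x-a)^2<(x+d)^2" .
 hence "x-a<x+d" using assms by (intro power_less_imp_less_base[of "x-a" 2 "x+d"]) auto
 thus "- d<a" by simp
qed

lemma arc_facts: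
 assumes w0: "0<w" and xi: "(h-w)/2<xi" "xi<room_reach h w" and et: "et=(h+w)/4-xi^2/(h-w)"
 shows "0<et" "et<w/2" "(h/2-et)^2=xi^2+(w/2-et)^2"
proof -
 have hw: "0<h-w" using w by simp
 have "xi^2<(room_reach h w)^2" using xi w hw by (intro power_strict_mono) auto
 hence "xi^2<(h-w)*((h+w)/4)" using reach_sq[OF w] by (simp add: power2_eq_square algebra_simps)
 hence "xi^2/(h-w)<(h+w)/4" using hw by (simp add: pos_divide_less_eq mult.commute)
 thus "0<et" using et by simp
 have "((h-w)/2)^2<xi^2" using xi hw by (intro power_strict_mono) auto
 hence "(h-w)*((h-w)/4)<xi^2" by (simp add: power2_eq_square)
 hence "(h-w)/4<xi^2/(h-w)" using hw by (simp add: pos_less_divide_eq mult.commute)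
 thus "et<w/2" using et by (simp add: field_simps)
 have "(h-w) * et=(h-w)*((h+w)/4)-xi^2" using hw by (simp add: et right_diff_distrib)
 thus "(h/2-et)^2=xi^2+(w/2-et)^2" by (simp add: power2_eq_square field_simps)
qed

lemma ball_arc:
 assumes w0: "0<w" and xi: "(h-w)/2<xi" "xi<room_reach h w" and et: "et=(h+w)/4-xi^2/(h-w)"
 shows "ball (xi, et) (h/2-et) <= mouthed_room h w w'"
proof (clarify)
 note f=arc_facts[OF assms]
 fix a b :: real assume ab: "(a, b) : ball (xi, et) (h/2-et)"
 have rh: "0 <= h/2-et" using f w by linarith
 have b: "(a-xi)^2+(b-et)^2<(h/2-et)^2" using ab ball_plane[OF rh] by simp
 from ball_plane_bounds[OF b rh] have bd: "\<bar>a-xi\<bar><h/2-et" "\<bar>b-et\<bar><h/2-et" .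
 have xih: "xi<h/2" using xi reach_bounds(2)[OF w] by linarith
 show "(a, b) : mouthed_room h w w'"
 proof (cases "0<a")
 case True
 thus ?thesis using bd xih f w unfolding mouthed_room_def by auto
 next
 case False
 have "0 <= xi" using xi w by simp
 from behind_wall[OF b[unfolded f(3)] this] False f(2)
 have "\<bar>b-et\<bar><w/2-et" "- (w/2-et)<a" by auto
 thus ?thesis using False f unfolding mouthed_room_def by auto
 qed
qed

lemma ball_join:
 assumes w0: "0<w" and xi: "0<xi" "xi<room_reach h w"
 shows "ball (xi, 0) (sqrt (xi^2+(w/2)^2)) <= mouthed_room h w w'" and "sqrt (xi^2+(w/2)^2)<h/2"
proof -
 let ?rh="sqrt (xi^2+(w/2)^2)"
 have rh: "0 <= ?rh" and rh2: "?rh^2=xi^2+(w/2)^2" by simp_all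
 have "xi^2<(room_reach h w)^2" using xi by (intro power_strict_mono) auto
 hence "?rh^2<(h/2)^2" unfolding rh2 reach_sq[OF w] by (simp add: power_divide)
 thus rhh: "?rh<h/2" by (rule power_less_imp_less_base) (use room_height_pos in simp)
 show "ball (xi, 0) ?rh <= mouthed_room h w w'"
 proof clarify
 fix a b :: real assume ab: "(a, b) : ball (xi, 0) ?rh"
 have b: "(a-xi)^2+(b-0)^2<?rh^2" using ab ball_plane[OF rh] by blast
 from ball_plane_bounds[OF b rh] have bd: "\<bar>a-xi\<bar><?rh" "\<bar>b\<bar><?rh" by auto
 have xih: "xi<h/2" using xi reach_bounds(2)[OF w] by linarith
 show "(a, b) : mouthed_room h w w'"
 proof (cases "0<a")
 case True
 thus ?thesis using bd xih rhh unfolding mouthed_room_def by auto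
 next
 case False
 from behind_wall[OF b[unfolded rh2]] False xi w0
 have "\<bar>b\<bar><w/2" "- (w/2)<a" by auto
 thus ?thesis using False w0 unfolding mouthed_room_def by auto
 qed
 qed
qed

lemma ball_centre:
 assumes xi: "room_reach h w <= xi" "xi <= h-room_reach h w'"
 shows "ball (xi, 0) (h/2) <= mouthed_room h w w'"
proof clarify
 fix a b :: real assume ab: "(a, b) : ball (xi, 0) (h/2)"
 have rh: "0 <= h/2" using room_height_pos by simp
 have b: "(a-xi)^2+(b-0)^2<(h/2)^2" using ab ball_plane[OF rh] by blast
 from ball_plane_bounds[OF b rh] have bd: "\<bar>a-xi\<bar><h/2" "\<bar>b\<bar><h/2" by auto
 have r: "(h/2)^2=(room_reach h v)^2+(v/2)^2" if "0 <= v" "v<h" for v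
 using reach_sq[OF that] by (simp add: power_divide field_simps)
 have edge: "\<bar>b\<bar> < v/2 &-(v/2)<c"
 if v: "0 <= v" "v<h" and x: "room_reach h v <= x" and c: "c <= 0" and s: "(c-x)^2+b^2<(h/2)^2" for v x c
 proof -
 have p: "0<room_reach h v" by (rule reach_bounds(1)[OF v])
 have "(room_reach h v)^2 <= x^2" using x p by (intro power_mono) auto
 hence "(c-x)^2+(b-0)^2<x^2+(v/2)^2" using s r[OF v] by simp
 from behind_wall[OF this] show ?thesis using x p v c by auto
 qed
 show "(a, b) : mouthed_room h w w'"
 proof (cases "a <= 0")
 case True
 from edge[OF w xi(1) True] b have "\<bar>b\<bar><w/2" "- (w/2)<a" by auto
 thus ?thesis using True w unfolding mouthed_room_def by auto
 next
 case False
 show ?thesis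
 proof (cases "h <= a")
 case True
 have "(h-a-(h-xi))^2+b^2<(h/2)^2" using b by (simp add: power2_commute)
 from edge[OF w' _ _ this] True xi(2) have "\<bar>b\<bar><w'/2" "- (w'/2)<h-a" by auto
 thus ?thesis using True w' unfolding mouthed_room_def by auto
 next
 case False
 thus ?thesis using \<open>\<not> a <= 0\<close> bd unfolding mouthed_room_def by auto
 qed
 qed
qed

end

lemma diag_ray:
 fixes h v xi et :: real
 assumes v: "0 <= v" and c: "0<xi" "xi<(h-v)/2" "v/2<et" "et<h/2"
 shows "EX ka>0. ka<(h-v)/2 &
 ((xi, et) : closed_segment (ka, h/2-ka) (ka, h/2) \<or> (xi, et) : closed_segment (ka, h/2-ka) (0, h/2-ka))"
proof (cases "xi <= h/2-et")
 case True
 define ka where "ka=h/2-et"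
 have k: "0<ka" "ka<(h-v)/2" "xi <= ka" using c True by (auto simp: ka_def field_simps)
 have z: "z=(1-u) * z+u * z" for u z :: real by (simp add: left_diff_distrib)
 have "xi=(1-(1-xi/ka)) * ka" using k by simp
 moreover have "et=h/2-ka" by (simp add: ka_def)
 ultimately have "(xi, et)=(1-(1-xi/ka)) *\<^sub>R (ka, h/2-ka)+(1-xi/ka) *\<^sub>R (0, h/2-ka)"
 using z[of "h/2-ka" "1-xi/ka"] by (simp only: scaleR_Pair add_Pair real_scaleR_def mult_zero_right add_0_right)
 moreover have "0 <= 1-xi/ka" "1-xi/ka <= 1" using k c by auto
 ultimately have "(xi, et) : closed_segment (ka, h/2-ka) (0, h/2-ka)" unfolding closed_segment_def by blast
 thus ?thesis using k by blast
next
 case False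
 define u where "u=(et-(h/2-xi))/xi"
 have u: "0 <= u" "u <= 1" "u * xi=et-(h/2-xi)" using False c by (auto simp: u_def field_simps)
 have "(1-u)*(H-xi)+u * H=H-xi+u * xi" for H by (simp add: algebra_simps)
 from this[of "h/2"] have "et=(1-u)*(h/2-xi)+u * (h/2)" using u(3) by linarith
 hence "(xi, et)=(1-u) *\<^sub>R (xi, h/2-xi)+u *\<^sub>R (xi, h/2)" by (simp add: algebra_simps)
 hence "(xi, et) : closed_segment (xi, h/2-xi) (xi, h/2)" using u unfolding closed_segment_def by blast
 thus ?thesis using c by blast
qed

lemma join_ray:
 fixes R v xi et :: real
 assumes v: "0 < v" "0<R" and c: "0<xi" "0 <= et" "et < v/2*(1-xi/R)"
 shows "EX ka>0. ka<R & (xi, et) : closed_segment (ka, 0) (0, v/2)"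
proof -
 define u where "u=et/(v/2)"
 have u: "0 <= u" "u<1-xi/R" "et=u * (v/2)" using c v by (auto simp: u_def field_simps)
 have u1: "u<1" using u(2) c v by (smt (verit) divide_pos_pos)
 define ka where "ka=xi/(1-u)"
 have k: "xi=(1-u) * ka" "0<ka" using u1 c by (auto simp: ka_def)
 have "xi/R<1-u" using u by simp
 hence "ka<R" using u1 v by (simp add: ka_def field_simps)
 moreover have "(xi, et)=(1-u) *\<^sub>R (ka, 0)+u *\<^sub>R (0, v/2)" using u(3) k(1) by simp
 hence "(xi, et) : closed_segment (ka, 0) (0, v/2)" using u(1) u1 unfolding closed_segment_def
 by (auto intro!: exI[of _ u])
 ultimately show ?thesis using k(2) by blast
qed

text \<open>
 The arc is a parabola with focus at the re-entrant corner and the horizontal wall as directrix.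
 A point that is closer to the corner than to the wall lies on the segment from the corner to the
 point of the parabola in its direction, the other points lie on vertical segments.
\<close>

lemma arc_height_iff:
 fixes h v xi et :: real
 assumes "v<h"
 shows "(h+v)/4-xi^2/(h-v) <= et \<longleftrightarrow> (h/2-et)^2 <= xi^2+(v/2-et)^2"
 and "(h/2-et)^2=xi^2+(v/2-et)^2 ==> et=(h+v)/4-xi^2/(h-v)"
proof -
 have d: "xi^2+(v/2-et)^2-(h/2-et)^2=(h-v)*(et-((h+v)/4-xi^2/(h-v)))"
 proof -
 define q where "q=xi^2/(h-v)"
 have q: "xi^2=(h-v) * q" using assms by (simp add: q_def)
 have "(h-v) * q+(v/2-et)^2-(h/2-et)^2=(h-v)*(et-((h+v)/4-q))"
 by (simp add: power2_eq_square field_simps)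
 thus ?thesis unfolding q_def[symmetric] q[symmetric] .
 qed
 have p: "0<h-v" using assms by simp
 have "(h/2-et)^2 <= xi^2+(v/2-et)^2 \<longleftrightarrow> 0 <= (h-v)*(et-((h+v)/4-xi^2/(h-v)))"
 unfolding d[symmetric] by simp
 also have "\<dots> \<longleftrightarrow> (h+v)/4-xi^2/(h-v) <= et" using p by (simp only: zero_le_mult_iff) auto
 finally show "(h+v)/4-xi^2/(h-v) <= et \<longleftrightarrow> (h/2-et)^2 <= xi^2+(v/2-et)^2" by simp
 assume "(h/2-et)^2=xi^2+(v/2-et)^2"
 hence "(h-v)*(et-((h+v)/4-xi^2/(h-v)))=0" unfolding d[symmetric] by simp
 thus "et=(h+v)/4-xi^2/(h-v)" using p by simp
qed

lemma arc_range:
 fixes h v xi et :: real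
 assumes v: "0 < v" "v<h" and xi: "0<xi" and et: "et=(h+v)/4-xi^2/(h-v)"
 shows "et < v/2 ==> (h-v)/2<xi" "0<et ==> xi<room_reach h v"
proof -
 have p: "0<h-v" using v by simp
 have m: "(h-v) * et=(h-v)*(h+v)/4-xi^2" using p by (simp add: et right_diff_distrib)
 show "(h-v)/2<xi" if "et < v/2"
 proof -
 have "(h-v) * et<(h-v)*(v/2)" using that p by simp
 hence "((h-v)/2)^2<xi^2" unfolding m by (simp add: power2_eq_square field_simps)
 thus ?thesis by (rule power_less_imp_less_base) (use xi in simp)
 qed
 show "xi<room_reach h v" if "0<et"
 proof -
 have "0<(h-v) * et" using that p by simp
 hence "xi^2<(room_reach h v)^2" unfolding m using v
 by (subst reach_sq[of v h]) (simp_all add: power2_eq_square field_simps)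
 thus ?thesis by (rule power_less_imp_less_base) (use reach_bounds(1)[of v h] v in simp)
 qed
qed

lemma arc_ray:
 fixes h v xi et :: real
 assumes v: "0 < v" "v<h"
 and c: "0<xi" "xi<room_reach h v" "v/2*(1-xi/room_reach h v)<et" "et<h/2" "(h-v)/2<xi \<or> et < v/2"
 shows "EX ka>(h-v)/2. ka<room_reach h v &
 ((xi, et) : closed_segment (ka, (h+v)/4-ka^2/(h-v)) (ka, h/2) \<or>
 (xi, et) : closed_segment (ka, (h+v)/4-ka^2/(h-v)) (0, v/2))"
proof -
 define D where "D=sqrt (xi^2+(v/2-et)^2)"
 have D2: "D^2=xi^2+(v/2-et)^2" and D0: "0 <= D" by (simp_all add: D_def)
 have R: "0<room_reach h v" using reach_bounds(1)[of v h] v by simp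
 show ?thesis
 proof (cases "D <= h/2-et")
 case True
 have Dxi: "xi <= D" by (rule power2_le_imp_le) (use D0 D2 in simp_all)
 have etv: "et < v/2"
 proof (rule ccontr)
 assume "\<not> et < v/2"
 thus False using c(5) Dxi True by (simp add: field_simps)
 qed
 have gap: "v/2-et<D" by (rule power_less_imp_less_base[of _ 2]) (use D0 D2 c in simp_all)
 define mu where "mu=((h-v)/2)/(D-(v/2-et))"
 have mu: "mu * (D-(v/2-et))=(h-v)/2"
 by (rule iffD1[OF nonzero_eq_divide_eq mu_def]) (use gap in simp)
 have mu1: "1 <= mu" using gap True by (simp add: mu_def field_simps)
 define ka where "ka=mu * xi"
 define ze where "ze=v/2-mu * (v/2-et)"
 have k0: "0<ka" using mu1 c by (simp add: ka_def)
 have z: "ze < v/2" using mu1 etv by (simp add: ze_def)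
 have "h/2-ze=mu * D" using mu by (simp add: ze_def field_simps)
 hence "(h/2-ze)^2=mu^2*(xi^2+(v/2-et)^2)" using D2 by (simp add: power_mult_distrib)
 hence par: "(h/2-ze)^2=ka^2+(v/2-ze)^2"
 by (simp add: ka_def ze_def power_mult_distrib distrib_left)
 have ze: "ze=(h+v)/4-ka^2/(h-v)" by (rule arc_height_iff(2)[OF v(2) par])
 have z0: "0<ze"
 proof (rule ccontr)
 assume "\<not> 0<ze"
 define m where "m=- ze"
 have m: "0 <= m" using \<open>\<not> 0<ze\<close> by (simp add: m_def)
 let ?R="room_reach h v"
 have k2: "ka^2 = ?R^2+m * (h-v)"
 using par v by (subst reach_sq[of v h]) (simp_all add: m_def power2_eq_square field_simps)
 have "v/2-et < v/2*(xi / ?R)" using c(3) by (simp add: algebra_simps)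
 hence "mu * (v/2-et)<mu * (v/2*(xi / ?R))" by (rule mult_strict_left_mono) (use mu1 in simp)
 also have "\<dots>=v/2*(ka / ?R)" by (simp add: ka_def)
 finally have "(v/2+m)*?R < v/2 * ka" using R by (simp add: ze_def m_def field_simps)
 hence "?R * (v/2+m)<ka * (v/2)" by (simp add: mult.commute)
 hence "(?R * (v/2+m))^2<(ka * (v/2))^2" using R m v by (intro power_strict_mono) auto
 hence "?R^2*(v/2+m)^2<(?R^2+m * (h-v))*(v/2)^2" unfolding k2[symmetric] by (simp only: power_mult_distrib)
 moreover have "(v/2+m)^2=v^2/4+(v * m+m^2)" "(v/2)^2=v^2/4" by (simp_all add: power2_eq_square field_simps)
 ultimately have "?R^2*(v * m+m^2)<m * (h-v)*(v^2/4)" by (simp only: distrib_left[of "?R^2"] distrib_right[of "?R^2"])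
 moreover have "?R^2*(v * m) <= ?R^2*(v * m+m^2)" by (intro mult_left_mono) auto
 ultimately have "?R^2*(v * m)<m * (h-v)*(v^2/4)" by linarith
 moreover have "?R^2*(v * m)=m * (h-v)*(v * (h+v)/4)"
 using v by (subst reach_sq[of v h]) (simp_all add: power2_eq_square field_simps)
 moreover have "m * (h-v)*(v^2/4) <= m * (h-v)*(v * (h+v)/4)"
 using m v by (intro mult_left_mono) (auto simp: power2_eq_square)
 ultimately show False by linarith
 qed
 have k: "(h-v)/2<ka" "ka<room_reach h v" using arc_range[OF v k0 ze] z z0 by blast+
 have l: "mu * (1/mu)=1" using mu1 by simp
 have "xi=(1-(1-1/mu)) * ka" using mu1 by (simp add: ka_def)
 moreover have "et=(1-(1-1/mu)) * ze+(1-1/mu)*(v/2)" using mu1 by (simp add: ze_def field_simps)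
 ultimately have "(xi, et)=(1-(1-1/mu)) *\<^sub>R (ka, ze)+(1-1/mu) *\<^sub>R (0, v/2)" by simp
 moreover have "0 <= 1-1/mu" "1-1/mu <= 1" using mu1 by auto
 ultimately have "(xi, et) : closed_segment (ka, ze) (0, v/2)" unfolding closed_segment_def by blast
 thus ?thesis using k unfolding ze by blast
 next
 case False
 define ze where "ze=(h+v)/4-xi^2/(h-v)"
 have "(h/2-et)^2 <= D^2" using False c(4) by (intro power_mono) auto
 hence le: "ze <= et" using arc_height_iff(1)[OF v(2)] by (simp add: ze_def D2)
 have xi: "(h-v)/2<xi"
 using c(5) arc_range(1)[OF v c(1) ze_def] le by auto
 define u where "u=(et-ze)/(h/2-ze)"
 have pos: "0<h/2-ze" using le c by simp
 have u: "0 <= u" "u <= 1" "u * (h/2-ze)=et-ze" using pos le c by (auto simp: u_def)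
 have "et=(1-u) * ze+u * (h/2)" using u(3) by (simp add: algebra_simps)
 hence "(xi, et)=(1-u) *\<^sub>R (xi, ze)+u *\<^sub>R (xi, h/2)" by (simp add: algebra_simps)
 hence "(xi, et) : closed_segment (xi, ze) (xi, h/2)" using u unfolding closed_segment_def by blast
 thus ?thesis using xi c(2) unfolding ze_def by blast
 qed
qed

section \<open>The domain\<close>

definition chart :: "(nat => real) => nat => side => half => point => point" where
 "chart h i a b p=(wall_x h i a+inward a * fst p, half_sign b * snd p)"

fun opposite :: "side => side" where
 "opposite West=East" | "opposite East=West"

lemma sign_sq [simp]: "inward a * inward a=1" "half_sign b * half_sign b=1"
 "(inward a)^2=1" "(half_sign b)^2=1" "\<bar>inward a\<bar>=1" "\<bar>half_sign b\<bar>=1"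
 by (cases a; cases b; simp)+

lemma chart_dist: "dist (chart h i a b p) (chart h i a b q)=dist p q"
proof -
 have "dist (wall_x h i a+inward a * fst p) (wall_x h i a+inward a * fst q)=dist (fst p) (fst q)"
 by (cases a) (auto simp: dist_real_def)
 moreover have "dist (half_sign b * snd p) (half_sign b * snd q)=dist (snd p) (snd q)"
 by (cases b) (auto simp: dist_real_def)
 ultimately show ?thesis by (simp add: chart_def dist_prod_def)
qed

lemma chart_surj: "EX p. chart h i a b p=x"
proof -
 have "chart h i a b (inward a * (fst x-wall_x h i a), half_sign b * snd x)=x"
 by (simp add: chart_def flip: mult.assoc)
 thus ?thesis by blast
qed

lemma chart_ball:
 assumes "ball p rh <= S" and "!!q. q : S ==> chart h i a b q : T"
 shows "ball (chart h i a b p) rh <= T"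
proof
 fix x assume x: "x : ball (chart h i a b p) rh"
 obtain q where q: "chart h i a b q=x" using chart_surj by blast
 have "q : ball p rh" using x by (simp add: chart_dist flip: q)
 thus "x : T" using assms q by blast
qed

lemma chart_segment:
 assumes "p : closed_segment q q'"
 shows "chart h i a b p : closed_segment (chart h i a b q) (chart h i a b q')"
proof -
 obtain u where u: "0 <= u" "u <= 1" "p=(1-u) *\<^sub>R q+u *\<^sub>R q'" using assms by (auto simp: closed_segment_def)
 have "chart h i a b p=(1-u) *\<^sub>R chart h i a b q+u *\<^sub>R chart h i a b q'"
 unfolding u(3) by (simp add: chart_def algebra_simps)
 thus ?thesis using u unfolding closed_segment_def by blast
qed

lemma chart_eq_iff: "chart h i a b p=chart h i a b q \<longleftrightarrow> p=q"
 using chart_dist[of h i a b p q] by (metis dist_eq_0_iff)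

locale rooms_passages =
 fixes h dl :: "nat => real"
 assumes RP: "rooms_and_passages h dl"
begin

lemma h_pos: "1 <= i ==> 0<h i" using RP by (simp add: rooms_and_passages_def)
lemma h_lim: "h ~~> 0" using RP by (simp add: rooms_and_passages_def)

lemma dl_bounds:
 assumes "1 <= i" "even i"
 shows "0<dl i" "dl i<h (i-1)" "dl i<h (i+1)"
 using RP assms by (auto simp: rooms_and_passages_def)

lemma xpos_step: "1 <= i ==> xpos h i=xpos h (i-1)+h i"
 by (cases i) (simp_all add: xpos_def)

lemma xpos_strict_mono: "i<j ==> xpos h i<xpos h j"
proof (induction j)
 case (Suc j)
 have "xpos h j<xpos h (Suc j)" using xpos_step[of "Suc j"] h_pos[of "Suc j"] by simp
 thus ?case using Suc by (cases "i=j") auto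
qed simp

lemma xpos_less_iff: "xpos h i<xpos h j \<longleftrightarrow> i<j"
 using xpos_strict_mono by (metis less_asym linorder_neqE_nat order_less_irrefl)

lemma xpos_le_iff: "xpos h i <= xpos h j \<longleftrightarrow> i <= j"
 using xpos_less_iff[of j i] by (simp add: not_less[symmetric])

lemma width_bounds:
 assumes "odd i"
 shows "0 <= mouth_width dl i a" "mouth_width dl i a<h i" "has_mouth i a ==> 0<mouth_width dl i a"
proof -
 have i: "1 <= i" using assms by (cases i) auto
 have "0 <= mouth_width dl i a & mouth_width dl i a<h i & (has_mouth i a --> 0<mouth_width dl i a)"
 proof (cases a)
 case West
 show ?thesis
 proof (cases "3 <= i")
 case True
 hence "1 <= i-1" "even (i-1)" "i-1+1=i" using assms by auto
 thus ?thesis using dl_bounds[of "i-1"] West True by simp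
 qed (use West h_pos[OF i] in simp)
 next
 case East
 thus ?thesis using dl_bounds[of "i+1"] assms i by simp
 qed
 thus "0 <= mouth_width dl i a" "mouth_width dl i a<h i" "has_mouth i a ==> 0<mouth_width dl i a" by auto
qed

lemma width_pos_has_mouth: "0<mouth_width dl i a ==> has_mouth i a"
 by (cases a) (auto split: if_splits)

lemma reach_eq: "reach h dl i a=room_reach (h i) (mouth_width dl i a)"
 by (simp add: reach_def room_reach_def)

lemma Omega_between:
 assumes i: "1 <= i" and x: "xpos h (i-1)<x" "x<xpos h i"
 shows "(x, y) : Omega h dl \<longleftrightarrow> \<bar>y\<bar><(if odd i then h i else dl i)/2"
proof -
 have same: "j=i" if "1 <= j" "xpos h (j-1) <= x" "x <= xpos h j" for j
 proof -
 have "xpos h (j-1)<xpos h i" "xpos h (i-1)<xpos h j" using that x by linarith+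
 thus ?thesis using i that by (simp add: xpos_less_iff)
 qed
 have e: "1 <= j & xpos h (j-1)<x & x<xpos h j \<longleftrightarrow> j=i" "1 <= j & xpos h (j-1) <= x & x <= xpos h j \<longleftrightarrow> j=i" for j
 using same[of j] i x by (metis less_imp_le)+
 have "(x, y) : Omega h dl \<longleftrightarrow>
 (EX j. (1 <= j & xpos h (j-1)<x & x<xpos h j) & odd j & \<bar>y\<bar><h j/2) \<or>
 (EX j. (1 <= j & xpos h (j-1) <= x & x <= xpos h j) & even j & \<bar>y\<bar><dl j/2)"
 unfolding Omega_def room_def passage_def by blast
 thus ?thesis unfolding e by auto
qed

lemma Omega_wall:
 assumes i: "1 <= i" "odd i"
 shows "(wall_x h i a, y) : Omega h dl \<longleftrightarrow> \<bar>y\<bar><mouth_width dl i a/2"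
proof -
 have gen: "(xpos h k, y) : Omega h dl \<longleftrightarrow> (EX j. 1 <= j & even j & (j=k \<or> j=Suc k) & \<bar>y\<bar><dl j/2)" for k
 proof -
 have "\<not> (xpos h (j-1)<xpos h k & xpos h k<xpos h j)" if "1 <= j" for j
 using that by (auto simp: xpos_less_iff)
 moreover have "xpos h (j-1) <= xpos h k & xpos h k <= xpos h j \<longleftrightarrow> j=k \<or> j=Suc k" if "1 <= j" for j
 using that by (auto simp: xpos_le_iff)
 ultimately have e: "1 <= j & xpos h (j-1)<xpos h k & xpos h k<xpos h j \<longleftrightarrow> False"
 "1 <= j & xpos h (j-1) <= xpos h k & xpos h k <= xpos h j \<longleftrightarrow> 1 <= j & (j=k \<or> j=Suc k)" for j by blast+
 have "(xpos h k, y) : Omega h dl \<longleftrightarrow>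
 (EX j. (1 <= j & xpos h (j-1)<xpos h k & xpos h k<xpos h j) & odd j & \<bar>y\<bar><h j/2) \<or>
 (EX j. (1 <= j & xpos h (j-1) <= xpos h k & xpos h k <= xpos h j) & even j & \<bar>y\<bar><dl j/2)"
 unfolding Omega_def room_def passage_def by blast
 thus ?thesis unfolding e by blast
 qed
 show ?thesis
 proof (cases a)
 case West
 have "3 <= i \<longleftrightarrow> 1 <= i-1" using i by (cases i; cases "i-1") (auto, presburger)
 thus ?thesis using i West gen[of "i-1"] by auto
 next
 case East
 thus ?thesis using i gen[of i] by auto
 qed
qed

definition strip :: "nat => point set" where
 "strip j={xpos h (j-1)-dl j<..<xpos h j+dl j} \<times> {- (dl j/2)<..<dl j/2}"

lemma strip_subset:
 assumes j: "1 <= j" "even j"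
 shows "strip j <= Omega h dl"
proof
 fix p assume p: "p : strip j"
 obtain x y where xy: "p=(x, y)" by (cases p)
 have b: "xpos h (j-1)-dl j<x" "x<xpos h j+dl j" "\<bar>y\<bar><dl j/2" using p by (auto simp: strip_def xy)
 have j2: "2 <= j" using j by presburger
 note d=dl_bounds[OF j]
 consider "x<xpos h (j-1)" | "xpos h (j-1) <= x" "x <= xpos h j" | "xpos h j<x" by linarith
 thus "p : Omega h dl"
 proof cases
 case 1
 have "p : room h (j-1)" using 1 b d xpos_step[of "j-1"] j2 by (auto simp: room_def xy)
 thus ?thesis using j j2 unfolding Omega_def by (intro UnI1 UN_I[of "j-1"]) auto
 next
 case 2
 hence "p : passage h dl j" using b by (auto simp: passage_def xy)
 thus ?thesis using j unfolding Omega_def by auto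
 next
 case 3
 have "p : room h (j+1)" using 3 b d xpos_step[of "j+1"] by (auto simp: room_def xy)
 thus ?thesis using j unfolding Omega_def by (intro UnI1 UN_I[of "j+1"]) auto
 qed
qed

lemma room_open: "open (room h i)"
proof -
 have "room h i={xpos h (i-1)<..<xpos h i} \<times> {- (h i/2)<..<h i/2}" by (auto simp: room_def)
 thus ?thesis by (simp add: open_Times)
qed

lemma room_subset: "1 <= i ==> odd i ==> room h i <= Omega h dl"
 unfolding Omega_def by auto

lemma Omega_open: "open (Omega h dl)"
proof -
 have "Omega h dl=(\<Union>i\<in>{i. 1 <= i & odd i}. room h i) \<union> (\<Union>i\<in>{i. 1 <= i & even i}. strip i)"
 proof
 have "passage h dl i <= strip i" if "1 <= i" "even i" for i
 using dl_bounds(1)[OF that] by (auto simp: passage_def strip_def)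
 thus "Omega h dl <= (\<Union>i\<in>{i. 1 <= i & odd i}. room h i) \<union> (\<Union>i\<in>{i. 1 <= i & even i}. strip i)"
 unfolding Omega_def by blast
 show "(\<Union>i\<in>{i. 1 <= i & odd i}. room h i) \<union> (\<Union>i\<in>{i. 1 <= i & even i}. strip i) <= Omega h dl"
 using strip_subset room_subset by blast
 qed
 moreover have "open (strip i)" for i unfolding strip_def by (intro open_Times) auto
 ultimately show ?thesis using room_open by (simp add: open_Un open_UN)
qed

lemma chart_room:
 assumes i: "1 <= i" "odd i" and p: "p : mouthed_room (h i) (mouth_width dl i a) (mouth_width dl i (opposite a))"
 shows "chart h i a b p : Omega h dl"
proof -
 obtain xi et where p': "p=(xi, et)" by (cases p)
 have y: "\<bar>half_sign b * et\<bar>=\<bar>et\<bar>" by (simp add: abs_mult)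
 have mouth: "(wall_x h i c+inward c * z, y) : Omega h dl"
 if z: "- mouth_width dl i c<z" "z <= 0" and yy: "\<bar>y\<bar><mouth_width dl i c/2" for c z y
 proof (cases c)
 case West
 hence "3 <= i" using that by (auto split: if_splits)
 hence "(wall_x h i c+inward c * z, y) : strip (i-1)"
 using that West dl_bounds[of "i-1"] i xpos_le_iff[of "i-1-1" "i-1"] by (auto simp: strip_def)
 moreover have "strip (i-1) <= Omega h dl" by (rule strip_subset) (use i \<open>3 <= i\<close> in auto)
 ultimately show ?thesis by blast
 next
 case East
 hence "(wall_x h i c+inward c * z, y) : strip (i+1)"
 using that dl_bounds[of "i+1"] i xpos_le_iff[of "i" "i+1"] by (auto simp: strip_def)
 thus ?thesis using strip_subset[of "i+1"] i by auto
 qed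
 have opp: "wall_x h i a+inward a * xi=wall_x h i (opposite a)+inward (opposite a)*(h i-xi)"
 using xpos_step[OF i(1)] by (cases a) auto
 from p[unfolded mouthed_room_def p'] consider "0<xi & xi<h i & \<bar>et\<bar><h i/2"
 | "- mouth_width dl i a<xi & xi <= 0 & \<bar>et\<bar><mouth_width dl i a/2"
 | "h i <= xi & xi<h i+mouth_width dl i (opposite a) & \<bar>et\<bar><mouth_width dl i (opposite a)/2" by auto
 thus ?thesis
 proof cases
 case 1
 hence "chart h i a b p : room h i" using xpos_step[OF i(1)] y by (cases a) (auto simp: chart_def room_def p')
 thus ?thesis using room_subset i by blast
 next
 case 2
 thus ?thesis unfolding chart_def p' using mouth[of a xi "half_sign b * et"] y by simp
 next
 case 3
 thus ?thesis unfolding chart_def p' fst_conv opp using mouth[of "opposite a" "h i-xi" "half_sign b * et"] y by simp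
 qed
qed

end

instance side :: countable by countable_datatype
instance half :: countable by countable_datatype
instance edge :: countable by countable_datatype

fun foot :: "(nat => real) => (nat => real) => edge => half => real => point" where
 "foot h dl (Pass i) k r=(xpos h (i-1)+r, half_sign k * (dl i/2))"
| "foot h dl (Centre i) k r=(xpos h (i-1)+reach h dl i West+r, half_sign k * (h i/2))"
| "foot h dl (Diag i a b) k r =
 chart h i a b (if k=North then (r/sqrt 2, h i/2) else (0, h i/2-r/sqrt 2))"
| "foot h dl (Arc i a b) k r =
 (let w=mouth_width dl i a
 in chart h i a b (if k=North then ((h i-w)/2+r, h i/2) else (0, w/2)))"
| "foot h dl (Join i a) k r=chart h i a k (0, mouth_width dl i a/2)"

fun cell :: "(nat => real) => (nat => real) => edge => point set" where
 "cell h dl (Pass i)={xpos h (i-1)<..<xpos h i} \<times> {- (dl i/2)<..<dl i/2}"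
| "cell h dl (Centre i) =
 {xpos h (i-1)+reach h dl i West<..<xpos h i-reach h dl i East} \<times> {- (h i/2)<..<h i/2}"
| "cell h dl (Diag i a b) =
 chart h i a b ` ({0<..<(h i-mouth_width dl i a)/2} \<times> {mouth_width dl i a/2<..<h i/2})"
| "cell h dl (Arc i a b)=(let w=mouth_width dl i a; R=reach h dl i a in
 chart h i a b ` {p. 0<fst p & fst p<R & w/2*(1-fst p/R) < snd p & snd p<h i/2 &
 ((h i-w)/2<fst p \<or> snd p<w/2)})"
| "cell h dl (Join i a)=(let w=mouth_width dl i a; R=reach h dl i a in
 chart h i a North ` {p. 0<fst p & \<bar>snd p\<bar><w/2*(1-fst p/R)})"

lemma open_chart: "open S ==> open (chart h i a b ` S)"
proof -
 assume S: "open S"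
 let ?u="%x. (inward a * (fst x-wall_x h i a), half_sign b * snd x)"
 have 1: "?u (chart h i a b p)=p" for p by (simp add: chart_def flip: mult.assoc)
 have 2: "chart h i a b (?u x)=x" for x by (simp add: chart_def flip: mult.assoc)
 have "chart h i a b ` S = ?u -` S"
 proof
 show "chart h i a b ` S <= ?u -` S" using 1 by auto
 show "?u -` S <= chart h i a b ` S"
 proof
 fix x assume "x : ?u -` S"
 hence "?u x : S" by (rule vimageD)
 thus "x : chart h i a b ` S" by (rule image_eqI[where f="chart h i a b", OF 2[of x, symmetric]])
 qed
 qed
 moreover have "open (?u -` S)" by (intro open_vimage[OF S] continuous_intros)
 ultimately show ?thesis by simp
qed

lemma open_cell: "open (cell h dl e)"
proof (cases e)
 case (Diag i a b)
 thus ?thesis by (auto intro!: open_chart open_Times)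
next
 case (Arc i a b)
 show ?thesis
 unfolding Arc cell.simps Let_def divide_inverse
 by (intro open_chart open_Collect_conj open_Collect_disj open_Collect_less continuous_intros)
next
 case (Join i a)
 show ?thesis
 unfolding Join cell.simps Let_def divide_inverse
 by (intro open_chart open_Collect_conj open_Collect_disj open_Collect_less continuous_intros)
qed (auto intro!: open_Times)

lemma edges_cases [consumes 1, case_names Pass Centre Diag Arc Join]:
 assumes "e : edges"
 and "!!i. e=Pass i ==> 1 <= i ==> even i ==> thesis"
 and "!!i. e=Centre i ==> 1 <= i ==> odd i ==> thesis"
 and "!!i a b. e=Diag i a b ==> 1 <= i ==> odd i ==> thesis"
 and "!!i a b. e=Arc i a b ==> 1 <= i ==> odd i ==> has_mouth i a ==> thesis"
 and "!!i a. e=Join i a ==> 1 <= i ==> odd i ==> has_mouth i a ==> thesis"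
 shows thesis
proof -
 have "(EX i. e=Pass i & 1 <= i & even i) \<or> (EX i. e=Centre i & 1 <= i & odd i) \<or>
 (EX i a b. e=Diag i a b & 1 <= i & odd i) \<or> (EX i a b. e=Arc i a b & 1 <= i & odd i & has_mouth i a) \<or>
 (EX i a. e=Join i a & 1 <= i & odd i & has_mouth i a)"
 using assms(1) unfolding edges_reg_def edges_sing_def by blast
 thus thesis
 by (elim disjE exE conjE) (erule (2) assms(2), erule (2) assms(3), erule (2) assms(4), erule (3) assms(5), erule (3) assms(6))
qed

lemma dist_vertical: "dist (a :: real, b :: real) (a, c)=\<bar>b-c\<bar>" and dist_horizontal: "dist (a :: real, b :: real) (c, b)=\<bar>a-c\<bar>"
 by (simp_all add: dist_prod_def dist_real_def)

lemma path_chart: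
 "edge_path h dl (Centre i) r=chart h i West k (reach h dl i West+r, 0)"
 "edge_path h dl (Diag i a b) r=chart h i a b (r/sqrt 2, h i/2-r/sqrt 2)"
 "edge_path h dl (Arc i a b) r=chart h i a b ((h i-mouth_width dl i a)/2+r,
 (h i+mouth_width dl i a)/4-((h i-mouth_width dl i a)/2+r)^2/(h i-mouth_width dl i a))"
 "edge_path h dl (Join i a) r=chart h i a k (r, 0)"
 "foot h dl (Centre i) k r=chart h i West k (reach h dl i West+r, h i/2)"
 by (simp_all add: chart_def Let_def)

context rooms_passages
begin

lemma wall_range: "1 <= i ==> 0<xi ==> xi<h i ==> xpos h (i-1)<wall_x h i a+inward a * xi & wall_x h i a+inward a * xi<xpos h i"
 using xpos_step[of i] by (cases a) auto

lemma horizontal_wall: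
 assumes "1 <= i" "odd i" "0<xi" "xi<h i"
 shows "chart h i a b (xi, h i/2) ~: Omega h dl"
 using Omega_between[OF assms(1), of "wall_x h i a+inward a * xi"] wall_range[OF assms(1,3,4), of a] h_pos[OF assms(1)] assms(2)
 by (simp add: chart_def abs_mult)

lemma vertical_wall:
 assumes "1 <= i" "odd i" "mouth_width dl i a/2 <= et"
 shows "chart h i a b (0, et) ~: Omega h dl"
 using Omega_wall[OF assms(1,2), of a "half_sign b * et"] width_bounds(1)[OF assms(2), of a] assms(3)
 by (simp add: chart_def abs_mult)

definition near_data :: "edge => real => real => bool" where
 "near_data e r rh \<longleftrightarrow> 0<rh & ball (edge_path h dl e r) rh <= Omega h dl &
 (ALL k. foot h dl e k r ~: Omega h dl & dist (edge_path h dl e r) (foot h dl e k r)=rh) &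
 foot h dl e North r ~= foot h dl e South r"

lemma reach_room:
 assumes "1 <= i" "odd i"
 shows "0<reach h dl i a" "reach h dl i a <= h i/2" "(h i-mouth_width dl i a)/2 <= reach h dl i a"
 "has_mouth i a ==> reach h dl i a<h i/2" "has_mouth i a ==> (h i-mouth_width dl i a)/2<reach h dl i a"
 using reach_bounds[OF width_bounds(1,2)[OF assms(2), of a]] width_bounds(3)[OF assms(2), of a]
 unfolding reach_eq by auto

lemma reach_sum: "1 <= i ==> odd i ==> reach h dl i West+reach h dl i East<h i"
 using reach_room(2)[of i West] reach_room(4)[of i East] by simp

lemma near_data_ex:
 assumes e: "e : edges" and r: "0<r" "r<edge_end h dl e"
 shows "EX rh. near_data e r rh"
 using e
proof (cases rule: edges_cases)
 case (Pass i)
 note d=dl_bounds[OF Pass(2,3)]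
 have x: "xpos h (i-1)<xpos h (i-1)+r" "xpos h (i-1)+r<xpos h i" using r Pass xpos_step[OF Pass(2)] by auto
 have "ball (xpos h (i-1)+r, 0) (dl i/2) <= strip i"
 proof clarify
 fix a b :: real assume "(a, b) : ball (xpos h (i-1)+r, 0) (dl i/2)"
 hence "(a-(xpos h (i-1)+r))^2+(b-0)^2<(dl i/2)^2" using ball_plane[of "dl i/2"] d by auto
 from ball_plane_bounds[OF this] have "\<bar>a-(xpos h (i-1)+r)\<bar><dl i/2" "\<bar>b-0\<bar><dl i/2" using d by auto
 hence "xpos h (i-1)-dl i<a" "a<xpos h i+dl i" "- (dl i/2)<b" "b<dl i/2" using d x by linarith+
 thus "(a, b) : strip i" by (simp add: strip_def)
 qed
 moreover have "(xpos h (i-1)+r, half_sign k * (dl i/2)) ~: Omega h dl" for k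
 using Omega_between[OF Pass(2) x] d Pass by (simp add: abs_mult)
 moreover have "dist (xpos h (i-1)+r, 0) (xpos h (i-1)+r, half_sign k * (dl i/2))=dl i/2" for k
 using d by (simp add: dist_vertical abs_mult)
 ultimately have "near_data e r (dl i/2)"
 unfolding near_data_def using strip_subset[OF Pass(2,3)] d Pass by auto
 thus ?thesis ..
next
 case (Centre i)
 note w=width_bounds[OF Centre(3)]
 let ?xi="reach h dl i West+r"
 have xi: "reach h dl i West <= ?xi" "?xi <= h i-reach h dl i East" "0<?xi" "?xi<h i"
 using r Centre reach_room(1)[OF Centre(2,3), of West] reach_room(1)[OF Centre(2,3), of East] by auto
 have b: "ball (?xi, 0) (h i/2) <= mouthed_room (h i) (mouth_width dl i West) (mouth_width dl i (opposite West))"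
 using ball_centre[OF w(1,2)[of West] w(1,2)[of East] xi(1,2)[unfolded reach_eq]] by (simp only: reach_eq opposite.simps)
 have ball: "ball (chart h i West k (?xi, 0)) (h i/2) <= Omega h dl" for k
 by (rule chart_ball[OF b chart_room[OF Centre(2,3)]])
 have "near_data e r (h i/2)"
 unfolding near_data_def Centre(1) path_chart(5)
 proof (intro conjI allI)
 show "0<h i/2" using h_pos[OF Centre(2)] by simp
 show "ball (edge_path h dl (Centre i) r) (h i/2) <= Omega h dl" using ball[of North] by (simp only: path_chart(1)[where k=North])
 fix k show "chart h i West k (?xi, h i/2) ~: Omega h dl" by (rule horizontal_wall[OF Centre(2,3) xi(3,4)])
 show "dist (edge_path h dl (Centre i) r) (chart h i West k (?xi, h i/2))=h i/2"
 unfolding path_chart(1)[where k=k] chart_dist using h_pos[OF Centre(2)] by (simp add: dist_vertical)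
 show "chart h i West North (?xi, h i/2) ~= chart h i West South (?xi, h i/2)"
 using h_pos[OF Centre(2)] by (simp add: chart_def)
 qed
 thus ?thesis ..
next
 case (Diag i a b)
 note w=width_bounds[OF Diag(3)]
 let ?w="mouth_width dl i a"
 define ka where "ka=r/sqrt 2"
 have "r/sqrt 2<(h i - ?w)/sqrt 2/sqrt 2" using r Diag by (intro divide_strict_right_mono) auto
 hence ka: "0<ka" "ka<(h i - ?w)/2" using r by (auto simp: ka_def)
 have ball: "ball (chart h i a b (ka, h i/2-ka)) ka <= Omega h dl"
 by (rule chart_ball[OF ball_diag[OF w(1,2) w(1,2) ka] chart_room[OF Diag(2,3)]])
 have wa: "0 <= ?w" by (rule w(1))
 have "chart h i a b (ka, h i/2) ~: Omega h dl" by (rule horizontal_wall[OF Diag(2,3)]) (use ka wa in auto)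
 moreover have "chart h i a b (0, h i/2-ka) ~: Omega h dl" by (rule vertical_wall[OF Diag(2,3)]) (use ka in \<open>auto simp: field_simps\<close>)
 moreover have "dist (ka, h i/2-ka) (ka, h i/2)=ka" "dist (ka, h i/2-ka) (0, h i/2-ka)=ka"
 using ka by (auto simp: dist_vertical dist_horizontal)
 ultimately have "near_data e r ka"
 unfolding near_data_def Diag(1) path_chart foot.simps ka_def[symmetric] using ka ball by (auto simp: chart_dist chart_eq_iff)
 thus ?thesis ..
next
 case (Arc i a b)
 note w=width_bounds[OF Arc(3)]
 let ?w="mouth_width dl i a"
 define xi where "xi=(h i - ?w)/2+r"
 define et where "et=(h i + ?w)/4-xi^2/(h i - ?w)"
 have xi: "(h i - ?w)/2<xi" "xi<room_reach (h i) ?w" using r Arc by (auto simp: xi_def reach_eq)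
 note A=w(1,2)[of a] w(1,2)[of a] w(3)[OF Arc(4)] xi et_def
 have ball: "ball (chart h i a b (xi, et)) (h i/2-et) <= Omega h dl"
 by (rule chart_ball[OF ball_arc[OF w(1,2) w(1,2) w(3)[OF Arc(4)] xi et_def] chart_room[OF Arc(2,3)]])
 note f=arc_facts[OF A]
 have p: "0<h i/2-et" using f(2) w(2)[of a] by simp
 have xi0: "0<xi" "xi<h i" using xi w(2)[of a] reach_room(2)[OF Arc(2,3), of a] h_pos[OF Arc(2)] by (auto simp: reach_eq)
 have "chart h i a b (xi, h i/2) ~: Omega h dl" by (rule horizontal_wall[OF Arc(2,3) xi0])
 moreover have "chart h i a b (0, ?w/2) ~: Omega h dl" by (rule vertical_wall[OF Arc(2,3)]) simp
 moreover have "dist (xi, et) (xi, h i/2)=h i/2-et" using p by (simp add: dist_vertical)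
 moreover have "dist (xi, et) (0, ?w/2)=h i/2-et"
 proof -
 have "dist (xi, et) (0, ?w/2)=sqrt (xi^2+(?w/2-et)^2)" by (simp add: dist_prod_def dist_real_def power2_commute)
 thus ?thesis using p unfolding f(3)[symmetric] by simp
 qed
 moreover have "xi ~= 0" using xi0 by simp
 ultimately have "near_data e r (h i/2-et)"
 unfolding near_data_def Arc(1) path_chart foot.simps Let_def xi_def[symmetric] et_def[symmetric] using p ball
 by (auto simp: chart_dist chart_eq_iff)
 thus ?thesis ..
next
 case (Join i a)
 note w=width_bounds[OF Join(3)]
 let ?w="mouth_width dl i a"
 have w0: "0<?w" by (rule w(3)[OF Join(4)])
 have r': "r<room_reach (h i) ?w" using r Join by (simp add: reach_eq)
 let ?rh="sqrt (r^2+(?w/2)^2)"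
 have ball: "ball (chart h i a North (r, 0)) ?rh <= Omega h dl"
 by (rule chart_ball[OF ball_join(1)[OF w(1,2) w(1,2) w0 r(1) r'] chart_room[OF Join(2,3)]])
 have "near_data e r ?rh"
 unfolding near_data_def Join(1) foot.simps
 proof (intro conjI allI)
 have "0<r^2" using r by simp
 thus "0<?rh" by (simp add: add_pos_nonneg)
 show "ball (edge_path h dl (Join i a) r) ?rh <= Omega h dl" using ball unfolding path_chart(4)[of h dl i a r North] .
 fix k show "chart h i a k (0, ?w/2) ~: Omega h dl" by (rule vertical_wall[OF Join(2,3)]) simp
 show "dist (edge_path h dl (Join i a) r) (chart h i a k (0, ?w/2)) = ?rh"
 unfolding path_chart(4)[where k=k] chart_dist using w0 by (simp add: dist_prod_def dist_real_def)
 show "chart h i a North (0, ?w/2) ~= chart h i a South (0, ?w/2)" using w0 by (simp add: chart_def)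
 qed
 thus ?thesis ..
qed

lemma foot_near:
 assumes "e : edges" "0<r" "r<edge_end h dl e"
 shows "foot h dl e k r : near_points (Omega h dl) (edge_path h dl e r)" "edge_path h dl e r : skeleton (Omega h dl)"
proof -
 obtain rh where "near_data e r rh" using near_data_ex[OF assms] ..
 hence d: "0<rh" "ball (edge_path h dl e r) rh <= Omega h dl"
 "!!k. foot h dl e k r ~: Omega h dl" "!!k. dist (edge_path h dl e r) (foot h dl e k r)=rh"
 "foot h dl e North r ~= foot h dl e South r" by (auto simp: near_data_def)
 have n: "foot h dl e k r : near_points (Omega h dl) (edge_path h dl e r)" for k
 by (rule near_pointI(1)[OF Omega_open d(2,1,3,4)])
 thus "foot h dl e k r : near_points (Omega h dl) (edge_path h dl e r)" .
 have "edge_path h dl e r : Omega h dl" using d(1,2) by auto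
 thus "edge_path h dl e r : skeleton (Omega h dl)" unfolding skeleton_def using n d(5) by blast
qed

lemma tau_on_segment:
 assumes "e : edges" "0<r" "r<edge_end h dl e" "x : closed_segment (edge_path h dl e r) (foot h dl e k r)" "x : Omega h dl"
 shows "tau h dl x=edge_path h dl e r"
 unfolding tau_def by (rule ridge_map_eq[OF Omega_open assms(5) foot_near(2,1)[OF assms(1-3)] assms(4)])

lemma chart_in_room:
 assumes "1 <= i" "0<xi" "xi<h i" "\<bar>et\<bar><h i/2"
 shows "chart h i a b (xi, et) : room h i"
 using wall_range[OF assms(1-3), of a] assms(4) by (simp add: chart_def room_def abs_mult)

lemma cell_ray:
 assumes e: "e : edges" and x: "x : cell h dl e"
 shows "x : Omega h dl" and "EX k r. 0<r & r<edge_end h dl e & x : closed_segment (edge_path h dl e r) (foot h dl e k r)"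
proof -
 have up: "(c, y) : closed_segment (c, 0) (c, half_sign (if 0 <= y then North else South) * d)" if "\<bar>y\<bar><d" for c y d :: real
 proof -
 have "(c, y)=(1-\<bar>y\<bar>/d) *\<^sub>R (c, 0)+(\<bar>y\<bar>/d) *\<^sub>R (c, half_sign (if 0 <= y then North else South) * d)"
 using that by (auto simp: algebra_simps)
 moreover have "0 <= \<bar>y\<bar>/d" "\<bar>y\<bar>/d <= 1" using that by auto
 ultimately show ?thesis unfolding closed_segment_def by blast
 qed
 have "x : Omega h dl & (EX k r. 0<r & r<edge_end h dl e & x : closed_segment (edge_path h dl e r) (foot h dl e k r))"
 using e
 proof (cases rule: edges_cases)
 case (Pass i)
 obtain u y where uy: "x=(u, y)" by (cases x)
 have b: "xpos h (i-1)<u" "u<xpos h i" "\<bar>y\<bar><dl i/2" using x Pass uy by auto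
 have "x : Omega h dl" using Omega_between[OF Pass(2) b(1,2)] b Pass uy by simp
 moreover have "0<u-xpos h (i-1)" "u-xpos h (i-1)<edge_end h dl e" using b Pass xpos_step[OF Pass(2)] by auto
 moreover have "x : closed_segment (edge_path h dl e (u-xpos h (i-1))) (foot h dl e (if 0 <= y then North else South) (u-xpos h (i-1)))"
 using up[OF b(3), of u] by (simp add: Pass(1) uy)
 ultimately show ?thesis by blast
 next
 case (Centre i)
 obtain u y where uy: "x=(u, y)" by (cases x)
 let ?c="xpos h (i-1)+reach h dl i West"
 have b: "?c<u" "u<xpos h i-reach h dl i East" "\<bar>y\<bar><h i/2" using x Centre uy by auto
 have b': "xpos h (i-1)<u" "u<xpos h i"
 using b reach_room(1)[OF Centre(2,3), of West] reach_room(1)[OF Centre(2,3), of East] by linarith+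
 have "x : Omega h dl" using Omega_between[OF Centre(2) b'] b Centre uy by simp
 moreover have "0<u - ?c" "u - ?c<edge_end h dl e" using b Centre xpos_step[OF Centre(2)] by auto
 moreover have "x : closed_segment (edge_path h dl e (u - ?c)) (foot h dl e (if 0 <= y then North else South) (u - ?c))"
 using up[OF b(3), of u] by (simp add: Centre(1) uy)
 ultimately show ?thesis by blast
 next
 case (Diag i a b)
 let ?w="mouth_width dl i a"
 note w=width_bounds[OF Diag(3), of a]
 obtain xi et where c: "x=chart h i a b (xi, et)" "0<xi" "xi<(h i - ?w)/2" "?w/2<et" "et<h i/2"
 using x Diag by auto
 have "x : Omega h dl"
 using chart_in_room[OF Diag(2), of xi et a b] room_subset[OF Diag(2,3)] c w by auto
 moreover obtain ka where k: "0<ka" "ka<(h i - ?w)/2"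
 "(xi, et) : closed_segment (ka, h i/2-ka) (ka, h i/2) \<or> (xi, et) : closed_segment (ka, h i/2-ka) (0, h i/2-ka)"
 using diag_ray[OF w(1) c(2-5)] by blast
 have r: "0 < sqrt 2 * ka" "sqrt 2 * ka<edge_end h dl e" "sqrt 2 * ka/sqrt 2=ka"
 proof -
 have "sqrt 2 * ka < sqrt 2*((h i - ?w)/2)" using k by simp
 also have "\<dots>=(h i - ?w)/sqrt 2" by (simp add: field_simps)
 finally show "sqrt 2 * ka<edge_end h dl e" using Diag by simp
 qed (use k in auto)
 have "x : closed_segment (edge_path h dl e (sqrt 2 * ka)) (foot h dl e North (sqrt 2 * ka)) \<or>
 x : closed_segment (edge_path h dl e (sqrt 2 * ka)) (foot h dl e South (sqrt 2 * ka))"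
 unfolding Diag(1) path_chart foot.simps c(1) r(3) using k(3) chart_segment by auto
 ultimately show ?thesis using r(1,2) by blast
 next
 case (Arc i a b)
 let ?w="mouth_width dl i a"
 note w=width_bounds[OF Arc(3), of a]
 obtain xi et where c: "x=chart h i a b (xi, et)" "0<xi" "xi<room_reach (h i) ?w"
 "?w/2*(1-xi/room_reach (h i) ?w)<et" "et<h i/2" "(h i - ?w)/2<xi \<or> et<?w/2"
 using x Arc by (auto simp: Let_def reach_eq)
 have w0: "0<?w" by (rule w(3)[OF Arc(4)])
 have "0<?w/2*(1-xi/room_reach (h i) ?w)" using c w0 by simp
 hence "\<bar>et\<bar><h i/2" using c by linarith
 moreover have "xi<h i" using c(3) reach_room(2)[OF Arc(2,3), of a] h_pos[OF Arc(2)] by (simp add: reach_eq)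
 ultimately have "x : Omega h dl"
 using chart_in_room[OF Arc(2), of xi et a b] room_subset[OF Arc(2,3)] c by auto
 moreover obtain ka where k: "(h i - ?w)/2<ka" "ka<room_reach (h i) ?w"
 "(xi, et) : closed_segment (ka, (h i + ?w)/4-ka^2/(h i - ?w)) (ka, h i/2) \<or>
 (xi, et) : closed_segment (ka, (h i + ?w)/4-ka^2/(h i - ?w)) (0, ?w/2)"
 using arc_ray[OF w0 w(2) c(2-6)] by blast
 define r where "r=ka-(h i - ?w)/2"
 have r: "0<r" "r<edge_end h dl e" "(h i - ?w)/2+r=ka" using k Arc by (auto simp: r_def reach_eq)
 have "x : closed_segment (edge_path h dl e r) (foot h dl e North r) \<or>
 x : closed_segment (edge_path h dl e r) (foot h dl e South r)"
 unfolding Arc(1) path_chart foot.simps Let_def c(1) r(3) using k(3) chart_segment by auto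
 ultimately show ?thesis using r(1,2) by blast
 next
 case (Join i a)
 let ?w="mouth_width dl i a"
 let ?R="room_reach (h i) ?w"
 note w=width_bounds[OF Join(3), of a]
 have w0: "0<?w" by (rule w(3)[OF Join(4)])
 have R0: "0<?R" using reach_room(1)[OF Join(2,3), of a] by (simp add: reach_eq)
 obtain xi et where c: "x=chart h i a North (xi, et)" "0<xi" "\<bar>et\<bar><?w/2*(1-xi / ?R)"
 using x Join by (auto simp: Let_def reach_eq)
 define k where "k=(if 0 <= et then North else South)"
 have c': "x=chart h i a k (xi, \<bar>et\<bar>)" by (auto simp: c(1) k_def chart_def)
 obtain ka where kk: "0<ka" "ka<?R" "(xi, \<bar>et\<bar>) : closed_segment (ka, 0) (0, ?w/2)"
 using join_ray[OF w0 R0 c(2) _ c(3)] by auto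
 have "0<?w/2*(1-xi / ?R)" using c(3) by linarith
 hence "0<1-xi / ?R" using w0 by (simp add: zero_less_mult_iff)
 hence "xi<?R" using R0 by simp
 hence "xi<h i" using reach_room(2)[OF Join(2,3), of a] h_pos[OF Join(2)] by (simp add: reach_eq)
 moreover have "?w/2*(1-xi / ?R) <= ?w/2*1" using w0 c(2) R0 by (intro mult_left_mono) auto
 hence "\<bar>et\<bar><h i/2" using c(3) w(2) by linarith
 ultimately have "x : Omega h dl"
 using chart_in_room[OF Join(2), of xi et a North] room_subset[OF Join(2,3)] c by auto
 moreover have "x : closed_segment (edge_path h dl e ka) (foot h dl e k ka)"
 unfolding Join(1) path_chart(4)[of h dl i a ka k] foot.simps c' by (rule chart_segment[OF kk(3)])
 moreover have "ka<edge_end h dl e" using kk Join by (simp add: reach_eq)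
 ultimately show ?thesis using kk(1) by blast
 qed
 thus "x : Omega h dl" "EX k r. 0<r & r<edge_end h dl e & x : closed_segment (edge_path h dl e r) (foot h dl e k r)" by blast+
qed

lemma cell_subset_region: "e : edges ==> cell h dl e <= region h dl e"
proof
 fix x assume e: "e : edges" and x: "x : cell h dl e"
 obtain k r where "0<r" "r<edge_end h dl e" "x : closed_segment (edge_path h dl e r) (foot h dl e k r)"
 using cell_ray(2)[OF e x] by blast
 thus "x : region h dl e"
 using tau_on_segment[OF e, of r x k] cell_ray(1)[OF e x] by (auto simp: region_def edge_set_def)
qed

end

context rooms_passages
begin

definition slab :: "real => nat" where
 "slab x=(THE i. 1 <= i & xpos h (i-1)<x & x<xpos h i)"

lemma slab_eq:
 assumes "1 <= i" "xpos h (i-1)<x" "x<xpos h i"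
 shows "slab x=i"
 unfolding slab_def
proof (rule the_equality)
 fix j assume j: "1 <= j & xpos h (j-1)<x & x<xpos h j"
 hence "xpos h (j-1)<xpos h i" "xpos h (i-1)<xpos h j" using assms by linarith+
 thus "j=i" using assms j by (simp add: xpos_less_iff)
qed (use assms in simp)

text \<open>The edge is read off the coordinates. That it can be recovered from a point shows that edges are disjoint.\<close>

definition edge_at :: "point => edge" where
 "edge_at p=(let i=slab (fst p); xi=fst p-xpos h (i-1); a=(if xi<h i/2 then West else East);
 z=(if xi<h i/2 then xi else h i-xi); b=(if 0 < snd p then North else South)
 in if even i then Pass i
 else if snd p=0 then (if z<reach h dl i a then Join i a else Centre i)
 else if mouth_width dl i a/2<\<bar>snd p\<bar> then Diag i a b else Arc i a b)"

lemma edge_at_chart: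
 assumes i: "1 <= i" "odd i" and xi: "0<xi" "xi<h i/2"
 shows "edge_at (chart h i a b (xi, 0))=(if xi<reach h dl i a then Join i a else Centre i)"
 and "0<et ==> edge_at (chart h i a b (xi, et))=(if mouth_width dl i a/2<et then Diag i a b else Arc i a b)"
proof -
 have "xi<h i" using xi by simp
 hence s: "slab (wall_x h i a+inward a * xi)=i" using slab_eq[OF i(1)] wall_range[OF i(1) xi(1), of a] by simp
 have x: "wall_x h i a+inward a * xi-xpos h (i-1)=(case a of West => xi | East => h i-xi)"
 using xpos_step[OF i(1)] by (cases a) auto
 show "edge_at (chart h i a b (xi, 0))=(if xi<reach h dl i a then Join i a else Centre i)"
 unfolding edge_at_def chart_def fst_conv snd_conv s x Let_def using i xi by (cases a) auto
 show "edge_at (chart h i a b (xi, et))=(if mouth_width dl i a/2<et then Diag i a b else Arc i a b)" if "0<et"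
 unfolding edge_at_def chart_def fst_conv snd_conv s x Let_def using i xi that by (cases a; cases b) auto
qed

lemma edge_at_edge:
 assumes e: "e : edges" and p: "p : edge_set h dl e"
 shows "edge_at p=e"
proof -
 obtain r where r: "0<r" "r<edge_end h dl e" "p=edge_path h dl e r" using p by (auto simp: edge_set_def)
 show ?thesis
 using e
 proof (cases rule: edges_cases)
 case (Pass i)
 have "slab (xpos h (i-1)+r)=i" by (rule slab_eq[OF Pass(2)]) (use r Pass xpos_step[OF Pass(2)] in auto)
 thus ?thesis using Pass r by (simp add: edge_at_def Let_def)
 next
 case (Centre i)
 have b: "reach h dl i West+r<h i-reach h dl i East" using r Centre by simp
 have s: "slab (xpos h (i-1)+reach h dl i West+r)=i"
 by (rule slab_eq[OF Centre(2)])
 (use r b xpos_step[OF Centre(2)] reach_room(1)[OF Centre(2,3), of West] reach_room(1)[OF Centre(2,3), of East] in linarith)+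
 show ?thesis unfolding r(3) Centre(1) edge_path.simps edge_at_def Let_def fst_conv snd_conv s using Centre(3) b r by auto
 next
 case (Diag i a b)
 let ?w="mouth_width dl i a"
 have "r/sqrt 2<(h i - ?w)/sqrt 2/sqrt 2" using r Diag by (intro divide_strict_right_mono) auto
 moreover define ka where "ka=r/sqrt 2"
 ultimately have "0<ka" "ka<(h i - ?w)/2" using r(1) by (simp_all del: divide_divide_eq_left add: divide_divide_eq_left[of _ "sqrt 2" "sqrt 2"])
 hence k: "0<ka" "ka<h i/2" "?w/2<h i/2-ka"
 using width_bounds(1)[OF Diag(3), of a] by (auto simp: field_simps)
 thus ?thesis unfolding r(3) Diag(1) path_chart ka_def[symmetric]
 using edge_at_chart(2)[OF Diag(2,3) k(1,2), where a=a and b=b and et="h i/2-ka"] by simp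
 next
 case (Arc i a b)
 let ?w="mouth_width dl i a"
 define xi where "xi=(h i - ?w)/2+r"
 define et where "et=(h i + ?w)/4-xi^2/(h i - ?w)"
 have xi: "(h i - ?w)/2<xi" "xi<room_reach (h i) ?w" using r Arc by (auto simp: xi_def reach_eq)
 note w=width_bounds[OF Arc(3), of a]
 note f=arc_facts[OF w(1,2) w(1,2) w(3)[OF Arc(4)] xi et_def]
 have "0<xi" "xi<h i/2" using xi w(2) reach_room(2)[OF Arc(2,3), of a] by (auto simp: reach_eq)
 thus ?thesis unfolding r(3) Arc(1) path_chart xi_def[symmetric] et_def[symmetric]
 using edge_at_chart(2)[OF Arc(2,3), of xi et a b] f by simp
 next
 case (Join i a)
 have "r<reach h dl i a" using r Join by simp
 thus ?thesis unfolding r(3) Join(1) path_chart(4)[where k=North]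
 using edge_at_chart(1)[OF Join(2,3) r(1), of a North] reach_room(2)[OF Join(2,3), of a] by simp
 qed
qed

lemma edge_sets_disjoint: "e : edges ==> e' : edges ==> p : edge_set h dl e ==> p : edge_set h dl e' ==> e=e'"
 using edge_at_edge by metis

lemma regions_disjoint: "e : edges ==> e' : edges ==> e ~= e' ==> region h dl e \<inter> region h dl e'={}"
 using edge_sets_disjoint unfolding region_def by blast

definition seams :: "nat => side => point set" where
 "seams i a={p. fst p=0} \<union> {p. fst p=h i/2} \<union> {p. snd p=0} \<union> {p. snd p=mouth_width dl i a/2} \<union>
 {p. fst p=(h i-mouth_width dl i a)/2} \<union> {p. fst p=reach h dl i a} \<union>
 {p. mouth_width dl i a/2/reach h dl i a * fst p+snd p=mouth_width dl i a/2}"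

lemma negligible_line: "(a, b) ~= (0, 0) ==> negligible {p :: point. a * fst p+b * snd p=c}"
 using negligible_hyperplane[of "(a, b)" c] by (auto simp: inner_prod_def zero_prod_def)

lemma negligible_seams: "negligible (seams i a)"
proof -
 have "negligible {p :: point. fst p=c}" "negligible {p :: point. snd p=c}" "negligible {p :: point. m * fst p+snd p=c}" for c m
 using negligible_line[of 1 0 c] negligible_line[of 0 1 c] negligible_line[of m 1 c] by auto
 thus ?thesis unfolding seams_def by (intro negligible_Un)
qed

lemma negligible_chart: "negligible S ==> negligible (chart h i a b ` S)"
proof (rule negligible_differentiable_image_negligible)
 have "(chart h i a b has_derivative (%p. (inward a * fst p, half_sign b * snd p))) (at x within S)" for x
 unfolding chart_def[abs_def] by (auto intro!: derivative_eq_intros)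
 thus "chart h i a b differentiable_on S" unfolding differentiable_on_def differentiable_def by blast
qed auto

lemma side_point:
 assumes i: "1 <= i" and x: "xpos h (i-1)<x" "x<xpos h i"
 obtains a b xi et where "(x, y)=chart h i a b (xi, et)" "0<xi" "xi <= h i/2" "et=\<bar>y\<bar>"
proof -
 define b where "b=(if 0 <= y then North else South)"
 have y: "y=half_sign b * \<bar>y\<bar>" by (simp add: b_def)
 show thesis
 proof (cases "x-xpos h (i-1) <= h i/2")
 case True
 show thesis by (rule that[of West b "x-xpos h (i-1)" "\<bar>y\<bar>"]) (use True x y in \<open>auto simp: chart_def\<close>)
 next
 case False
 show thesis by (rule that[of East b "xpos h i-x" "\<bar>y\<bar>"]) (use False x y xpos_step[OF i] in \<open>auto simp: chart_def\<close>)
 qed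
qed

text \<open>Away from the seams every point of a room lies in the cell of exactly one kind of edge, determined by comparing its local coordinates with the mouth width and the reach.\<close>

lemma cells_cover:
 assumes x: "p : Omega h dl" and no: "!!i a b. 1 <= i ==> p ~: chart h i a b ` seams i a"
 shows "EX e:edges. p : cell h dl e"
proof -
 obtain x y where p: "p=(x, y)" by (cases p)
 have nw: "x ~= wall_x h i a" if "1 <= i" for i a
 proof
 assume "x=wall_x h i a"
 hence "p=chart h i a North (0, y)" by (simp add: p chart_def)
 moreover have "(0, y) : seams i a" by (simp add: seams_def)
 ultimately show False using no[OF that] by blast
 qed
 obtain i where i: "1 <= i" "xpos h (i-1) <= x" "x <= xpos h i" "even i --> \<bar>y\<bar><dl i/2" "odd i --> \<bar>y\<bar><h i/2"
 using x unfolding Omega_def room_def passage_def p by (auto dest: less_imp_le)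
 hence x: "xpos h (i-1)<x" "x<xpos h i" using nw[OF i(1), of West] nw[OF i(1), of East] by auto
 show ?thesis
 proof (cases "even i")
 case True
 hence "p : cell h dl (Pass i)" using i x by (auto simp: p)
 moreover have "Pass i : edges" using True i by (auto simp: edges_reg_def)
 ultimately show ?thesis by blast
 next
 case False
 obtain a b xi et where c: "(x, y)=chart h i a b (xi, et)" "0<xi" "xi <= h i/2" "et=\<bar>y\<bar>"
 by (rule side_point[OF i(1) x])
 let ?w="mouth_width dl i a"
 let ?R="reach h dl i a"
 have R: "0<?R" "?R <= h i/2" "(h i - ?w)/2 <= ?R" using reach_room[OF i(1) False] by auto
 note w=width_bounds[OF False, of a]
 have "(xi, et) ~: seams i a" using no[OF i(1), of a b] c by (auto simp: p)
 hence s: "xi ~= h i/2" "et ~= 0" "et ~= ?w/2" "xi ~= (h i - ?w)/2" "xi ~= ?R" "?w/2 / ?R * xi+et ~= ?w/2"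
 by (auto simp: seams_def)
 have et: "0<et" "et<h i/2" using s c i False by auto
 have sl: "?w/2*(1-xi / ?R) = ?w/2 - ?w/2 / ?R * xi" by (simp add: algebra_simps)
 have E: "Centre i : edges" "Diag i a b : edges" "has_mouth i a ==> Arc i a b : edges" "has_mouth i a ==> Join i a : edges"
 using i False by (auto simp: edges_reg_def edges_sing_def)
 consider "?R<xi" | "xi<(h i - ?w)/2" "?w/2<et"
 | "xi<?R" "?w/2*(1-xi / ?R)<et" "(h i - ?w)/2<xi \<or> et<?w/2" "0<?w"
 | "xi<?R" "et<?w/2*(1-xi / ?R)" "0<?w"
 proof -
 have w0: "0<?w" if "\<not> (xi<(h i - ?w)/2 & ?w/2<et)"
 proof (rule ccontr)
 assume "\<not> 0<?w"
 hence "?w=0" using w by simp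
 thus False using that et c(3) s(1) by simp
 qed
 thus thesis using that s sl by fastforce
 qed
 thus ?thesis
 proof cases
 case 1
 have "x-xpos h (i-1)=(case a of West => xi | East => h i-xi)" using c(1) xpos_step[OF i(1)] by (cases a) (auto simp: chart_def)
 moreover have "reach h dl i (opposite a) <= h i/2" by (rule reach_room(2)[OF i(1) False])
 ultimately have "p : cell h dl (Centre i)"
 unfolding p cell.simps mem_Times_iff fst_conv snd_conv
 using 1 et c(2-4) s(1) xpos_step[OF i(1)] by (cases a) auto
 thus ?thesis using E by blast
 next
 case 2
 hence "p : cell h dl (Diag i a b)" using c et by (auto simp: p)
 thus ?thesis using E by blast
 next
 case 3
 hence "p : cell h dl (Arc i a b)" using c et by (auto simp: p Let_def)
 thus ?thesis using E(3)[OF width_pos_has_mouth[OF 3(4)]] by blast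
 next
 case 4
 have "p=chart h i a North (xi, y)" using c(1) by (simp add: p chart_def)
 hence "p : cell h dl (Join i a)" using c 4 by (auto simp: Let_def)
 thus ?thesis using E(4)[OF width_pos_has_mouth[OF 4(3)]] by blast
 qed
 qed
qed

lemma negligible_uncovered: "negligible (Omega h dl-(\<Union>e\<in>edges. cell h dl e))"
proof (rule negligible_subset)
 show "negligible (\<Union>(i, a, b)\<in>UNIV. chart h i a b ` seams i a)"
 by (rule negligible_countable_Union) (auto intro!: negligible_chart negligible_seams)
 show "Omega h dl-(\<Union>e\<in>edges. cell h dl e) <= (\<Union>(i, a, b)\<in>UNIV. chart h i a b ` seams i a)"
 using cells_cover by fastforce
qed

lemma region_cell: "e : edges ==> negligible (region h dl e-cell h dl e)"
proof (rule negligible_subset[OF negligible_uncovered])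
 assume e: "e : edges"
 show "region h dl e-cell h dl e <= Omega h dl-(\<Union>e\<in>edges. cell h dl e)"
 proof
 fix x assume x: "x : region h dl e-cell h dl e"
 have "x ~: cell h dl e'" if e': "e' : edges" for e'
 proof
 assume "x : cell h dl e'"
 hence "x : region h dl e'" using cell_subset_region[OF e'] by blast
 hence "e=e'" using regions_disjoint[OF e e'] x by blast
 thus False using x \<open>x : cell h dl e'\<close> by blast
 qed
 thus "x : Omega h dl-(\<Union>e\<in>edges. cell h dl e)" using x by (auto simp: region_def)
 qed
qed

section \<open>Arc length\<close>

definition path_deriv :: "edge => real => point" where
 "path_deriv e r=(case e of Pass i => (1, 0) | Centre i => (1, 0)
 | Diag i a b => (inward a/sqrt 2,-half_sign b/sqrt 2)
 | Arc i a b => (inward a,-half_sign b * (2*((h i-mouth_width dl i a)/2+r)/(h i-mouth_width dl i a)))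
 | Join i a => (inward a, 0))"

lemma path_has_deriv: "(edge_path h dl e has_vector_derivative path_deriv e r) (at r)"
proof -
 have P: "((%r. (f r, g r)) has_vector_derivative (f', g')) (at r)"
 if "(f has_real_derivative f') (at r)" "(g has_real_derivative g') (at r)" for f g f' g'
 using has_vector_derivative_Pair[OF that[unfolded has_real_derivative_iff_has_vector_derivative]] .
 show ?thesis
 proof (cases e)
 case (Arc i a b)
 define q where "q=inverse (h i-mouth_width dl i a)"
 have eq: "edge_path h dl (Arc i a b)=(%r. (wall_x h i a+inward a * ((h i-mouth_width dl i a)/2+r),
 half_sign b * ((h i+mouth_width dl i a)/4-((h i-mouth_width dl i a)/2+r)^2 * q)))"
 by (rule ext) (simp only: edge_path.simps Let_def q_def divide_inverse[of _ "h i-mouth_width dl i a"])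
 have d: "path_deriv (Arc i a b) r=(inward a,-half_sign b * (2*((h i-mouth_width dl i a)/2+r) * q))"
 by (simp only: path_deriv_def edge.case q_def divide_inverse[of _ "h i-mouth_width dl i a"])
 show ?thesis unfolding Arc eq d
 by (rule P) (auto intro!: derivative_eq_intros)
 next
 case (Diag i a b)
 define q where "q=inverse (sqrt 2)"
 have eq: "edge_path h dl (Diag i a b)=(%r. (wall_x h i a+inward a * (r * q), half_sign b * (h i/2-r * q)))"
 by (rule ext) (simp only: edge_path.simps q_def divide_inverse[of _ "sqrt 2"])
 have d: "path_deriv (Diag i a b) r=(inward a * q,-half_sign b * q)"
 by (simp only: path_deriv_def edge.case q_def divide_inverse[of _ "sqrt 2"])
 show ?thesis unfolding Diag eq d
 by (rule P) (auto intro!: derivative_eq_intros)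
 next
 case (Pass i)
 have eq: "edge_path h dl (Pass i)=(%r. (xpos h (i-1)+r, 0))" by (rule ext) simp
 show ?thesis unfolding Pass eq path_deriv_def edge.case by (rule P) (auto intro!: derivative_eq_intros)
 next
 case (Centre i)
 have eq: "edge_path h dl (Centre i)=(%r. (xpos h (i-1)+reach h dl i West+r, 0))" by (rule ext) simp
 show ?thesis unfolding Centre eq path_deriv_def edge.case by (rule P) (auto intro!: derivative_eq_intros)
 next
 case (Join i a)
 have eq: "edge_path h dl (Join i a)=(%r. (wall_x h i a+inward a * r, 0))" by (rule ext) simp
 show ?thesis unfolding Join eq path_deriv_def edge.case by (rule P) (auto intro!: derivative_eq_intros)
 qed
qed

lemma path_speed:
 shows "1 <= norm (path_deriv e r)" "continuous_on A (%r. norm (path_deriv e r))"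
proof -
 have "1 <= norm (u, v)" if "\<bar>u\<bar>=1" for u v :: real
 using norm_fst_le[of u v] that by (simp add: norm_prod_def real_le_rsqrt)
 moreover have "norm (inward a/sqrt 2,-half_sign b/sqrt 2)=1" for a b
 by (simp add: norm_prod_def power_divide)
 ultimately show "1 <= norm (path_deriv e r)" by (cases e) (auto simp: path_deriv_def)
 show "continuous_on A (%r. norm (path_deriv e r))"
 unfolding path_deriv_def divide_inverse
 by (cases e; simp only: edge.case; intro continuous_intros)
qed

lemma arc_length_eq: "arc_length h dl e r=integral {0..r} (%rh. norm (path_deriv e rh))"
 unfolding arc_length_def using vector_derivative_at[OF path_has_deriv] by simp

text \<open>All parametrisations have speed at least 1, so the inverse of the arc length does not increase distances.\<close>

lemma arc_length_diff:
 assumes "0 <= r" "r <= r'"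
 shows "r'-r <= arc_length h dl e r'-arc_length h dl e r"
proof -
 have int: "(%rh. norm (path_deriv e rh)) integrable_on {u..v}" for u v
 by (rule integrable_continuous_interval[OF path_speed(2)])
 have "arc_length h dl e r+integral {r..r'} (%rh. norm (path_deriv e rh))=arc_length h dl e r'"
 unfolding arc_length_eq by (rule Henstock_Kurzweil_Integration.integral_combine[OF assms int])
 moreover have "integral {r..r'} (%rh. 1) <= integral {r..r'} (%rh. norm (path_deriv e rh))"
 using path_speed(1) by (intro integral_le int) auto
 ultimately show ?thesis using assms by simp
qed

lemma arc_length_inj: "inj_on (arc_length h dl e) {0..b}"
proof (rule inj_onI)
 fix x y assume *: "x : {0..b}" "y : {0..b}" "arc_length h dl e x=arc_length h dl e y"
 have b: "0 <= x" "0 <= y" using * by auto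
 show "x=y"
 proof (cases "x <= y")
 case True
 thus ?thesis using arc_length_diff[OF b(1) True, of e] *(3) by linarith
 next
 case False
 hence "y <= x" by simp
 thus ?thesis using arc_length_diff[OF b(2) \<open>y <= x\<close>, of e] *(3) by linarith
 qed
qed

lemma arc_length_0 [simp]: "arc_length h dl e 0=0" by (simp add: arc_length_def)

lemma arc_length_onto:
 assumes "sg : {0..edge_length h dl e}" "0 <= edge_end h dl e"
 obtains r where "0 <= r" "r <= edge_end h dl e" "arc_length h dl e r=sg"
proof -
 have "continuous_on {0..edge_end h dl e} (arc_length h dl e)"
 unfolding arc_length_eq by (rule indefinite_integral_continuous_1[OF integrable_continuous_interval[OF path_speed(2)]])
 thus thesis using IVT'[of "arc_length h dl e" 0 sg "edge_end h dl e"] assms that by (auto simp: edge_length_def)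
qed

lemma edge_end_pos: "e : edges ==> 0<edge_end h dl e"
proof (induction rule: edges_cases)
 case (Pass i) thus ?case using h_pos by simp
next
 case (Centre i) thus ?case using reach_sum[of i] by simp
next
 case (Diag i a b) thus ?case using width_bounds(2)[of i a] by simp
next
 case (Arc i a b) thus ?case using reach_room(5)[of i a] by simp
next
 case (Join i a) thus ?case using reach_room(1)[of i a] by simp
qed

lemma edge_point_arc_length:
 assumes "0 <= r" "r <= edge_end h dl e"
 shows "edge_point h dl e (arc_length h dl e r)=edge_path h dl e r"
 unfolding edge_point_def using assms inv_into_f_f[OF arc_length_inj] by simp

lemma arc_interval_param:
 assumes e: "e : edges" and sg: "sg : arc_interval h dl e"
 obtains r where "0<r" "r<edge_end h dl e" "arc_length h dl e r=sg" "edge_point h dl e sg=edge_path h dl e r"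
proof -
 obtain r where r: "0 <= r" "r <= edge_end h dl e" "arc_length h dl e r=sg"
 using arc_length_onto[of sg e] sg edge_end_pos[OF e] by auto
 have "r ~= 0" "r ~= edge_end h dl e" using r(3) sg by (auto simp: edge_length_def)
 thus thesis using that[of r] r edge_point_arc_length[OF r(1,2)] by auto
qed

lemma edge_point_in_edge: "e : edges ==> sg : arc_interval h dl e ==> edge_point h dl e sg : edge_set h dl e"
 by (rule arc_interval_param) (auto simp: edge_set_def)

lemma arc_length_in_interval:
 assumes "0<r" "r<edge_end h dl e"
 shows "arc_length h dl e r : arc_interval h dl e"
 using arc_length_diff[of 0 r e] arc_length_diff[of r "edge_end h dl e" e] assms by (auto simp: edge_length_def)

end

lemma AE_lebesgue_on_negligible:
 assumes "G : sets lebesgue" "negligible N" "!!x. x : G ==> x ~: N ==> P x"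
 shows "AE x in lon G. P x"
proof -
 have "AE x in lebesgue. x ~: N" using assms(2) by (intro AE_not_in) (simp add: negligible_iff_null_sets)
 hence "AE x in lebesgue. x : G --> P x" using assms(3) by (elim eventually_mono) blast
 thus ?thesis using assms(1) by (simp add: AE_restrict_space_iff)
qed

lemma negligible_of_AE_lebesgue_on:
 assumes G: "G : sets lebesgue" and P: "AE x in lon G. P x"
 shows "negligible {x : G. \<not> P x}"
proof -
 have "AE x in lebesgue. x : G --> P x" using P G by (simp add: AE_restrict_space_iff)
 from AE_E3[OF this] obtain N where N: "N : null_sets lebesgue" "!!x. x : space lebesgue-N ==> x : G --> P x" by blast
 have "negligible N" using N(1) by (simp add: negligible_iff_null_sets)
 moreover have "{x : G. \<not> P x} <= N" using N(2) by auto
 ultimately show ?thesis by (rule negligible_subset)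
qed

lemma negligible_Times_UNIV:
 fixes R :: "real set"
 assumes "negligible R"
 shows "negligible (R \<times> (UNIV :: real set))"
proof -
 have "R : null_sets lebesgue" using assms by (simp add: negligible_iff_null_sets)
 hence "EX N:null_sets lborel. R <= N" by (simp only: null_sets_completion_iff2)
 then obtain N where N: "N : null_sets lborel" "R <= N" by (rule bexE)
 have "N \<times> (UNIV :: real set) : null_sets (lborel \<Otimes>\<^sub>M lborel)"
 using N(1) by (auto simp: null_sets_def lborel.emeasure_pair_measure_Times)
 hence "N \<times> (UNIV :: real set) : null_sets lborel" by (simp add: lborel_prod)
 hence "N \<times> (UNIV :: real set) : null_sets lebesgue" by (rule null_sets_completionI)
 hence "negligible (N \<times> (UNIV :: real set))" by (simp add: negligible_iff_null_sets)
 thus ?thesis by (rule negligible_subset) (use N(2) in blast)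
qed

context rooms_passages
begin

lemma region_almost_open: "e : edges ==> almost_open (region h dl e)"
 unfolding almost_open_def by (rule exI[of _ "cell h dl e"]) (simp add: open_cell cell_subset_region region_cell)

lemma region_sets: "e : edges ==> region h dl e : sets lebesgue"
 by (rule almost_open_sets[OF region_almost_open])

lemma infinite_edges: "infinite edges"
proof
 assume "finite edges"
 moreover have "range (%n. Pass (2 * Suc n)) <= edges" by (auto simp: edges_reg_def)
 ultimately have "finite (range (%n. Pass (2 * Suc n)))" by (rule finite_subset[rotated])
 moreover have "inj (%n. Pass (2 * Suc n))" by (rule injI) simp
 ultimately show False using range_inj_infinite by metis
qed

lemma rpartition: "measurable_partition (Omega h dl) edges (region h dl)"
proof
 show "countable edges" by (rule countableI_type)
 show "infinite edges" by (rule infinite_edges)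
 show "Omega h dl : sets lebesgue" using Omega_open by (simp add: borel_open)
 show "region h dl e : sets lebesgue" if "e : edges" for e by (rule region_sets[OF that])
 show "region h dl e <= Omega h dl" for e by (auto simp: region_def)
 show "region h dl e \<inter> region h dl e'={}" if "e : edges" "e' : edges" "e ~= e'" for e e' by (rule regions_disjoint[OF that])
 show "negligible (Omega h dl-(\<Union>e\<in>edges. region h dl e))"
 by (rule negligible_subset[OF negligible_uncovered]) (use cell_subset_region in blast)
qed

lemma foot_has_deriv: "EX d. ((%r. foot h dl e k r) has_vector_derivative d) (at r)"
proof -
 have P: "((%r. (A+B * r, C+D * r)) has_vector_derivative (B, D)) (at r)" for A B C D :: real
 by (rule has_vector_derivative_Pair; unfold has_real_derivative_iff_has_vector_derivative[symmetric]) (auto intro!: derivative_eq_intros)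
 have "EX A B C D. foot h dl e k=(%r. (A+B * r, C+D * r))"
 proof (cases e)
 case (Pass i)
 show ?thesis by (rule exI[of _ "xpos h (i-1)"], rule exI[of _ 1], rule exI[of _ "half_sign k * (dl i/2)"], rule exI[of _ 0]) (rule ext, simp add: Pass)
 next
 case (Centre i)
 show ?thesis by (rule exI[of _ "xpos h (i-1)+reach h dl i West"], rule exI[of _ 1], rule exI[of _ "half_sign k * (h i/2)"], rule exI[of _ 0]) (rule ext, simp add: Centre)
 next
 case (Diag i a b)
 show ?thesis
 by (rule exI[of _ "wall_x h i a"], rule exI[of _ "if k=North then inward a * (1/sqrt 2) else 0"],
 rule exI[of _ "half_sign b * (h i/2)"], rule exI[of _ "if k=North then 0 else-(half_sign b * (1/sqrt 2))"])
 (rule ext, simp add: Diag chart_def right_diff_distrib)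
 next
 case (Arc i a b)
 let ?w="mouth_width dl i a"
 show ?thesis
 by (rule exI[of _ "wall_x h i a+(if k=North then inward a * ((h i - ?w)/2) else 0)"], rule exI[of _ "if k=North then inward a else 0"],
 rule exI[of _ "half_sign b * (if k=North then h i/2 else ?w/2)"], rule exI[of _ 0])
 (rule ext, simp add: Arc chart_def Let_def distrib_left)
 next
 case (Join i a)
 show ?thesis by (rule exI[of _ "wall_x h i a"], rule exI[of _ 0], rule exI[of _ "half_sign k * (mouth_width dl i a/2)"], rule exI[of _ 0]) (rule ext, simp add: Join chart_def)
 qed
 then obtain A B C D where eq: "foot h dl e k=(%r. (A+B * r, C+D * r))" by (elim exE)
 show ?thesis unfolding eq by (rule exI, rule P)
qed

text \<open>The exceptional set is the image, under a differentiable map of the parameter and the position on the segment, of a null set times the line; the null set of parameters is obtained from the one of arc lengths by a map that does not increase distances.\<close>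

lemma tau_AE_const:
 assumes e: "e : edges" and g: "AE sg in lon (arc_interval h dl e). g (edge_point h dl e sg)=c"
 shows "AE x in lon (region h dl e). (g \<circ> tau h dl) x=c"
proof -
 define N where "N={sg : arc_interval h dl e. g (edge_point h dl e sg) ~= c}"
 have N: "negligible N" unfolding N_def by (rule negligible_of_AE_lebesgue_on[OF _ g]) simp
 let ?ps="inv_into {0..edge_end h dl e} (arc_length h dl e)"
 define R where "R={r. 0<r & r<edge_end h dl e & arc_length h dl e r : N}"
 have inv: "?ps (arc_length h dl e r)=r" if "0 <= r" "r <= edge_end h dl e" for r
 using inv_into_f_f[OF arc_length_inj] that by simp
 have "negligible (?ps ` N)"
 proof (rule negligible_locally_Lipschitz_image[OF _ N])
 fix sg assume sg: "sg : N"
 have "norm (?ps sg' - ?ps sg) <= 1 * norm (sg'-sg)" if sg': "sg' : N" for sg'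
 proof -
 obtain r where r: "0<r" "r<edge_end h dl e" "arc_length h dl e r=sg" by (rule arc_interval_param[OF e, of sg]) (use sg N_def in auto)
 obtain r' where r': "0<r'" "r'<edge_end h dl e" "arc_length h dl e r'=sg'" by (rule arc_interval_param[OF e, of sg']) (use sg' N_def in auto)
 have p: "?ps sg=r" "?ps sg'=r'" using inv[of r] inv[of r'] r r' by auto
 show ?thesis
 proof (cases "r <= r'")
 case True
 thus ?thesis unfolding p using arc_length_diff[of r r' e] r r' by simp
 next
 case False
 thus ?thesis unfolding p using arc_length_diff[of r' r e] r r' by simp
 qed
 qed
 thus "EX T B. open T & sg : T & (ALL y:N \<inter> T. norm (?ps y - ?ps sg) <= B * norm (y-sg))"
 by (intro exI[of _ UNIV] exI[of _ 1]) auto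
 qed simp
 hence R: "negligible R"
 proof (rule negligible_subset)
 show "R <= ?ps ` N"
 proof
 fix r assume r: "r : R"
 hence "?ps (arc_length h dl e r)=r" by (intro inv) (auto simp: R_def)
 thus "r : ?ps ` N" using r unfolding R_def by (metis (mono_tags, lifting) image_eqI mem_Collect_eq)
 qed
 qed
 define F where "F k p=(1-snd p) *\<^sub>R edge_path h dl e (fst p)+snd p *\<^sub>R foot h dl e k (fst p)" for k and p :: point
 have F: "negligible (F k ` (R \<times> UNIV))" for k
 proof (rule negligible_differentiable_image_negligible[OF _ negligible_Times_UNIV[OF R]])
 show "F k differentiable_on R \<times> UNIV"
 unfolding differentiable_on_def
 proof
 fix p :: point
 obtain d where d: "((%r. foot h dl e k r) has_vector_derivative d) (at (fst p))" using foot_has_deriv by blast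
 have 1: "((%p. edge_path h dl e (fst p)) has_derivative (%v. fst v *\<^sub>R path_deriv e (fst p))) (at p within R \<times> UNIV)"
 using path_has_deriv[of e "fst p"] unfolding has_vector_derivative_def
 by (rule has_derivative_compose[OF has_derivative_fst[OF has_derivative_ident]])
 have 2: "((%p. foot h dl e k (fst p)) has_derivative (%v. fst v *\<^sub>R d)) (at p within R \<times> UNIV)"
 using d unfolding has_vector_derivative_def
 by (rule has_derivative_compose[OF has_derivative_fst[OF has_derivative_ident]])
 have s: "(snd has_derivative snd) (at p within R \<times> (UNIV :: real set))" by (rule has_derivative_snd[OF has_derivative_ident])
 show "F k differentiable (at p within R \<times> UNIV)"
 unfolding F_def[abs_def]
 by (rule differentiableI,
 rule has_derivative_add[OF has_derivative_scaleR[OF has_derivative_diff[OF has_derivative_const s] 1] has_derivative_scaleR[OF s 2]])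
 qed
 qed simp
 have neg: "negligible ((region h dl e-cell h dl e) \<union> (F North ` (R \<times> UNIV) \<union> F South ` (R \<times> UNIV)))"
 using region_cell[OF e] F by (intro negligible_Un)
 show ?thesis
 proof (rule AE_lebesgue_on_negligible[OF region_sets[OF e] neg])
 fix x assume x: "x : region h dl e" "x ~: (region h dl e-cell h dl e) \<union> (F North ` (R \<times> UNIV) \<union> F South ` (R \<times> UNIV))"
 hence xc: "x : cell h dl e" by blast
 obtain k r where r: "0<r" "r<edge_end h dl e" "x : closed_segment (edge_path h dl e r) (foot h dl e k r)"
 using cell_ray(2)[OF e xc] by blast
 have t: "tau h dl x=edge_path h dl e r" by (rule tau_on_segment[OF e r cell_ray(1)[OF e xc]])
 obtain s where s: "x=(1-s) *\<^sub>R edge_path h dl e r+s *\<^sub>R foot h dl e k r" using r(3) unfolding closed_segment_def by blast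
 have xF: "x=F k (r, s)" by (simp add: F_def s)
 show "(g \<circ> tau h dl) x=c"
 proof (rule ccontr)
 assume "(g \<circ> tau h dl) x ~= c"
 hence "g (edge_point h dl e (arc_length h dl e r)) ~= c" using t r edge_point_arc_length[of r e] by simp
 hence "r : R" using r arc_length_in_interval[OF r(1,2)] by (simp add: R_def N_def)
 hence "x : F k ` (R \<times> UNIV)" unfolding xF by blast
 thus False using x(2) by (cases k) auto
 qed
 qed
qed

subsection \<open>Passages\<close>

lemma tau_pass:
 assumes i: "1 <= i" "even i" and p: "p : cell h dl (Pass i)"
 shows "tau h dl p=(fst p, 0)"
proof -
 have e: "Pass i : edges" using i by (auto simp: edges_reg_def)
 obtain k r where r: "0<r" "r<edge_end h dl (Pass i)" "p : closed_segment (edge_path h dl (Pass i) r) (foot h dl (Pass i) k r)"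
 using cell_ray(2)[OF e p] by blast
 obtain s where "p=(1-s) *\<^sub>R (xpos h (i-1)+r, 0)+s *\<^sub>R (xpos h (i-1)+r, half_sign k * (dl i/2))"
 using r(3) unfolding closed_segment_def by auto
 hence "fst p=xpos h (i-1)+r" by (simp add: left_diff_distrib)
 thus ?thesis using tau_on_segment[OF e r cell_ray(1)[OF e p]] by simp
qed

lemma grad_norm_pass:
 assumes i: "1 <= i" "even i" and p: "p : cell h dl (Pass i)"
 shows "grad_norm (Omega h dl) p=1"
proof -
 have "((%q :: point. (fst q, 0 :: real)) has_derivative (%v. (fst v, 0))) (at p)"
 by (auto intro!: derivative_eq_intros)
 hence "(ridge_map (Omega h dl) has_derivative (%v. (fst v, 0))) (at p)"
 by (rule has_derivative_transform_within_open[OF _ open_cell p]) (simp add: tau_pass[OF i, unfolded tau_def])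
 hence "fd (ridge_map (Omega h dl)) (at p)=(%v. (fst v, 0))" by (rule frechet_derivative_at[symmetric])
 moreover have "(\<Sum>b\<in>(Basis :: point set). (norm (fst b, 0 :: real))^2)=1"
 proof -
 have B: "(Basis :: point set)={(1, 0), (0, 1)}" by (auto simp: Basis_prod_def)
 show ?thesis unfolding B by (simp add: norm_prod_def)
 qed
 ultimately show ?thesis by (simp add: grad_norm_def)
qed

text \<open>In a passage \<open>\<tau>\<close> is the projection to the axis.\<close>

lemma alpha_pass:
 assumes i: "1 <= i" "even i" and sg: "sg : arc_interval h dl (Pass i)"
 shows "alpha h dl (Pass i) sg=dl i"
proof -
 have e: "Pass i : edges" using i by (auto simp: edges_reg_def)
 note d=dl_bounds[OF i]
 obtain r where r: "0<r" "r<edge_end h dl (Pass i)" "edge_point h dl (Pass i) sg=edge_path h dl (Pass i) r"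
 by (rule arc_interval_param[OF e sg])
 define x where "x=xpos h (i-1)+r"
 have x: "xpos h (i-1)<x" "x<xpos h i" using r xpos_step[OF i(1)] by (auto simp: x_def)
 have t: "edge_point h dl (Pass i) sg=(x, 0)" using r(3) by (simp add: x_def)
 obtain rh where n: "near_data (Pass i) r rh" using near_data_ex[OF e r(1,2)] ..
 hence "dist (edge_path h dl (Pass i) r) (foot h dl (Pass i) North r)=rh" unfolding near_data_def by blast
 hence "dist (x, 0) (x, dl i/2)=rh" by (simp add: x_def)
 hence rh: "rh=dl i/2" using d by (simp add: dist_vertical)
 have l: "segment_length (Omega h dl) (x, 0)=dl i/2"
 proof -
 have nd: "0<rh" "ball (edge_path h dl (Pass i) r) rh <= Omega h dl" "foot h dl (Pass i) North r ~: Omega h dl"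
 "dist (edge_path h dl (Pass i) r) (foot h dl (Pass i) North r)=rh" using n unfolding near_data_def by blast+
 have "edge_path h dl (Pass i) r=(x, 0)" by (simp add: x_def)
 thus ?thesis using near_pointI(2)[OF Omega_open nd(2,1,3,4)] rh unfolding segment_length_def by simp
 qed
 have near: "fst z=x & \<bar>snd z\<bar>=dl i/2" if z: "z : near_points (Omega h dl) (x, 0)" for z
 proof -
 have "z ~: Omega h dl" using z Omega_open by (auto simp: near_points_def frontier_def interior_open)
 hence ns: "z ~: strip i" using strip_subset[OF i] by blast
 have "dist (x, 0) z=dl i/2" using z l by (simp add: near_points_def segment_length_def)
 hence "sqrt ((x-fst z)^2+(snd z)^2)=dl i/2" by (simp add: dist_prod_def dist_real_def)
 hence sq: "(x-fst z)^2+(snd z)^2=(dl i/2)^2" by (metis real_sqrt_pow2 sum_power2_ge_zero)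
 have "(x-fst z)^2 <= (dl i/2)^2" "(snd z)^2 <= (dl i/2)^2" using sq zero_le_power2[of "x-fst z"] zero_le_power2[of "snd z"] by linarith+
 hence "\<bar>x-fst z\<bar> <= \<bar>dl i/2\<bar>" "\<bar>snd z\<bar> <= \<bar>dl i/2\<bar>" by (simp_all only: abs_le_square_iff)
 hence b: "\<bar>x-fst z\<bar> <= dl i/2" "\<bar>snd z\<bar> <= dl i/2" using d by simp_all
 have "\<bar>snd z\<bar>=dl i/2"
 proof (rule ccontr)
 assume "\<bar>snd z\<bar> ~= dl i/2"
 hence "\<bar>snd z\<bar><dl i/2" using b by simp
 moreover have "xpos h (i-1)-dl i<fst z" "fst z<xpos h i+dl i" using b x d by linarith+
 ultimately have "z : strip i" unfolding strip_def mem_Times_iff by auto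
 thus False using ns by blast
 qed
 moreover have "(snd z)^2=(dl i/2)^2" using calculation by (metis power2_abs)
 hence "fst z=x" using sq by simp
 ultimately show ?thesis by blast
 qed
 have "(x, 0) : skeleton (Omega h dl)" using foot_near(2)[OF e r(1,2)] by (simp add: x_def)
 then obtain y z where yz: "y : near_points (Omega h dl) (x, 0)" "z : near_points (Omega h dl) (x, 0)" "y ~= z"
 by (auto simp: skeleton_def)
 have plus: "near_plus (Omega h dl) (x, 0) : near_points (Omega h dl) (x, 0)"
 unfolding near_plus_def by (rule someI[of "%y. y : near_points (Omega h dl) (x, 0)", OF yz(1)])
 have "EX q. q : near_points (Omega h dl) (x, 0) & q ~= near_plus (Omega h dl) (x, 0)" using yz by metis
 from someI_ex[OF this] have minus: "near_minus (Omega h dl) (x, 0) : near_points (Omega h dl) (x, 0)"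
 unfolding near_minus_def by blast
 have one: "grad_norm (Omega h dl) (segment_point (Omega h dl) (x, 0) s)=1" if s: "s : {- (dl i/2)<..<dl i/2}" for s
 proof (rule grad_norm_pass[OF i])
 define q where "q=(if 0 <= s then near_plus (Omega h dl) (x, 0) else near_minus (Omega h dl) (x, 0))"
 have q: "fst q=x" "\<bar>snd q\<bar>=dl i/2" using near plus minus by (auto simp: q_def)
 have sp: "segment_point (Omega h dl) (x, 0) s=(x, 0)+(\<bar>s\<bar>/(dl i/2)) *\<^sub>R (q-(x, 0))"
 by (simp only: segment_point_def l q_def)
 have f: "fst (segment_point (Omega h dl) (x, 0) s)=x" unfolding sp by (simp add: q)
 have "\<bar>snd (segment_point (Omega h dl) (x, 0) s)\<bar>=\<bar>s\<bar>/(dl i/2) * \<bar>snd q\<bar>" unfolding sp using d by (simp add: abs_mult)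
 also have "\<dots>=\<bar>s\<bar>" unfolding q(2) using d by simp
 finally have "\<bar>snd (segment_point (Omega h dl) (x, 0) s)\<bar><dl i/2" using s by auto
 thus "segment_point (Omega h dl) (x, 0) s : cell h dl (Pass i)"
 unfolding cell.simps mem_Times_iff f using x by auto
 qed
 have "alpha h dl (Pass i) sg=(LINT s|lon {- (dl i/2)<..<dl i/2}. 1/grad_norm (Omega h dl) (segment_point (Omega h dl) (x, 0) s))"
 by (simp add: alpha_def Let_def t l)
 also have "\<dots>=(LINT s|lon {- (dl i/2)<..<dl i/2}. 1)"
 by (rule BI_cong) (auto simp: one)
 also have "\<dots>=dl i" using d by (simp add: measure_restrict_space)
 finally show ?thesis .
qed

lemma edge_length_pos: "e : edges ==> 0<edge_length h dl e"
 using arc_length_diff[of 0 "edge_end h dl e" e] edge_end_pos[of e] by (simp add: edge_length_def)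

lemma alpha_nonneg: "0 <= alpha h dl e sg"
 unfolding alpha_def Let_def by (rule BI_nonneg) (simp add: grad_norm_def sum_nonneg)

definition edge_index :: "edge => nat" where
 "edge_index e=(case e of Pass i => i | Centre i => i | Diag i a b => i | Arc i a b => i | Join i a => i)"

lemma finite_edge_index: "finite {e. edge_index e <= n}"
proof (rule finite_subset)
 have sides: "finite (UNIV :: side set)" "finite (UNIV :: half set)"
 by (rule finite_subset[of _ "{West, East}"]; auto intro: side.exhaust)
 (rule finite_subset[of _ "{North, South}"]; auto intro: half.exhaust)
 show "{e. edge_index e <= n} <= Pass ` {..n} \<union> Centre ` {..n} \<union> (%(i, a, b). Diag i a b) ` ({..n} \<times> UNIV) \<union>
 (%(i, a, b). Arc i a b) ` ({..n} \<times> UNIV) \<union> (%(i, a). Join i a) ` ({..n} \<times> UNIV)"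
 proof
 fix e assume "e : {e. edge_index e <= n}"
 thus "e : Pass ` {..n} \<union> Centre ` {..n} \<union> (%(i, a, b). Diag i a b) ` ({..n} \<times> UNIV) \<union>
 (%(i, a, b). Arc i a b) ` ({..n} \<times> UNIV) \<union> (%(i, a). Join i a) ` ({..n} \<times> UNIV)"
 by (cases e) (auto simp: edge_index_def image_iff)
 qed
 show "finite (Pass ` {..n} \<union> Centre ` {..n} \<union> (%(i, a, b). Diag i a b) ` ({..n} \<times> UNIV) \<union>
 (%(i, a, b). Arc i a b) ` ({..n} \<times> UNIV) \<union> (%(i, a). Join i a) ` ({..n} \<times> UNIV))"
 using sides finite_Prod_UNIV[OF sides] by (intro finite_UnI finite_imageI finite_cartesian_product) auto
qed

lemma regular_cell_rectangle:
 assumes e: "e : edges_reg"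
 shows "EX x1 x2 y1 y2. cell h dl e={x1<..<x2} \<times> {y1<..<y2} & x1 <= x2 & y1 <= y2 &
 x2-x1 <= h (edge_index e)+\<bar>h (edge_index e-1)\<bar> & y2-y1 <= h (edge_index e)+\<bar>h (edge_index e-1)\<bar>"
proof -
 have "e : edges" using e by blast
 thus ?thesis
 proof (cases rule: edges_cases)
 case (Pass i)
 show ?thesis
 by (rule exI[of _ "xpos h (i-1)"], rule exI[of _ "xpos h i"], rule exI[of _ "- (dl i/2)"], rule exI[of _ "dl i/2"])
 (use dl_bounds[OF Pass(2,3)] h_pos[OF Pass(2)] xpos_step[OF Pass(2)] in \<open>auto simp: Pass(1) edge_index_def\<close>)
 next
 case (Centre i)
 have "0<reach h dl i West" "0<reach h dl i East" using reach_room(1)[OF Centre(2,3)] by auto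
 thus ?thesis
 by (intro exI[of _ "xpos h (i-1)+reach h dl i West"] exI[of _ "xpos h i-reach h dl i East"] exI[of _ "- (h i/2)"] exI[of _ "h i/2"])
 (use reach_sum[OF Centre(2,3)] h_pos[OF Centre(2)] xpos_step[OF Centre(2)] in \<open>auto simp: Centre(1) edge_index_def\<close>)
 next
 case (Diag i a b)
 let ?w="mouth_width dl i a"
 define A where "A=(h i - ?w)/2"
 define B where "B = ?w/2"
 define C where "C=h i/2"
 note w=width_bounds(1,2)[OF Diag(3), of a]
 have b: "0 <= A" "B <= C" "A <= h i" "C-B <= h i" using w by (auto simp: A_def B_def C_def)
 have iff: "x : cell h dl e \<longleftrightarrow> (inward a * (fst x-wall_x h i a), half_sign b * snd x) : {0<..<A} \<times> {B<..<C}" for x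
 proof
 assume "x : cell h dl e"
 then obtain p where "p : {0<..<A} \<times> {B<..<C}" "x=chart h i a b p" unfolding Diag(1) cell.simps A_def B_def C_def by (rule imageE)
 thus "(inward a * (fst x-wall_x h i a), half_sign b * snd x) : {0<..<A} \<times> {B<..<C}"
 by (simp add: chart_def flip: mult.assoc)
 next
 assume m: "(inward a * (fst x-wall_x h i a), half_sign b * snd x) : {0<..<A} \<times> {B<..<C}"
 have "x=chart h i a b (inward a * (fst x-wall_x h i a), half_sign b * snd x)" by (simp add: chart_def flip: mult.assoc)
 thus "x : cell h dl e" unfolding Diag(1) cell.simps A_def[symmetric] B_def[symmetric] C_def[symmetric] using m by (rule image_eqI)
 qed
 let ?x1="wall_x h i a+(if a=West then 0 else-A)" and ?x2="wall_x h i a+(if a=West then A else 0)"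
 let ?y1="if b=North then B else-C" and ?y2="if b=North then C else-B"
 have "cell h dl e={?x1<..<?x2} \<times> {?y1<..<?y2}"
 by (rule set_eqI, unfold iff, cases a; cases b) (auto simp: mem_Times_iff)
 moreover have "?x1 <= ?x2" "?y1 <= ?y2" "?x2 - ?x1 <= h i" "?y2 - ?y1 <= h i" using b by auto
 moreover have "h i <= h (edge_index e)+\<bar>h (edge_index e-1)\<bar>" by (simp add: Diag(1) edge_index_def)
 ultimately show ?thesis by (meson order_trans)
 qed (use e in \<open>auto simp: edges_reg_def\<close>)
qed

lemma regular_region_box:
 assumes e: "e : edges_reg"
 obtains p q :: point where "box p q <= region h dl e" "negligible (region h dl e-box p q)"
 "!!b. b : Basis ==> p \<bullet> b <= q \<bullet> b" "norm (q-p) <= 2*(h (edge_index e)+\<bar>h (edge_index e-1)\<bar>)"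
proof -
 obtain x1 x2 y1 y2 where c: "cell h dl e={x1<..<x2} \<times> {y1<..<y2}" "x1 <= x2" "y1 <= y2"
 "x2-x1 <= h (edge_index e)+\<bar>h (edge_index e-1)\<bar>" "y2-y1 <= h (edge_index e)+\<bar>h (edge_index e-1)\<bar>"
 using regular_cell_rectangle[OF e] by blast
 have ee: "e : edges" using e by blast
 have box: "box (x1, y1) (x2, y2)=cell h dl e" unfolding c(1) by (auto simp: box_def Basis_prod_def)
 have "(x2, y2)-(x1, y1)=(x2-x1, 0)+(0, y2-y1)" by simp
 hence "norm ((x2, y2)-(x1, y1)) <= norm (x2-x1, 0::real)+norm (0::real, y2-y1)" by (metis norm_triangle_ineq)
 also have "\<dots>=(x2-x1)+(y2-y1)" using c by (simp add: norm_prod_def)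
 also have "\<dots> <= 2*(h (edge_index e)+\<bar>h (edge_index e-1)\<bar>)" unfolding mult_2 by (rule add_mono[OF c(4,5)])
 finally have n: "norm ((x2, y2)-(x1, y1)) <= 2*(h (edge_index e)+\<bar>h (edge_index e-1)\<bar>)" .
 show thesis
 by (rule that[of "(x1, y1)" "(x2, y2)"])
 (use c(2,3) n cell_subset_region[OF ee] region_cell[OF ee] box in \<open>auto simp: Basis_prod_def\<close>)
qed

end

lemma integral_lebesgue_on_cong_AE:
 fixes f g :: "'a::euclidean_space => complex"
 assumes G: "G : sets lebesgue" and eq: "AE x in lon G. f x=g x"
 shows "(LINT x|lon G. f x)=(LINT x|lon G. g x)"
proof (cases "f : bm (lon G)")
 case True
 hence "g : bm (lon G)" by (rule borel_measurable_lebesgue_on_AE[OF _ G eq])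
 thus ?thesis by (rule integral_cong_AE[OF True _ eq])
next
 case False
 have "AE x in lon G. g x=f x" using eq by (elim eventually_mono) simp
 hence "g ~: bm (lon G)" using False borel_measurable_lebesgue_on_AE[OF _ G] by metis
 hence "\<not> integrable (lon G) f" "\<not> integrable (lon G) g"
 using False borel_measurable_integrable by blast+
 thus ?thesis by (simp add: not_integrable_integral_eq)
qed

lemma has_weak_derivative_cong:
 assumes "!!x. x : G ==> f x=f' x"
 shows "hwd G f v g \<longleftrightarrow> hwd G f' v g"
proof -
 have "integrable (lon K) f \<longleftrightarrow> integrable (lon K) f'" if "K <= G" for K
 by (rule BI_icong) (use assms that in auto)
 hence "lint G f \<longleftrightarrow> lint G f'" by (auto simp: locally_integrable_def)
 moreover have "(LINT x|lon G. f x * cr (fd ph (at x) v)) =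
 (LINT x|lon G. f' x * cr (fd ph (at x) v))" for ph
 by (rule BI_cong) (use assms in auto)
 ultimately show ?thesis unfolding has_weak_derivative_def by simp
qed

lemma H1_cong:
 assumes eq: "!!x. x : G ==> f x=f' x"
 shows "f : carr (H1 G) \<longleftrightarrow> f' : carr (H1 G)" "f : carr (L2 G) \<longleftrightarrow> f' : carr (L2 G)"
 and "ip (H1 G) u f=ip (H1 G) u f'" "ip (H1 G) f u=ip (H1 G) f' u" "ip (L2 G) u f=ip (L2 G) u f'"
 and "nm (H1 G) f=nm (H1 G) f'" "nm (L2 G) f=nm (L2 G) f'"
proof -
 have d: "hwd G f v=hwd G f' v" for v
 by (rule ext) (rule has_weak_derivative_cong[OF eq])
 have w: "wkd G f v=wkd G f' v" for v unfolding weak_derivative_def d by (rule refl)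
 show L: "f : carr (L2 G) \<longleftrightarrow> f' : carr (L2 G)"
 proof -
 have "f : bm (lon G) \<longleftrightarrow> f' : bm (lon G)"
 by (rule measurable_cong) (use eq in auto)
 moreover have "integrable (lon G) (%x. (cmod (f x))^2) \<longleftrightarrow> integrable (lon G) (%x. (cmod (f' x))^2)"
 by (rule BI_icong) (use eq in auto)
 ultimately show ?thesis by (simp add: L2_mem)
 qed
 show "f : carr (H1 G) \<longleftrightarrow> f' : carr (H1 G)" unfolding H1_def using L d by simp
 show u1: "ip (H1 G) u f=ip (H1 G) u f'" for u
 unfolding H1_def hspace.simps w by (rule BI_cong) (use eq in auto)
 show u2: "ip (H1 G) f u=ip (H1 G) f' u" for u
 unfolding H1_def hspace.simps w by (rule BI_cong) (use eq in auto)
 show l1: "ip (L2 G) u f=ip (L2 G) u f'" for u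
 unfolding L2_ip by (rule BI_cong) (use eq in auto)
 have l2: "ip (L2 G) f u=ip (L2 G) f' u" for u
 unfolding L2_ip by (rule BI_cong) (use eq in auto)
 show "nm (H1 G) f=nm (H1 G) f'" "nm (L2 G) f=nm (L2 G) f'"
 unfolding hnorm_def by (simp_all only: u1 u2 l1 l2)
qed

lemma H1_ip_AE_const:
 assumes G: "almost_open G" and k: "AE x in lon G. k x=(c :: complex)"
 shows "ip (H1 G) k v=ip (L2 G) k v"
proof -
 have "AE x in lon G. ALL b:Basis. wkd G k b x=0"
 using weak_derivative_AE_const[OF G k] by (intro AE_finite_allI) auto
 thus ?thesis unfolding H1_def L2_ip hspace.simps
 by (intro integral_lebesgue_on_cong_AE almost_open_sets[OF G]) (elim eventually_mono, simp)
qed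

lemma H1_hnorm_ge_L2:
 assumes "almost_open G" "u : carr (H1 G)"
 shows "(nm (L2 G) u)^2 <= (nm (H1 G) u)^2"
 unfolding H1_hnorm_sq[OF assms] by (simp add: sum_nonneg)

lemma integral_two_parts:
 fixes f :: "'a::euclidean_space => real"
 assumes f: "integrable (lon G) f" and s: "G : sets lebesgue" "Q : sets lebesgue" "Q1 : sets lebesgue" "Q2 : sets lebesgue"
 and Q: "Q <= G" "Q1 <= Q" "Q2 <= Q" "Q1 \<inter> Q2={}" "negligible (Q-(Q1 \<union> Q2))"
 shows "(LINT x|lon Q. f x)=(LINT x|lon Q1. f x)+(LINT x|lon Q2. f x)"
proof -
 have fS: "integrable lebesgue (%x. ind S x *\<^sub>R f x)" if "S : sets lebesgue" "S <= G" for S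
 using integrable_lebesgue_on_subset[OF f s(1) that] that by (simp add: integrable_restrict_space)
 have r: "(LINT x|lon S. f x)=(LINT x|lebesgue. ind S x *\<^sub>R f x)" if "S : sets lebesgue" for S
 using that by (simp add: integral_restrict_space)
 have "AE x in lebesgue. x ~: Q-(Q1 \<union> Q2)" using Q(5) by (intro AE_not_in) (simp add: negligible_iff_null_sets)
 hence "AE x in lebesgue. ind Q x *\<^sub>R f x=ind Q1 x *\<^sub>R f x+ind Q2 x *\<^sub>R f x"
 by (elim eventually_mono) (use Q in \<open>auto simp: indicator_def\<close>)
 hence "(LINT x|lebesgue. ind Q x *\<^sub>R f x)=(LINT x|lebesgue. ind Q1 x *\<^sub>R f x+ind Q2 x *\<^sub>R f x)"
 by (intro integral_cong_AE borel_measurable_integrable fS s Q Bochner_Integration.integrable_add order_trans[OF Q(2) Q(1)] order_trans[OF Q(3) Q(1)])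
 also have "\<dots>=(LINT x|lebesgue. ind Q1 x *\<^sub>R f x)+(LINT x|lebesgue. ind Q2 x *\<^sub>R f x)"
 by (intro BI_add fS s order_trans[OF Q(2) Q(1)] order_trans[OF Q(3) Q(1)])
 finally show ?thesis using r s by simp
qed

text \<open>Up to finitely many continuous functionals, the norm on \<open>Q\<close> is controlled by a small multiple of the gradient.\<close>

definition gradient_controls :: "real => 'a::euclidean_space set => 'a set => bool" where
 "gradient_controls ep G Q \<longleftrightarrow> (EX J. finite J & J <= carr (L2 G) & (ALL u:carr (H1 G).
 (LINT x|lon Q. (cmod (u x))^2) <=
 ep * (\<Sum>b\<in>Basis. LINT x|lon Q. (cmod (wkd G u b x))^2)+(\<Sum>j\<in>J. (cmod (ip (L2 G) u j))^2)))"

text \<open>The functionals of both parts are kept; the factor \<open>sqrt 2\<close> compensates for those that occur in both families.\<close>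

lemma gradient_controls_union:
 assumes G: "almost_open G" and c: "gradient_controls ep G Q1" "gradient_controls ep G Q2"
 and s: "Q : sets lebesgue" "Q1 : sets lebesgue" "Q2 : sets lebesgue"
 and Q: "Q <= G" "Q1 <= Q" "Q2 <= Q" "Q1 \<inter> Q2={}" "negligible (Q-(Q1 \<union> Q2))"
 shows "gradient_controls ep G Q"
proof -
 obtain J1 where J1: "finite J1" "J1 <= carr (L2 G)" "!!u. u : carr (H1 G) ==>
 (LINT x|lon Q1. (cmod (u x))^2) <=
 ep * (\<Sum>b\<in>Basis. LINT x|lon Q1. (cmod (wkd G u b x))^2)+(\<Sum>j\<in>J1. (cmod (ip (L2 G) u j))^2)"
 using c(1) unfolding gradient_controls_def by blast
 obtain J2 where J2: "finite J2" "J2 <= carr (L2 G)" "!!u. u : carr (H1 G) ==>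
 (LINT x|lon Q2. (cmod (u x))^2) <=
 ep * (\<Sum>b\<in>Basis. LINT x|lon Q2. (cmod (wkd G u b x))^2)+(\<Sum>j\<in>J2. (cmod (ip (L2 G) u j))^2)"
 using c(2) unfolding gradient_controls_def by blast
 interpret L: semi_ip "L2 G" by (rule L2_semi_ip)
 have scaled: "(\<Sum>j\<in>J1. (cmod (ip (L2 G) u j))^2)+(\<Sum>j\<in>J2. (cmod (ip (L2 G) u j))^2) <=
 (\<Sum>j\<in>(%j x. cr (sqrt 2) * j x) ` (J1 \<union> J2). (cmod (ip (L2 G) u j))^2)" if u: "u : carr (L2 G)" for u
 proof -
 have inj: "inj_on (%j x. cr (sqrt 2) * j x) (J1 \<union> J2)"
 proof (rule inj_onI)
 fix j k :: "'a => complex" assume e: "(%x. cr (sqrt 2) * j x)=(%x. cr (sqrt 2) * k x)"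
 show "j=k" by (rule ext) (use fun_cong[OF e] in simp)
 qed
 have sc: "(cmod (ip (L2 G) u (%x. cr (sqrt 2) * j x)))^2=2*(cmod (ip (L2 G) u j))^2" if "j : J1 \<union> J2" for j
 proof -
 have "j : carr (L2 G)" using that J1 J2 by blast
 thus ?thesis using L.ip_scale_right[OF _ u, of j "cr (sqrt 2)"] by (simp add: norm_mult power_mult_distrib)
 qed
 have "(\<Sum>j\<in>J1. (cmod (ip (L2 G) u j))^2) <= (\<Sum>j\<in>J1 \<union> J2. (cmod (ip (L2 G) u j))^2)"
 "(\<Sum>j\<in>J2. (cmod (ip (L2 G) u j))^2) <= (\<Sum>j\<in>J1 \<union> J2. (cmod (ip (L2 G) u j))^2)"
 using J1(1) J2(1) by (auto intro!: sum_mono2)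
 hence "(\<Sum>j\<in>J1. (cmod (ip (L2 G) u j))^2)+(\<Sum>j\<in>J2. (cmod (ip (L2 G) u j))^2) <= (\<Sum>j\<in>J1 \<union> J2. 2*(cmod (ip (L2 G) u j))^2)"
 by (simp add: sum_distrib_left[symmetric])
 also have "\<dots>=(\<Sum>j\<in>(%j x. cr (sqrt 2) * j x) ` (J1 \<union> J2). (cmod (ip (L2 G) u j))^2)"
 unfolding sum.reindex[OF inj] comp_def by (rule sum.cong) (simp_all add: sc)
 finally show ?thesis .
 qed
 show ?thesis
 unfolding gradient_controls_def
 proof (intro exI conjI ballI)
 show "finite ((%j x. cr (sqrt 2) * j x) ` (J1 \<union> J2))" using J1 J2 by simp
 show "(%j x. cr (sqrt 2) * j x) ` (J1 \<union> J2) <= carr (L2 G)" using J1 J2 by auto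
 fix u assume u: "u : carr (H1 G)"
 note uL=H1_sub_L2[OF u]
 have ui: "integrable (lon G) (%x. (cmod (u x))^2)" using uL by (simp add: L2_mem)
 have di: "integrable (lon G) (%x. (cmod (wkd G u b x))^2)" if "b : Basis" for b
 using H1_weak_derivative_L2[OF G u that] by (simp add: L2_mem)
 have "(LINT x|lon Q. (cmod (u x))^2)=(LINT x|lon Q1. (cmod (u x))^2)+(LINT x|lon Q2. (cmod (u x))^2)"
 by (rule integral_two_parts[OF ui almost_open_sets[OF G] s Q])
 moreover have "(\<Sum>b\<in>Basis. LINT x|lon Q. (cmod (wkd G u b x))^2) =
 (\<Sum>b\<in>Basis. LINT x|lon Q1. (cmod (wkd G u b x))^2)+(\<Sum>b\<in>Basis. LINT x|lon Q2. (cmod (wkd G u b x))^2)"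
 unfolding sum.distrib[symmetric] by (rule sum.cong) (simp_all add: integral_two_parts[OF di almost_open_sets[OF G] s Q])
 ultimately show "(LINT x|lon Q. (cmod (u x))^2) <=
 ep * (\<Sum>b\<in>Basis. LINT x|lon Q. (cmod (wkd G u b x))^2) +
 (\<Sum>j\<in>(%j x. cr (sqrt 2) * j x) ` (J1 \<union> J2). (cmod (ip (L2 G) u j))^2)"
 using J1(3)[OF u] J2(3)[OF u] scaled[OF uL] by (simp only: distrib_left)
 qed
qed

lemma small_box_estimate:
 fixes p q :: point
 assumes G: "almost_open G" and QG: "box p q <= G" and pq: "!!b. b : Basis ==> p \<bullet> b <= q \<bullet> b"
 and small: "4*(norm (q-p))^2 <= ep" and u: "u : carr (H1 G)"
 shows "(LINT x|lon (box p q). (cmod (u x))^2) <=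
 (cmod (LINT x|lon (box p q). u x))^2/measure lborel (box p q) +
 ep * (\<Sum>b\<in>Basis. LINT x|lon (box p q). (cmod (wkd G u b x))^2)"
proof -
 let ?m="measure lborel (box p q)"
 let ?D="\<Sum>b\<in>Basis. LINT x|lon (box p q). (cmod (wkd G u b x))^2"
 let ?A="LINT x|lon (box p q). (cmod (u x))^2"
 let ?I="(cmod (LINT x|lon (box p q). u x))^2"
 have D: "0 <= ?D" by (intro sum_nonneg BI_nonneg) simp
 have P: "?m * ?A <= ?I + ?m * (4*(norm (q-p))^2*?D)"
 using poincare_box[OF G QG pq u] by (simp add: algebra_simps)
 show ?thesis
 proof (cases "?m=0")
 case True
 have "box p q : null_sets lborel" using True emeasure_lborel_box_finite[of p q] by (simp add: null_sets_def emeasure_eq_ennreal_measure)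
 hence "AE x in lon (box p q). (cmod (u x))^2=0"
 by (intro AE_lebesgue_on_negligible[of _ "box p q"]) (auto simp: negligible_iff_null_sets intro: null_sets_completionI)
 hence "?A=0" by (rule integral_eq_zero_AE)
 moreover have "0 <= ep" using small by (smt (verit) zero_le_power2)
 ultimately show ?thesis using D by simp
 next
 case False
 hence m: "0<?m" by (simp add: zero_less_measure_iff)
 have "?m * (4*(norm (q-p))^2*?D) <= ?m * (ep * ?D)" using small D m by (intro mult_left_mono mult_right_mono) auto
 hence "?m * ?A <= ?I + ?m * (ep * ?D)" using P by (rule order_trans[rotated, OF add_left_mono])
 also have "\<dots> = ?m * (?I / ?m+ep * ?D)" using m by (simp add: distrib_left)
 finally have "?m * ?A <= ?m * (?I / ?m+ep * ?D)" .
 thus ?thesis using m by (simp only: mult_le_cancel_left_pos)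
 qed
qed

lemma gradient_controls_small_box:
 fixes p q :: point
 assumes G: "almost_open G" and QG: "box p q <= G" and pq: "!!b. b : Basis ==> p \<bullet> b <= q \<bullet> b"
 and small: "4*(norm (q-p))^2 <= ep"
 shows "gradient_controls ep G (box p q)"
proof -
 let ?m="measure lborel (box p q)"
 define j where "j=(%x. cr (ind (box p q) x/sqrt ?m))"
 have Gs: "G : sets lebesgue" by (rule almost_open_sets[OF G])
 have bs: "box p q : sets lebesgue" by simp
 have "integrable (lon G) (%x. ind (box p q) x :: real)"
 using QG bs Gs emeasure_lborel_box_finite[of p q] by (subst integrable_restrict_space)
 (auto simp: indicator_inter_arith[symmetric] Int_absorb1 intro!: integrable_real_indicator)
 hence "integrable (lon G) (%x. ind (box p q) x * (1 / ?m))" by (rule integrable_mult_left) 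
 moreover have "(cmod (j x))^2=ind (box p q) x * (1 / ?m)" for x
 by (simp add: j_def indicator_def norm_divide power_divide)
 moreover have "j : bm (lon G)"
 proof -
 have "(%x. ind (box p q) x/sqrt ?m :: real) : bm lebesgue"
 using bs by (intro borel_measurable_divide borel_measurable_indicator) auto
 moreover have "cr : bm borel"
 by (intro borel_measurable_continuous_onI continuous_intros)
 ultimately have "j : bm lebesgue" unfolding j_def by (rule measurable_compose)
 thus ?thesis by (rule measurable_restrict_space1)
 qed
 ultimately have j: "j : carr (L2 G)" by (simp add: L2_mem)
 show ?thesis
 unfolding gradient_controls_def
 proof (intro exI[of _ "{j}"] conjI ballI)
 fix u assume u: "u : carr (H1 G)"
 have "ip (L2 G) u j=(LINT x|lon G. u x * cr (ind (box p q) x/sqrt ?m))"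
 by (simp add: L2_ip j_def)
 also have "\<dots>=(LINT x|lon G. ind (box p q) x *\<^sub>R u x)/cr (sqrt ?m)"
 proof -
 have "(%x. u x * cr (ind (box p q) x/sqrt ?m))=(%x. (ind (box p q) x *\<^sub>R u x)/cr (sqrt ?m))"
 by (rule ext) (simp add: scaleR_conv_of_real mult.commute)
 thus ?thesis by simp
 qed
 also have "(LINT x|lon G. ind (box p q) x *\<^sub>R u x)=(LINT x|lon (box p q). u x)"
 proof -
 have "(LINT x|lon G. ind (box p q) x *\<^sub>R u x)=(LINT x|lebesgue. ind G x *\<^sub>R (ind (box p q) x *\<^sub>R u x))"
 using Gs by (simp add: integral_restrict_space)
 also have "\<dots>=(LINT x|lebesgue. ind (box p q) x *\<^sub>R u x)"
 by (rule BI_cong) (use QG in \<open>auto simp: indicator_def\<close>)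
 also have "\<dots>=(LINT x|lon (box p q). u x)" using bs by (simp add: integral_restrict_space)
 finally show ?thesis .
 qed
 finally have "(cmod (ip (L2 G) u j))^2=(cmod (LINT x|lon (box p q). u x))^2 / ?m"
 by (simp add: norm_divide power_divide)
 thus "(LINT x|lon (box p q). (cmod (u x))^2) <=
 ep * (\<Sum>b\<in>Basis. LINT x|lon (box p q). (cmod (wkd G u b x))^2)+(\<Sum>j\<in>{j}. (cmod (ip (L2 G) u j))^2)"
 using small_box_estimate[OF G QG pq small u] by simp
 qed (use j in auto)
qed

lemma negligible_plane_line: "(a, b) ~= (0, 0) ==> negligible {p :: point. a * fst p+b * snd p=c}"
 using negligible_hyperplane[of "(a, b)" c] by (auto simp: inner_prod_def zero_prod_def)

lemma rectangle_box: "{x1<..<x2} \<times> {y1<..<y2}=box (x1, y1) (x2, y2 :: real)" for x1 x2 :: real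
 by (auto simp: box_def Basis_prod_def)

text \<open>Bisecting both sides \<open>n\<close> times produces rectangles that are small enough for the Poincare inequality, whose mean terms are the functionals.\<close>

lemma gradient_controls_rectangle:
 fixes x1 x2 y1 y2 :: real
 assumes G: "almost_open G" and ep: "0<ep"
 shows "{x1<..<x2} \<times> {y1<..<y2} <= G ==> x1 <= x2 ==> y1 <= y2 ==>
 4*(norm (x2-x1, y2-y1))^2 <= 4 ^ n * ep ==> gradient_controls ep G ({x1<..<x2} \<times> {y1<..<y2 :: real})"
proof (induction n arbitrary: x1 x2 y1 y2)
 case 0
 thus ?case unfolding rectangle_box
 by (intro gradient_controls_small_box[OF G]) (auto simp: Basis_prod_def)
next
 case (Suc n)
 define xm where "xm=(x1+x2)/2"
 define ym where "ym=(y1+y2)/2"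
 have rs: "{a<..<b} \<times> {c<..<d} : sets lebesgue" for a b c d :: real unfolding rectangle_box by simp
 have sm: "4*(norm (a, b))^2 <= 4 ^ n * ep" if "a=(x2-x1)/2" "b=(y2-y1)/2" for a b
 proof -
 have "(a, b)=(1/2) *\<^sub>R (x2-x1, y2-y1)" using that by simp
 hence eq: "norm (a, b)=norm (x2-x1, y2-y1)/2" by (metis norm_scaleR abs_divide abs_numeral abs_one mult.commute times_divide_eq_right mult_1_right)
 have "4*(norm (a, b))^2=(norm (x2-x1, y2-y1))^2" unfolding eq by (simp add: power_divide)
 thus ?thesis using Suc.prems(4) by simp
 qed
 have o: "x1 <= xm" "xm <= x2" "y1 <= ym" "ym <= y2" using Suc.prems by (auto simp: xm_def ym_def)
 have quarter: "gradient_controls ep G ({a<..<b} \<times> {c<..<d})"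
 if "a=x1 & b=xm \<or> a=xm & b=x2" "c=y1 & d=ym \<or> c=ym & d=y2" for a b c d
 proof (rule Suc.IH)
 have "{a<..<b} \<times> {c<..<d} <= {x1<..<x2} \<times> {y1<..<y2}" using that o by auto
 thus "{a<..<b} \<times> {c<..<d} <= G" using Suc.prems(1) by blast
 show "a <= b" "c <= d" using that o by auto
 show "4*(norm (b-a, d-c))^2 <= 4 ^ n * ep"
 by (rule sm) (use that in \<open>auto simp: xm_def ym_def field_simps\<close>)
 qed
 have half: "gradient_controls ep G ({a<..<b} \<times> {y1<..<y2})" if "a=x1 & b=xm \<or> a=xm & b=x2" for a b
 proof (rule gradient_controls_union[OF G quarter[OF that, of y1 ym] quarter[OF that, of ym y2] rs rs rs])
 have "{a<..<b} \<times> {y1<..<y2} <= {x1<..<x2} \<times> {y1<..<y2}" using that o by auto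
 thus "{a<..<b} \<times> {y1<..<y2} <= G" using Suc.prems(1) by blast
 have "negligible {p :: point. 0 * fst p+1 * snd p=ym}" by (rule negligible_plane_line) simp
 thus "negligible ({a<..<b} \<times> {y1<..<y2}-({a<..<b} \<times> {y1<..<ym} \<union> {a<..<b} \<times> {ym<..<y2}))"
 by (rule negligible_subset) auto
 qed (use o in auto)
 show ?case
 proof (rule gradient_controls_union[OF G half[of x1 xm] half[of xm x2] rs rs rs])
 show "{x1<..<x2} \<times> {y1<..<y2} <= G" by (rule Suc.prems(1))
 have "negligible {p :: point. 1 * fst p+0 * snd p=xm}" by (rule negligible_plane_line) simp
 thus "negligible ({x1<..<x2} \<times> {y1<..<y2}-({x1<..<xm} \<times> {y1<..<y2} \<union> {xm<..<x2} \<times> {y1<..<y2}))"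
 by (rule negligible_subset) auto
 qed (use o in auto)
qed

context rooms_passages
begin

abbreviation reg :: "edge => point set" where "reg \<equiv> region h dl"
abbreviation V where "V \<equiv> H1_Omega h dl"
abbreviation L where "L \<equiv> L2_Omega h dl"

lemma cell_bounded:
 assumes e: "e : edges"
 shows "bounded (cell h dl e)"
proof -
 have ch: "bounded (chart h i a b ` S)" if S: "bounded S" for i a b S
 proof -
 obtain x d where d: "!!y. y : S ==> dist x y <= d" using S by (auto simp: bounded_def)
 show ?thesis unfolding bounded_def
 by (rule exI[of _ "chart h i a b x"], rule exI[of _ d]) (use d in \<open>auto simp: chart_dist\<close>)
 qed
 have bt: "bounded ({a<..<b} \<times> {c<..<d})" for a b c d :: real unfolding rectangle_box by (rule bounded_box)
 show ?thesis
 using e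
 proof (cases rule: edges_cases)
 case (Arc i a b)
 let ?w="mouth_width dl i a" and ?R="reach h dl i a"
 have R: "0<?R" by (rule reach_room(1)[OF Arc(2,3)])
 have "bounded {p. 0<fst p & fst p<?R & ?w/2*(1-fst p / ?R) < snd p & snd p<h i/2 &
 ((h i - ?w)/2<fst p \<or> snd p<?w/2)}"
 proof (rule bounded_subset[OF bt[of 0 ?R 0 "h i/2"]], rule subsetI)
 fix p assume p: "p : {p. 0<fst p & fst p<?R & ?w/2*(1-fst p / ?R) < snd p & snd p<h i/2 &
 ((h i - ?w)/2<fst p \<or> snd p<?w/2)}"
 hence "0 <= ?w/2*(1-fst p / ?R)" using width_bounds(1)[OF Arc(3), of a] R by (intro mult_nonneg_nonneg) auto
 thus "p : {0<..<?R} \<times> {0<..<h i/2}" using p by (auto simp: mem_Times_iff)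
 qed
 thus ?thesis unfolding Arc(1) cell.simps Let_def by (rule ch)
 next
 case (Join i a)
 let ?w="mouth_width dl i a" and ?R="reach h dl i a"
 have R: "0<?R" by (rule reach_room(1)[OF Join(2,3)])
 have w: "0<?w" by (rule width_bounds(3)[OF Join(3,4)])
 have "bounded {p. 0<fst p & \<bar>snd p\<bar><?w/2*(1-fst p / ?R)}"
 proof (rule bounded_subset[OF bt[of 0 ?R "- ?w" ?w]], rule subsetI)
 fix p assume p: "p : {p. 0<fst p & \<bar>snd p\<bar><?w/2*(1-fst p / ?R)}"
 hence "0<?w/2*(1-fst p / ?R)" by (auto intro: le_less_trans[OF abs_ge_zero])
 hence "0<1-fst p / ?R" using w by (simp add: zero_less_mult_iff)
 hence 1: "fst p<?R" using R by simp
 have "?w/2*(1-fst p / ?R) <= ?w/2*1" using w p R by (intro mult_left_mono) auto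
 with CollectD[OF p, THEN conjunct2] have "\<bar>snd p\<bar><?w" using w by linarith
 thus "p : {0<..<?R} \<times> {- ?w<..<?w}" using 1 p by (auto simp: mem_Times_iff)
 qed
 thus ?thesis unfolding Join(1) cell.simps Let_def by (rule ch)
 next
 case (Diag i a b)
 show ?thesis unfolding Diag(1) cell.simps by (rule ch[OF bt])
 next
 case (Pass i)
 show ?thesis unfolding Pass(1) cell.simps by (rule bt)
 next
 case (Centre i)
 show ?thesis unfolding Centre(1) cell.simps by (rule bt)
 qed
qed

lemma region_lmeasurable:
 assumes e: "e : edges"
 shows "reg e : lmeasurable"
proof -
 have "cell h dl e : lmeasurable" by (rule lmeasurable_open[OF cell_bounded[OF e] open_cell])
 moreover have "reg e-cell h dl e : lmeasurable" using region_cell[OF e] by (simp add: negligible_iff_measure)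
 ultimately have "cell h dl e \<union> (reg e-cell h dl e) : lmeasurable" by (rule fmeasurable.Un)
 moreover have "cell h dl e \<union> (reg e-cell h dl e)=reg e" using cell_subset_region[OF e] by blast
 ultimately show ?thesis by simp
qed

lemma const_L2:
 assumes e: "e : edges"
 shows "(%x. c) : carr (L2 (reg e))"
 using finite_measure.integrable_const[OF finite_measure_lebesgue_on[OF region_lmeasurable[OF e]], of "(cmod c)^2"]
 by (simp add: L2_mem)

lemma L2_parts_spaces: "hsum_spaces edges (%e. L2 (reg e))" by (rule hsum_spaces.intro) (rule L2_semi_ip)
lemma H1_parts_spaces: "hsum_spaces edges (%e. H1 (reg e))" by (rule hsum_spaces.intro) (rule H1_semi_ip[OF region_almost_open])

lemma L_mem: "u : carr L \<longleftrightarrow> (ALL e:edges. u : carr (L2 (reg e))) & (%e. (nm (L2 (reg e)) u)^2) summable_on edges"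
 unfolding L2_Omega_def measurable_partition.L2_mem_parts[OF rpartition] by (rule hsum_mem)

lemma V_mem: "u : carr V \<longleftrightarrow> (ALL e:edges. u : carr (H1 (reg e))) & (%e. (nm (H1 (reg e)) u)^2) summable_on edges"
 unfolding H1_Omega_def by (rule hsum_mem)

lemma L_ip: "u : carr L ==> v : carr L ==> ip L u v=(\<Sum>\<^sub>\<infinity>e\<in>edges. ip (L2 (reg e)) u v)"
 using measurable_partition.L2_ip_parts[OF rpartition] unfolding L2_Omega_def hsum_ip by blast

lemma V_ip: "ip V u v=(\<Sum>\<^sub>\<infinity>e\<in>edges. ip (H1 (reg e)) u v)"
 unfolding H1_Omega_def by (rule hsum_ip)

lemma L_semi_ip: "semi_ip L" unfolding L2_Omega_def by (rule L2_semi_ip)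

lemma V_semi_ip: "semi_ip V" unfolding H1_Omega_def by (rule hsum_spaces.semi_ip_hsum[OF H1_parts_spaces])

lemma L_hnorm_sq:
 assumes u: "u : carr L"
 shows "(nm L u)^2=(\<Sum>\<^sub>\<infinity>e\<in>edges. (nm (L2 (reg e)) u)^2)"
proof -
 have us: "u : carr (hsum edges (%e. L2 (reg e)))" using u unfolding hsum_mem L_mem .
 have "nm L u=nm (hsum edges (%e. L2 (reg e))) u"
 unfolding hnorm_def L_ip[OF u u] hsum_ip by (rule refl)
 thus ?thesis using hsum_spaces.hnorm_sq_eq[OF L2_parts_spaces us] by simp
qed

lemma V_hnorm_sq: "u : carr V ==> (nm V u)^2=(\<Sum>\<^sub>\<infinity>e\<in>edges. (nm (H1 (reg e)) u)^2)"
 unfolding H1_Omega_def by (rule hsum_spaces.hnorm_sq_eq[OF H1_parts_spaces])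

lemma V_subset_L: "u : carr V ==> u : carr L"
proof -
 assume u: "u : carr V"
 have "(%e. (nm (L2 (reg e)) u)^2) summable_on edges"
 by (rule summable_on_comparison_test[where f="%e. (nm (H1 (reg e)) u)^2"])
 (use u H1_hnorm_ge_L2[OF region_almost_open] in \<open>auto simp: V_mem\<close>)
 thus ?thesis using u H1_sub_L2 by (auto simp: L_mem V_mem)
qed

lemma V_hnorm_ge: "u : carr V ==> nm L u <= nm V u"
proof -
 assume u: "u : carr V"
 have "(nm L u)^2 <= (nm V u)^2"
 unfolding L_hnorm_sq[OF V_subset_L[OF u]] V_hnorm_sq[OF u]
 by (rule infsum_mono) (use u V_subset_L[OF u] H1_hnorm_ge_L2[OF region_almost_open] in \<open>auto simp: V_mem L_mem\<close>)
 thus ?thesis by (rule power2_le_imp_le) (rule semi_ip.hnorm_nonneg[OF V_semi_ip u])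
qed

definition rpart :: "edge set => (point => complex) => point => complex" where
 "rpart E u x=(if EX e:E. x : reg e then u x else 0)"

lemma rpart_on:
 assumes "E <= edges" "e : edges" "x : reg e"
 shows "rpart E u x=(if e : E then u x else 0)"
proof (cases "e : E")
 case True
 thus ?thesis using assms(3) by (auto simp: rpart_def)
next
 case False
 have "x ~: reg e'" if "e' : E" for e'
 using regions_disjoint[OF assms(2), of e'] that assms False by blast
 thus ?thesis using False by (auto simp: rpart_def)
qed

lemma rpart_ip:
 assumes "E <= edges" "e : edges"
 shows "e : E ==> ip (L2 (reg e)) v (rpart E u)=ip (L2 (reg e)) v u"
 "e : E ==> ip (H1 (reg e)) v (rpart E u)=ip (H1 (reg e)) v u"
 "e ~: E ==> v : carr (L2 (reg e)) ==> ip (L2 (reg e)) v (rpart E u)=0"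
 "e ~: E ==> v : carr (H1 (reg e)) ==> ip (H1 (reg e)) v (rpart E u)=0"
proof -
 have 1: "rpart E u x=u x" if "e : E" "x : reg e" for x using rpart_on[OF assms that(2)] that(1) by simp
 have 2: "rpart E u x=0" if "e ~: E" "x : reg e" for x using rpart_on[OF assms that(2)] that(1) by simp
 show "e : E ==> ip (L2 (reg e)) v (rpart E u)=ip (L2 (reg e)) v u" by (rule H1_cong(5)) (rule 1)
 show "e : E ==> ip (H1 (reg e)) v (rpart E u)=ip (H1 (reg e)) v u" by (rule H1_cong(3)) (rule 1)
 show "ip (L2 (reg e)) v (rpart E u)=0" if "e ~: E" "v : carr (L2 (reg e))"
 using H1_cong(5)[of "reg e" "rpart E u" "%x. 0" v] 2[OF that(1)] semi_ip.ip_zero_right[OF L2_semi_ip that(2)] by simp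
 show "ip (H1 (reg e)) v (rpart E u)=0" if "e ~: E" "v : carr (H1 (reg e))"
 using H1_cong(3)[of "reg e" "rpart E u" "%x. 0" v] 2[OF that(1)]
 semi_ip.ip_zero_right[OF H1_semi_ip[OF region_almost_open[OF assms(2)]] that(2)] by simp
qed

lemma rpart_mem:
 assumes sp: "!!e. e : edges ==> semi_ip (X e)"
 and cg: "!!e f f'. e : edges ==> (!!x. x : reg e ==> f x=f' x) ==>
 (f : carr (X e) \<longleftrightarrow> f' : carr (X e)) & nm (X e) f=nm (X e) f'"
 and E: "E <= edges" and u: "!!e. e : E ==> u : carr (X e)" and sm: "(%e. (nm (X e) u)^2) summable_on E"
 shows "rpart E u : carr (hsum edges X)"
 unfolding hsum_mem
proof (intro conjI ballI)
 have on: "(rpart E u : carr (X e) \<longleftrightarrow> u : carr (X e)) & nm (X e) (rpart E u)=nm (X e) u" if "e : E" for e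
 proof (rule cg)
 show e: "e : edges" using that E by blast
 show "rpart E u x=u x" if "x : reg e" for x using rpart_on[OF E e that] \<open>e : E\<close> by simp
 qed
 have off: "(rpart E u : carr (X e) \<longleftrightarrow> (%x. 0) : carr (X e)) & nm (X e) (rpart E u)=nm (X e) (%x. 0)" if "e : edges" "e ~: E" for e
 proof (rule cg[OF that(1)])
 show "rpart E u x=0" if "x : reg e" for x using rpart_on[OF E \<open>e : edges\<close> that] \<open>e ~: E\<close> by simp
 qed
 have z: "(%x. 0) : carr (X e)" "nm (X e) (%x. 0)=0" if "e : edges" for e
 using semi_ip.zero_mem[OF sp[OF that]] semi_ip.hnorm_zero[OF sp[OF that]] by auto
 show "rpart E u : carr (X e)" if "e : edges" for e using on[of e] off[OF that] z[OF that] u by (cases "e : E") auto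
 have "(%e. (nm (X e) (rpart E u))^2) summable_on edges \<longleftrightarrow> (%e. (nm (X e) u)^2) summable_on E"
 by (rule summable_on_cong_neutral) (use E on off z in auto)
 thus "(%e. (nm (X e) (rpart E u))^2) summable_on edges" using sm by simp
qed

lemma rpart_V:
 assumes "E <= edges" "!!e. e : E ==> u : carr (H1 (reg e))" "(%e. (nm (H1 (reg e)) u)^2) summable_on E"
 shows "rpart E u : carr V"
 unfolding H1_Omega_def
proof (rule rpart_mem[OF H1_semi_ip[OF region_almost_open] _ assms])
 fix e and f f' :: "point => complex" assume eq: "!!x. x : reg e ==> f x=f' x"
 show "(f : carr (H1 (reg e)) \<longleftrightarrow> f' : carr (H1 (reg e))) & nm (H1 (reg e)) f=nm (H1 (reg e)) f'"
 by (intro conjI H1_cong(1,6) eq)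
qed

lemma rpart_L:
 assumes "E <= edges" "!!e. e : E ==> u : carr (L2 (reg e))" "(%e. (nm (L2 (reg e)) u)^2) summable_on E"
 shows "rpart E u : carr L"
proof -
 have "rpart E u : carr (hsum edges (%e. L2 (reg e)))"
 proof (rule rpart_mem[OF L2_semi_ip _ assms])
 fix e and f f' :: "point => complex" assume eq: "!!x. x : reg e ==> f x=f' x"
 show "(f : carr (L2 (reg e)) \<longleftrightarrow> f' : carr (L2 (reg e))) & nm (L2 (reg e)) f=nm (L2 (reg e)) f'"
 by (intro conjI H1_cong(2,7) eq)
 qed
 thus ?thesis unfolding hsum_mem L_mem .
qed

text \<open>A function of the form domain on one region extends by 0 to the domain, and for elements of the operator domain the form norms on the regions are summable because they are bounded by the norms of \<open>u\<close> and of its image.\<close>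

lemma H_Omega_eq: "H_Omega h dl = op_shift (assoc_op V L) (- 1)"
proof (rule set_eqI, clarify)
 fix u w :: "point => complex"
 interpret L: semi_ip L by (rule L_semi_ip)
 show "(u, w) : H_Omega h dl \<longleftrightarrow> (u, w) : op_shift (assoc_op V L) (- 1)"
 proof
 assume "(u, w) : H_Omega h dl"
 hence u: "u : carr L" and w: "w : carr L" and a: "!!e. e : edges ==> (u, w) : neumann_laplacian (reg e)"
 by (auto simp: H_Omega_def)
 define f where "f=(%x. w x+u x)"
 have f: "f : carr L" unfolding f_def by (rule L.add_mem[OF w u])
 have as: "(u, f) : assoc_op (H1 (reg e)) (L2 (reg e))" if e: "e : edges" for e
 proof -
 obtain g where g: "(u, g) : assoc_op (H1 (reg e)) (L2 (reg e))" "w=(%x. g x+(- 1) * u x)"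
 using a[OF e] by (auto simp: neumann_laplacian_def op_shift_def)
 have "f=g" by (rule ext) (simp add: f_def g(2))
 thus ?thesis using g(1) by simp
 qed
 have uH: "u : carr (H1 (reg e))" and ip_eq: "!!v. v : carr (H1 (reg e)) ==> ip (H1 (reg e)) u v=ip (L2 (reg e)) f v" if "e : edges" for e
 using as[OF that] by (auto simp: assoc_op_def)
 have le: "(nm (H1 (reg e)) u)^2 <= (nm (L2 (reg e)) f)^2+(nm (L2 (reg e)) u)^2" if e: "e : edges" for e
 proof -
 interpret E: semi_ip "L2 (reg e)" by (rule L2_semi_ip)
 have fe: "f : carr (L2 (reg e))" and ue: "u : carr (L2 (reg e))" using f u e by (auto simp: L_mem)
 have "(nm (H1 (reg e)) u)^2=Re (ip (L2 (reg e)) f u)"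
 using semi_ip.hnorm_sq[OF H1_semi_ip[OF region_almost_open[OF e]] uH[OF e]] ip_eq[OF e uH[OF e]] by simp
 also have "\<dots> <= nm (L2 (reg e)) f * nm (L2 (reg e)) u"
 using E.cauchy_schwarz[OF fe ue] complex_Re_le_cmod order_trans by blast
 also have "\<dots> <= (nm (L2 (reg e)) f)^2+(nm (L2 (reg e)) u)^2"
 using sum_squares_bound[of "nm (L2 (reg e)) f" "nm (L2 (reg e)) u"]
 mult_nonneg_nonneg[OF E.hnorm_nonneg[OF fe] E.hnorm_nonneg[OF ue]] by linarith
 finally show ?thesis .
 qed
 have sf: "(%e. (nm (L2 (reg e)) f)^2) summable_on edges" using f unfolding L_mem by (rule conjunct2)
 have su: "(%e. (nm (L2 (reg e)) u)^2) summable_on edges" using u unfolding L_mem by (rule conjunct2)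
 have "(%e. (nm (H1 (reg e)) u)^2) summable_on edges"
 by (rule summable_on_comparison_test[OF summable_on_add[OF sf su] le zero_le_power2])
 hence uV: "u : carr V" using uH unfolding V_mem by blast
 have "ip V u v=ip L f v" if v: "v : carr V" for v
 proof -
 have vH: "ALL e:edges. v : carr (H1 (reg e))" using v unfolding V_mem by (rule conjunct1)
 show ?thesis unfolding V_ip L_ip[OF f V_subset_L[OF v]] by (rule infsum_cong) (rule ip_eq[OF _ bspec[OF vH]])
 qed
 hence "(u, f) : assoc_op V L" using uV f by (simp add: assoc_op_def)
 moreover have "w=(%x. f x+(- 1) * u x)" by (rule ext) (simp add: f_def)
 ultimately show "(u, w) : op_shift (assoc_op V L) (- 1)" unfolding op_shift_def by blast
 next
 assume "(u, w) : op_shift (assoc_op V L) (- 1)"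
 then obtain f where f: "u : carr V" "f : carr L" "!!v. v : carr V ==> ip V u v=ip L f v" "w=(%x. f x+(- 1) * u x)"
 by (auto simp: op_shift_def assoc_op_def)
 have uL: "u : carr L" by (rule V_subset_L[OF f(1)])
 have wL: "w : carr L" unfolding f(4) by (rule L.add_mem[OF f(2) L.scale_mem[OF uL]])
 have "(u, w) : neumann_laplacian (reg e)" if e: "e : edges" for e
 proof -
 have E: "{e} <= edges" using e by simp
 have "ip (H1 (reg e)) u v=ip (L2 (reg e)) f v" if v: "v : carr (H1 (reg e))" for v
 proof -
 let ?v="rpart {e} v"
 have vV: "?v : carr V" by (rule rpart_V[OF E]) (use v in auto)
 have "ip V u ?v=ip (H1 (reg e)) u ?v" unfolding H1_Omega_def
 by (rule hsum_ip_single[OF e]) (use rpart_ip(4)[OF E] f(1) in \<open>auto simp: V_mem\<close>)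
 also have "\<dots>=ip (H1 (reg e)) u v" by (rule rpart_ip(2)[OF E e]) simp
 finally have 1: "ip V u ?v=ip (H1 (reg e)) u v" .
 have "ip L f ?v=ip (hsum edges (%e. L2 (reg e))) f ?v" unfolding L_ip[OF f(2) V_subset_L[OF vV]] hsum_ip by (rule refl)
 also have "\<dots>=ip (L2 (reg e)) f ?v"
 by (rule hsum_ip_single[OF e]) (use rpart_ip(3)[OF E] f(2) in \<open>auto simp: L_mem\<close>)
 also have "\<dots>=ip (L2 (reg e)) f v" by (rule rpart_ip(1)[OF E e]) simp
 finally show ?thesis using 1 f(3)[OF vV] by simp
 qed
 moreover have "u : carr (H1 (reg e))" "f : carr (L2 (reg e))" using f(1,2) e by (auto simp: V_mem L_mem)
 ultimately have "(u, f) : assoc_op (H1 (reg e)) (L2 (reg e))" by (simp add: assoc_op_def)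
 thus ?thesis unfolding neumann_laplacian_def op_shift_def f(4) by blast
 qed
 thus "(u, w) : H_Omega h dl" using uL wL by (simp add: H_Omega_def)
 qed
qed

lemma V_complete: "semi_hilbert V"
 unfolding H1_Omega_def
proof (rule hsum_complete)
 show "semi_hilbert (H1 (reg e))" if "e : edges" for e by (rule H1_complete[OF region_almost_open[OF that]])
 fix g assume g: "!!e. e : edges ==> g e : carr (H1 (reg e))"
 define f where "f x=g (SOME e. e : edges & x : reg e) x" for x
 have f: "f x=g e x" if "e : edges" "x : reg e" for e x
 proof -
 have "(SOME e. e : edges & x : reg e)=e"
 by (rule some_equality) (use that regions_disjoint in blast)+
 thus ?thesis by (simp add: f_def)
 qed
 show "EX f. ALL e:edges. f : carr (H1 (reg e)) & nm (H1 (reg e)) (%x. f x-g e x)=0"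
 proof (intro exI ballI conjI)
 fix e assume e: "e : edges"
 show "f : carr (H1 (reg e))" using H1_cong(1)[of "reg e" f "g e"] f[OF e] g[OF e] by blast
 have "nm (H1 (reg e)) (%x. f x-g e x)=nm (H1 (reg e)) (%x. 0)" by (rule H1_cong(6)) (simp add: f[OF e])
 thus "nm (H1 (reg e)) (%x. f x-g e x)=0"
 using semi_ip.hnorm_zero[OF H1_semi_ip[OF region_almost_open[OF e]]] by simp
 qed
qed

definition rconst :: "(point => complex) set" where
 "rconst={k : carr L. ALL e:edges. EX c. AE x in lon (reg e). k x=c}"

text \<open>On constants the form reduces to the inner product because their weak derivatives vanish.\<close>

lemma rconst_V:
 assumes k: "k : rconst"
 shows "k : carr V" and "v : carr V ==> ip V k v=ip L k v"
proof -
 have kL: "k : carr L" and kc: "!!e. e : edges ==> EX c. AE x in lon (reg e). k x=c"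
 using k by (auto simp: rconst_def)
 have ip_eq: "ip (H1 (reg e)) k v=ip (L2 (reg e)) k v" if e: "e : edges" for e v
 proof -
 obtain c where "AE x in lon (reg e). k x=c" using kc[OF e] ..
 thus ?thesis by (rule H1_ip_AE_const[OF region_almost_open[OF e]])
 qed
 have kH: "k : carr (H1 (reg e))" if e: "e : edges" for e
 proof -
 obtain c where "AE x in lon (reg e). k x=c" using kc[OF e] ..
 thus ?thesis by (rule H1_AE_const_mem[OF region_sets[OF e], rotated]) (use kL e in \<open>auto simp: L_mem\<close>)
 qed
 have "nm (H1 (reg e)) k=nm (L2 (reg e)) k" if "e : edges" for e unfolding hnorm_def ip_eq[OF that] by (rule refl)
 hence "(%e. (nm (H1 (reg e)) k)^2) summable_on edges \<longleftrightarrow> (%e. (nm (L2 (reg e)) k)^2) summable_on edges"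
 by (intro summable_on_cong) simp
 thus "k : carr V" using kH kL by (simp add: V_mem L_mem)
 show "ip V k v=ip L k v" if v: "v : carr V"
 unfolding V_ip L_ip[OF kL V_subset_L[OF v]] by (rule infsum_cong) (rule ip_eq)
qed

lemma region_indicator_constant:
 assumes e: "e : edges"
 shows "rpart {e} (%x. c) : rconst"
proof -
 have E: "{e} <= edges" using e by simp
 have "rpart {e} (%x. c) : carr L" by (rule rpart_L[OF E]) (use const_L2[OF e] in auto)
 moreover have "EX d. AE x in lon (reg e'). rpart {e} (%x. c) x=d" if e': "e' : edges" for e'
 by (rule exI[of _ "if e'=e then c else 0"], rule AE_I2) (use rpart_on[OF E e'] region_sets[OF e'] in auto)
 ultimately show ?thesis unfolding rconst_def by blast
qed

lemma ip_const_right: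
 "ip (L2 (reg e)) f (%x. c)=cnj c * (LINT x|lon (reg e). f x)"
 unfolding L2_ip by (subst mult.commute) (rule integral_mult_right_zero)

lemma mean_zero:
 assumes v: "v : carr L" "!!k. k : rconst ==> ip L v k=0" and e: "e : edges"
 shows "(LINT x|lon (reg e). v x)=0"
proof -
 have E: "{e} <= edges" using e by simp
 let ?k="rpart {e} (%x. 1)"
 have k: "?k : rconst" by (rule region_indicator_constant[OF e])
 hence kL: "?k : carr L" by (simp add: rconst_def)
 have "ip L v ?k=ip (hsum edges (%e. L2 (reg e))) v ?k" unfolding L_ip[OF v(1) kL] hsum_ip by (rule refl)
 also have "\<dots>=ip (L2 (reg e)) v ?k"
 by (rule hsum_ip_single[OF e]) (use rpart_ip(3)[OF E] v(1) in \<open>auto simp: L_mem\<close>)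
 also have "\<dots>=ip (L2 (reg e)) v (%x. 1)" by (rule rpart_ip(1)[OF E e]) simp
 also have "\<dots>=(LINT x|lon (reg e). v x)" unfolding ip_const_right by simp
 finally show ?thesis using v(2)[OF k] by simp
qed

lemma rconst_projection:
 assumes f: "f : carr L"
 shows "EX k:rconst. ALL k':rconst. ip L (%x. f x-k x) k'=0"
proof -
 define m where "m e=(nm (L2 (reg e)) (%x. 1))^2" for e
 define c where "c e=ip (L2 (reg e)) f (%x. 1)/cr (m e)" for e
 define k where "k x=c (SOME e. e : edges & x : reg e)" for x
 interpret L: semi_ip L by (rule L_semi_ip)
 have kc: "k x=c e" if "e : edges" "x : reg e" for e x
 proof -
 have "(SOME e. e : edges & x : reg e)=e"
 by (rule some_equality) (use that regions_disjoint in blast)+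
 thus ?thesis by (simp add: k_def)
 qed
 have fe: "f : carr (L2 (reg e))" if "e : edges" for e using f that by (auto simp: L_mem)
 have cs: "(cmod (ip (L2 (reg e)) f (%x. 1)))^2 <= (nm (L2 (reg e)) f)^2 * m e" if e: "e : edges" for e
 using power_mono[OF semi_ip.cauchy_schwarz[OF L2_semi_ip fe[OF e] const_L2[OF e, of 1]], of 2]
 by (simp add: m_def power_mult_distrib)
 have m0: "0 <= m e" for e by (simp add: m_def)
 have kn: "(nm (L2 (reg e)) k)^2 <= (nm (L2 (reg e)) f)^2" if e: "e : edges" for e
 proof -
 have "nm (L2 (reg e)) k=nm (L2 (reg e)) (%x. c e * 1)" by (rule H1_cong(7)) (simp add: kc[OF e])
 also have "\<dots>=cmod (c e) * nm (L2 (reg e)) (%x. 1)" by (rule semi_ip.hnorm_scale[OF L2_semi_ip const_L2[OF e]])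
 finally have "(nm (L2 (reg e)) k)^2=(cmod (c e))^2 * m e" by (simp add: m_def power_mult_distrib)
 also have "\<dots> <= (nm (L2 (reg e)) f)^2"
 proof (cases "m e=0")
 case False
 hence "0<m e" using m0[of e] by simp
 hence "(cmod (c e))^2 * m e=(cmod (ip (L2 (reg e)) f (%x. 1)))^2/m e"
 by (simp add: c_def norm_divide power_divide power2_eq_square[of "m e"])
 thus ?thesis using cs[OF e] \<open>0<m e\<close> by (simp add: pos_divide_le_eq)
 qed simp
 finally show ?thesis .
 qed
 have kL: "k : carr L"
 unfolding L_mem
 proof (intro conjI ballI)
 show "k : carr (L2 (reg e))" if e: "e : edges" for e
 using H1_cong(2)[of "reg e" k "%x. c e"] kc[OF e] const_L2[OF e] by blast
 show "(%e. (nm (L2 (reg e)) k)^2) summable_on edges"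
 by (rule summable_on_comparison_test[where f="%e. (nm (L2 (reg e)) f)^2"]) (use f kn in \<open>auto simp: L_mem\<close>)
 qed
 have kK: "k : rconst"
 unfolding rconst_def
 proof (intro CollectI conjI ballI kL)
 fix e assume e: "e : edges"
 show "EX d. AE x in lon (reg e). k x=d" by (rule exI[of _ "c e"], rule AE_I2) (simp add: kc[OF e] region_sets[OF e])
 qed
 have zero: "ip (L2 (reg e)) (%x. f x-k x) (%x. 1)=0" if e: "e : edges" for e
 proof -
 interpret E: semi_ip "L2 (reg e)" by (rule L2_semi_ip)
 have ke: "k : carr (L2 (reg e))" using kL e by (auto simp: L_mem)
 have "ip (L2 (reg e)) k (%x. 1)=ip (L2 (reg e)) (%x. c e * 1) (%x. 1)"
 unfolding L2_ip by (rule BI_cong) (use kc[OF e] in auto)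
 also have "\<dots>=c e * cr (m e)"
 using E.ip_scale_left[OF const_L2[OF e] const_L2[OF e], of "c e" 1 1] E.ip_self[OF const_L2[OF e, of 1]] by (simp add: m_def)
 also have "\<dots>=ip (L2 (reg e)) f (%x. 1)"
 using cs[OF e] by (cases "m e=0") (auto simp: c_def)
 finally show ?thesis using E.ip_diff_left[OF fe[OF e] ke const_L2[OF e]] by simp
 qed
 show ?thesis
 proof (rule bexI[OF _ kK], rule ballI)
 fix k' assume k': "k' : rconst"
 hence k'L: "k' : carr L" by (simp add: rconst_def)
 have "ip (L2 (reg e)) (%x. f x-k x) k'=0" if e: "e : edges" for e
 proof -
 obtain d where d: "AE x in lon (reg e). k' x=d" using k' e by (auto simp: rconst_def)
 have "ip (L2 (reg e)) (%x. f x-k x) k'=ip (L2 (reg e)) (%x. f x-k x) (%x. d)"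
 unfolding L2_ip by (rule integral_lebesgue_on_cong_AE[OF region_sets[OF e]]) (use d in \<open>elim eventually_mono, simp\<close>)
 also have "\<dots>=cnj d * ip (L2 (reg e)) (%x. f x-k x) (%x. 1)" unfolding ip_const_right by simp
 finally show ?thesis using zero[OF e] by simp
 qed
 thus "ip L (%x. f x-k x) k'=0" unfolding L_ip[OF L.diff_mem[OF f kL] k'L] by (rule infsum_0)
 qed
qed

end

lemma integral_up_to_null:
 fixes f :: "'a::euclidean_space => 'b::{banach, second_countable_topology}"
 assumes f: "f : bm (lon R)" and s: "R : sets lebesgue" "B : sets lebesgue"
 and B: "B <= R" "negligible (R-B)"
 shows "(LINT x|lon R. f x)=(LINT x|lon B. f x)"
proof -
 have m: "(%x. ind R x *\<^sub>R f x) : bm lebesgue"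
 using f s by (simp add: borel_measurable_restrict_space_iff)
 have eq: "(%x. ind B x *\<^sub>R f x)=(%x. ind B x *\<^sub>R (ind R x *\<^sub>R f x))"
 by (rule ext) (use B in \<open>auto simp: indicator_def\<close>)
 have mB: "(%x. ind B x *\<^sub>R f x) : bm lebesgue"
 unfolding eq by (intro borel_measurable_scaleR borel_measurable_indicator s m)
 have "AE x in lebesgue. x ~: R-B" using B(2) by (intro AE_not_in) (simp add: negligible_iff_null_sets)
 hence "AE x in lebesgue. ind R x *\<^sub>R f x=ind B x *\<^sub>R f x"
 by (elim eventually_mono) (use B in \<open>auto simp: indicator_def\<close>)
 hence "(LINT x|lebesgue. ind R x *\<^sub>R f x)=(LINT x|lebesgue. ind B x *\<^sub>R f x)"
 by (rule integral_cong_AE[OF m mB])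
 thus ?thesis using s by (simp add: integral_restrict_space)
qed

context rooms_passages
begin

lemma box_norms:
 assumes e: "e : edges" and b: "box p q <= reg e" "negligible (reg e-box p q)" and u: "u : carr (H1 (reg e))"
 shows "(nm (L2 (reg e)) u)^2=(LINT x|lon (box p q). (cmod (u x))^2)"
 and "(\<Sum>b\<in>Basis. LINT x|lon (box p q). (cmod (wkd (reg e) u b x))^2) <= (nm (H1 (reg e)) u)^2"
proof -
 have eq: "(nm (L2 (reg e)) v)^2=(LINT x|lon (box p q). (cmod (v x))^2)" if "v : carr (L2 (reg e))" for v
 unfolding L2_hnorm_sq
 by (rule integral_up_to_null) (use that region_sets[OF e] b borel_measurable_integrable in \<open>auto simp: L2_mem\<close>)
 show "(nm (L2 (reg e)) u)^2=(LINT x|lon (box p q). (cmod (u x))^2)" by (rule eq[OF H1_sub_L2[OF u]])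
 have "(\<Sum>b\<in>Basis. LINT x|lon (box p q). (cmod (wkd (reg e) u b x))^2) =
 (\<Sum>b\<in>Basis. (nm (L2 (reg e)) (wkd (reg e) u b))^2)"
 by (rule sum.cong[OF refl]) (rule eq[symmetric], rule H1_weak_derivative_L2[OF region_almost_open[OF e] u])
 thus "(\<Sum>b\<in>Basis. LINT x|lon (box p q). (cmod (wkd (reg e) u b x))^2) <= (nm (H1 (reg e)) u)^2"
 unfolding H1_hnorm_sq[OF region_almost_open[OF e] u] by simp
qed

lemma regular_region_controls:
 assumes e: "e : edges_reg" and ep: "0<ep"
 shows "EX J. finite J & J <= carr (L2 (reg e)) & (ALL u:carr (H1 (reg e)).
 (nm (L2 (reg e)) u)^2 <= ep * (nm (H1 (reg e)) u)^2+(\<Sum>j\<in>J. (cmod (ip (L2 (reg e)) u j))^2))"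
proof -
 have ee: "e : edges" using e by blast
 obtain p q where b: "box p q <= reg e" "negligible (reg e-box p q)" "!!b. b : Basis ==> p \<bullet> b <= q \<bullet> b"
 by (rule regular_region_box[OF e]) (rule that)
 obtain x1 y1 x2 y2 where pq: "p=(x1, y1)" "q=(x2, y2)" by (cases p; cases q)
 have le: "x1 <= x2" "y1 <= y2" using b(3)[of "(1, 0)"] b(3)[of "(0, 1)"] by (auto simp: pq Basis_prod_def)
 obtain n where "4*(norm (x2-x1, y2-y1))^2/ep<4 ^ n" using real_arch_pow[of 4 "4*(norm (x2-x1, y2-y1))^2/ep"] by auto
 hence n: "4*(norm (x2-x1, y2-y1))^2 <= 4 ^ n * ep" using ep by (simp add: pos_divide_less_eq)
 have "gradient_controls ep (reg e) (box p q)"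
 using gradient_controls_rectangle[OF region_almost_open[OF ee] ep _ le n] b(1) unfolding rectangle_box pq by blast
 then obtain J where J: "finite J" "J <= carr (L2 (reg e))" "!!u. u : carr (H1 (reg e)) ==>
 (LINT x|lon (box p q). (cmod (u x))^2) <=
 ep * (\<Sum>b\<in>Basis. LINT x|lon (box p q). (cmod (wkd (reg e) u b x))^2)+(\<Sum>j\<in>J. (cmod (ip (L2 (reg e)) u j))^2)"
 unfolding gradient_controls_def by blast
 have "(nm (L2 (reg e)) u)^2 <= ep * (nm (H1 (reg e)) u)^2+(\<Sum>j\<in>J. (cmod (ip (L2 (reg e)) u j))^2)" if u: "u : carr (H1 (reg e))" for u
 proof -
 note n=box_norms[OF ee b(1,2) u]
 have "ep * (\<Sum>b\<in>Basis. LINT x|lon (box p q). (cmod (wkd (reg e) u b x))^2) <= ep * (nm (H1 (reg e)) u)^2"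
 using n(2) ep by (intro mult_left_mono) auto
 thus ?thesis using J(3)[OF u] n(1) by linarith
 qed
 thus ?thesis using J(1,2) by blast
qed

text \<open>The height and the previous height bound the diameter of a regular region, and they tend to 0.\<close>

lemma small_regions_poincare:
 assumes ep: "0<ep"
 obtains n where "!!e u. e : edges_reg ==> n<edge_index e ==> u : carr (H1 (reg e)) ==>
 (LINT x|lon (reg e). u x)=0 ==> (nm (L2 (reg e)) u)^2 <= ep * (nm (H1 (reg e)) u)^2"
proof -
 define d where "d=sqrt ep/8"
 have d: "0<d" using ep by (simp add: d_def)
 obtain n where n: "!!i. i >= n ==> \<bar>h i\<bar><d" using LIMSEQ_D[OF h_lim d] by auto
 show thesis
 proof (rule that[of n])
 fix e u assume e: "e : edges_reg" and i: "n<edge_index e" and u: "u : carr (H1 (reg e))" and mz: "(LINT x|lon (reg e). u x)=0"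
 have ee: "e : edges" using e by blast
 obtain p q where b: "box p q <= reg e" "negligible (reg e-box p q)" "!!b. b : Basis ==> p \<bullet> b <= q \<bullet> b"
 "norm (q-p) <= 2*(h (edge_index e)+\<bar>h (edge_index e-1)\<bar>)"
 by (rule regular_region_box[OF e]) (rule that)
 have "h (edge_index e)<d" "\<bar>h (edge_index e-1)\<bar><d" using n[of "edge_index e"] n[of "edge_index e-1"] i by auto
 hence "norm (q-p) <= 4 * d" using b(4) by (simp add: distrib_left)
 hence "(norm (q-p))^2 <= (4 * d)^2" by (intro power_mono) auto
 also have "(4 * d)^2=ep/4" using ep by (simp add: d_def power_mult_distrib power_divide)
 finally have small: "4*(norm (q-p))^2 <= ep" by simp
 have "(LINT x|lon (box p q). u x)=0"
 using integral_up_to_null[OF _ region_sets[OF ee] _ b(1,2), of u] mz H1_sub_L2[OF u] by (simp add: L2_mem)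
 hence "(nm (L2 (reg e)) u)^2 <= ep * (\<Sum>b\<in>Basis. LINT x|lon (box p q). (cmod (wkd (reg e) u b x))^2)"
 using small_box_estimate[OF region_almost_open[OF ee] b(1) b(3) small u] unfolding box_norms(1)[OF ee b(1,2) u] by simp
 also have "\<dots> <= ep * (nm (H1 (reg e)) u)^2" using box_norms(2)[OF ee b(1,2) u] ep by (intro mult_left_mono) auto
 finally show "(nm (L2 (reg e)) u)^2 <= ep * (nm (H1 (reg e)) u)^2" .
 qed
qed

lemma ip_region_part:
 assumes E: "E <= edges" and u: "u : carr L" and v: "v : carr L"
 shows "rpart E u : carr L" "ip L (rpart E u) v=ip L u (rpart E v)"
 "(nm L (rpart E u))^2=(\<Sum>\<^sub>\<infinity>e\<in>E. (nm (L2 (reg e)) u)^2)"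
proof -
 have mem: "rpart E u : carr L" if "u : carr L" for u
 by (rule rpart_L[OF E]) (use that E in \<open>auto simp: L_mem intro: summable_on_subset_banach\<close>)
 show "rpart E u : carr L" by (rule mem[OF u])
 have "ip (L2 (reg e)) (rpart E u) v=ip (L2 (reg e)) u (rpart E v)" if e: "e : edges" for e
 unfolding L2_ip by (rule BI_cong) (use rpart_on[OF E e] in auto)
 thus "ip L (rpart E u) v=ip L u (rpart E v)"
 unfolding L_ip[OF mem[OF u] v] L_ip[OF u mem[OF v]] by (rule infsum_cong)
 have on: "nm (L2 (reg e)) (rpart E u)=nm (L2 (reg e)) u" if "e : E" for e
 by (rule H1_cong(7)) (use that in \<open>auto simp: rpart_def\<close>)
 have off: "nm (L2 (reg e)) (rpart E u)=0" if e: "e : edges" "e ~: E" for e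
 proof -
 have "nm (L2 (reg e)) (rpart E u)=nm (L2 (reg e)) (%x. 0)"
 by (rule H1_cong(7)) (use rpart_on[OF E e(1)] e(2) in auto)
 thus ?thesis using semi_ip.hnorm_zero[OF L2_semi_ip] by simp
 qed
 show "(nm L (rpart E u))^2=(\<Sum>\<^sub>\<infinity>e\<in>E. (nm (L2 (reg e)) u)^2)"
 unfolding L_hnorm_sq[OF mem[OF u]] by (rule infsum_cong_neutral) (use E on off in auto)
qed

lemma regular_parts_estimate:
 assumes ep: "0<ep"
 and ph: "!!n. ph n : carr V" "!!n. nm V (ph n) <= C" "!!n e. e : edges ==> (LINT x|lon (reg e). ph n x)=0"
 and weak: "!!v. v : carr L ==> (%n. ip L (ph n) v) ~~> 0"
 shows "EX g. g ~~> 0 & (ALL n. (\<Sum>\<^sub>\<infinity>e\<in>edges_reg. (nm (L2 (reg e)) (ph n))^2) <= ep * C^2+(g n :: real))"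
proof -
 obtain m where m: "!!e u. e : edges_reg ==> m<edge_index e ==> u : carr (H1 (reg e)) ==>
 (LINT x|lon (reg e). u x)=0 ==> (nm (L2 (reg e)) u)^2 <= ep * (nm (H1 (reg e)) u)^2"
 by (rule small_regions_poincare[OF ep]) (rule that)
 define F where "F={e : edges_reg. edge_index e <= m}"
 have F: "finite F" unfolding F_def by (rule finite_subset[OF _ finite_edge_index[of m]]) auto
 have "ALL e. EX J. e : edges_reg --> finite J & J <= carr (L2 (reg e)) & (ALL u:carr (H1 (reg e)).
 (nm (L2 (reg e)) u)^2 <= ep * (nm (H1 (reg e)) u)^2+(\<Sum>j\<in>J. (cmod (ip (L2 (reg e)) u j))^2))"
 using regular_region_controls[OF _ ep] by blast
 from choice[OF this] obtain J where J: "!!e. e : edges_reg ==> finite (J e)" "!!e. e : edges_reg ==> J e <= carr (L2 (reg e))"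
 "!!e u. e : edges_reg ==> u : carr (H1 (reg e)) ==>
 (nm (L2 (reg e)) u)^2 <= ep * (nm (H1 (reg e)) u)^2+(\<Sum>j\<in>J e. (cmod (ip (L2 (reg e)) u j))^2)" by blast
 define g where "g n=(\<Sum>e\<in>F. \<Sum>j\<in>J e. (cmod (ip (L2 (reg e)) (ph n) j))^2)" for n
 have lim: "(%n. (cmod (ip (L2 (reg e)) (ph n) j))^2) ~~> 0" if e: "e : F" and j: "j : J e" for e j
 proof -
 have e': "e : edges" "{e} <= edges" "e : edges_reg" using e by (auto simp: F_def)
 have jL: "rpart {e} j : carr L" by (rule rpart_L[OF e'(2)]) (use J(2)[OF e'(3)] j in auto)
 have "ip L (ph n) (rpart {e} j)=ip (L2 (reg e)) (ph n) j" for n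
 proof -
 have "ip L (ph n) (rpart {e} j)=ip (hsum edges (%e. L2 (reg e))) (ph n) (rpart {e} j)"
 unfolding L_ip[OF V_subset_L[OF ph(1)] jL] hsum_ip by (rule refl)
 also have "\<dots>=ip (L2 (reg e)) (ph n) (rpart {e} j)"
 by (rule hsum_ip_single[OF e'(1)]) (use rpart_ip(3)[OF e'(2)] V_subset_L[OF ph(1)] in \<open>auto simp: L_mem\<close>)
 also have "\<dots>=ip (L2 (reg e)) (ph n) j" by (rule rpart_ip(1)[OF e'(2,1)]) simp
 finally show ?thesis .
 qed
 hence "(%n. ip (L2 (reg e)) (ph n) j) ~~> 0" using weak[OF jL] by simp
 from tendsto_power[OF tendsto_norm[OF this], of 2] show ?thesis by simp
 qed
 have "g ~~> 0" unfolding g_def by (intro tendsto_null_sum lim)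
 moreover have "(\<Sum>\<^sub>\<infinity>e\<in>edges_reg. (nm (L2 (reg e)) (ph n))^2) <= ep * C^2+g n" for n
 proof (rule infsum_le_finite_sums)
 have "(%e. (nm (L2 (reg e)) (ph n))^2) summable_on edges" using V_subset_L[OF ph(1)[of n]] by (simp add: L_mem)
 thus "(%e. (nm (L2 (reg e)) (ph n))^2) summable_on edges_reg" by (rule summable_on_subset_banach) blast
 fix T assume T: "finite T" "T <= edges_reg"
 have phH: "ph n : carr (H1 (reg e))" if "e : T" for e using ph(1)[of n] T that by (auto simp: V_mem)
 have "(nm (L2 (reg e)) (ph n))^2 <= ep * (nm (H1 (reg e)) (ph n))^2 +
 (if e : F then \<Sum>j\<in>J e. (cmod (ip (L2 (reg e)) (ph n) j))^2 else 0)" if e: "e : T" for e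
 proof -
 have er: "e : edges_reg" using e T by blast
 show ?thesis
 proof (cases "e : F")
 case True
 thus ?thesis using J(3)[OF er phH[OF e]] by simp
 next
 case False
 hence "m<edge_index e" using er by (simp add: F_def)
 thus ?thesis using m[OF er _ phH[OF e] ph(3)] er False by simp
 qed
 qed
 hence "(\<Sum>e\<in>T. (nm (L2 (reg e)) (ph n))^2) <= (\<Sum>e\<in>T. ep * (nm (H1 (reg e)) (ph n))^2 +
 (if e : F then \<Sum>j\<in>J e. (cmod (ip (L2 (reg e)) (ph n) j))^2 else 0))" by (rule sum_mono)
 also have "\<dots>=ep * (\<Sum>e\<in>T. (nm (H1 (reg e)) (ph n))^2) +
 (\<Sum>e\<in>T. if e : F then \<Sum>j\<in>J e. (cmod (ip (L2 (reg e)) (ph n) j))^2 else 0)"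
 by (simp only: sum.distrib sum_distrib_left)
 also have "(\<Sum>e\<in>T. if e : F then \<Sum>j\<in>J e. (cmod (ip (L2 (reg e)) (ph n) j))^2 else 0) =
 (\<Sum>e\<in>T \<inter> F. \<Sum>j\<in>J e. (cmod (ip (L2 (reg e)) (ph n) j))^2)" by (rule sum.inter_restrict[OF T(1), symmetric])
 also have "\<dots> <= g n" unfolding g_def by (rule sum_mono2[OF F]) (auto intro: sum_nonneg)
 also have "(\<Sum>e\<in>T. (nm (H1 (reg e)) (ph n))^2) <= (nm V (ph n))^2"
 unfolding V_hnorm_sq[OF ph(1)] by (rule finite_sum_le_infsum) (use ph(1)[of n] T in \<open>auto simp: V_mem\<close>)
 also have "(nm V (ph n))^2 <= C^2" using ph(2) semi_ip.hnorm_nonneg[OF V_semi_ip ph(1)] by (intro power_mono) auto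
 finally show "(\<Sum>e\<in>T. (nm (L2 (reg e)) (ph n))^2) <= ep * C^2+g n" using ep by simp
 qed
 ultimately show ?thesis by blast
qed

lemma zero_mem_H1_Gamma: "(%x. 0) : carr (H1_Gamma h dl)"
 and ip_H1_Gamma_zero: "ip (H1_Gamma h dl) g (%x. 0)=0"
proof -
 let ?X="%e. if e : edges_reg then H1_edge h dl e else const_edge h dl e"
 have d0: "AE sg in lon (arc_interval h dl e). edge_deriv h dl e (%x. 0) sg=0" for e
 unfolding edge_deriv_def by (rule weak_derivative_AE_const[OF open_almost_open, where c=0]) auto
 have ip0: "ip (?X e) f (%x. 0)=0" for e f
 proof (cases "e : edges_reg")
 case True
 have "ip (H1_edge h dl e) f (%x. 0)=(LINT sg|lon (arc_interval h dl e). (0 :: complex))"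
 unfolding H1_edge_def hspace.simps
 by (rule integral_lebesgue_on_cong_AE) (use d0[of e] in \<open>simp, elim eventually_mono, simp\<close>)
 thus ?thesis using True by simp
 next
 case False
 thus ?thesis by (simp add: const_edge_def L2_edge_def)
 qed
 show "ip (H1_Gamma h dl) g (%x. 0)=0"
 unfolding H1_Gamma_def hsum_ip by (rule infsum_0) (rule ip0)
 have "(%x. 0) : carr (?X e)" for e
 proof (cases "e : edges_reg")
 case True
 have "hwd (arc_interval h dl e) (%sg. 0) 1 (%x. 0)"
 by (rule has_weak_derivative_AE_const[where c=0]) auto
 thus ?thesis using True by (auto simp: H1_edge_def L2_edge_def intro!: exI[of _ "%x. 0"])
 next
 case False
 thus ?thesis by (auto simp: const_edge_def)
 qed
 moreover have "nm (?X e) (%x. 0)=0" for e unfolding hnorm_def ip0 by simp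
 ultimately show "(%x. 0) : carr (H1_Gamma h dl)" unfolding H1_Gamma_def hsum_mem by simp
qed

text \<open>
 A function that is supported on the regions of singular edges and has mean zero on each of them is
 orthogonal to every composition with \<open>\<tau>\<close>, because these are constant there. So the adjoint
 of \<open>T\<^sub>1\<close> annihilates it.
\<close>

lemma T1_adj_singular_part:
 assumes u: "u : carr V" "!!e. e : edges ==> (LINT x|lon (reg e). u x)=0"
 shows "(rpart edges_sing u, %x. 0) : T1_adj h dl" "rpart edges_sing u : carr V"
proof -
 have E: "edges_sing <= edges" by blast
 let ?s="rpart edges_sing u"
 show sV: "?s : carr V"
 by (rule rpart_V[OF E]) (use u(1) in \<open>auto simp: V_mem intro: summable_on_subset_banach\<close>)
 have "ip V (g \<circ> tau h dl) ?s=0" if g: "g : carr (H1_Gamma h dl)" for g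
 unfolding V_ip
 proof (rule infsum_0)
 fix e assume e: "e : edges"
 note ao=region_almost_open[OF e]
 show "ip (H1 (reg e)) (g \<circ> tau h dl) ?s=0"
 proof (cases "e : edges_reg")
 case True
 hence ns: "e ~: edges_sing" by (auto simp: edges_reg_def edges_sing_def)
 have "ip (H1 (reg e)) (g \<circ> tau h dl) ?s=ip (H1 (reg e)) (g \<circ> tau h dl) (%x. 0)"
 by (rule H1_cong(3)) (use rpart_on[OF E e] ns in auto)
 also have "\<dots>=(LINT x|lon (reg e). 0)"
 proof -
 have "AE x in lon (reg e). ALL b:Basis. wkd (reg e) (%x. 0) b x=0"
 by (intro AE_finite_allI weak_derivative_AE_const[OF ao, where c=0]) auto
 thus ?thesis unfolding H1_def hspace.simps
 by (intro integral_lebesgue_on_cong_AE almost_open_sets[OF ao]) (elim eventually_mono, simp)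
 qed
 finally show ?thesis by simp
 next
 case False
 hence es: "e : edges_sing" using e by blast
 have "g : carr (const_edge h dl e)" using g e False unfolding H1_Gamma_def hsum_mem by (auto split: if_splits)
 then obtain c where c: "AE sg in lon (arc_interval h dl e). g (edge_point h dl e sg)=c" by (auto simp: const_edge_def)
 have k: "AE x in lon (reg e). (g \<circ> tau h dl) x=c" by (rule tau_AE_const[OF e c])
 have "ip (H1 (reg e)) (g \<circ> tau h dl) ?s=ip (L2 (reg e)) (g \<circ> tau h dl) ?s" by (rule H1_ip_AE_const[OF ao k])
 also have "\<dots>=ip (L2 (reg e)) (g \<circ> tau h dl) u" by (rule rpart_ip(1)[OF E e es])
 also have "\<dots>=ip (L2 (reg e)) (%x. c) u"
 unfolding L2_ip by (rule integral_lebesgue_on_cong_AE[OF region_sets[OF e]]) (use k in \<open>elim eventually_mono, simp\<close>)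
 also have "\<dots>=cnj (ip (L2 (reg e)) u (%x. c))"
 by (rule semi_ip.ip_commute[OF L2_semi_ip _ const_L2[OF e]]) (use u(1) e H1_sub_L2 in \<open>auto simp: V_mem\<close>)
 also have "\<dots>=0" unfolding ip_const_right u(2)[OF e] by simp
 finally show ?thesis .
 qed
 qed
 thus "(?s, %x. 0) : T1_adj h dl"
 unfolding T1_adj_def hadjoint_def T1_def graph_on_def using sV zero_mem_H1_Gamma ip_H1_Gamma_zero by auto
qed

text \<open>The singular parts converge to 0 along a subsequence, the regular parts carry at most a quarter of the norm in the limit, yet every member has norm 1.\<close>

lemma no_bounded_orthonormal_sequence:
 assumes compact: "compact_op V L (op_shift (T1_adj h dl O T1 h dl) (- 1) O E1 h dl)"
 and on: "semi_ip.orthonormal L (UNIV :: nat set) ph"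
 and ph: "!!n. ph n : carr V & (ALL k:rconst. ip L (ph n) k=0) & nm V (ph n) <= C"
 shows False
proof -
 interpret L: semi_ip L by (rule L_semi_ip)
 have phV: "ph n : carr V" and phC: "nm V (ph n) <= C" for n using ph by auto
 have phL: "ph n : carr L" for n by (rule V_subset_L[OF phV])
 have mz: "(LINT x|lon (reg e). ph n x)=0" if "e : edges" for n e
 by (rule mean_zero[OF phL _ that]) (use ph in blast)
 have weak: "(%n. ip L (ph n) v) ~~> 0" if "v : carr L" for v by (rule L.orthonormal_weakly_null[OF on that])
 have E: "edges_sing <= edges" by blast
 define s where "s n=rpart edges_sing (ph n)" for n
 have sV: "s n : carr V" and sadj: "(s n, %x. 0) : T1_adj h dl" for n
 unfolding s_def using T1_adj_singular_part[OF phV mz] by auto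
 have sL: "s n : carr L" for n by (rule V_subset_L[OF sV])
 interpret VV: semi_ip V by (rule V_semi_ip)
 have mV: "(%x.-s n x) : carr V" for n by (rule VV.minus_mem[OF sV])
 have rel: "(s n, %x.-s n x) : op_shift (T1_adj h dl O T1 h dl) (- 1) O E1 h dl" for n
 proof
 have "((%x. 0), (%x. 0) \<circ> tau h dl) : T1 h dl" unfolding T1_def graph_on_def using zero_mem_H1_Gamma by blast
 hence "(s n, (%x. 0) \<circ> tau h dl) : T1_adj h dl O T1 h dl" using sadj by blast
 hence "(s n, %x. ((%x. 0) \<circ> tau h dl) x+(- 1) * s n x) : op_shift (T1_adj h dl O T1 h dl) (- 1)"
 unfolding op_shift_def by blast
 moreover have "(%x. ((%x. 0) \<circ> tau h dl) x+(- 1) * s n x)=(%x.-s n x)" by (rule ext) simp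
 ultimately show "(s n, %x.-s n x) : op_shift (T1_adj h dl O T1 h dl) (- 1)" by (simp only:)
 show "((%x.-s n x), %x.-s n x) : E1 h dl" unfolding E1_def graph_on_def using mV by blast
 qed
 have bound: "nm V (s n) <= C" for n
 proof -
 have "(nm V (s n))^2 <= (nm V (ph n))^2"
 unfolding V_hnorm_sq[OF sV] V_hnorm_sq[OF phV]
 proof (rule infsum_mono)
 show "(%e. (nm (H1 (reg e)) (s n))^2) summable_on edges" "(%e. (nm (H1 (reg e)) (ph n))^2) summable_on edges"
 using sV[of n] phV[of n] by (auto simp: V_mem)
 fix e assume e: "e : edges"
 show "(nm (H1 (reg e)) (s n))^2 <= (nm (H1 (reg e)) (ph n))^2"
 proof (cases "e : edges_sing")
 case True
 have "nm (H1 (reg e)) (s n)=nm (H1 (reg e)) (ph n)"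
 unfolding s_def by (rule H1_cong(6)) (use rpart_on[OF E e] True in auto)
 thus ?thesis by simp
 next
 case False
 have "nm (H1 (reg e)) (s n)=nm (H1 (reg e)) (%x. 0)"
 unfolding s_def by (rule H1_cong(6)) (use rpart_on[OF E e] False in auto)
 thus ?thesis using semi_ip.hnorm_zero[OF H1_semi_ip[OF region_almost_open[OF e]]] by simp
 qed
 qed
 hence "nm V (s n) <= nm V (ph n)" by (rule power2_le_imp_le) (rule VV.hnorm_nonneg[OF phV])
 thus ?thesis using phC order_trans by blast
 qed
 obtain r w where r: "strict_mono (r :: nat => nat)" and w: "w : carr L"
 and lim: "(%n. nm L (%x.-s (r n) x-w x)) ~~> 0"
 using compact[unfolded compact_op_def, rule_format, of s "%n x.-s n x"] rel bound by blast
 have msL: "(%x.-s n x) : carr L" for n by (rule L.minus_mem[OF sL])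
 have "(%n. ip L (%x.-s (r n) x) w) ~~> ip L w w" by (rule L.ip_tendsto[OF msL w w lim])
 moreover have "(%n. ip L (%x.-s (r n) x) w) ~~> 0"
 proof -
 have "ip L (%x.-s n x) w=- ip L (ph n) (rpart edges_sing w)" for n
 unfolding L.ip_minus_left[OF sL w] unfolding s_def ip_region_part(2)[OF E phL w] by (rule refl)
 moreover have "(%n. ip L (ph n) (rpart edges_sing w)) ~~> 0" by (rule weak[OF ip_region_part(1)[OF E w w]])
 from tendsto_minus[OF LIMSEQ_subseq_LIMSEQ[OF this r]]
 have "(%n.-ip L (ph (r n)) (rpart edges_sing w)) ~~> 0" by (simp add: comp_def)
 ultimately show ?thesis by simp
 qed
 ultimately have "ip L w w=0" by (rule LIMSEQ_unique)
 hence w0: "nm L w=0" by (simp add: hnorm_def)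
 have "(%n. nm L (%x.-s (r n) x)) ~~> nm L w" by (rule L.hnorm_tendsto[OF msL w lim])
 hence "(%n. nm L (s (r n))) ~~> 0" using w0 L.hnorm_minus[OF sL] by simp
 from tendsto_power[OF this, of 2] have sing: "(%n. (nm L (s (r n)))^2) ~~> 0" by simp
 define ep where "ep=1/(4*(C^2+1))"
 have C1: "0<C^2+1" by (simp add: add_nonneg_pos)
 have ep: "0<ep" using C1 by (simp add: ep_def)
 have "ep * C^2=(C^2/(C^2+1))/4" by (simp add: ep_def)
 also have "C^2/(C^2+1) <= 1" using C1 by simp
 finally have epC: "ep * C^2 <= 1/4" by simp
 obtain g where g: "g ~~> 0" "!!n. (\<Sum>\<^sub>\<infinity>e\<in>edges_reg. (nm (L2 (reg e)) (ph n))^2) <= ep * C^2+(g n :: real)"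
 using regular_parts_estimate[OF ep phV phC mz weak] by blast
 have one: "1 <= ep * C^2+g n+(nm L (s n))^2" for n
 proof -
 have sm: "(%e. (nm (L2 (reg e)) (ph n))^2) summable_on edges" using phL[of n] by (simp add: L_mem)
 have "edges_reg \<inter> edges_sing={}" by (auto simp: edges_reg_def edges_sing_def)
 moreover have "(%e. (nm (L2 (reg e)) (ph n))^2) summable_on edges_reg" by (rule summable_on_subset_banach[OF sm]) blast
 moreover have "(%e. (nm (L2 (reg e)) (ph n))^2) summable_on edges_sing" by (rule summable_on_subset_banach[OF sm]) blast
 ultimately have "(\<Sum>\<^sub>\<infinity>e\<in>edges. (nm (L2 (reg e)) (ph n))^2) =
 (\<Sum>\<^sub>\<infinity>e\<in>edges_reg. (nm (L2 (reg e)) (ph n))^2)+(\<Sum>\<^sub>\<infinity>e\<in>edges_sing. (nm (L2 (reg e)) (ph n))^2)"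
 by (intro infsum_Un_disjoint)
 moreover have "(nm L (ph n))^2=1" using L.orthonormal_hnorm[OF on] by simp
 ultimately show ?thesis using g(2)[of n] ip_region_part(3)[OF E phL[of n] phL[of n]] L_hnorm_sq[OF phL, of n] unfolding s_def by simp
 qed
 have "(%n. ep * C^2+(g \<circ> r) n+(nm L (s (r n)))^2) ~~> ep * C^2+0+0"
 by (intro tendsto_add tendsto_const LIMSEQ_subseq_LIMSEQ[OF g(1) r] sing)
 hence "1 <= ep * C^2+0+0" by (rule LIMSEQ_le_const) (use one in auto)
 thus False using epC by simp
qed

theorem fredholm_H_Omega:
 assumes "compact_op V L (op_shift (T1_adj h dl O T1 h dl) (- 1) O E1 h dl)" and "z ~= 0"
 shows "fredholm L (op_shift (H_Omega h dl) (- z))"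
proof -
 interpret VV: semi_hilbert V by (rule V_complete)
 interpret L: semi_ip L by (rule L_semi_ip)
 interpret form_pair V L rconst
 proof
 show "v : carr V ==> v : carr L" for v by (rule V_subset_L)
 show "v : carr V ==> nm L v <= nm V v" for v by (rule V_hnorm_ge)
 show "k : rconst ==> k : carr V" for k by (rule rconst_V(1))
 show "k : rconst ==> v : carr V ==> ip V k v=ip L k v" for k v by (rule rconst_V(2))
 show "f : carr L ==> EX k:rconst. ALL k':rconst. ip L (%x. f x-k x) k'=0" for f by (rule rconst_projection)
 show False if "L.orthonormal (UNIV :: nat set) ph" "!!n. ph n : carr V & (ALL k:rconst. ip L (ph n) k=0) & nm V (ph n) <= C" for ph C
 by (rule no_bounded_orthonormal_sequence[OF assms(1) that])
 qed
 show ?thesis unfolding H_Omega_eq by (rule fredholm_off_eigenvalue[OF assms(2)])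
qed

end

context rooms_passages
begin

lemma L2_edge_semi_ip: "semi_ip (L2_edge h dl e)"
 unfolding L2_edge_def by (rule weighted_L2_semi_ip) (rule alpha_nonneg)

lemma ip_AE_const:
 assumes f: "AE sg in lon (arc_interval h dl e). f (edge_point h dl e sg)=c"
 and g: "AE sg in lon (arc_interval h dl e). g (edge_point h dl e sg)=d"
 shows "ip (L2_edge h dl e) f g=c * cnj d * cr (LINT sg|lon (arc_interval h dl e). alpha h dl e sg)"
proof -
 have "ip (L2_edge h dl e) f g=(LINT sg|lon (arc_interval h dl e). (c * cnj d) * cr (alpha h dl e sg))"
 unfolding L2_edge_def hspace.simps
 proof (rule integral_lebesgue_on_cong_AE)
 show "AE sg in lon (arc_interval h dl e). f (edge_point h dl e sg) * cnj (g (edge_point h dl e sg)) * cr (alpha h dl e sg)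
 =(c * cnj d) * cr (alpha h dl e sg)"
 by (rule eventually_elim2[OF f g]) simp
 qed simp
 also have "\<dots>=(c * cnj d)*(LINT sg|lon (arc_interval h dl e). cr (alpha h dl e sg))"
 by (rule integral_mult_right_zero)
 finally show ?thesis by simp
qed

lemma const_edge_semi_ip: "semi_ip (const_edge h dl e)"
proof -
 let ?M="lon (arc_interval h dl e)"
 define A where "A=(LINT sg|?M. alpha h dl e sg)"
 have A: "0 <= A" unfolding A_def by (rule BI_nonneg) (rule alpha_nonneg)
 have mem: "f : carr (const_edge h dl e) \<longleftrightarrow> (EX c. AE sg in ?M. f (edge_point h dl e sg)=c)" for f
 by (simp add: const_edge_def)
 have ip: "ip (const_edge h dl e) f g=c * cnj d * cr A"
 if "AE sg in ?M. f (edge_point h dl e sg)=c" "AE sg in ?M. g (edge_point h dl e sg)=d" for f g c d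
 unfolding A_def ip_AE_const[OF that, symmetric] by (simp add: const_edge_def)
 have add: "AE sg in ?M. f (edge_point h dl e sg)+g (edge_point h dl e sg)=c+d"
 if "AE sg in ?M. f (edge_point h dl e sg)=c" "AE sg in ?M. g (edge_point h dl e sg)=d" for f g c d
 by (rule eventually_elim2[OF that]) simp
 have scale: "AE sg in ?M. b * f (edge_point h dl e sg)=b * c" if "AE sg in ?M. f (edge_point h dl e sg)=c" for f b c
 using that by (elim eventually_mono) simp
 show ?thesis
 proof
 show "(%x. 0) : carr (const_edge h dl e)" unfolding mem by (rule exI[of _ 0]) simp
 next
 fix f g assume "f : carr (const_edge h dl e)" "g : carr (const_edge h dl e)"
 then obtain c d where "AE sg in ?M. f (edge_point h dl e sg)=c" "AE sg in ?M. g (edge_point h dl e sg)=d" unfolding mem by blast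
 from add[OF this] show "(%x. f x+g x) : carr (const_edge h dl e)" unfolding mem by (rule exI)
 next
 fix f c assume "f : carr (const_edge h dl e)"
 then obtain d where "AE sg in ?M. f (edge_point h dl e sg)=d" unfolding mem by blast
 from scale[OF this] show "(%x. c * f x) : carr (const_edge h dl e)" unfolding mem by (rule exI)
 next
 fix f g k assume "f : carr (const_edge h dl e)" "g : carr (const_edge h dl e)" "k : carr (const_edge h dl e)"
 then obtain c d b where c: "AE sg in ?M. f (edge_point h dl e sg)=c" "AE sg in ?M. g (edge_point h dl e sg)=d" "AE sg in ?M. k (edge_point h dl e sg)=b"
 unfolding mem by blast
 show "ip (const_edge h dl e) (%x. f x+g x) k=ip (const_edge h dl e) f k+ip (const_edge h dl e) g k"
 unfolding ip[OF add[OF c(1,2)] c(3)] ip[OF c(1,3)] ip[OF c(2,3)] by (simp add: algebra_simps)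
 next
 fix f k a assume "f : carr (const_edge h dl e)" "k : carr (const_edge h dl e)"
 then obtain c b where c: "AE sg in ?M. f (edge_point h dl e sg)=c" "AE sg in ?M. k (edge_point h dl e sg)=b" unfolding mem by blast
 show "ip (const_edge h dl e) (%x. a * f x) k=a * ip (const_edge h dl e) f k"
 unfolding ip[OF scale[OF c(1)] c(2)] ip[OF c] by (simp add: algebra_simps)
 next
 fix f g assume "f : carr (const_edge h dl e)" "g : carr (const_edge h dl e)"
 then obtain c d where c: "AE sg in ?M. f (edge_point h dl e sg)=c" "AE sg in ?M. g (edge_point h dl e sg)=d" unfolding mem by blast
 show "ip (const_edge h dl e) g f=cnj (ip (const_edge h dl e) f g)" unfolding ip[OF c] ip[OF c(2,1)] by (simp add: algebra_simps)
 next
 fix f assume "f : carr (const_edge h dl e)"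
 then obtain c where c: "AE sg in ?M. f (edge_point h dl e sg)=c" unfolding mem by blast
 show "0 <= Re (ip (const_edge h dl e) f f)" unfolding ip[OF c c] using A by (simp add: complex_mult_cnj)
 qed
qed

abbreviation LG where "LG \<equiv> L2_Gamma h dl"
abbreviation VG where "VG \<equiv> H1_Gamma h dl"
abbreviation XL where "XL \<equiv> %e. if e : edges_reg then L2_edge h dl e else const_edge h dl e"
abbreviation XV where "XV \<equiv> %e. if e : edges_reg then H1_edge h dl e else const_edge h dl e"

lemma L2_Gamma_semi_ip: "semi_ip LG"
 unfolding L2_Gamma_def
 by (rule hsum_spaces.semi_ip_hsum, rule hsum_spaces.intro) (simp add: L2_edge_semi_ip const_edge_semi_ip)

lemma beta_nonneg: "0 <= beta h dl e sg"
 unfolding beta_def Let_def by (rule BI_nonneg) (simp add: grad_norm_def sum_nonneg)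

lemma H1_edge_hnorm_ge:
 assumes f: "f : carr (H1_edge h dl e)"
 shows "(nm (L2_edge h dl e) f)^2 <= (nm (H1_edge h dl e) f)^2"
proof -
 let ?M="lon (arc_interval h dl e)"
 let ?f="%sg. f (edge_point h dl e sg)"
 obtain g where g: "hwd (arc_interval h dl e) ?f 1 g" "integrable ?M (%sg. (cmod (g sg))^2 * beta h dl e sg)"
 and fi: "integrable ?M (%sg. (cmod (?f sg))^2 * alpha h dl e sg)" using f by (auto simp: H1_edge_def L2_edge_def)
 have d: "AE sg in ?M. edge_deriv h dl e f sg=g sg"
 unfolding edge_deriv_def by (rule weak_derivative_AE[OF open_almost_open g(1)]) simp
 have "ip (H1_edge h dl e) f f=(LINT sg|?M. cr ((cmod (g sg))^2 * beta h dl e sg+(cmod (?f sg))^2 * alpha h dl e sg))"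
 unfolding H1_edge_def hspace.simps
 by (rule integral_lebesgue_on_cong_AE) (use d in \<open>simp, elim eventually_mono, simp only: of_real_add of_real_mult complex_norm_square\<close>)
 hence H: "Re (ip (H1_edge h dl e) f f)=(LINT sg|?M. (cmod (g sg))^2 * beta h dl e sg)+(LINT sg|?M. (cmod (?f sg))^2 * alpha h dl e sg)"
 using g(2) fi by (simp only: integral_complex_of_real Re_complex_of_real BI_add)
 have "ip (L2_edge h dl e) f f=(LINT sg|?M. cr ((cmod (?f sg))^2 * alpha h dl e sg))"
 unfolding L2_edge_def hspace.simps by (rule BI_cong) (simp_all only: of_real_mult complex_norm_square)
 hence Lr: "Re (ip (L2_edge h dl e) f f)=(LINT sg|?M. (cmod (?f sg))^2 * alpha h dl e sg)"
 by (simp only: integral_complex_of_real Re_complex_of_real)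
 have nn: "0 <= (LINT sg|?M. (cmod (g sg))^2 * beta h dl e sg)" "0 <= (LINT sg|?M. (cmod (?f sg))^2 * alpha h dl e sg)"
 by (rule BI_nonneg, simp add: beta_nonneg alpha_nonneg)+
 show ?thesis unfolding hnorm_def using H Lr nn by simp
qed

lemma H1_Gamma_subset: "f : carr VG ==> f : carr LG"
proof -
 assume f: "f : carr VG"
 have fm: "ALL e:edges. f : carr (XV e)" and fs: "(%e. (nm (XV e) f)^2) summable_on edges"
 using f unfolding H1_Gamma_def hsum_mem by blast+
 have mem: "f : carr (XL e)" if e: "e : edges" for e
 using bspec[OF fm e] by (cases "e : edges_reg") (simp_all add: H1_edge_def)
 have le: "(nm (XL e) f)^2 <= (nm (XV e) f)^2" if e: "e : edges" for e
 using bspec[OF fm e] H1_edge_hnorm_ge[of f e] by (cases "e : edges_reg") simp_all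
 have "(%e. (nm (XL e) f)^2) summable_on edges" by (rule summable_on_comparison_test[OF fs le zero_le_power2])
 thus ?thesis using mem unfolding L2_Gamma_def hsum_mem by blast
qed

definition passage_mass :: "nat => real" where "passage_mass i=dl i * edge_length h dl (Pass i)"

definition pass_fun :: "nat => point => complex" where
 "pass_fun i x=(if x : edge_set h dl (Pass i) then cr (1/sqrt (passage_mass i)) else 0)"

lemma passage_mass_pos: "1 <= i ==> even i ==> 0<passage_mass i"
 unfolding passage_mass_def
 by (rule mult_pos_pos[OF dl_bounds(1) edge_length_pos]) (auto simp: edges_reg_def)

lemma pass_fun_edge:
 assumes i: "1 <= i" "even i" and e: "e : edges" and sg: "sg : arc_interval h dl e"
 shows "pass_fun i (edge_point h dl e sg)=(if e=Pass i then cr (1/sqrt (passage_mass i)) else 0)"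
proof -
 have p: "Pass i : edges" using i by (auto simp: edges_reg_def)
 note m=edge_point_in_edge[OF e sg]
 show ?thesis using m edge_sets_disjoint[OF e p m] unfolding pass_fun_def by (cases "e=Pass i") auto
qed

lemma pass_fun_AE:
 assumes i: "1 <= i" "even i" and e: "e : edges"
 shows "AE sg in lon (arc_interval h dl e). pass_fun i (edge_point h dl e sg) =
 (if e=Pass i then cr (1/sqrt (passage_mass i)) else 0)"
 by (rule AE_I2) (use pass_fun_edge[OF i e] in simp)

lemma pass_fun_ip:
 assumes i: "1 <= i" "even i" and e: "e : edges"
 shows "ip (H1_edge h dl e) (pass_fun i) v=ip (L2_edge h dl e) (pass_fun i) v"
 and "e ~= Pass i ==> ip (L2_edge h dl e) (pass_fun i) v=0"
 and "e ~= Pass i ==> ip (L2_edge h dl e) v (pass_fun i)=0"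
 and "ip (L2_edge h dl (Pass i)) (pass_fun i) (pass_fun i)=1"
proof -
 let ?M="lon (arc_interval h dl e)"
 have "AE sg in ?M. edge_deriv h dl e (pass_fun i) sg=0"
 unfolding edge_deriv_def by (rule weak_derivative_AE_const[OF open_almost_open pass_fun_AE[OF i e]]) simp
 thus "ip (H1_edge h dl e) (pass_fun i) v=ip (L2_edge h dl e) (pass_fun i) v"
 unfolding H1_edge_def L2_edge_def hspace.simps
 by (intro integral_lebesgue_on_cong_AE) (simp, elim eventually_mono, simp)
 show "ip (L2_edge h dl e) (pass_fun i) v=0" if "e ~= Pass i"
 proof -
 have "ip (L2_edge h dl e) (pass_fun i) v=(LINT sg|?M. 0)"
 unfolding L2_edge_def hspace.simps
 by (rule BI_cong) (use pass_fun_edge[OF i e] that in auto)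
 thus ?thesis by simp
 qed
 show "ip (L2_edge h dl e) v (pass_fun i)=0" if "e ~= Pass i"
 proof -
 have "ip (L2_edge h dl e) v (pass_fun i)=(LINT sg|?M. 0)"
 unfolding L2_edge_def hspace.simps
 by (rule BI_cong) (use pass_fun_edge[OF i e] that in auto)
 thus ?thesis by simp
 qed
 have p: "Pass i : edges" using i by (auto simp: edges_reg_def)
 have A: "(LINT sg|lon (arc_interval h dl (Pass i)). alpha h dl (Pass i) sg)=passage_mass i"
 proof -
 have "(LINT sg|lon (arc_interval h dl (Pass i)). alpha h dl (Pass i) sg)=(LINT sg|lon (arc_interval h dl (Pass i)). dl i)"
 by (rule BI_cong) (use alpha_pass[OF i] in auto)
 also have "\<dots>=passage_mass i" using edge_length_pos[OF p] by (simp add: measure_restrict_space passage_mass_def)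
 finally show ?thesis .
 qed
 have c: "cr (1/sqrt (passage_mass i)) * cnj (cr (1/sqrt (passage_mass i))) * cr (passage_mass i)=1"
 proof -
 have "1/sqrt (passage_mass i)*(1/sqrt (passage_mass i)) * passage_mass i=1" using passage_mass_pos[OF i] by simp
 thus ?thesis by (metis complex_cnj_complex_of_real of_real_1 of_real_mult)
 qed
 have "AE sg in lon (arc_interval h dl (Pass i)). pass_fun i (edge_point h dl (Pass i) sg)=cr (1/sqrt (passage_mass i))"
 using pass_fun_AE[OF i p] by simp
 from ip_AE_const[OF this this] show "ip (L2_edge h dl (Pass i)) (pass_fun i) (pass_fun i)=1" unfolding A c .
qed

lemma pass_fun_edge_mem:
 assumes i: "1 <= i" "even i" and e: "e : edges"
 shows "pass_fun i : carr (H1_edge h dl e)"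
proof -
 let ?M="lon (arc_interval h dl e)"
 let ?c="if e=Pass i then cr (1/sqrt (passage_mass i)) else 0"
 have "(%sg. pass_fun i (edge_point h dl e sg)) : bm ?M"
 using measurable_cong[of ?M "%sg. pass_fun i (edge_point h dl e sg)" "%sg. ?c" borel] pass_fun_edge[OF i e] by simp
 moreover have "integrable ?M (%sg. (cmod (pass_fun i (edge_point h dl e sg)))^2 * alpha h dl e sg)"
 proof -
 have fm: "finite_measure ?M" by (rule finite_measure_lebesgue_on) (rule bounded_set_imp_lmeasurable, auto)
 have int: "integrable ?M (%sg. (cmod ?c)^2 * dl i)" by (rule finite_measure.integrable_const[OF fm])
 have eq: "(cmod (pass_fun i (edge_point h dl e sg)))^2 * alpha h dl e sg=(cmod ?c)^2 * dl i" if "sg : space ?M" for sg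
 using pass_fun_edge[OF i e, of sg] alpha_pass[OF i, of sg] that by (cases "e=Pass i") auto
 show ?thesis by (rule iffD2[OF BI_icong[OF refl eq] int])
 qed
 moreover have "hwd (arc_interval h dl e) (%sg. pass_fun i (edge_point h dl e sg)) 1 (%x. 0)"
 by (rule has_weak_derivative_AE_const[OF _ pass_fun_AE[OF i e]]) simp
 ultimately show ?thesis by (auto simp: H1_edge_def L2_edge_def intro!: exI[of _ "%x. 0"])
qed

lemma pass_fun_assoc:
 assumes i: "1 <= i" "even i"
 shows "(pass_fun i, pass_fun i) : assoc_op VG LG"
proof -
 have eq: "ip (XV e) (pass_fun i) v=ip (XL e) (pass_fun i) v" if "e : edges" for e v
 using pass_fun_ip(1)[OF i that] by simp
 have p: "Pass i : edges" using i by (auto simp: edges_reg_def)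
 have "ALL e:edges. pass_fun i : carr (XV e)"
 proof
 fix e assume e: "e : edges"
 show "pass_fun i : carr (XV e)"
 proof (cases "e : edges_reg")
 case True
 thus ?thesis using pass_fun_edge_mem[OF i e] by simp
 next
 case False
 have "pass_fun i : carr (const_edge h dl e)"
 unfolding const_edge_def hspace.simps by (rule CollectI, rule exI, rule pass_fun_AE[OF i e])
 thus ?thesis using False by simp
 qed
 qed
 moreover have "(%e. (nm (XV e) (pass_fun i))^2) summable_on edges"
 proof (rule finite_nonzero_values_imp_summable_on, rule finite_subset)
 show "{e : edges. (nm (XV e) (pass_fun i))^2 ~= 0} <= {Pass i}"
 proof (rule subsetI, rule ccontr)
 fix e assume e: "e : {e : edges. (nm (XV e) (pass_fun i))^2 ~= 0}" "e ~: {Pass i}"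
 hence ee: "e : edges" "e ~= Pass i" by auto
 have "ip (XV e) (pass_fun i) (pass_fun i)=0"
 unfolding eq[OF ee(1)] using pass_fun_ip(2)[OF i ee] by (simp add: const_edge_def)
 thus False using e(1) by (simp add: hnorm_def)
 qed
 qed simp
 ultimately have V: "pass_fun i : carr VG" unfolding H1_Gamma_def hsum_mem by blast
 have "ip VG (pass_fun i) v=ip LG (pass_fun i) v" for v
 unfolding H1_Gamma_def L2_Gamma_def hsum_ip by (rule infsum_cong) (rule eq)
 thus ?thesis using V H1_Gamma_subset[OF V] unfolding assoc_op_def by blast
qed

lemma pass_funs_orthonormal:
 "semi_ip.orthonormal LG (UNIV :: nat set) (%n. pass_fun (2 * Suc n))"
 unfolding semi_ip.orthonormal_def[OF L2_Gamma_semi_ip]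
proof (intro conjI ballI)
 have ev: "1 <= 2 * Suc n" "even (2 * Suc n)" for n by auto
 fix n m :: nat
 show "pass_fun (2 * Suc n) : carr LG" using pass_fun_assoc[OF ev] by (simp add: assoc_op_def)
 have p: "Pass (2 * Suc n) : edges" "Pass (2 * Suc n) : edges_reg" using ev[of n] by (auto simp: edges_reg_def)
 have off: "ip (XL e) (pass_fun (2 * Suc n)) (pass_fun (2 * Suc m))=0"
 if "e : edges" "e ~= Pass (2 * Suc n) \<or> e ~= Pass (2 * Suc m)" for e
 proof (cases "e=Pass (2 * Suc n)")
 case True
 hence "e ~= Pass (2 * Suc m)" using that(2) by blast
 thus ?thesis using pass_fun_ip(3)[OF ev[of m] that(1)] by (simp add: const_edge_def)
 next
 case False
 thus ?thesis using pass_fun_ip(2)[OF ev[of n] that(1)] by (simp add: const_edge_def)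
 qed
 show "ip LG (pass_fun (2 * Suc n)) (pass_fun (2 * Suc m)) = of_bool (n=m)"
 proof (cases "n=m")
 case True
 have "ip LG (pass_fun (2 * Suc n)) (pass_fun (2 * Suc m))=ip (XL (Pass (2 * Suc n))) (pass_fun (2 * Suc n)) (pass_fun (2 * Suc m))"
 unfolding L2_Gamma_def by (rule hsum_ip_single[OF p(1)]) (rule off, auto)
 thus ?thesis using pass_fun_ip(4)[OF ev[of n] p(1)] p(2) True by simp
 next
 case False
 hence ne: "e ~= Pass (2 * Suc n) \<or> e ~= Pass (2 * Suc m)" for e by auto
 have "ip LG (pass_fun (2 * Suc n)) (pass_fun (2 * Suc m))=0"
 unfolding L2_Gamma_def hsum_ip by (rule infsum_0) (rule off[OF _ ne])
 thus ?thesis using False by simp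
 qed
qed

lemma compact_opD:
 assumes "compact_op X Y T" "!!n :: nat. (u n, v n) : T" "!!n. nm X (u n) <= C"
 shows "EX r w. strict_mono (r :: nat => nat) & w : carr Y & (%n. nm Y (%x. v (r n) x-w x)) ~~> 0"
 using assms unfolding compact_op_def by blast

lemma op_shiftI: "(u, w) : A ==> (u, %x. w x+c * u x) : op_shift A c"
 unfolding op_shift_def by blast

lemma op_shift_domain: "(u, w) : op_shift A c ==> EX w'. (u, w') : A"
 unfolding op_shift_def by blast

text \<open>An infinite-dimensional kernel of \<open>H\<close> puts 0 into its essential spectrum.\<close>

lemma zero_in_ess_spectrum:
 assumes semi: "semi_ip X" and sub: "carr U <= carr X"
 and ph: "!!n :: nat. (ph n, ph n) : assoc_op U X" and on: "semi_ip.orthonormal X UNIV ph"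
 shows "0 : ess_spectrum X (op_shift (assoc_op U X) (- 1))"
proof -
 interpret semi_ip X by (rule semi)
 let ?A="op_shift (op_shift (assoc_op U X) (- 1)) (- 0)"
 have "ph n : op_kernel X ?A" for n
 proof -
 have "(ph n, %x. ph n x+(- 1) * ph n x) : op_shift (assoc_op U X) (- 1)" by (rule op_shiftI[OF ph])
 hence "(ph n, %x. (ph n x+(- 1) * ph n x)+(- 0) * ph n x) : ?A" by (rule op_shiftI)
 moreover have "(%x. (ph n x+(- 1) * ph n x)+(- 0) * ph n x)=(%x. 0)" by (rule ext) simp
 ultimately have "(ph n, %x. 0) : ?A" by (simp only:)
 thus ?thesis unfolding op_kernel_def using hnorm_zero by blast
 qed
 moreover have "op_kernel X ?A <= carr X"
 proof
 fix u assume "u : op_kernel X ?A"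
 then obtain w where "(u, w) : ?A" unfolding op_kernel_def by blast
 then obtain w' where "(u, w') : op_shift (assoc_op U X) (- 1)" using op_shift_domain by blast
 then obtain w'' where "(u, w'') : assoc_op U X" using op_shift_domain by blast
 thus "u : carr X" using sub by (auto simp: assoc_op_def)
 qed
 ultimately have "\<not> finite_codim X {%x. 0} (op_kernel X ?A)" by (rule orthonormal_infinite_dim[OF on])
 thus ?thesis unfolding ess_spectrum_def fredholm_def by blast
qed

lemma H_Gamma_noncompact: "\<not> compact_op LG LG ((op_shift (H_Gamma h dl) 1)\<inverse>)"
proof
 let ?ph="%n. pass_fun (2 * Suc n)"
 interpret semi_ip LG by (rule L2_Gamma_semi_ip)
 have ev: "1 <= 2 * Suc n" "even (2 * Suc n)" for n by auto
 have rel: "(?ph n, ?ph n) : (op_shift (H_Gamma h dl) 1)\<inverse>" for n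
 proof -
 have "(?ph n, %x. ?ph n x+(- 1)*?ph n x) : H_Gamma h dl" unfolding H_Gamma_def by (rule op_shiftI[OF pass_fun_assoc[OF ev]])
 hence "(?ph n, %x. (?ph n x+(- 1)*?ph n x)+1*?ph n x) : op_shift (H_Gamma h dl) 1" by (rule op_shiftI)
 moreover have "(%x. (?ph n x+(- 1)*?ph n x)+1*?ph n x) = ?ph n" by (rule ext) simp
 ultimately have "(?ph n, ?ph n) : op_shift (H_Gamma h dl) 1" by (simp only:)
 thus ?thesis by (rule converseI)
 qed
 have b: "nm LG (?ph n) <= 1" for n using orthonormal_hnorm[OF pass_funs_orthonormal, of n] by simp
 assume c: "compact_op LG LG ((op_shift (H_Gamma h dl) 1)\<inverse>)"
 from compact_opD[where u = ?ph and v = ?ph, OF c rel b] obtain r w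
 where r: "strict_mono (r :: nat => nat)" and w: "w : carr LG" and lim: "(%n. nm LG (%x. ?ph (r n) x-w x)) ~~> 0"
 by (elim exE conjE) (rule that)
 show False by (rule notE[OF orthonormal_no_convergent_subseq[OF pass_funs_orthonormal r w] lim])
qed

lemma zero_in_ess_H_Gamma: "0 : ess_spectrum LG (H_Gamma h dl)"
 unfolding H_Gamma_def
 by (rule zero_in_ess_spectrum[OF L2_Gamma_semi_ip _ _ pass_funs_orthonormal])
 (auto intro: H1_Gamma_subset intro!: pass_fun_assoc)

definition pass_ind :: "nat => point => complex" where
 "pass_ind n=rpart {Pass (2 * Suc n)} (%x. cr (1/nm (L2 (reg (Pass (2 * Suc n)))) (%x. 1)))"

lemma pass_inds_constant: "pass_ind n : rconst"
 unfolding pass_ind_def by (rule region_indicator_constant) (auto simp: edges_reg_def)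

lemma pass_inds_orthonormal: "semi_ip.orthonormal L (UNIV :: nat set) pass_ind"
 unfolding semi_ip.orthonormal_def[OF L_semi_ip]
proof (intro conjI ballI)
 fix n m :: nat
 have mem: "pass_ind k : carr L" for k using pass_inds_constant by (simp add: rconst_def)
 show "pass_ind n : carr L" by (rule mem)
 let ?e="%k. Pass (2 * Suc k)"
 have e: "?e k : edges" "{?e k} <= edges" for k by (auto simp: edges_reg_def)
 let ?N="nm (L2 (reg (?e n))) (%x. 1)"
 interpret E: semi_ip "L2 (reg (?e n))" by (rule L2_semi_ip)
 note c1=const_L2[OF e(1)]
 have "?N ~= 0"
 proof
 assume "?N=0"
 hence "(LINT x|lon (reg (?e n)). (cmod 1)^2)=0" using L2_hnorm_sq[of "reg (?e n)" "%x. 1"] by simp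
 hence "measure (lon (reg (?e n))) (reg (?e n))=0" by simp
 hence "measure lebesgue (reg (?e n))=0" using region_sets[OF e(1), of n] by (subst (asm) measure_restrict_space) (simp_all del: mult_Suc_right)
 hence "negligible (reg (?e n))" using region_lmeasurable[OF e(1)] by (simp add: negligible_iff_measure)
 hence "negligible (cell h dl (?e n))" by (rule negligible_subset[OF _ cell_subset_region[OF e(1)]])
 moreover have "xpos h (2 * Suc n-1)<xpos h (2 * Suc n)" by (rule xpos_strict_mono) simp
 hence "cell h dl (?e n) ~= {}" using dl_bounds(1)[of "2 * Suc n"] by (auto simp: not_le)
 ultimately show False using open_not_negligible[OF open_cell] by blast
 qed
 hence N: "0<?N" using E.hnorm_nonneg[OF c1, of 1] by (simp add: less_le)
 have sum: "ip L (pass_ind n) (pass_ind m)=ip (hsum edges (%e. L2 (reg e))) (pass_ind n) (pass_ind m)"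
 unfolding L_ip[OF mem mem] hsum_ip by (rule refl)
 have single: "ip (hsum edges (%e. L2 (reg e))) (pass_ind n) (pass_ind m)=ip (L2 (reg (?e m))) (pass_ind n) (pass_ind m)"
 by (rule hsum_ip_single[OF e(1)], unfold pass_ind_def[of m], rule rpart_ip(3)[OF e(2)])
 (use mem[of n] in \<open>auto simp: L_mem\<close>)
 show "ip L (pass_ind n) (pass_ind m) = of_bool (n=m)"
 proof (cases "n=m")
 case True
 have "ip (L2 (reg (?e n))) (pass_ind n) (pass_ind n) =
 ip (L2 (reg (?e n))) (%x. cr (1 / ?N)*1) (%x. cr (1 / ?N)*1)"
 unfolding L2_ip by (rule BI_cong)
 (auto simp: pass_ind_def rpart_def)
 also have "\<dots>=cr ((nm (L2 (reg (?e n))) (%x. cr (1 / ?N)*1))^2)"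
 by (rule E.ip_self) (rule E.scale_mem[OF c1])
 also have "nm (L2 (reg (?e n))) (%x. cr (1 / ?N)*1)=cmod (cr (1 / ?N))*?N" by (rule E.hnorm_scale[OF c1])
 also have "\<dots>=1" using N by (simp add: norm_divide)
 finally show ?thesis using sum single True by simp
 next
 case False
 have "ip (L2 (reg (?e m))) (pass_ind n) (pass_ind m)=(LINT x|lon (reg (?e m)). 0)"
 unfolding L2_ip by (rule BI_cong)
 (use rpart_on[OF e(2)[of n] e(1)[of m]] False in \<open>auto simp: pass_ind_def\<close>)
 thus ?thesis using sum single False by simp
 qed
qed

lemma E1_noncompact: "\<not> compact_op V L (E1 h dl)"
proof
 interpret L: semi_ip L by (rule L_semi_ip)
 have iV: "pass_ind n : carr V" for n by (rule rconst_V(1)[OF pass_inds_constant])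
 have "nm V (pass_ind n)=nm L (pass_ind n)" for n
 unfolding hnorm_def rconst_V(2)[OF pass_inds_constant iV] by (rule refl)
 hence b: "nm V (pass_ind n) <= 1" for n using L.orthonormal_hnorm[OF pass_inds_orthonormal, of n] by simp
 have rel: "(pass_ind n, pass_ind n) : E1 h dl" for n unfolding E1_def graph_on_def using iV by blast
 assume c: "compact_op V L (E1 h dl)"
 from compact_opD[where u=pass_ind and v=pass_ind, OF c rel b] obtain r w
 where r: "strict_mono (r :: nat => nat)" and w: "w : carr L" and lim: "(%n. nm L (%x. pass_ind (r n) x-w x)) ~~> 0"
 by (elim exE conjE) (rule that)
 show False by (rule notE[OF L.orthonormal_no_convergent_subseq[OF pass_inds_orthonormal r w] lim])
qed

lemma zero_in_ess_H_Omega: "0 : ess_spectrum L (H_Omega h dl)"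
 unfolding H_Omega_eq
proof (rule zero_in_ess_spectrum[OF L_semi_ip _ _ pass_inds_orthonormal])
 show "carr V <= carr L" using V_subset_L by blast
 show "(pass_ind n, pass_ind n) : assoc_op V L" for n
 using rconst_V[OF pass_inds_constant[of n]] V_subset_L by (simp add: assoc_op_def)
qed

end

theorem theorem5p7:
  fixes h \<delta> :: "nat \<Rightarrow> real"
  assumes "rooms_and_passages h \<delta>"
  shows
    "(\<not> compact_op (L2_Gamma h \<delta>) (L2_Gamma h \<delta>) ((op_shift (H_Gamma h \<delta>) 1)\<inverse>) \<and>
        0 \<in> ess_spectrum (L2_Gamma h \<delta>) (H_Gamma h \<delta>)) \<and>
     (\<not> compact_op (H1_Omega h \<delta>) (L2_Omega h \<delta>) (E1 h \<delta>) \<and>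
        0 \<in> ess_spectrum (L2_Omega h \<delta>) (H_Omega h \<delta>)) \<and>
     (compact_op (H1_Omega h \<delta>) (L2_Omega h \<delta>)
        (op_shift (T1_adj h \<delta> O T1 h \<delta>) (- 1) O E1 h \<delta>) \<longrightarrow>
      ess_spectrum (L2_Omega h \<delta>) (H_Omega h \<delta>) \<subseteq> ess_spectrum (L2_Gamma h \<delta>) (H_Gamma h \<delta>))"
proof -
  interpret rooms_passages h \<delta> by (rule rooms_passages.intro[OF assms])
  have "ess_spectrum L (H_Omega h \<delta>) \<subseteq> ess_spectrum (L2_Gamma h \<delta>) (H_Gamma h \<delta>)"
    if c: "compact_op V L (op_shift (T1_adj h \<delta> O T1 h \<delta>) (- 1) O E1 h \<delta>)"
  proof
    fix z assume z: "z \<in> ess_spectrum L (H_Omega h \<delta>)"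
    have "z = 0"
    proof (rule ccontr)
      assume "z \<noteq> 0"
      then show False using fredholm_H_Omega[OF c] z unfolding ess_spectrum_def by blast
    qed
    then show "z \<in> ess_spectrum (L2_Gamma h \<delta>) (H_Gamma h \<delta>)" using zero_in_ess_H_Gamma by simp
  qed
  then show ?thesis using H_Gamma_noncompact zero_in_ess_H_Gamma E1_noncompact zero_in_ess_H_Omega by blast
qed

end
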